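(* Let $(\Sigma,\omega_\Sigma)$ be a simplicial tropical fan, let $f$ be a meromorphic function on $\Sigma$, and let $(\widetilde\Sigma,\omega_{\widetilde\Sigma})=\mathrm{TM}_f(\Sigma)$ be the tropical modification of $\Sigma$ along (the divisor of) $f$. Assume that $\Sigma$ is div-faithful. Then there is an isomorphism $$A^\bullet(\widetilde\Sigma,\mathbb Q)\simeq A^\bullet(\Sigma,\mathbb Q)$$ between Chow rings with rational coefficients, and an isomorphism between Minkowski weights $$\mathrm{MW}_\bullet(\widetilde\Sigma,\mathbb Z)\simeq\mathrm{MW}_\bullet(\Sigma,\mathbb Z).$$ If in addition either $\Sigma$ is saturated or $A^\bullet(\Sigma)$ is torsion-free, then there is an isomorphism between the Chow rings with integral coefficients $$A^\bullet(\widetilde\Sigma)\simeq A^\bullet(\Sigma).$$ The isomorphisms are all compatible with the degree maps (defined when $\Sigma$ is unimodular).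
   Context: **Fans.** $N$ is a free abelian group of finite rank, $M=\mathrm{Hom}(N,\mathbb Z)$, $N_{\mathbb R}=N\otimes\mathbb R$. A rational fan $\Sigma$ in $N_{\mathbb R}$ is a non-empty finite collection of strongly convex rational polyhedral cones, closed under taking faces, any two of which meet in a common face; $|\Sigma|$ is its support, $\Sigma_k$ the set of its $k$-dimensional cones, rays are elements of $\Sigma_1$, and $e_\rho$ is the primitive vector of a ray $\rho$. For a cone $\sigma$, $N_\sigma=N\cap\mathrm{span}(\sigma)$, $N^\sigma=N/N_\sigma$, $M^\sigma=\mathrm{Hom}(N^\sigma,\mathbb Z)$. $\Sigma$ is simplicial if each cone is generated by as many rays as its dimension, unimodular if each $\sigma\in\Sigma$ is generated by a basis of $N_\sigma$. If $\tau$ is a codimension one face of $\sigma$, $\mathfrak n_{\sigma/\tau}\in N_\sigma$ denotes any vector lying on the same side of $\mathrm{span}(\tau)$ as $\sigma$ with $N_\tau+\mathbb Z\,\mathfrak n_{\sigma/\tau}=N_\sigma$, and $e^\tau_\sigma$ is its image in $N^\tau$. The star fan $\Sigma^\sigma$ is the fan in $N^\sigma_{\mathbb R}$ formed by the images $\eta^\sigma$ of the cones $\eta\in\Sigma$ containing $\sigma$. **Tropical fans.** $\mathrm{MW}_p(\Sigma)=\mathrm{MW}_p(\Sigma,\mathbb Z)$ is the group of Minkowski weights: maps $w\colon\Sigma_p\to\mathbb Z$ with $\sum_{\sigma\supset\tau,\,\sigma\in\Sigma_p}w(\sigma)e^\tau_\sigma=0$ in $N^\tau$ for all $\tau\in\Sigma_{p-1}$.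 A tropical fan $(\Sigma,\omega_\Sigma)$ of dimension $d$ is a rational fan of pure dimension $d$ with an orientation, i.e. an element $\omega_\Sigma\in\mathrm{MW}_d(\Sigma)$ taking only non-zero values. Star fans carry the induced orientation $\omega_{\Sigma^\sigma}(\eta^\sigma)=\omega_\Sigma(\eta)$. **Meromorphic functions, divisors, tropical modifications.** A meromorphic function $f$ on $\Sigma$ is a continuous function $|\Sigma|\to\mathbb R$ whose restriction to each cone $\sigma$ is given by an integral linear form $f_\sigma\in\mathrm{Hom}(N_\sigma,\mathbb Z)$. For $\tau\in\Sigma_{d-1}$, $\mathrm{ord}_\tau(f)=-\sum_{\sigma\supset\tau}\omega_\Sigma(\sigma)f_\sigma(\mathfrak n_{\sigma/\tau})+f_\tau\bigl(\sum_{\sigma\supset\tau}\omega_\Sigma(\sigma)\mathfrak n_{\sigma/\tau}\bigr)$ (sums over $\sigma\in\Sigma_d$), and $\mathrm{div}(f)$ is $\tau\mapsto\mathrm{ord}_\tau(f)$, an element of $\mathrm{MW}_{d-1}(\Sigma)$. Let $\Delta$ be the subfan of all $\tau\in\Sigma_{d-1}$ with $\mathrm{ord}_\tau(f)\neq0$ and their faces ($\Delta=\varnothing$ if $\mathrm{div}(f)$ is trivial, i.e. zero). $\mathrm{TM}_f(\Sigma)$ is the tropical fan in $(N\times\mathbb Z)_{\mathbb R}$ with cones $\sigma_o=\{(x,f(x)):x\in\sigma\}$ for $\sigma\in\Sigma$ and $\delta_\uparrow=\delta_o+\mathbb R_{\ge0}(0,1)$ for $\delta\in\Delta$, with orientation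 $\sigma_o\mapsto\omega_\Sigma(\sigma)$ ($\sigma\in\Sigma_d$), $\delta_\uparrow\mapsto\mathrm{ord}_\delta(f)$ ($\delta\in\Delta_{d-1}$). **Div-faithful, saturated.** $\Sigma$ is div-faithful if for every $\eta\in\Sigma$, every meromorphic function on the tropical fan $\Sigma^\eta$ with trivial divisor is the restriction to $|\Sigma^\eta|$ of a linear form on $N^\eta_{\mathbb R}$. $\Sigma$ is saturated if for every $\sigma\in\Sigma$, every function on $|\Sigma^\sigma|$ induced by an element of $M^\sigma\otimes\mathbb Q$ and integral on each cone of $\Sigma^\sigma$ (i.e. taking integer values on lattice points) is induced by an element of $M^\sigma$. **Chow ring, degree.** For $\Sigma$ simplicial, $A^\bullet(\Sigma)=\mathbb Z[\mathrm x_\zeta]_{\zeta\in\Sigma_1}/(I+J)$, with $I$ generated by the products $\mathrm x_{\rho_1}\cdots\mathrm x_{\rho_k}$ for rays $\rho_1,\dots,\rho_k$ not contained in a common cone of $\Sigma$, and $J$ generated by $\sum_{\zeta\in\Sigma_1}m(e_\zeta)\mathrm x_\zeta$, $m\in M$; $A^\bullet(\Sigma,\mathbb Q)=A^\bullet(\Sigma)\otimes\mathbb Q$. For $\sigma\in\Sigma$, $x_\sigma$ is the product of the classes $x_\zeta$ of $\mathrm x_\zeta$ over the rays $\zeta$ of $\sigma$. If $\Sigma$ is a unimodular tropical fan of dimension $d$ (then $\widetilde\Sigma$ is unimodular as well), $\deg_\Sigma\colon A^d(\Sigma)\to\mathbb Z$ is the well-defined homomorphism with $\deg_\Sigma(x_\sigma)=\omega_\Sigma(\sigma)$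 for $\sigma\in\Sigma_d$. Compatibility with degree maps means that in degree $d$ the isomorphisms of Chow rings identify $\deg_{\widetilde\Sigma}$ with $\deg_\Sigma$, and that, correspondingly, the isomorphism of Minkowski weights in dimension $d$ identifies $\omega_{\widetilde\Sigma}$ with $\omega_\Sigma$. *)

theory Defs
  imports
    "HOL-Analysis.Analysis"
    "HOL-Algebra.QuotRing"
    "HOL-Algebra.Generated_Groups"
    "HOL-Library.Poly_Mapping"
begin

section \<open>Lattices\<close>

text \<open>
  A free abelian group \<open>N\<close> of finite rank is realised as a lattice in a Euclidean space: the
  integral span of a linearly independent set, not necessarily of full rank. Then \<open>N\<^sub>\<real>\<close> is
  \<open>span N\<close>. Linear forms are represented by linear forms on the whole ambient space; only
  their values on \<open>span N\<close> matter.
\<close>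

definition int_span :: "'a::real_vector set \<Rightarrow> 'a set" where
  "int_span B = {\<Sum>b\<in>B. of_int (c b) *\<^sub>R b | c :: 'a \<Rightarrow> int. True}"

definition is_lattice :: "'a::euclidean_space set \<Rightarrow> bool" where
  "is_lattice N \<longleftrightarrow> (\<exists>B. independent B \<and> N = int_span B)"

text \<open>For \<open>K = \<int>\<close> this is \<open>M = Hom(N, \<int>)\<close>, for \<open>K = \<rat>\<close> it is \<open>M \<otimes> \<rat>\<close>.\<close>

definition dual_lattice :: "real set \<Rightarrow> 'a::euclidean_space set \<Rightarrow> ('a \<Rightarrow> real) set" where
  "dual_lattice K N = {m. linear m \<and> (\<forall>x\<in>N. m x \<in> K)}"

text \<open>\<open>N\<^sub>\<sigma>\<close>\<close>

definition sublattice :: "'a::euclidean_space set \<Rightarrow> 'a set \<Rightarrow> 'a set" where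
  "sublattice N \<sigma> = N \<inter> span \<sigma>"

text \<open>
  The quotient of the ambient space by \<open>span \<sigma>\<close> is modelled by the orthogonal complement of
  \<open>span \<sigma>\<close>, every coset being represented by its unique element orthogonal to \<open>\<sigma>\<close>. The
  kernel of the projection on \<open>N\<close> is \<open>N\<^sub>\<sigma>\<close>, so that the image of \<open>N\<close> is \<open>N / N\<^sub>\<sigma>\<close>. This only
  serves to keep all star fans inside one type; no notion below depends on the inner product
  otherwise.
\<close>

definition quot_proj :: "'a::euclidean_space set \<Rightarrow> 'a \<Rightarrow> 'a" where
  "quot_proj \<sigma> x = (THE y. y \<in> orthogonal_comp (span \<sigma>) \<and> x - y \<in> span \<sigma>)"

definition quot_lattice :: "'a::euclidean_space set \<Rightarrow> 'a set \<Rightarrow> 'a set" where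
  "quot_lattice N \<sigma> = quot_proj \<sigma> ` N"


section \<open>Rational fans\<close>

definition rational_cone :: "'a::euclidean_space set \<Rightarrow> 'a set \<Rightarrow> bool" where
  "rational_cone N \<sigma> \<longleftrightarrow> (\<exists>S. finite S \<and> S \<subseteq> N \<and> \<sigma> = convex_cone hull S)"

definition strongly_convex :: "'a::euclidean_space set \<Rightarrow> bool" where
  "strongly_convex \<sigma> \<longleftrightarrow> (\<forall>x. x \<in> \<sigma> \<and> - x \<in> \<sigma> \<longrightarrow> x = 0)"

text \<open>
  The faces of a polyhedral cone are its non-empty faces in the sense of \<open>face_of\<close>, which
  also admits the empty set.
\<close>

definition cone_face :: "'a::euclidean_space set \<Rightarrow> 'a set \<Rightarrow> bool" where
  "cone_face \<tau> \<sigma> \<longleftrightarrow> \<tau> face_of \<sigma> \<and> \<tau> \<noteq> {}"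

definition rational_fan :: "'a::euclidean_space set \<Rightarrow> 'a set set \<Rightarrow> bool" where
  "rational_fan N \<Sigma> \<longleftrightarrow>
     finite \<Sigma> \<and> \<Sigma> \<noteq> {} \<and>
     (\<forall>\<sigma>\<in>\<Sigma>. rational_cone N \<sigma> \<and> strongly_convex \<sigma>) \<and>
     (\<forall>\<sigma>\<in>\<Sigma>. \<forall>\<tau>. cone_face \<tau> \<sigma> \<longrightarrow> \<tau> \<in> \<Sigma>) \<and>
     (\<forall>\<sigma>\<in>\<Sigma>. \<forall>\<eta>\<in>\<Sigma>. cone_face (\<sigma> \<inter> \<eta>) \<sigma> \<and> cone_face (\<sigma> \<inter> \<eta>) \<eta>)"

definition cones_of_dim :: "'a::euclidean_space set set \<Rightarrow> nat \<Rightarrow> 'a set set" where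
  "cones_of_dim \<Sigma> k = {\<sigma>\<in>\<Sigma>. dim \<sigma> = k}"

abbreviation rays :: "'a::euclidean_space set set \<Rightarrow> 'a set set" where
  "rays \<Sigma> \<equiv> cones_of_dim \<Sigma> 1"

text \<open>The primitive vector of a ray \<open>\<rho>\<close>, i.e. the generator of the monoid of its lattice points.\<close>

definition prim_vec :: "'a::euclidean_space set \<Rightarrow> 'a set \<Rightarrow> 'a" where
  "prim_vec N \<rho> = (THE v. N \<inter> \<rho> = {of_nat k *\<^sub>R v | k. True})"

definition simplicial_fan :: "'a::euclidean_space set set \<Rightarrow> bool" where
  "simplicial_fan \<Sigma> \<longleftrightarrow>
     (\<forall>\<sigma>\<in>\<Sigma>. \<exists>R. R \<subseteq> rays \<Sigma> \<and> card R = dim \<sigma> \<and> \<sigma> = convex_cone hull (\<Union>R))"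

definition unimodular_fan :: "'a::euclidean_space set \<Rightarrow> 'a set set \<Rightarrow> bool" where
  "unimodular_fan N \<Sigma> \<longleftrightarrow>
     (\<forall>\<sigma>\<in>\<Sigma>. \<exists>B. independent B \<and> int_span B = sublattice N \<sigma> \<and> \<sigma> = convex_cone hull B)"

text \<open>The cones of the star fan are the images of the cones containing \<open>\<sigma>\<close>.\<close>

definition star_fan :: "'a::euclidean_space set set \<Rightarrow> 'a set \<Rightarrow> 'a set set" where
  "star_fan \<Sigma> \<sigma> = (\<lambda>\<eta>. quot_proj \<sigma> ` \<eta>) ` {\<eta>\<in>\<Sigma>. \<sigma> \<subseteq> \<eta>}"

text \<open>
  The vectors \<open>\<nn>\<^sub>\<sigma>\<^sub>/\<^sub>\<tau>\<close> for a codimension one face \<open>\<tau>\<close> of \<open>\<sigma>\<close>. Being on the same side of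
  \<open>span \<tau>\<close> as \<open>\<sigma>\<close> is witnessed by a linear form \<open>x \<mapsto> u \<bullet> x\<close> cutting out \<open>span \<tau>\<close> in
  \<open>span \<sigma>\<close>.
\<close>

definition is_normal_vec :: "'a::euclidean_space set \<Rightarrow> 'a set \<Rightarrow> 'a set \<Rightarrow> 'a \<Rightarrow> bool" where
  "is_normal_vec N \<sigma> \<tau> n \<longleftrightarrow>
     n \<in> sublattice N \<sigma> \<and>
     (\<exists>u. (\<forall>x\<in>span \<tau>. u \<bullet> x = 0) \<and> (\<forall>x\<in>\<sigma>. 0 \<le> u \<bullet> x) \<and> 0 < u \<bullet> n) \<and>
     {t + of_int k *\<^sub>R n | t (k::int). t \<in> sublattice N \<tau>} = sublattice N \<sigma>"

definition normal_vec :: "'a::euclidean_space set \<Rightarrow> 'a set \<Rightarrow> 'a set \<Rightarrow> 'a" where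
  "normal_vec N \<sigma> \<tau> = (SOME n. is_normal_vec N \<sigma> \<tau> n)"


section \<open>Minkowski weights and tropical fans\<close>

text \<open>
  Maps on \<open>\<Sigma>\<^sub>p\<close> are represented by functions vanishing outside \<open>\<Sigma>\<^sub>p\<close>. The vector
  \<open>quot_proj \<tau> (normal_vec N \<sigma> \<tau>)\<close> is the image of \<open>\<nn>\<^sub>\<sigma>\<^sub>/\<^sub>\<tau>\<close> in \<open>N / N\<^sub>\<tau>\<close>.
\<close>

definition balanced :: "'a::euclidean_space set \<Rightarrow> 'a set set \<Rightarrow> nat \<Rightarrow> ('a set \<Rightarrow> int) \<Rightarrow> bool" where
  "balanced N \<Sigma> p w \<longleftrightarrow>
     (\<forall>\<tau>\<in>\<Sigma>. dim \<tau> + 1 = p \<longrightarrow>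
       (\<Sum>\<sigma> | \<sigma> \<in> cones_of_dim \<Sigma> p \<and> \<tau> \<subseteq> \<sigma>.
          of_int (w \<sigma>) *\<^sub>R quot_proj \<tau> (normal_vec N \<sigma> \<tau>)) = 0)"

definition MW :: "'a::euclidean_space set \<Rightarrow> 'a set set \<Rightarrow> nat \<Rightarrow> ('a set \<Rightarrow> int) monoid" where
  "MW N \<Sigma> p =
     \<lparr> carrier = {w. (\<forall>\<sigma>. \<sigma> \<notin> cones_of_dim \<Sigma> p \<longrightarrow> w \<sigma> = 0) \<and> balanced N \<Sigma> p w},
       mult = (\<lambda>w w' \<sigma>. w \<sigma> + w' \<sigma>),
       one = (\<lambda>\<sigma>. 0) \<rparr>"

definition tropical_fan ::
    "'a::euclidean_space set \<Rightarrow> 'a set set \<Rightarrow> nat \<Rightarrow> ('a set \<Rightarrow> int) \<Rightarrow> bool" where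
  "tropical_fan N \<Sigma> d \<omega> \<longleftrightarrow>
     rational_fan N \<Sigma> \<and>
     (\<forall>\<sigma>\<in>\<Sigma>. \<exists>\<eta>\<in>cones_of_dim \<Sigma> d. \<sigma> \<subseteq> \<eta>) \<and>
     \<omega> \<in> carrier (MW N \<Sigma> d) \<and>
     (\<forall>\<sigma>\<in>cones_of_dim \<Sigma> d. \<omega> \<sigma> \<noteq> 0)"

text \<open>The induced orientation of the star fan: the image of \<open>\<eta>\<close> gets the weight of \<open>\<eta>\<close>.\<close>

definition star_orientation ::
    "'a::euclidean_space set set \<Rightarrow> ('a set \<Rightarrow> int) \<Rightarrow> 'a set \<Rightarrow> 'a set \<Rightarrow> int" where
  "star_orientation \<Sigma> \<omega> \<sigma> \<zeta> =
     (if \<zeta> \<in> star_fan \<Sigma> \<sigma>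
      then \<omega> (the_inv_into {\<eta>\<in>\<Sigma>. \<sigma> \<subseteq> \<eta>} (\<lambda>\<eta>. quot_proj \<sigma> ` \<eta>) \<zeta>) else 0)"


section \<open>Meromorphic functions, divisors, tropical modifications\<close>

text \<open>Functions on the support \<open>\<Union>\<Sigma>\<close> are total; only their values on the support matter.\<close>

definition meromorphic :: "'a::euclidean_space set \<Rightarrow> 'a set set \<Rightarrow> ('a \<Rightarrow> real) \<Rightarrow> bool" where
  "meromorphic N \<Sigma> f \<longleftrightarrow>
     continuous_on (\<Union>\<Sigma>) f \<and>
     (\<forall>\<sigma>\<in>\<Sigma>. \<exists>l \<in> dual_lattice \<int> (sublattice N \<sigma>). \<forall>x\<in>\<sigma>. f x = l x)"

text \<open>\<open>f\<^sub>\<sigma>\<close>; its values on \<open>span \<sigma>\<close>, the only ones used, are determined by \<open>f\<close>.\<close>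

definition lin_part :: "('a::euclidean_space \<Rightarrow> real) \<Rightarrow> 'a set \<Rightarrow> 'a \<Rightarrow> real" where
  "lin_part f \<sigma> = (SOME l. linear l \<and> (\<forall>x\<in>\<sigma>. f x = l x))"

text \<open>The real number under the floor is an integer when \<open>f\<close> is meromorphic.\<close>

definition ord_at :: "'a::euclidean_space set \<Rightarrow> 'a set set \<Rightarrow> nat \<Rightarrow> ('a set \<Rightarrow> int) \<Rightarrow>
    ('a \<Rightarrow> real) \<Rightarrow> 'a set \<Rightarrow> int" where
  "ord_at N \<Sigma> d \<omega> f \<tau> =
     \<lfloor>- (\<Sum>\<sigma> | \<sigma> \<in> cones_of_dim \<Sigma> d \<and> \<tau> \<subseteq> \<sigma>. of_int (\<omega> \<sigma>) * lin_part f \<sigma> (normal_vec N \<sigma> \<tau>))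
      + lin_part f \<tau> (\<Sum>\<sigma> | \<sigma> \<in> cones_of_dim \<Sigma> d \<and> \<tau> \<subseteq> \<sigma>. of_int (\<omega> \<sigma>) *\<^sub>R normal_vec N \<sigma> \<tau>)\<rfloor>"

text \<open>Codimension one is written \<open>dim \<tau> + 1 = d\<close>, as there are no such cones when \<open>d = 0\<close>.\<close>

definition trivial_div :: "'a::euclidean_space set \<Rightarrow> 'a set set \<Rightarrow> nat \<Rightarrow> ('a set \<Rightarrow> int) \<Rightarrow>
    ('a \<Rightarrow> real) \<Rightarrow> bool" where
  "trivial_div N \<Sigma> d \<omega> f \<longleftrightarrow> (\<forall>\<tau>\<in>\<Sigma>. dim \<tau> + 1 = d \<longrightarrow> ord_at N \<Sigma> d \<omega> f \<tau> = 0)"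

definition div_subfan :: "'a::euclidean_space set \<Rightarrow> 'a set set \<Rightarrow> nat \<Rightarrow> ('a set \<Rightarrow> int) \<Rightarrow>
    ('a \<Rightarrow> real) \<Rightarrow> 'a set set" where
  "div_subfan N \<Sigma> d \<omega> f =
     {\<delta>. \<exists>\<tau>\<in>\<Sigma>. dim \<tau> + 1 = d \<and> ord_at N \<Sigma> d \<omega> f \<tau> \<noteq> 0 \<and> cone_face \<delta> \<tau>}"

definition graph_cone :: "('a::euclidean_space \<Rightarrow> real) \<Rightarrow> 'a set \<Rightarrow> ('a \<times> real) set" where
  "graph_cone f \<sigma> = (\<lambda>x. (x, f x)) ` \<sigma>"

definition up_cone :: "('a::euclidean_space \<Rightarrow> real) \<Rightarrow> 'a set \<Rightarrow> ('a \<times> real) set" where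
  "up_cone f \<delta> = {y + t *\<^sub>R (0, 1) | y t. y \<in> graph_cone f \<delta> \<and> 0 \<le> t}"

text \<open>
  \<open>TM\<^sub>f(\<Sigma>)\<close>, a fan for the lattice \<open>N \<times> \<int>\<close>, together with its orientation; \<open>\<sigma>\<close> and \<open>\<delta>\<close>
  are recovered from \<open>\<sigma>\<^sub>o\<close> and \<open>\<delta>\<^sub>\<up>\<close> by projecting to the first factor.
\<close>

definition tropical_modification ::
    "'a::euclidean_space set \<Rightarrow> 'a set set \<Rightarrow> nat \<Rightarrow> ('a set \<Rightarrow> int) \<Rightarrow> ('a \<Rightarrow> real) \<Rightarrow>
     ('a \<times> real) set set \<times> (('a \<times> real) set \<Rightarrow> int)" where
  "tropical_modification N \<Sigma> d \<omega> f =
     (let \<Delta> = div_subfan N \<Sigma> d \<omega> f in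
      (graph_cone f ` \<Sigma> \<union> up_cone f ` \<Delta>,
       \<lambda>\<zeta>. if \<zeta> \<in> graph_cone f ` cones_of_dim \<Sigma> d then \<omega> (fst ` \<zeta>)
           else if \<zeta> \<in> up_cone f ` {\<delta>\<in>\<Delta>. dim \<delta> + 1 = d} then ord_at N \<Sigma> d \<omega> f (fst ` \<zeta>)
           else 0))"


section \<open>Div-faithful and saturated fans\<close>

definition div_faithful :: "'a::euclidean_space set \<Rightarrow> 'a set set \<Rightarrow> nat \<Rightarrow> ('a set \<Rightarrow> int) \<Rightarrow> bool" where
  "div_faithful N \<Sigma> d \<omega> \<longleftrightarrow>
     (\<forall>\<eta>\<in>\<Sigma>. \<forall>g.
        meromorphic (quot_lattice N \<eta>) (star_fan \<Sigma> \<eta>) g \<and>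
        trivial_div (quot_lattice N \<eta>) (star_fan \<Sigma> \<eta>) (d - dim \<eta>) (star_orientation \<Sigma> \<omega> \<eta>) g
        \<longrightarrow> (\<exists>l. linear l \<and> (\<forall>x\<in>\<Union>(star_fan \<Sigma> \<eta>). g x = l x)))"

definition saturated_fan :: "'a::euclidean_space set \<Rightarrow> 'a set set \<Rightarrow> bool" where
  "saturated_fan N \<Sigma> \<longleftrightarrow>
     (\<forall>\<sigma>\<in>\<Sigma>. \<forall>l\<in>dual_lattice \<rat> (quot_lattice N \<sigma>).
        (\<forall>\<eta>\<in>star_fan \<Sigma> \<sigma>. \<forall>x\<in>\<eta> \<inter> quot_lattice N \<sigma>. l x \<in> \<int>)
        \<longrightarrow> (\<exists>m\<in>dual_lattice \<int> (quot_lattice N \<sigma>). \<forall>x\<in>\<Union>(star_fan \<Sigma> \<sigma>). l x = m x))"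


section \<open>Chow rings\<close>

text \<open>
  \<open>\<int>[X\<^sub>v]\<^bsub>v\<in>V\<^esub>\<close>: polynomials are finitely supported maps from monomials, i.e. finitely supported
  exponent vectors, to coefficients.
\<close>

type_synonym 'v int_mpoly = "('v \<Rightarrow>\<^sub>0 nat) \<Rightarrow>\<^sub>0 int"

definition poly_ring_on :: "'v set \<Rightarrow> 'v int_mpoly ring" where
  "poly_ring_on V =
     \<lparr> carrier = {p. \<forall>m\<in>Poly_Mapping.keys p. Poly_Mapping.keys m \<subseteq> V},
       mult = (*), one = 1, zero = 0, add = (+) \<rparr>"

definition Xvar :: "'v \<Rightarrow> 'v int_mpoly" where
  "Xvar v = Poly_Mapping.single (Poly_Mapping.single v 1) 1"

definition homogeneous :: "nat \<Rightarrow> 'v int_mpoly \<Rightarrow> bool" where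
  "homogeneous k p \<longleftrightarrow>
     (\<forall>m\<in>Poly_Mapping.keys p. (\<Sum>v\<in>Poly_Mapping.keys m. Poly_Mapping.lookup m v) = k)"

definition chow_gens_I :: "'a::euclidean_space set set \<Rightarrow> 'a set int_mpoly set" where
  "chow_gens_I \<Sigma> =
     {\<Prod>\<rho>\<in>R. Xvar \<rho> | R. R \<subseteq> rays \<Sigma> \<and> \<not> (\<exists>\<sigma>\<in>\<Sigma>. \<forall>\<rho>\<in>R. \<rho> \<subseteq> \<sigma>)}"

text \<open>The numbers \<open>m (prim_vec N \<zeta>)\<close> are integers, so the floor is only a conversion.\<close>

definition chow_gens_J :: "'a::euclidean_space set \<Rightarrow> 'a set set \<Rightarrow> 'a set int_mpoly set" where
  "chow_gens_J N \<Sigma> =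
     {\<Sum>\<zeta>\<in>rays \<Sigma>. of_int \<lfloor>m (prim_vec N \<zeta>)\<rfloor> * Xvar \<zeta> | m. m \<in> dual_lattice \<int> N}"

definition chow_ideal :: "'a::euclidean_space set \<Rightarrow> 'a set set \<Rightarrow> 'a set int_mpoly set" where
  "chow_ideal N \<Sigma> = genideal (poly_ring_on (rays \<Sigma>)) (chow_gens_I \<Sigma> \<union> chow_gens_J N \<Sigma>)"

definition chow_ring :: "'a::euclidean_space set \<Rightarrow> 'a set set \<Rightarrow> 'a set int_mpoly set ring" where
  "chow_ring N \<Sigma> = poly_ring_on (rays \<Sigma>) Quot chow_ideal N \<Sigma>"

definition chow_class ::
    "'a::euclidean_space set \<Rightarrow> 'a set set \<Rightarrow> 'a set int_mpoly \<Rightarrow> 'a set int_mpoly set" where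
  "chow_class N \<Sigma> p = chow_ideal N \<Sigma> +>\<^bsub>poly_ring_on (rays \<Sigma>)\<^esub> p"

text \<open>\<open>A\<^sup>k(\<Sigma>)\<close>\<close>

definition chow_graded ::
    "'a::euclidean_space set \<Rightarrow> 'a set set \<Rightarrow> nat \<Rightarrow> 'a set int_mpoly set set" where
  "chow_graded N \<Sigma> k =
     chow_class N \<Sigma> ` {p \<in> carrier (poly_ring_on (rays \<Sigma>)). homogeneous k p}"

text \<open>\<open>x\<^sub>\<sigma>\<close>\<close>

definition chow_x :: "'a::euclidean_space set \<Rightarrow> 'a set set \<Rightarrow> 'a set \<Rightarrow> 'a set int_mpoly set" where
  "chow_x N \<Sigma> \<sigma> =
     finprod (chow_ring N \<Sigma>) (\<lambda>\<zeta>. chow_class N \<Sigma> (Xvar \<zeta>)) {\<zeta>\<in>rays \<Sigma>. \<zeta> \<subseteq> \<sigma>}"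

definition torsion_free_ring :: "('r, 'm) ring_scheme \<Rightarrow> bool" where
  "torsion_free_ring R \<longleftrightarrow>
     (\<forall>n::nat. \<forall>a\<in>carrier R. 0 < n \<and> [n] \<cdot>\<^bsub>R\<^esub> a = \<zero>\<^bsub>R\<^esub> \<longrightarrow> a = \<zero>\<^bsub>R\<^esub>)"


section \<open>Tensor product with the rational numbers\<close>

text \<open>
  For a commutative ring \<open>R\<close>, the ring \<open>R \<otimes> \<rat>\<close> (over \<open>\<int>\<close>) is the free abelian group on the
  pairs \<open>(a, s)\<close>, with multiplication extending \<open>(a, s) (b, t) = (a b, s t)\<close>, modulo the
  relations of bilinearity. The subgroup generated by these relations is already an ideal.
\<close>

definition pair_ring :: "('r, 'm) ring_scheme \<Rightarrow> (('r \<times> rat) \<Rightarrow>\<^sub>0 int) ring" where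
  "pair_ring R =
     \<lparr> carrier = {p. Poly_Mapping.keys p \<subseteq> carrier R \<times> UNIV},
       mult = (\<lambda>p q. \<Sum>(a, s)\<in>Poly_Mapping.keys p. \<Sum>(b, t)\<in>Poly_Mapping.keys q.
                 Poly_Mapping.single (a \<otimes>\<^bsub>R\<^esub> b, s * t)
                   (Poly_Mapping.lookup p (a, s) * Poly_Mapping.lookup q (b, t))),
       one = Poly_Mapping.single (\<one>\<^bsub>R\<^esub>, 1) 1, zero = 0, add = (+) \<rparr>"

definition bilinear_rels :: "('r, 'm) ring_scheme \<Rightarrow> (('r \<times> rat) \<Rightarrow>\<^sub>0 int) set" where
  "bilinear_rels R =
     {Poly_Mapping.single (a \<oplus>\<^bsub>R\<^esub> b, s) 1 - Poly_Mapping.single (a, s) 1 - Poly_Mapping.single (b, s) 1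
        | a b s. a \<in> carrier R \<and> b \<in> carrier R} \<union>
     {Poly_Mapping.single (a, s + t) 1 - Poly_Mapping.single (a, s) 1 - Poly_Mapping.single (a, t) 1
        | a s t. a \<in> carrier R}"

definition rat_tensor :: "('r, 'm) ring_scheme \<Rightarrow> (('r \<times> rat) \<Rightarrow>\<^sub>0 int) set ring" where
  "rat_tensor R = pair_ring R Quot genideal (pair_ring R) (bilinear_rels R)"

text \<open>The element \<open>a \<otimes> s\<close>.\<close>

definition pure_tensor :: "('r, 'm) ring_scheme \<Rightarrow> 'r \<Rightarrow> rat \<Rightarrow> (('r \<times> rat) \<Rightarrow>\<^sub>0 int) set" where
  "pure_tensor R a s =
     genideal (pair_ring R) (bilinear_rels R) +>\<^bsub>pair_ring R\<^esub> Poly_Mapping.single (a, s) 1"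

definition rat_chow_ring ::
    "'a::euclidean_space set \<Rightarrow> 'a set set \<Rightarrow> (('a set int_mpoly set \<times> rat) \<Rightarrow>\<^sub>0 int) set ring" where
  "rat_chow_ring N \<Sigma> = rat_tensor (chow_ring N \<Sigma>)"

text \<open>\<open>A\<^sup>k(\<Sigma>) \<otimes> \<rat>\<close> as a subgroup of \<open>A(\<Sigma>) \<otimes> \<rat>\<close>.\<close>

definition rat_chow_graded ::
    "'a::euclidean_space set \<Rightarrow> 'a set set \<Rightarrow> nat \<Rightarrow>
     (('a set int_mpoly set \<times> rat) \<Rightarrow>\<^sub>0 int) set set" where
  "rat_chow_graded N \<Sigma> k =
     generate (add_monoid (rat_chow_ring N \<Sigma>))
       {pure_tensor (chow_ring N \<Sigma>) a s | a s. a \<in> chow_graded N \<Sigma> k}"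


section \<open>Degree maps and graded isomorphisms\<close>

definition additive_map_on ::
    "('r, 'm) ring_scheme \<Rightarrow> 'r set \<Rightarrow> ('r \<Rightarrow> 'k::ab_group_add) \<Rightarrow> bool" where
  "additive_map_on R G h \<longleftrightarrow> (\<forall>x\<in>G. \<forall>y\<in>G. h (x \<oplus>\<^bsub>R\<^esub> y) = h x + h y)"

text \<open>
  The degree map of a unimodular tropical fan of dimension \<open>d\<close>, as a function on \<open>A\<^sup>d(\<Sigma>)\<close>
  (extensional, to make the definite description unique), and its rational extension.
\<close>

definition chow_deg :: "'a::euclidean_space set \<Rightarrow> 'a set set \<Rightarrow> nat \<Rightarrow> ('a set \<Rightarrow> int) \<Rightarrow>
    'a set int_mpoly set \<Rightarrow> int" where
  "chow_deg N \<Sigma> d \<omega> =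
     (THE h. h \<in> extensional (chow_graded N \<Sigma> d) \<and>
             additive_map_on (chow_ring N \<Sigma>) (chow_graded N \<Sigma> d) h \<and>
             (\<forall>\<sigma>\<in>cones_of_dim \<Sigma> d. h (chow_x N \<Sigma> \<sigma>) = \<omega> \<sigma>))"

definition rat_chow_deg :: "'a::euclidean_space set \<Rightarrow> 'a set set \<Rightarrow> nat \<Rightarrow> ('a set \<Rightarrow> int) \<Rightarrow>
    (('a set int_mpoly set \<times> rat) \<Rightarrow>\<^sub>0 int) set \<Rightarrow> rat" where
  "rat_chow_deg N \<Sigma> d \<omega> =
     (THE h. h \<in> extensional (rat_chow_graded N \<Sigma> d) \<and>
             additive_map_on (rat_chow_ring N \<Sigma>) (rat_chow_graded N \<Sigma> d) h \<and>
             (\<forall>a\<in>chow_graded N \<Sigma> d. \<forall>s.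
                h (pure_tensor (chow_ring N \<Sigma>) a s) = of_int (chow_deg N \<Sigma> d \<omega> a) * s))"

definition graded_ring_iso ::
    "('r, 'm) ring_scheme \<Rightarrow> (nat \<Rightarrow> 'r set) \<Rightarrow> ('s, 'n) ring_scheme \<Rightarrow> (nat \<Rightarrow> 's set) \<Rightarrow>
     ('r \<Rightarrow> 's) set" where
  "graded_ring_iso R grR S grS = {\<phi> \<in> ring_iso R S. \<forall>k. \<phi> ` grR k = grS k}"

end

theory Submission
  imports Defs
begin

text \<open>
  The assignment \<open>x\<^sub>\<rho> \<mapsto> x\<^sub>\<rho>\<^sub>o\<close> respects the relations and defines \<open>g: A(\<Sigma>) \<rightarrow> A(TM\<^sub>f(\<Sigma>))\<close>. The linear form given by
  the last coordinate expresses the class of the new ray as \<open>- [f]\<close>, where \<open>[f] = \<Sum>\<^sub>\<rho> f(e\<^sub>\<rho>) x\<^sub>\<rho>\<close>, so \<open>g\<close> is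
  surjective, and it is invertible as soon as \<open>x\<^sub>\<sigma> [f] = 0\<close> for all \<open>\<sigma> \<notin> \<Delta>\<close>. For such \<open>\<sigma>\<close>,
  div-faithfulness of the star fan of \<open>\<sigma>\<close> makes \<open>f\<close> linear on the whole star of \<open>\<sigma>\<close>; the linear form is
  rational, so that \<open>x\<^sub>\<sigma> [f]\<close> is torsion, and it is integral when \<open>\<Sigma>\<close> is saturated.

  A Minkowski weight of the modification is determined by its restriction \<open>w\<close> to the cones \<open>\<sigma>\<^sub>o\<close>: balancing
  around \<open>\<delta>\<^sub>o\<close> forces the value on \<open>\<delta>\<^sub>\<up>\<close> to be the order of \<open>f\<close> along \<open>\<delta>\<close> with respect to \<open>w\<close>. Every \<open>w\<close> arises,
  because the divisor of \<open>f\<close> with respect to \<open>w\<close> is again balanced and vanishes outside \<open>\<Delta>\<close>.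

  In the unimodular case the rays act on Minkowski weights by commuting operators that satisfy the
  relations of the Chow ring. Applying a monomial of degree \<open>d\<close> to \<open>\<omega>\<close> yields its degree, and the degree
  of \<open>- x\<^sub>\<delta> [f]\<close> is the order of \<open>f\<close> along \<open>\<delta>\<close>, which is the weight of \<open>\<delta>\<^sub>\<up>\<close>.
\<close>

section \<open>Quotient rings and extension of scalars\<close>

text \<open>The fan is only simplicial, so primitive vectors of rays need not be lattice normal
  vectors. The factors \<open>kap\<close> record the discrepancy, and divisors of weights are
  balanced because these factors have the same product along both flags obtained by adding two rays
  in either order. Div-faithfulness speaks of \<omega> alone, while all weights have to be treated.
  It enters in one way only: a cone outside \<Delta> has a star on which f is linear, and linearity
  no longer refers to \<omega>. On polynomials, \<open>drop_var\<close> (new ray to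
  \<open>- fdiv\<close>) is an exact left inverse of the lift. Injectivity thus amounts to
  \<open>drop_var\<close> sending relations into an ideal K: the torsion ideal for rational
  coefficients, the Chow ideal for integral ones. Torsion is harmless for degrees as well, their
  values being integers. Degree maps are definite descriptions, so existence and uniqueness are
  required on both fans; on the modification both are transported along the two substitutions, and
  its cones are studied through their projections to \<Sigma>.\<close>

lemma quot_lift:
  assumes "ideal I R" "\<And>x y. x \<in> carrier R \<Longrightarrow> y \<in> carrier R \<Longrightarrow> x \<ominus>\<^bsub>R\<^esub> y \<in> I \<Longrightarrow> f x = f y"
  obtains F where "\<And>x. x \<in> carrier R \<Longrightarrow> F (I +>\<^bsub>R\<^esub> x) = f x"
proof
  interpret ideal I R by fact
  fix x assume x: "x \<in> carrier R"
  define y where "y = (SOME y. y \<in> carrier R \<and> I +>\<^bsub>R\<^esub> x = I +>\<^bsub>R\<^esub> y)"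
  have "y \<in> carrier R \<and> I +>\<^bsub>R\<^esub> x = I +>\<^bsub>R\<^esub> y"
    unfolding y_def by (rule someI[of _ x]) (use x in auto)
  then show "(\<lambda>X. f (SOME y. y \<in> carrier R \<and> X = I +>\<^bsub>R\<^esub> y)) (I +>\<^bsub>R\<^esub> x) = f x"
    using quotient_eq_iff_same_a_r_cos[OF ideal_axioms, of x y] assms(2)[of x y] x by (simp add: y_def)
qed

lemma carrier_quot: "carrier (R Quot I) = (\<lambda>x. I +>\<^bsub>R\<^esub> x) ` carrier R"
  by (auto simp: FactRing_simps)

lemma quot_hom_lift:
  assumes "ideal I R" "ring S" "h \<in> ring_hom R S" "\<And>x. x \<in> I \<Longrightarrow> h x = \<zero>\<^bsub>S\<^esub>"
  obtains H where "H \<in> ring_hom (R Quot I) S" "\<And>x. x \<in> carrier R \<Longrightarrow> H (I +>\<^bsub>R\<^esub> x) = h x"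
proof -
  interpret ideal I R by fact
  interpret S: ring S by fact
  interpret h: ring_hom_ring R S h
    by (rule ring_hom_ringI2) (use assms S.ring_axioms ring_axioms in auto)
  have eq: "h x = h y" if "x \<in> carrier R" "y \<in> carrier R" "x \<ominus>\<^bsub>R\<^esub> y \<in> I" for x y
  proof -
    have "h x \<ominus>\<^bsub>S\<^esub> h y = h (x \<ominus>\<^bsub>R\<^esub> y)" using that by (simp add: a_minus_def a_minus_def)
    then have "h x \<ominus>\<^bsub>S\<^esub> h y = \<zero>\<^bsub>S\<^esub>" using assms(4) that by simp
    moreover have "h x = (h x \<ominus>\<^bsub>S\<^esub> h y) \<oplus>\<^bsub>S\<^esub> h y" using that by (simp add: a_minus_def S.a_assoc S.l_neg)
    ultimately show ?thesis using that by simp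
  qed
  obtain H where H: "\<And>x. x \<in> carrier R \<Longrightarrow> H (I +>\<^bsub>R\<^esub> x) = h x"
    using quot_lift[OF assms(1), of h] eq by metis
  have "H \<in> ring_hom (R Quot I) S"
  proof (rule ring_hom_memI)
    fix X assume "X \<in> carrier (R Quot I)"
    then show "H X \<in> carrier S" by (auto simp: carrier_quot H)
  next
    fix X Y assume "X \<in> carrier (R Quot I)" "Y \<in> carrier (R Quot I)"
    then obtain x y where xy: "x \<in> carrier R" "X = I +>\<^bsub>R\<^esub> x" "y \<in> carrier R" "Y = I +>\<^bsub>R\<^esub> y"
      by (auto simp: carrier_quot)
    have "X \<otimes>\<^bsub>R Quot I\<^esub> Y = I +>\<^bsub>R\<^esub> (x \<otimes>\<^bsub>R\<^esub> y)" "X \<oplus>\<^bsub>R Quot I\<^esub> Y = I +>\<^bsub>R\<^esub> (x \<oplus>\<^bsub>R\<^esub> y)"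
      using rcos_ring_hom xy by (auto dest: ring_hom_mult ring_hom_add)
    then show "H (X \<otimes>\<^bsub>R Quot I\<^esub> Y) = H X \<otimes>\<^bsub>S\<^esub> H Y" "H (X \<oplus>\<^bsub>R Quot I\<^esub> Y) = H X \<oplus>\<^bsub>S\<^esub> H Y"
      using xy by (simp_all add: H)
  next
    show "H \<one>\<^bsub>R Quot I\<^esub> = \<one>\<^bsub>S\<^esub>"
      by (simp add: FactRing_def H)
  qed
  then show ?thesis using H that by blast
qed

text \<open>An image absorbs multiplication by all of \<open>S\<close> because every element of
  \<open>S\<close> is hit. This allows the relation ideal of a target to be compared with the image
  of the relation ideal of the source.\<close>

lemma ideal_surj_image:
  assumes "ring_hom_ring R S h" "h ` carrier R = carrier S" "ideal I R"
  shows "ideal (h ` I) S"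
proof -
  interpret h: ring_hom_ring R S h by fact
  interpret ideal I R by fact
  show ?thesis
  proof (rule idealI)
    show "ring S" by (rule h.S.ring_axioms)
    show "subgroup (h ` I) (add_monoid S)"
    proof
      show "h ` I \<subseteq> carrier (add_monoid S)" using a_subset by auto
      show "x \<otimes>\<^bsub>add_monoid S\<^esub> y \<in> h ` I" if "x \<in> h ` I" "y \<in> h ` I" for x y
      proof -
        obtain a b where "a \<in> I" "b \<in> I" "x = h a" "y = h b" using \<open>x \<in> _\<close> \<open>y \<in> _\<close> by blast
        then show ?thesis using a_subset
          by (intro image_eqI[of _ _ "a \<oplus>\<^bsub>R\<^esub> b"]) auto
      qed
      show "\<one>\<^bsub>add_monoid S\<^esub> \<in> h ` I" by (intro image_eqI[of _ _ "\<zero>\<^bsub>R\<^esub>"]) auto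
      show "inv\<^bsub>add_monoid S\<^esub> x \<in> h ` I" if x: "x \<in> h ` I" for x
      proof -
        obtain a where a: "a \<in> I" "x = h a" using x by blast
        then have "h (\<ominus>\<^bsub>R\<^esub> a) = \<ominus>\<^bsub>S\<^esub> x" using a_subset by auto
        then show ?thesis using a by (metis a_inv_closed a_inv_def image_eqI)
      qed
    qed
    fix a x assume ax: "a \<in> h ` I" "x \<in> carrier S"
    obtain b y where bb: "b \<in> I" "a = h b" "y \<in> carrier R" "x = h y" using ax assms(2) by blast
    show "x \<otimes>\<^bsub>S\<^esub> a \<in> h ` I" using bb a_subset
      by (intro image_eqI[of _ _ "y \<otimes>\<^bsub>R\<^esub> b"]) (auto simp: I_l_closed)
    show "a \<otimes>\<^bsub>S\<^esub> x \<in> h ` I" using bb a_subset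
      by (intro image_eqI[of _ _ "b \<otimes>\<^bsub>R\<^esub> y"]) (auto simp: I_r_closed)
  qed
qed

section \<open>Extension of scalars by generators and relations\<close>

definition pair_mult :: "('r, 'm) ring_scheme \<Rightarrow> ('r \<times> rat) \<Rightarrow> ('r \<times> rat) \<Rightarrow> ('r \<times> rat)" where
  "pair_mult R x y = (fst x \<otimes>\<^bsub>R\<^esub> fst y, snd x * snd y)"

lemma frag_cmul_single: "frag_cmul c (Poly_Mapping.single x d) = Poly_Mapping.single x (c * d)"
  by (rule poly_mapping_eqI) (auto simp: lookup_single when_def)

lemma frag_extend_diff_fun:
  fixes f g :: "'a \<Rightarrow> ('b \<Rightarrow>\<^sub>0 int)"
  shows "frag_extend (\<lambda>x. f x - g x) p = frag_extend f p - frag_extend g p"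
proof -
  have "frag_cmul c (a - b) = frag_cmul c a - frag_cmul c b" for c and a b :: "'b \<Rightarrow>\<^sub>0 int"
    by (rule poly_mapping_eqI) (simp add: lookup_minus algebra_simps)
  then show ?thesis by (simp add: frag_extend_def sum_subtractf)
qed

lemma pair_ring_simps:
  "carrier (pair_ring R) = {p. Poly_Mapping.keys p \<subseteq> carrier R \<times> UNIV}"
  "\<zero>\<^bsub>pair_ring R\<^esub> = 0" "\<one>\<^bsub>pair_ring R\<^esub> = frag_of (\<one>\<^bsub>R\<^esub>, 1)" "p \<oplus>\<^bsub>pair_ring R\<^esub> q = p + q"
  by (simp_all add: pair_ring_def)

text \<open>Nested \<open>frag_extend\<close> exhibits the product as the biadditive extension of
  \<open>pair_mult\<close>, so that identities can be proved by \<open>frag_induction\<close> on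
  single pairs.\<close>

lemma pair_ring_mult:
  "p \<otimes>\<^bsub>pair_ring R\<^esub> q = frag_extend (\<lambda>x. frag_extend (\<lambda>y. frag_of (pair_mult R x y)) q) p"
  unfolding frag_extend_def frag_cmul_sum frag_cmul_cmul frag_cmul_single
  by (simp add: pair_ring_def pair_mult_def case_prod_unfold)

lemma pair_ring_mult_frag [simp]:
  "frag_of x \<otimes>\<^bsub>pair_ring R\<^esub> frag_of y = frag_of (pair_mult R x y)"
  by (simp add: pair_ring_mult)

lemma pair_ring_bilin:
  "(p - p') \<otimes>\<^bsub>pair_ring R\<^esub> q = p \<otimes>\<^bsub>pair_ring R\<^esub> q - p' \<otimes>\<^bsub>pair_ring R\<^esub> q"
  "p \<otimes>\<^bsub>pair_ring R\<^esub> (q - q') = p \<otimes>\<^bsub>pair_ring R\<^esub> q - p \<otimes>\<^bsub>pair_ring R\<^esub> q'"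
  "(p + p') \<otimes>\<^bsub>pair_ring R\<^esub> q = p \<otimes>\<^bsub>pair_ring R\<^esub> q + p' \<otimes>\<^bsub>pair_ring R\<^esub> q"
  "p \<otimes>\<^bsub>pair_ring R\<^esub> 0 = 0" "0 \<otimes>\<^bsub>pair_ring R\<^esub> q = 0"
  by (simp_all add: pair_ring_mult frag_extend_diff frag_extend_add frag_extend_diff_fun frag_extend_eq_0)

text \<open>The product is additive in each argument, so \<open>frag_induction\<close> reduces its
  laws to single pairs, where they are the laws of \<open>R\<close> and of the rationals
  componentwise.\<close>

lemma (in cring) pair_ring_cring: "cring (pair_ring R)"
proof -
  let ?P = "pair_ring R" and ?S = "carrier R \<times> (UNIV :: rat set)"
  have carr: "p \<in> carrier ?P \<longleftrightarrow> Poly_Mapping.keys p \<subseteq> ?S" for p by (simp add: pair_ring_simps)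
  have cl0: "0 \<in> carrier ?P" by (simp add: carr)
  have cldiff: "p - q \<in> carrier ?P" if "p \<in> carrier ?P" "q \<in> carrier ?P" for p q
    using that keys_diff[of p q] by (auto simp: carr)
  have clfrag: "frag_of x \<in> carrier ?P" if "x \<in> ?S" for x using that by (simp add: carr)
  have pmcl: "pair_mult R x y \<in> ?S" if "x \<in> ?S" "y \<in> ?S" for x y
    using that by (auto simp: pair_mult_def)
  have clmult: "p \<otimes>\<^bsub>?P\<^esub> q \<in> carrier ?P" if p: "p \<in> carrier ?P" and q: "q \<in> carrier ?P" for p q
    using p[unfolded carr]
  proof (induction p rule: frag_induction)
    case (one x)
    show ?case using q[unfolded carr]
      by (induction q rule: frag_induction)
        (use one in \<open>auto simp: pair_ring_bilin cl0 cldiff clfrag pmcl simp del: mem_Times_iff\<close>)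
  qed (auto simp: pair_ring_bilin cl0 cldiff)
  have comm: "p \<otimes>\<^bsub>?P\<^esub> q = q \<otimes>\<^bsub>?P\<^esub> p" if p: "p \<in> carrier ?P" and q: "q \<in> carrier ?P" for p q
    using p[unfolded carr]
  proof (induction p rule: frag_induction)
    case (one x)
    show ?case using q[unfolded carr]
      by (induction q rule: frag_induction)
        (use one in \<open>auto simp: pair_ring_bilin pair_mult_def m_comm mult.commute\<close>)
  qed (auto simp: pair_ring_bilin)
  have assoc: "(p \<otimes>\<^bsub>?P\<^esub> q) \<otimes>\<^bsub>?P\<^esub> r = p \<otimes>\<^bsub>?P\<^esub> (q \<otimes>\<^bsub>?P\<^esub> r)"
    if p: "p \<in> carrier ?P" and q: "q \<in> carrier ?P" and r: "r \<in> carrier ?P" for p q r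
    using p[unfolded carr]
  proof (induction p rule: frag_induction)
    case (one x)
    note x = one
    show ?case using q[unfolded carr]
    proof (induction q rule: frag_induction)
      case (one y)
      show ?case using r[unfolded carr]
        by (induction r rule: frag_induction)
          (use x one in \<open>auto simp: pair_ring_bilin pair_mult_def m_assoc mult.assoc\<close>)
    qed (auto simp: pair_ring_bilin)
  qed (auto simp: pair_ring_bilin)
  have unit: "\<one>\<^bsub>?P\<^esub> \<otimes>\<^bsub>?P\<^esub> p = p" if p: "p \<in> carrier ?P" for p
    using p[unfolded carr]
    by (induction p rule: frag_induction) (auto simp: pair_ring_bilin pair_ring_simps pair_mult_def)
  have one: "\<one>\<^bsub>?P\<^esub> \<in> carrier ?P" by (auto simp: pair_ring_simps)
  have add: "p + q \<in> carrier ?P" if "p \<in> carrier ?P" "q \<in> carrier ?P" for p q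
    using that keys_add[of p q] by (auto simp: carr)
  show ?thesis
  proof (rule cringI)
    show "abelian_group ?P"
    proof (rule abelian_groupI)
      show "\<exists>y\<in>carrier ?P. y \<oplus>\<^bsub>?P\<^esub> x = \<zero>\<^bsub>?P\<^esub>" if "x \<in> carrier ?P" for x
        by (rule bexI[of _ "- x"]) (use that in \<open>auto simp: pair_ring_simps\<close>)
    qed (use add cl0 in \<open>auto simp: pair_ring_simps(2-) ac_simps\<close>)
    show "comm_monoid ?P"
      by (rule comm_monoidI) (use clmult assoc comm unit one in auto)
    show "(x \<oplus>\<^bsub>?P\<^esub> y) \<otimes>\<^bsub>?P\<^esub> z = x \<otimes>\<^bsub>?P\<^esub> z \<oplus>\<^bsub>?P\<^esub> y \<otimes>\<^bsub>?P\<^esub> z" for x y z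
      by (simp add: pair_ring_simps pair_ring_bilin)
  qed
qed

lemma (in cring) pair_ring_minus:
  assumes "p \<in> carrier (pair_ring R)" "q \<in> carrier (pair_ring R)"
  shows "p \<ominus>\<^bsub>pair_ring R\<^esub> q = p - q"
proof -
  interpret P: cring "pair_ring R" by (rule pair_ring_cring)
  have "- q \<in> carrier (pair_ring R)" "q \<oplus>\<^bsub>pair_ring R\<^esub> (- q) = \<zero>\<^bsub>pair_ring R\<^esub>"
    using assms by (auto simp: pair_ring_simps)
  then have "\<ominus>\<^bsub>pair_ring R\<^esub> q = - q" using assms by (metis P.add.inv_equality P.add.m_comm)
  then show ?thesis by (simp add: P.minus_eq pair_ring_simps)
qed

lemma bilinear_relsI:
  "a \<in> carrier R \<Longrightarrow> b \<in> carrier R \<Longrightarrow>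
    frag_of (a \<oplus>\<^bsub>R\<^esub> b, s) - frag_of (a, s) - frag_of (b, s) \<in> bilinear_rels R"
  "a \<in> carrier R \<Longrightarrow> frag_of (a, s + t) - frag_of (a, s) - frag_of (a, t) \<in> bilinear_rels R"
  unfolding bilinear_rels_def by blast+

lemma bilinear_relsE:
  assumes "p \<in> bilinear_rels R"
  obtains (left) a b s where "a \<in> carrier R" "b \<in> carrier R"
      "p = frag_of (a \<oplus>\<^bsub>R\<^esub> b, s) - frag_of (a, s) - frag_of (b, s)"
    | (right) a s t where "a \<in> carrier R" "p = frag_of (a, s + t) - frag_of (a, s) - frag_of (a, t)"
  using assms unfolding bilinear_rels_def by blast

abbreviation tensor_ideal :: "('r, 'm) ring_scheme \<Rightarrow> (('r \<times> rat) \<Rightarrow>\<^sub>0 int) set" where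
  "tensor_ideal R \<equiv> genideal (pair_ring R) (bilinear_rels R)"

lemma (in cring) bilinear_rels_carrier: "bilinear_rels R \<subseteq> carrier (pair_ring R)"
proof -
  have "frag_of a - frag_of b - frag_of c \<in> carrier (pair_ring R)"
    if "a \<in> carrier R \<times> UNIV" "b \<in> carrier R \<times> UNIV" "c \<in> carrier R \<times> UNIV" for a b c
    using that keys_diff[of "frag_of a - frag_of b" "frag_of c"] keys_diff[of "frag_of a" "frag_of b"]
    by (auto simp: pair_ring_simps)
  then show ?thesis unfolding bilinear_rels_def by auto
qed

lemma (in cring) tensor_ideal_ideal: "ideal (tensor_ideal R) (pair_ring R)"
  using cring.axioms(1)[OF pair_ring_cring] bilinear_rels_carrier by (rule ring.genideal_ideal)

lemma (in cring) bilinear_rels_tensor_ideal: "bilinear_rels R \<subseteq> tensor_ideal R"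
  using cring.axioms(1)[OF pair_ring_cring] bilinear_rels_carrier by (rule ring.genideal_self)

lemma (in cring) tensor_ideal_closed:
  "p \<in> tensor_ideal R \<Longrightarrow> q \<in> tensor_ideal R \<Longrightarrow> p + q \<in> tensor_ideal R"
  "p \<in> tensor_ideal R \<Longrightarrow> q \<in> tensor_ideal R \<Longrightarrow> p - q \<in> tensor_ideal R"
  "0 \<in> tensor_ideal R"
proof -
  interpret P: cring "pair_ring R" by (rule pair_ring_cring)
  interpret ideal "tensor_ideal R" "pair_ring R" by (rule tensor_ideal_ideal)
  show "p + q \<in> tensor_ideal R" if "p \<in> tensor_ideal R" "q \<in> tensor_ideal R"
    using a_closed[OF that] by (simp add: pair_ring_simps)
  show "p - q \<in> tensor_ideal R" if "p \<in> tensor_ideal R" "q \<in> tensor_ideal R"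
  proof -
    have "p \<ominus>\<^bsub>pair_ring R\<^esub> q \<in> tensor_ideal R"
      using a_closed[OF that(1) a_inv_closed[OF that(2)]] by (simp only: P.minus_eq)
    then show ?thesis using pair_ring_minus[OF a_Hcarr[OF that(1)] a_Hcarr[OF that(2)]] by (simp only:)
  qed
  show "0 \<in> tensor_ideal R" using zero_closed by (simp add: pair_ring_simps)
qed

lemma (in cring) rat_tensor_ring: "ring (rat_tensor R)"
  unfolding rat_tensor_def using tensor_ideal_ideal by (rule ideal.quotient_is_ring)

abbreviation tensor_class where
  "tensor_class R p \<equiv> tensor_ideal R +>\<^bsub>pair_ring R\<^esub> p"

lemma (in cring) tensor_class_eq_iff:
  assumes "p \<in> carrier (pair_ring R)" "q \<in> carrier (pair_ring R)"
  shows "tensor_class R p = tensor_class R q \<longleftrightarrow> p - q \<in> tensor_ideal R"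
proof -
  interpret P: cring "pair_ring R" by (rule pair_ring_cring)
  show ?thesis
    using P.quotient_eq_iff_same_a_r_cos[OF tensor_ideal_ideal assms] assms
    by (simp add: pair_ring_minus)
qed

lemma (in cring) pure_carrier:
  assumes "a \<in> carrier R"
  shows "pure_tensor R a s \<in> carrier (rat_tensor R)"
  using assms by (auto simp: pure_tensor_def rat_tensor_def carrier_quot pair_ring_simps)

text \<open>The functional is checked on all multiples of a relation because the relations generate an ideal.\<close>

lemma (in cring) rat_tensor_functional:
  fixes D :: "'a \<Rightarrow> int"
  assumes D: "\<And>a b. a \<in> carrier R \<Longrightarrow> b \<in> carrier R \<Longrightarrow> D (a \<oplus> b) = D a + D b"
  obtains E :: "_ \<Rightarrow> rat" where
    "\<And>x y. x \<in> carrier (rat_tensor R) \<Longrightarrow> y \<in> carrier (rat_tensor R) \<Longrightarrow>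
       E (x \<oplus>\<^bsub>rat_tensor R\<^esub> y) = E x + E y"
    "\<And>a s. a \<in> carrier R \<Longrightarrow> E (pure_tensor R a s) = of_int (D a) * s"
proof -
  let ?P = "pair_ring R"
  interpret P: cring ?P by (rule pair_ring_cring)
  define F :: "('a \<times> rat \<Rightarrow>\<^sub>0 int) \<Rightarrow> rat" where
    "F p = (\<Sum>x\<in>Poly_Mapping.keys p. of_int (Poly_Mapping.lookup p x) * (of_int (D (fst x)) * snd x))" for p
  have F_add: "F (p + q) = F p + F q" for p q
    unfolding F_def by (rule setsum_keys_plus_distrib) (auto simp: algebra_simps)
  have F_frag: "F (frag_of x) = of_int (D (fst x)) * snd x" for x by (simp add: F_def)
  have F0: "F 0 = 0" by (simp add: F_def)
  have F_diff: "F (p - q) = F p - F q" for p q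
    using F_add[of "p - q" q] by simp
  define K where "K = {p \<in> carrier ?P. \<forall>q\<in>carrier ?P. F (p \<otimes>\<^bsub>?P\<^esub> q) = 0}"
  have "ideal K ?P"
  proof (rule idealI)
    show "ring ?P" by (rule P.ring_axioms)
    show "subgroup K (add_monoid ?P)"
    proof
      show "K \<subseteq> carrier (add_monoid ?P)" by (auto simp: K_def)
      show "x \<otimes>\<^bsub>add_monoid ?P\<^esub> y \<in> K" if "x \<in> K" "y \<in> K" for x y
        using that P.a_closed[of x y] by (auto simp: K_def pair_ring_bilin F_add pair_ring_simps(4))
      show "\<one>\<^bsub>add_monoid ?P\<^esub> \<in> K" by (auto simp: K_def F0 pair_ring_bilin pair_ring_simps)
      show "inv\<^bsub>add_monoid ?P\<^esub> x \<in> K" if "x \<in> K" for x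
      proof -
        have x: "x \<in> carrier ?P" using that by (auto simp: K_def)
        have "\<ominus>\<^bsub>?P\<^esub> x = 0 - x"
          using pair_ring_minus[of 0 x] x P.zero_closed by (simp add: P.minus_eq pair_ring_simps(2,4))
        moreover have "\<ominus>\<^bsub>?P\<^esub> x \<in> carrier ?P" using x by simp
        ultimately have "\<ominus>\<^bsub>?P\<^esub> x \<in> K" using that by (auto simp: K_def F0 F_diff pair_ring_bilin simp del: diff_0)
        then show ?thesis by (simp add: a_inv_def)
      qed
    qed
    show "x \<otimes>\<^bsub>?P\<^esub> a \<in> K" "a \<otimes>\<^bsub>?P\<^esub> x \<in> K" if "a \<in> K" "x \<in> carrier ?P" for a x
    proof -
      have "x \<otimes>\<^bsub>?P\<^esub> a = a \<otimes>\<^bsub>?P\<^esub> x" using that P.m_comm by (auto simp: K_def)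
      moreover show "a \<otimes>\<^bsub>?P\<^esub> x \<in> K" using that by (auto simp: K_def P.m_assoc)
      ultimately show "x \<otimes>\<^bsub>?P\<^esub> a \<in> K" by simp
    qed
  qed
  moreover have "bilinear_rels R \<subseteq> K"
  proof
    fix p assume p: "p \<in> bilinear_rels R"
    have "F (p \<otimes>\<^bsub>?P\<^esub> q) = 0" if q: "q \<in> carrier ?P" for q
      using q[unfolded pair_ring_simps mem_Collect_eq]
    proof (induction q rule: frag_induction)
      case (one x)
      show ?case using p
      proof (cases rule: bilinear_relsE)
        case (left a b s)
        then show ?thesis using one unfolding left(3)
          by (auto simp: pair_ring_bilin F_diff F_frag pair_mult_def D l_distr algebra_simps simp del: diff_diff_eq)
      next
        case (right a s t)
        then show ?thesis using one unfolding right(2)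
          by (auto simp: pair_ring_bilin F_diff F_add F_frag pair_mult_def algebra_simps)
      qed
    qed (auto simp: pair_ring_bilin F0 F_diff)
    then show "p \<in> K" using p bilinear_rels_carrier by (auto simp: K_def)
  qed
  ultimately have IK: "tensor_ideal R \<subseteq> K" by (rule P.genideal_minimal)
  have FI: "F p = 0" if "p \<in> tensor_ideal R" for p
  proof -
    have "p \<in> carrier ?P" "F (p \<otimes>\<^bsub>?P\<^esub> \<one>\<^bsub>?P\<^esub>) = 0" using IK that by (auto simp: K_def)
    then show ?thesis by simp
  qed
  obtain E where E: "\<And>p. p \<in> carrier ?P \<Longrightarrow> E (tensor_class R p) = F p"
  proof (rule quot_lift[OF tensor_ideal_ideal, of F])
    fix p q assume "p \<in> carrier ?P" "q \<in> carrier ?P" "p \<ominus>\<^bsub>?P\<^esub> q \<in> tensor_ideal R"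
    then show "F p = F q" using FI[of "p - q"] pair_ring_minus[of p q] by (simp add: F_diff)
  qed blast
  show ?thesis
  proof (rule that[of E])
    fix x y assume "x \<in> carrier (rat_tensor R)" "y \<in> carrier (rat_tensor R)"
    then obtain p q where pq: "p \<in> carrier ?P" "q \<in> carrier ?P" "x = tensor_class R p" "y = tensor_class R q"
      by (auto simp: rat_tensor_def carrier_quot)
    have "x \<oplus>\<^bsub>rat_tensor R\<^esub> y = tensor_class R (p + q)"
      using ring_hom_add[OF ideal.rcos_ring_hom[OF tensor_ideal_ideal] pq(1,2)] pq(3,4)
      by (simp add: rat_tensor_def pair_ring_simps)
    moreover have "p + q \<in> carrier ?P" using P.a_closed[OF pq(1,2)] by (simp add: pair_ring_simps)
    ultimately show "E (x \<oplus>\<^bsub>rat_tensor R\<^esub> y) = E x + E y" using pq by (simp add: E F_add)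
  next
    fix a s assume "a \<in> carrier R"
    then show "E (pure_tensor R a s) = of_int (D a) * s"
      by (simp add: pure_tensor_def E F_frag pair_ring_simps)
  qed
qed

text \<open>Write \<open>s\<close> as \<open>n\<close> times \<open>s / n\<close> and move the
  factor \<open>n\<close> to the left: the pair becomes one with first entry zero.\<close>

lemma (in cring) tensor_single_torsion:
  assumes c: "c \<in> carrier R" "0 < (n::nat)" "[n] \<cdot> c = \<zero>"
  shows "frag_of (c, s) \<in> tensor_ideal R"
proof -
  have zero: "frag_of (\<zero>, t) \<in> tensor_ideal R" for t
  proof -
    have "frag_of (\<zero> \<oplus> \<zero>, t) - frag_of (\<zero>, t) - frag_of (\<zero>, t) \<in> bilinear_rels R"
      unfolding bilinear_rels_def by blast
    then have "- frag_of (\<zero>, t) \<in> tensor_ideal R" using bilinear_rels_tensor_ideal by auto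
    from tensor_ideal_closed(2)[OF tensor_ideal_closed(3) this] show ?thesis by simp
  qed
  have zero': "frag_of (c, 0) \<in> tensor_ideal R"
  proof -
    have "frag_of (c, 0 + 0) - frag_of (c, 0) - frag_of (c, 0) \<in> bilinear_rels R"
      unfolding bilinear_rels_def using c by blast
    then have "- frag_of (c, 0::rat) \<in> tensor_ideal R" using bilinear_rels_tensor_ideal by auto
    from tensor_ideal_closed(2)[OF tensor_ideal_closed(3) this] show ?thesis by simp
  qed
  \<comment> \<open>The integer factor changes sides one summand at a time; each step uses the
    difference of a left and a right additivity relation.\<close>
  have swap: "frag_of ([k] \<cdot> c, t) - frag_of (c, of_nat k * t) \<in> tensor_ideal R" for k :: nat and t
  proof (induction k)
    case 0
    show ?case using tensor_ideal_closed(2)[OF zero zero'] by simp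
  next
    case (Suc k)
    have "frag_of ([k] \<cdot> c \<oplus> c, t) - frag_of ([k] \<cdot> c, t) - frag_of (c, t) \<in> tensor_ideal R"
      by (intro subsetD[OF bilinear_rels_tensor_ideal] bilinear_relsI) (use c in auto)
    moreover have "frag_of (c, of_nat k * t + t) - frag_of (c, of_nat k * t) - frag_of (c, t) \<in> tensor_ideal R"
      by (intro subsetD[OF bilinear_rels_tensor_ideal] bilinear_relsI) (use c in auto)
    ultimately have "(frag_of ([k] \<cdot> c \<oplus> c, t) - frag_of ([k] \<cdot> c, t) - frag_of (c, t))
       - (frag_of (c, of_nat k * t + t) - frag_of (c, of_nat k * t) - frag_of (c, t))
       + (frag_of ([k] \<cdot> c, t) - frag_of (c, of_nat k * t)) \<in> tensor_ideal R"
      using Suc tensor_ideal_closed by blast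
    then show ?case using c by (simp add: algebra_simps)
  qed
  have "frag_of (\<zero>, s / of_nat n) - (frag_of ([n] \<cdot> c, s / of_nat n) - frag_of (c, of_nat n * (s / of_nat n)))
      \<in> tensor_ideal R"
    using tensor_ideal_closed(2)[OF zero swap] .
  then show ?thesis using c by simp
qed

text \<open>The kernel of the induced map on pairs lies in the ideal of bilinearity relations: a pair
  \<open>(a, s)\<close> may be replaced by \<open>(a', s)\<close> with a chosen \<open>a'\<close> of the same image, the difference being
  torsion.\<close>

lemma rat_tensor_iso:
  assumes R: "cring R" and S: "cring S" and g: "g \<in> ring_hom R S" and surj: "g ` carrier R = carrier S"
    and tors: "\<And>a. a \<in> carrier R \<Longrightarrow> g a = \<zero>\<^bsub>S\<^esub> \<Longrightarrow> \<exists>n>0. [(n::nat)] \<cdot>\<^bsub>R\<^esub> a = \<zero>\<^bsub>R\<^esub>"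
  obtains H where "H \<in> ring_iso (rat_tensor R) (rat_tensor S)"
    "\<And>a s. a \<in> carrier R \<Longrightarrow> H (pure_tensor R a s) = pure_tensor S (g a) s"
proof -
  interpret R: cring R by fact
  interpret S: cring S by fact
  interpret g: ring_hom_cring R S g by (rule ring_hom_cringI) (use R S g in \<open>auto simp: ring_hom_ringI2 cring.axioms\<close>)
  let ?P = "pair_ring R" and ?Q = "pair_ring S"
  interpret P: cring ?P by (rule R.pair_ring_cring)
  interpret Q: cring ?Q by (rule S.pair_ring_cring)
  define G where "G = frag_extend (\<lambda>x. frag_of (g (fst x), snd x :: rat))"
  have G_add: "G (p + q) = G p + G q" and G_diff: "G (p - q) = G p - G q" and G0: "G 0 = 0"
    and G_frag: "G (frag_of x) = frag_of (g (fst x), snd x)" for p q x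
    by (simp_all add: G_def frag_extend_add frag_extend_diff)
  have G_carr: "G p \<in> carrier ?Q" if "p \<in> carrier ?P" for p
    using that keys_frag_extend[of "\<lambda>x. frag_of (g (fst x), snd x :: rat)" p]
    by (fastforce simp: pair_ring_simps G_def)
  have G_mult: "G (p \<otimes>\<^bsub>?P\<^esub> q) = G p \<otimes>\<^bsub>?Q\<^esub> G q" if p: "p \<in> carrier ?P" and q: "q \<in> carrier ?P" for p q
    using p[unfolded pair_ring_simps mem_Collect_eq]
  proof (induction p rule: frag_induction)
    case (one x)
    show ?case using q[unfolded pair_ring_simps mem_Collect_eq]
      by (induction q rule: frag_induction)
        (use one in \<open>auto simp: pair_ring_bilin G_diff G_frag G0 pair_mult_def\<close>)
  qed (auto simp: pair_ring_bilin G0 G_diff)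
  interpret G: ring_hom_ring ?P ?Q G
    by (rule ring_hom_ringI)
      (auto simp: G_carr G_mult pair_ring_simps(3,4) G_add G_frag P.ring_axioms Q.ring_axioms)
  have G_surj: "G ` carrier ?P = carrier ?Q"
  proof
    show "G ` carrier ?P \<subseteq> carrier ?Q" using G_carr by auto
    have "q \<in> G ` carrier ?P" if "Poly_Mapping.keys q \<subseteq> carrier S \<times> UNIV" for q
      using that
    proof (induction q rule: frag_induction)
      case zero
      show ?case using G0 P.zero_closed by (metis imageI pair_ring_simps(2))
    next
      case (one x)
      then obtain b s where x: "x = (b, s)" "b \<in> carrier S" by auto
      then obtain a where "a \<in> carrier R" "b = g a" using surj by blast
      then show ?case
        by (intro image_eqI[of _ _ "frag_of (a, s)"]) (auto simp: G_frag x pair_ring_simps)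
    next
      case (diff a b)
      then obtain p q where pq: "p \<in> carrier ?P" "q \<in> carrier ?P" "a = G p" "b = G q" by blast
      then have "p - q \<in> carrier ?P" using R.pair_ring_minus[of p q] P.minus_closed[of p q] by simp
      then show ?case using pq by (intro image_eqI[of _ _ "p - q"]) (auto simp: G_diff)
    qed
    then show "carrier ?Q \<subseteq> G ` carrier ?P" by (auto simp: pair_ring_simps)
  qed
  define c where "c b = (SOME a. a \<in> carrier R \<and> g a = b)" for b
  have c: "c b \<in> carrier R" "g (c b) = b" if "b \<in> carrier S" for b
  proof -
    have "\<exists>a. a \<in> carrier R \<and> g a = b" using that unfolding surj[symmetric] by auto
    from someI_ex[OF this] show "c b \<in> carrier R" "g (c b) = b" unfolding c_def by auto
  qed
  define C where "C = frag_extend (\<lambda>x. frag_of (c (fst x), snd x :: rat))"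
  have C_diff: "C (p - q) = C p - C q" and C0: "C 0 = 0"
    and C_frag: "C (frag_of x) = frag_of (c (fst x), snd x)" for p q x
    by (simp_all add: C_def frag_extend_diff)
  have section_mod: "p - C (G p) \<in> tensor_ideal R" if p: "p \<in> carrier ?P" for p
    using p[unfolded pair_ring_simps mem_Collect_eq]
  proof (induction p rule: frag_induction)
    case (one x)
    then obtain a s where x: "x = (a, s)" "a \<in> carrier R" by auto
    define a' where "a' = c (g a)"
    have a': "a' \<in> carrier R" "g a' = g a" using c x by (auto simp: a'_def)
    have "g (a \<ominus>\<^bsub>R\<^esub> a') = \<zero>\<^bsub>S\<^esub>" using a' x by (simp add: R.minus_eq S.r_neg)
    then obtain n :: nat where n: "n > 0" "[n] \<cdot>\<^bsub>R\<^esub> (a \<ominus>\<^bsub>R\<^esub> a') = \<zero>\<^bsub>R\<^esub>" using tors[of "a \<ominus>\<^bsub>R\<^esub> a'"] a' x by auto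
    have "frag_of (a \<ominus>\<^bsub>R\<^esub> a', s) \<in> tensor_ideal R"
      using R.tensor_single_torsion n a' x by simp
    moreover have "frag_of ((a \<ominus>\<^bsub>R\<^esub> a') \<oplus>\<^bsub>R\<^esub> a', s) - frag_of (a \<ominus>\<^bsub>R\<^esub> a', s) - frag_of (a', s) \<in> tensor_ideal R"
      by (intro subsetD[OF R.bilinear_rels_tensor_ideal] bilinear_relsI) (use a' x in auto)
    ultimately have "frag_of ((a \<ominus>\<^bsub>R\<^esub> a') \<oplus>\<^bsub>R\<^esub> a', s) - frag_of (a', s) \<in> tensor_ideal R"
      using R.tensor_ideal_closed(1) by fastforce
    moreover have "(a \<ominus>\<^bsub>R\<^esub> a') \<oplus>\<^bsub>R\<^esub> a' = a" using a' x by (simp add: R.minus_eq R.a_assoc R.l_neg)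
    ultimately show ?case by (simp add: x G_frag C_frag a'_def)
  next
    case (diff a b)
    have "(a - b) - C (G (a - b)) = (a - C (G a)) - (b - C (G b))"
      by (simp add: G_diff C_diff)
    then show ?case using R.tensor_ideal_closed(2) diff by metis
  qed (auto simp: G0 C0 R.tensor_ideal_closed)
  \<comment> \<open>Relations of \<open>S\<close> lift exactly, not just up to torsion, because a
    sum is lifted as \<open>c a \<oplus> c b\<close> instead of by a separate choice of
    preimage.\<close>
  have rel_img: "\<exists>r\<in>bilinear_rels R. G r = t" if "t \<in> bilinear_rels S" for t
    using that
  proof (cases rule: bilinear_relsE)
    case (left a b s)
    have "c a \<in> carrier R" "c b \<in> carrier R" "g (c a) = a" "g (c b) = b" using c left by auto
    then show ?thesis using left(3) bilinear_relsI(1)[of "c a" R "c b" s]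
      by (intro bexI[of _ "frag_of (c a \<oplus>\<^bsub>R\<^esub> c b, s) - frag_of (c a, s) - frag_of (c b, s)"])
        (simp_all add: G_diff G_frag)
  next
    case (right a s u)
    have "c a \<in> carrier R" "g (c a) = a" using c right by auto
    then show ?thesis using right(2) bilinear_relsI(2)[of "c a" R s u]
      by (intro bexI[of _ "frag_of (c a, s + u) - frag_of (c a, s) - frag_of (c a, u)"])
        (simp_all add: G_diff G_frag)
  qed
  have GI: "ideal (G ` tensor_ideal R) ?Q"
    by (rule ideal_surj_image) (use G.ring_hom_ring_axioms G_surj R.tensor_ideal_ideal in auto)
  have I_sub: "tensor_ideal S \<subseteq> G ` tensor_ideal R"
  proof (rule Q.genideal_minimal[OF GI])
    show "bilinear_rels S \<subseteq> G ` tensor_ideal R" using rel_img R.bilinear_rels_tensor_ideal by blast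
  qed
  have rel_img': "G r \<in> bilinear_rels S" if "r \<in> bilinear_rels R" for r
    using that
  proof (cases rule: bilinear_relsE)
    case (left a b s)
    then show ?thesis using bilinear_relsI(1)[of "g a" S "g b" s] by (simp add: G_diff G_frag)
  next
    case (right a s u)
    then show ?thesis using bilinear_relsI(2)[of "g a" S s u] by (simp add: G_diff G_frag)
  qed
  have "ideal {x \<in> carrier ?P. G x \<in> tensor_ideal S} ?P"
    by (rule G.ideal_vimage[OF S.tensor_ideal_ideal])
  then have "tensor_ideal R \<subseteq> {x \<in> carrier ?P. G x \<in> tensor_ideal S}"
    by (rule P.genideal_minimal)
      (use rel_img' R.bilinear_rels_carrier S.bilinear_rels_tensor_ideal in blast)
  then have G_I: "G p \<in> tensor_ideal S" if "p \<in> tensor_ideal R" for p using that by auto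
  \<comment> \<open>\<open>q\<close> is chosen in the ideal with the same image as \<open>p\<close>.
    Then \<open>G (p - q) = 0\<close>, and \<open>section_mod\<close> collapses to
    \<open>p - q \<in> tensor_ideal R\<close> because \<open>C 0 = 0\<close>.\<close>
  have I_G: "p \<in> tensor_ideal R" if "p \<in> carrier ?P" "G p \<in> tensor_ideal S" for p
  proof -
    obtain q where q: "q \<in> tensor_ideal R" "G p = G q" using I_sub \<open>G p \<in> _\<close> by blast
    have qc: "q \<in> carrier ?P" using q ideal.Icarr[OF R.tensor_ideal_ideal] by blast
    then have pq: "p - q \<in> carrier ?P" using that R.pair_ring_minus[of p q] P.minus_closed by metis
    have "p - q \<in> tensor_ideal R" using section_mod[OF pq] by (simp add: G_diff q C0)
    from R.tensor_ideal_closed(1)[OF this q(1)] show ?thesis by simp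
  qed
  let ?h = "\<lambda>p. tensor_class S (G p)"
  have h: "?h \<in> ring_hom ?P (rat_tensor S)"
    using ring_hom_trans[OF G.homh ideal.rcos_ring_hom[OF S.tensor_ideal_ideal]]
    by (simp add: rat_tensor_def comp_def)
  have zero: "tensor_class S q = \<zero>\<^bsub>rat_tensor S\<^esub> \<longleftrightarrow> q \<in> tensor_ideal S" if "q \<in> carrier ?Q" for q
  proof -
    have "\<zero>\<^bsub>rat_tensor S\<^esub> = tensor_class S 0"
      using ring_hom_zero[OF ideal.rcos_ring_hom[OF S.tensor_ideal_ideal] Q.ring_axioms
          ideal.quotient_is_ring[OF S.tensor_ideal_ideal]]
      by (simp add: rat_tensor_def pair_ring_simps)
    then show ?thesis using S.tensor_class_eq_iff[of q 0] that Q.zero_closed by (simp add: pair_ring_simps(2))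
  qed
  obtain H where H: "H \<in> ring_hom (rat_tensor R) (rat_tensor S)"
    "\<And>p. p \<in> carrier ?P \<Longrightarrow> H (tensor_class R p) = tensor_class S (G p)"
    using quot_hom_lift[OF R.tensor_ideal_ideal S.rat_tensor_ring h] zero G_I G_carr
      ideal.Icarr[OF R.tensor_ideal_ideal] unfolding rat_tensor_def by metis
  have bij: "bij_betw H (carrier (rat_tensor R)) (carrier (rat_tensor S))"
    unfolding bij_betw_def
  proof
    show "inj_on H (carrier (rat_tensor R))"
    proof (rule inj_onI)
      fix x y assume "x \<in> carrier (rat_tensor R)" "y \<in> carrier (rat_tensor R)" and eq: "H x = H y"
      then obtain p q where pq: "p \<in> carrier ?P" "q \<in> carrier ?P" "x = tensor_class R p" "y = tensor_class R q"
        by (auto simp: rat_tensor_def carrier_quot)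
      have "G p - G q \<in> tensor_ideal S"
        using eq S.tensor_class_eq_iff[OF G_carr G_carr, of p q] pq by (simp add: H)
      then have "p - q \<in> tensor_ideal R" using I_G[of "p - q"] pq R.pair_ring_minus[of p q] P.minus_closed
        by (metis G_diff)
      then show "x = y" using R.tensor_class_eq_iff pq by simp
    qed
    show "H ` carrier (rat_tensor R) = carrier (rat_tensor S)"
      unfolding rat_tensor_def carrier_quot G_surj[symmetric] image_image by (auto simp: H)
  qed
  show ?thesis
  proof (rule that)
    show "H \<in> ring_iso (rat_tensor R) (rat_tensor S)" using H(1) bij by (simp add: ring_iso_def)
    show "H (pure_tensor R a s) = pure_tensor S (g a) s" if "a \<in> carrier R" for a s
      using that H(2)[of "frag_of (a, s)"] by (simp add: pure_tensor_def G_frag pair_ring_simps)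
  qed
qed

section \<open>Evaluation of polynomials\<close>

abbreviation polys :: "'v set \<Rightarrow> 'v int_mpoly set" where
  "polys V \<equiv> carrier (poly_ring_on V)"

lemma poly_ring_simps [simp]:
  "p \<otimes>\<^bsub>poly_ring_on V\<^esub> q = p * q" "p \<oplus>\<^bsub>poly_ring_on V\<^esub> q = p + q"
  "\<one>\<^bsub>poly_ring_on V\<^esub> = 1" "\<zero>\<^bsub>poly_ring_on V\<^esub> = 0"
  by (simp_all add: poly_ring_on_def)

lemma polys_iff: "p \<in> polys V \<longleftrightarrow> (\<forall>m\<in>Poly_Mapping.keys p. Poly_Mapping.keys m \<subseteq> V)"
  by (simp add: poly_ring_on_def)

lemma polys_add: "p \<in> polys V \<Longrightarrow> q \<in> polys V \<Longrightarrow> p + q \<in> polys V"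
  using keys_add[of p q] by (auto simp: polys_iff)

lemma polys_uminus: "p \<in> polys V \<Longrightarrow> - p \<in> polys V"
  by (auto simp: polys_iff)

lemma polys_diff: "p \<in> polys V \<Longrightarrow> q \<in> polys V \<Longrightarrow> p - q \<in> polys V"
  using polys_add[of p V "- q"] polys_uminus[of q V] by simp

lemma polys_mult: "p \<in> polys V \<Longrightarrow> q \<in> polys V \<Longrightarrow> p * q \<in> polys V"
proof -
  assume pq: "p \<in> polys V" "q \<in> polys V"
  have "Poly_Mapping.keys (a + b) \<subseteq> V"
    if "a \<in> Poly_Mapping.keys p" "b \<in> Poly_Mapping.keys q" for a b
    using keys_add[of a b] that pq by (auto simp: polys_iff)
  then show "p * q \<in> polys V" using keys_mult[of p q] unfolding polys_iff by blast
qed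

lemma polys_0: "0 \<in> polys V" and polys_1: "1 \<in> polys V"
  by (auto simp: polys_iff)

lemma polys_of_int: "of_int c \<in> polys V"
  unfolding polys_iff by (metis empty_subsetI insert_iff keys_single keys_zero single_of_int empty_iff)

lemma polys_sum: "(\<And>x. x \<in> A \<Longrightarrow> f x \<in> polys V) \<Longrightarrow> sum f A \<in> polys V"
  by (induction A rule: infinite_finite_induct) (auto simp: polys_add polys_0)

lemma polys_prod: "(\<And>x. x \<in> A \<Longrightarrow> f x \<in> polys V) \<Longrightarrow> prod f A \<in> polys V"
  by (induction A rule: infinite_finite_induct) (auto simp: polys_mult polys_1)

lemma polys_power: "p \<in> polys V \<Longrightarrow> p ^ n \<in> polys V"
  by (induction n) (auto simp: polys_mult polys_1)

lemma polys_Xvar: "v \<in> V \<Longrightarrow> Xvar v \<in> polys V"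
  by (simp add: polys_iff Xvar_def)

lemma poly_ring_cring: "cring (poly_ring_on V)"
proof (rule cringI)
  show "abelian_group (poly_ring_on V)"
  proof (rule abelian_groupI)
    show "\<exists>y\<in>polys V. y \<oplus>\<^bsub>poly_ring_on V\<^esub> x = \<zero>\<^bsub>poly_ring_on V\<^esub>" if "x \<in> polys V" for x
      by (rule bexI[of _ "- x"]) (use that polys_uminus in auto)
  qed (auto simp: polys_add polys_0 ac_simps)
  show "comm_monoid (poly_ring_on V)"
    by (rule comm_monoidI) (auto simp: polys_mult polys_1 ac_simps)
qed (auto simp: algebra_simps)

lemma poly_ring_minus:
  assumes "p \<in> polys V" "q \<in> polys V"
  shows "p \<ominus>\<^bsub>poly_ring_on V\<^esub> q = p - q"
proof -
  interpret P: cring "poly_ring_on V" by (rule poly_ring_cring)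
  have "\<ominus>\<^bsub>poly_ring_on V\<^esub> q = - q"
    using assms polys_uminus by (intro P.minus_equality) auto
  then show ?thesis by (simp add: a_minus_def)
qed

lemma poly_idealI:
  assumes "K \<subseteq> polys V" "0 \<in> K" "\<And>p q. p \<in> K \<Longrightarrow> q \<in> K \<Longrightarrow> p + q \<in> K"
    "\<And>p r. p \<in> K \<Longrightarrow> r \<in> polys V \<Longrightarrow> r * p \<in> K"
  shows "ideal K (poly_ring_on V)"
proof -
  interpret P: cring "poly_ring_on V" by (rule poly_ring_cring)
  show ?thesis
  proof (rule idealI)
    show "subgroup K (add_monoid (poly_ring_on V))"
    proof
      show "inv\<^bsub>add_monoid (poly_ring_on V)\<^esub> x \<in> K" if "x \<in> K" for x
      proof -
        have "\<ominus>\<^bsub>poly_ring_on V\<^esub> x = (- 1) * x"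
          using assms(1) that polys_uminus[of x V] by (intro P.minus_equality) auto
        then have "\<ominus>\<^bsub>poly_ring_on V\<^esub> x \<in> K" using assms(4)[of x "- 1"] that polys_uminus polys_1 by metis
        then show ?thesis by (simp add: a_inv_def)
      qed
    qed (use assms in auto)
  qed (use assms P.ring_axioms in \<open>auto simp: mult.commute\<close>)
qed

lemma poly_ideal_closed:
  assumes "ideal K (poly_ring_on V)"
  shows "0 \<in> K" "p \<in> K \<Longrightarrow> q \<in> K \<Longrightarrow> p + q \<in> K" "p \<in> K \<Longrightarrow> q \<in> K \<Longrightarrow> p - q \<in> K"
    "p \<in> K \<Longrightarrow> r \<in> polys V \<Longrightarrow> r * p \<in> K" "p \<in> K \<Longrightarrow> p \<in> polys V"
proof -
  interpret ideal K "poly_ring_on V" by fact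
  show "0 \<in> K" using additive_subgroup.zero_closed[OF ideal.axioms(1)[OF assms]] by simp
  show add: "p + q \<in> K" if "p \<in> K" "q \<in> K" for p q using additive_subgroup.a_closed[OF ideal.axioms(1)[OF assms] that] by simp
  show mult: "r * p \<in> K" if "p \<in> K" "r \<in> polys V" for p r using I_l_closed[OF that] by simp
  show "p - q \<in> K" if "p \<in> K" "q \<in> K"
    using add[OF that(1) mult[OF that(2) polys_uminus[OF polys_1]]] by simp
  show "p \<in> polys V" if "p \<in> K" using that by (rule Icarr)
qed

definition ev_mono :: "('v \<Rightarrow> 'b::comm_ring_1) \<Rightarrow> ('v \<Rightarrow>\<^sub>0 nat) \<Rightarrow> 'b" where
  "ev_mono \<theta> m = (\<Prod>v\<in>Poly_Mapping.keys m. \<theta> v ^ Poly_Mapping.lookup m v)"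

text \<open>Substitution is defined on the whole type of polynomials and into any commutative ring
  type; the carriers \<open>polys V\<close> enter only afterwards, through
  \<open>ev_polys\<close>.\<close>

definition ev :: "('v \<Rightarrow> 'b::comm_ring_1) \<Rightarrow> 'v int_mpoly \<Rightarrow> 'b" where
  "ev \<theta> p = (\<Sum>m\<in>Poly_Mapping.keys p. of_int (Poly_Mapping.lookup p m) * ev_mono \<theta> m)"

lemma ev_mono_superset:
  assumes "finite A" "Poly_Mapping.keys m \<subseteq> A"
  shows "ev_mono \<theta> m = (\<Prod>v\<in>A. \<theta> v ^ Poly_Mapping.lookup m v)"
  unfolding ev_mono_def by (rule prod.mono_neutral_left) (use assms in \<open>auto simp: in_keys_iff\<close>)

lemma ev_mono_add: "ev_mono \<theta> (m + n) = ev_mono \<theta> m * ev_mono \<theta> n"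
  by (simp add: ev_mono_superset[of "Poly_Mapping.keys m \<union> Poly_Mapping.keys n"] keys_add
      lookup_add power_add prod.distrib)

lemma ev_mono_0 [simp]: "ev_mono \<theta> 0 = 1"
  by (simp add: ev_mono_def)

lemma ev_add: "ev \<theta> (p + q) = ev \<theta> p + ev \<theta> q"
  unfolding ev_def by (rule setsum_keys_plus_distrib) (auto simp: algebra_simps)

lemma ev_0 [simp]: "ev \<theta> 0 = 0"
  by (simp add: ev_def)

lemma ev_uminus: "ev \<theta> (- p) = - ev \<theta> p"
  using ev_add[of \<theta> p "- p"] by (simp add: eq_neg_iff_add_eq_0 add.commute)

lemma ev_diff: "ev \<theta> (p - q) = ev \<theta> p - ev \<theta> q"
  using ev_add[of \<theta> p "- q"] by (simp add: ev_uminus)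

lemma ev_frag: "ev \<theta> (frag_of m) = ev_mono \<theta> m"
  by (simp add: ev_def)

lemma ev_single: "ev \<theta> (Poly_Mapping.single m c) = of_int c * ev_mono \<theta> m"
  by (simp add: ev_def)

lemma ev_1 [simp]: "ev \<theta> 1 = 1"
  using ev_single[of \<theta> 0 1] by simp

lemma frag_of_mult: "frag_of m * frag_of n = (frag_of (m + n) :: 'v int_mpoly)"
  by (simp add: mult_single)

lemma ev_mult: "ev \<theta> (p * q) = ev \<theta> p * ev \<theta> q"
proof (induction p rule: frag_induction[OF subset_UNIV])
  case (2 x)
  show ?case
  proof (induction q rule: frag_induction[OF subset_UNIV])
    case (2 y)
    show ?case unfolding frag_of_mult ev_frag ev_mono_add ..
  qed (auto simp: ev_diff algebra_simps)
qed (auto simp: ev_diff algebra_simps)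

lemma of_int_single: "(of_int c :: 'v int_mpoly) = Poly_Mapping.single 0 c"
  by (rule poly_mapping_eqI) (simp add: lookup_of_int lookup_single)

lemma ev_of_int [simp]: "ev \<theta> (of_int c) = of_int c"
  by (simp add: of_int_single ev_single)

lemma ev_Xvar [simp]: "ev \<theta> (Xvar v) = \<theta> v"
  by (simp add: Xvar_def ev_frag ev_mono_def)

lemma ev_sum: "ev \<theta> (sum f A) = (\<Sum>x\<in>A. ev \<theta> (f x))"
  by (induction A rule: infinite_finite_induct) (auto simp: ev_add)

lemma ev_prod: "ev \<theta> (prod f A) = (\<Prod>x\<in>A. ev \<theta> (f x))"
  by (induction A rule: infinite_finite_induct) (auto simp: ev_mult)

lemma ev_power: "ev \<theta> (p ^ n) = ev \<theta> p ^ n"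
  by (induction n) (auto simp: ev_mult)

lemma ev_mono_Xvar: "ev_mono Xvar m = frag_of m"
proof -
  have pw: "Xvar v ^ k = frag_of (Poly_Mapping.single v k)" for v :: 'a and k
    by (induction k) (simp_all add: Xvar_def frag_of_mult flip: single_add)
  have "(\<Prod>v\<in>A. frag_of (g v)) = (frag_of (\<Sum>v\<in>A. g v) :: 'a int_mpoly)" for A and g :: "'a \<Rightarrow> _"
    by (induction A rule: infinite_finite_induct) (auto simp: frag_of_mult)
  moreover have "(\<Sum>v\<in>Poly_Mapping.keys m. Poly_Mapping.single v (Poly_Mapping.lookup m v)) = m"
    by (rule poly_mapping_eqI)
      (simp add: lookup_sum lookup_single when_def in_keys_iff sum.delta' flip: sum.inter_filter)
  ultimately show ?thesis by (simp add: ev_mono_def pw)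
qed

lemma ev_Xvar_id: "ev Xvar p = p"
  by (induction p rule: frag_induction[OF subset_UNIV]) (auto simp: ev_diff ev_frag ev_mono_Xvar)

lemma ev_ev: "ev \<phi> (ev \<theta> p) = ev (\<lambda>v. ev \<phi> (\<theta> v)) p"
  by (induction p rule: frag_induction[OF subset_UNIV])
    (auto simp: ev_diff ev_frag ev_mono_def ev_prod ev_power)

lemma ev_polys:
  assumes "p \<in> polys V" "\<And>v. v \<in> V \<Longrightarrow> \<theta> v \<in> polys W"
  shows "ev \<theta> p \<in> polys W"
  unfolding ev_def ev_mono_def
proof (intro polys_sum polys_mult polys_of_int polys_prod polys_power assms(2))
  fix m v assume "m \<in> Poly_Mapping.keys p" "v \<in> Poly_Mapping.keys m"
  then show "v \<in> V" using assms(1) by (auto simp: polys_iff)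
qed

lemma ev_ring_hom:
  assumes "\<And>v. v \<in> V \<Longrightarrow> \<theta> v \<in> polys W"
  shows "ev \<theta> \<in> ring_hom (poly_ring_on V) (poly_ring_on W)"
  by (rule ring_hom_memI) (auto simp: ev_add ev_mult intro: ev_polys assms)

text \<open>The polynomials that \<open>ev \<theta>\<close> sends into \<open>K\<close> form an
  ideal, so it suffices to look at generators.\<close>

lemma ev_genideal:
  assumes \<theta>: "\<And>v. v \<in> V \<Longrightarrow> \<theta> v \<in> polys W" and K: "ideal K (poly_ring_on W)"
    and S: "S \<subseteq> polys V" "\<And>p. p \<in> S \<Longrightarrow> ev \<theta> p \<in> K"
    and p: "p \<in> genideal (poly_ring_on V) S"
  shows "ev \<theta> p \<in> K"
proof -
  have "ideal {p \<in> polys V. ev \<theta> p \<in> K} (poly_ring_on V)"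
    by (rule poly_idealI)
      (auto simp: ev_add ev_mult polys_0 polys_add polys_mult intro: poly_ideal_closed[OF K] ev_polys \<theta>)
  then have "genideal (poly_ring_on V) S \<subseteq> {p \<in> polys V. ev \<theta> p \<in> K}"
    by (rule ring.genideal_minimal[OF cring.axioms(1)[OF poly_ring_cring]]) (use S in auto)
  then show ?thesis using p by auto
qed

section \<open>Degrees of polynomials\<close>

definition mdeg :: "('v \<Rightarrow>\<^sub>0 nat) \<Rightarrow> nat" where
  "mdeg m = (\<Sum>v\<in>Poly_Mapping.keys m. Poly_Mapping.lookup m v)"

lemma homogeneous_iff: "homogeneous k p \<longleftrightarrow> (\<forall>m\<in>Poly_Mapping.keys p. mdeg m = k)"
  by (simp add: homogeneous_def mdeg_def)

lemma mdeg_superset: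
  assumes "finite A" "Poly_Mapping.keys m \<subseteq> A"
  shows "mdeg m = (\<Sum>v\<in>A. Poly_Mapping.lookup m v)"
  unfolding mdeg_def by (rule sum.mono_neutral_left) (use assms in \<open>auto simp: in_keys_iff\<close>)

lemma mdeg_add: "mdeg (m + n) = mdeg m + mdeg n"
  by (simp add: mdeg_superset[of "Poly_Mapping.keys m \<union> Poly_Mapping.keys n"] keys_add
      lookup_add sum.distrib)

lemma mdeg_single [simp]: "mdeg (Poly_Mapping.single v k) = k"
  by (simp add: mdeg_def)

lemma homogeneous_add: "homogeneous k p \<Longrightarrow> homogeneous k q \<Longrightarrow> homogeneous k (p + q)"
  using keys_add[of p q] unfolding homogeneous_iff by blast

lemma homogeneous_0: "homogeneous k 0"
  by (simp add: homogeneous_iff)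

lemma homogeneous_uminus: "homogeneous k p \<Longrightarrow> homogeneous k (- p)"
  by (simp add: homogeneous_iff)

lemma homogeneous_mult: "homogeneous k p \<Longrightarrow> homogeneous l q \<Longrightarrow> homogeneous (k + l) (p * q)"
  using keys_mult[of p q] unfolding homogeneous_iff by (fastforce simp: mdeg_add)

lemma homogeneous_Xvar: "homogeneous 1 (Xvar v)"
  by (simp add: homogeneous_iff Xvar_def)

lemma homogeneous_of_int: "homogeneous 0 (of_int c)"
  unfolding homogeneous_iff by (metis empty_iff insert_iff keys_single keys_zero single_of_int mdeg_single single_zero)

lemma homogeneous_sum: "(\<And>x. x \<in> A \<Longrightarrow> homogeneous k (f x)) \<Longrightarrow> homogeneous k (sum f A)"
  by (induction A rule: infinite_finite_induct) (auto simp: homogeneous_add homogeneous_0)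

lemma homogeneous_prod:
  "finite A \<Longrightarrow> (\<And>x. x \<in> A \<Longrightarrow> homogeneous (k x) (f x)) \<Longrightarrow> homogeneous (sum k A) (prod f A)"
proof (induction A rule: finite_induct)
  case empty
  show ?case using homogeneous_of_int[of 1] by simp
qed (auto intro: homogeneous_mult)

lemma homogeneous_power: "homogeneous k p \<Longrightarrow> homogeneous (n * k) (p ^ n)"
proof (induction n)
  case 0
  show ?case using homogeneous_of_int[of 1] by simp
qed (auto intro: homogeneous_mult)

text \<open>A monomial of degree \<open>k\<close> becomes a product of \<open>k\<close> forms of
  degree one. Both substitutions between the Chow rings have this shape, which is why the
  isomorphisms are graded.\<close>

lemma homogeneous_ev:
  assumes p: "p \<in> polys V" "homogeneous k p" and \<theta>: "\<And>v. v \<in> V \<Longrightarrow> homogeneous 1 (\<theta> v)"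
  shows "homogeneous k (ev \<theta> p)"
  unfolding ev_def
proof (rule homogeneous_sum)
  fix m assume m: "m \<in> Poly_Mapping.keys p"
  have "homogeneous (\<Sum>v\<in>Poly_Mapping.keys m. Poly_Mapping.lookup m v * 1) (ev_mono \<theta> m)"
    unfolding ev_mono_def
    by (intro homogeneous_prod homogeneous_power \<theta>) (use p m in \<open>auto simp: polys_iff\<close>)
  then have "homogeneous k (ev_mono \<theta> m)" using p m by (simp add: homogeneous_iff mdeg_def)
  then show "homogeneous k (of_int (Poly_Mapping.lookup p m) * ev_mono \<theta> m)"
    using homogeneous_mult[OF homogeneous_of_int] by fastforce
qed

section \<open>Lattices\<close>

lemma int_spanI: "x = (\<Sum>b\<in>B. of_int (c b) *\<^sub>R b) \<Longrightarrow> x \<in> int_span B"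
  unfolding int_span_def by blast

lemma int_span_0: "0 \<in> int_span B"
  by (rule int_spanI[of _ "\<lambda>_. 0"]) simp

lemma int_span_add:
  assumes "x \<in> int_span B" "y \<in> int_span B" shows "x + y \<in> int_span B"
proof -
  obtain c d where "x = (\<Sum>b\<in>B. of_int (c b) *\<^sub>R b)" "y = (\<Sum>b\<in>B. of_int (d b) *\<^sub>R b)"
    using assms unfolding int_span_def by blast
  then show ?thesis
    by (intro int_spanI[of _ "\<lambda>b. c b + d b"]) (simp add: scaleR_left_distrib sum.distrib)
qed

lemma int_span_scale:
  assumes "x \<in> int_span B" shows "of_int k *\<^sub>R x \<in> int_span B"
proof -
  obtain c where "x = (\<Sum>b\<in>B. of_int (c b) *\<^sub>R b)"
    using assms unfolding int_span_def by blast
  then show ?thesis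
    by (intro int_spanI[of _ "\<lambda>b. k * c b"]) (simp add: scaleR_right.sum)
qed

lemma int_span_diff: "x \<in> int_span B \<Longrightarrow> y \<in> int_span B \<Longrightarrow> x - y \<in> int_span B"
  using int_span_add[of x B "of_int (- 1) *\<^sub>R y"] int_span_scale[of y B "- 1"] by simp

lemma int_span_sum: "(\<And>i. i \<in> I \<Longrightarrow> f i \<in> int_span B) \<Longrightarrow> sum f I \<in> int_span B"
  by (induction I rule: infinite_finite_induct) (auto simp: int_span_0 int_span_add)

lemma int_span_base:
  assumes "finite B" "b \<in> B" shows "b \<in> int_span B"
proof (rule int_spanI[of _ "\<lambda>x. if x = b then 1 else 0"])
  have "(\<Sum>x\<in>B. of_int (if x = b then 1 else 0) *\<^sub>R x) = (\<Sum>x\<in>B. if x = b then x else 0)"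
    by (rule sum.cong) auto
  then show "b = (\<Sum>x\<in>B. of_int (if x = b then 1 else 0) *\<^sub>R x)" using assms by (simp add: sum.delta)
qed

lemma int_span_span: "x \<in> int_span B \<Longrightarrow> x \<in> span B"
  unfolding int_span_def by (auto intro: span_sum span_scale span_base)

lemma int_span_minimal:
  assumes "B \<subseteq> int_span A" shows "int_span B \<subseteq> int_span A"
proof
  fix x assume "x \<in> int_span B"
  then obtain c where "x = (\<Sum>b\<in>B. of_int (c b) *\<^sub>R b)" unfolding int_span_def by blast
  then show "x \<in> int_span A" using assms by (auto intro!: int_span_sum int_span_scale)
qed

lemma int_span_insert:
  assumes "finite B" "n \<notin> B"
  shows "int_span (insert n B) = {t + of_int k *\<^sub>R n | t (k::int). t \<in> int_span B}"
proof
  show "int_span (insert n B) \<subseteq> {t + of_int k *\<^sub>R n | t (k::int). t \<in> int_span B}"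
  proof
    fix x assume "x \<in> int_span (insert n B)"
    then obtain c where "x = (\<Sum>b\<in>insert n B. of_int (c b) *\<^sub>R b)" unfolding int_span_def by blast
    then have "x = (\<Sum>b\<in>B. of_int (c b) *\<^sub>R b) + of_int (c n) *\<^sub>R n" using assms by (simp add: add.commute)
    then show "x \<in> {t + of_int k *\<^sub>R n | t (k::int). t \<in> int_span B}" using int_spanI by blast
  qed
  have "int_span B \<subseteq> int_span (insert n B)"
    using int_span_minimal[of B "insert n B"] int_span_base[of "insert n B"] assms by blast
  moreover have "n \<in> int_span (insert n B)" using int_span_base[of "insert n B"] assms by blast
  ultimately show "{t + of_int k *\<^sub>R n | t (k::int). t \<in> int_span B} \<subseteq> int_span (insert n B)"
    by (auto intro!: int_span_add int_span_scale)
qed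

lemma dual_basis:
  fixes B :: "'a::euclidean_space set"
  assumes "independent B"
  obtains g :: "'a \<Rightarrow> 'a \<Rightarrow> real" where "\<And>b. linear (g b)"
    "\<And>b b'. b' \<in> B \<Longrightarrow> g b b' = (if b = b' then 1 else 0)"
    "\<And>x. x \<in> span B \<Longrightarrow> x = (\<Sum>b\<in>B. g b x *\<^sub>R b)"
proof -
  have fin: "finite B" using assms by (rule independent_imp_finite)
  have "\<exists>g::'a \<Rightarrow> real. linear g \<and> (\<forall>b'\<in>B. g b' = (if b = b' then 1 else 0))" for b
    using linear_independent_extend[OF assms, of "\<lambda>b'. if b = b' then 1 else (0::real)"] by simp
  then obtain g :: "'a \<Rightarrow> 'a \<Rightarrow> real" where
    g: "\<And>b. linear (g b)" "\<And>b b'. b' \<in> B \<Longrightarrow> g b b' = (if b = b' then 1 else 0)" by metis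
  have "x = (\<Sum>b\<in>B. g b x *\<^sub>R b)" if "x \<in> span B" for x
  proof (rule linear_eq_on_span[OF linear_ident _ _ that])
    show "linear (\<lambda>x. \<Sum>b\<in>B. g b x *\<^sub>R b)"
      by (intro linear_compose_sum ballI linear_compose_scale_right bounded_linear.linear)
        (auto intro!: linear_compose_scale linear_conv_bounded_linear[THEN iffD1] bounded_linear_scaleR_left[THEN bounded_linear_compose] g)
    fix x assume "x \<in> B"
    then have "(\<Sum>b\<in>B. g b x *\<^sub>R b) = (\<Sum>b\<in>B. if b = x then b else 0)"
      by (intro sum.cong) (auto simp: g)
    then show "x = (\<Sum>b\<in>B. g b x *\<^sub>R b)" using \<open>x \<in> B\<close> fin by (simp add: sum.delta)
  qed
  with g show ?thesis using that by blast
qed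

text \<open>Discreteness: the integer coordinates of a point are values of the dual linear forms,
  hence bounded on a ball, so only finitely many coefficient vectors occur.\<close>

lemma finite_int_span_bounded:
  fixes B :: "'a::euclidean_space set"
  assumes B: "independent B"
  shows "finite (int_span B \<inter> cball 0 r)"
proof -
  have fin: "finite B" using B by (rule independent_imp_finite)
  obtain g where g: "\<And>b. linear (g b)"
    "\<And>b b'. b' \<in> B \<Longrightarrow> g b b' = (if b = b' then 1 else (0::real))"
    "\<And>x. x \<in> span B \<Longrightarrow> x = (\<Sum>b\<in>B. g b x *\<^sub>R b)" using dual_basis[OF B] by blast
  obtain K where K: "\<And>b x. norm (g b x) \<le> K b * norm x"
    using linear_bounded[OF g(1)] by metis
  define C where "C = (\<Pi>\<^sub>E b\<in>B. {- \<lceil>\<bar>K b\<bar> * \<bar>r\<bar>\<rceil> .. \<lceil>\<bar>K b\<bar> * \<bar>r\<bar>\<rceil>} :: int set)"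
  have "x \<in> (\<lambda>c. \<Sum>b\<in>B. of_int (c b) *\<^sub>R b) ` C" if x: "x \<in> int_span B" "norm x \<le> r" for x
  proof -
    obtain c where c: "x = (\<Sum>b\<in>B. of_int (c b) *\<^sub>R b)" using x unfolding int_span_def by blast
    have gc: "g b x = of_int (c b)" if "b \<in> B" for b
    proof -
      have "g b x = (\<Sum>b'\<in>B. of_int (c b') * g b b')"
        unfolding c by (simp add: linear_sum[OF g(1)] linear_scale[OF g(1)])
      also have "\<dots> = (\<Sum>b'\<in>B. if b' = b then of_int (c b') else 0)" by (rule sum.cong) (auto simp: g)
      finally show ?thesis using that fin by (simp add: sum.delta)
    qed
    have "\<bar>real_of_int (c b)\<bar> \<le> \<bar>K b\<bar> * \<bar>r\<bar>" if "b \<in> B" for b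
    proof -
      have "\<bar>real_of_int (c b)\<bar> \<le> K b * norm x" using K[of b x] gc[OF that] by simp
      also have "\<dots> \<le> \<bar>K b\<bar> * \<bar>r\<bar>" using x(2) by (intro mult_mono) auto
      finally show ?thesis .
    qed
    then have "c b \<in> {- \<lceil>\<bar>K b\<bar> * \<bar>r\<bar>\<rceil> .. \<lceil>\<bar>K b\<bar> * \<bar>r\<bar>\<rceil>}" if "b \<in> B" for b
      using that by (fastforce simp: abs_le_iff le_ceiling_iff minus_le_iff)
    then have "restrict c B \<in> C" unfolding C_def by simp
    then show ?thesis using c by (intro image_eqI[of _ _ "restrict c B"]) auto
  qed
  then have "int_span B \<inter> cball 0 r \<subseteq> (\<lambda>c. \<Sum>b\<in>B. of_int (c b) *\<^sub>R b) ` C" by auto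
  moreover have "finite C" unfolding C_def by (intro finite_PiE fin) auto
  ultimately show ?thesis using finite_subset by blast
qed

lemma lattice_closed:
  assumes "is_lattice N"
  shows "0 \<in> N" "x \<in> N \<Longrightarrow> y \<in> N \<Longrightarrow> x + y \<in> N" "x \<in> N \<Longrightarrow> y \<in> N \<Longrightarrow> x - y \<in> N"
    "x \<in> N \<Longrightarrow> of_int k *\<^sub>R x \<in> N" "(\<And>i. i \<in> I \<Longrightarrow> f i \<in> N) \<Longrightarrow> sum f I \<in> N"
  using assms unfolding is_lattice_def
  by (auto simp: int_span_0 int_span_add int_span_diff int_span_scale int_span_sum)

lemma lattice_int_span:
  assumes "is_lattice N" "B \<subseteq> N" shows "int_span B \<subseteq> N"
  using assms int_span_minimal unfolding is_lattice_def by blast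

text \<open>Rounding the coordinates down leaves a remainder in the fundamental parallelepiped of
  \<open>B\<close>.\<close>

lemma reduce_mod_int_span:
  fixes B :: "'a::euclidean_space set"
  assumes "independent B"
  obtains r :: "'a \<Rightarrow> 'a" where "\<And>x. x \<in> span B \<Longrightarrow> r x \<in> int_span B"
    "\<And>x. x \<in> span B \<Longrightarrow> norm (x - r x) \<le> (\<Sum>b\<in>B. norm b)"
proof -
  obtain g where g: "\<And>x. x \<in> span B \<Longrightarrow> x = (\<Sum>b\<in>B. g b x *\<^sub>R b)" using dual_basis[OF assms] by metis
  define r where "r x = (\<Sum>b\<in>B. of_int \<lfloor>g b x\<rfloor> *\<^sub>R b)" for x
  have "norm (x - r x) \<le> (\<Sum>b\<in>B. norm b)" if "x \<in> span B" for x
  proof -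
    have "x - r x = (\<Sum>b\<in>B. g b x *\<^sub>R b) - r x" using g[OF that] by simp
    then have "x - r x = (\<Sum>b\<in>B. frac (g b x) *\<^sub>R b)"
      by (simp add: r_def frac_def scaleR_left_diff_distrib sum_subtractf)
    also have "norm \<dots> \<le> (\<Sum>b\<in>B. norm b)"
    proof (rule sum_norm_le)
      fix b show "norm (frac (g b x) *\<^sub>R b) \<le> norm b"
        using frac_ge_0[of "g b x"] frac_lt_1[of "g b x"] by (simp add: mult_left_le_one_le)
    qed
    finally show ?thesis .
  qed
  moreover have "r x \<in> int_span B" for x unfolding r_def by (rule int_spanI) simp
  ultimately show ?thesis using that by blast
qed

text \<open>The new basis vector is a lattice point of least positive height over
  \<open>span B\<close>, the height \<open>h\<close> being the \<open>v\<close>-coordinate.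
  Discreteness provides the minimum, and division with remainder by it shows that nothing is
  missed.\<close>

lemma lattice_extend_step:
  fixes N :: "'a::euclidean_space set"
  assumes N: "is_lattice N" and B: "independent B" "N \<inter> span B = int_span B"
    and v: "v \<in> N" "v \<notin> span B"
  obtains n where "n \<in> N" "n \<notin> span B" "N \<inter> span (insert v B) = int_span (insert n B)"
    "span (insert n B) = span (insert v B)"
proof -
  have fin: "finite B" using B by (simp add: independent_imp_finite)
  have BN: "B \<subseteq> N" using B int_span_base[OF fin] by blast
  have ind: "independent (insert v B)" using B v by (simp add: independent_insert)
  have vB: "v \<notin> B" using v span_base by blast
  obtain h :: "'a \<Rightarrow> real" where h: "linear h" "\<And>b. b \<in> insert v B \<Longrightarrow> h b = (if b = v then 1 else 0)"
    using linear_independent_extend[OF ind, of "\<lambda>b. if b = v then 1 else 0"] by blast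
  have hB: "h x = 0" if "x \<in> span B" for x
    by (rule linear_eq_0_on_span[OF h(1) _ that]) (use h vB in auto)
  have hv: "h v = 1" using h by simp
  have vs: "v \<in> span (insert v B)" by (simp add: span_base)
  have ker: "x \<in> span B" if x: "x \<in> span (insert v B)" "h x = 0" for x
  proof -
    obtain k where k: "x - k *\<^sub>R v \<in> span B" using span_breakdown[of v "insert v B" x] x vB by auto
    then have "h x - k * h v = 0" using hB[OF k] by (simp add: linear_diff[OF h(1)] linear_scale[OF h(1)])
    then show ?thesis using k x hv by simp
  qed
  obtain r where r: "\<And>x. x \<in> span B \<Longrightarrow> r x \<in> int_span B"
    "\<And>x. x \<in> span B \<Longrightarrow> norm (x - r x) \<le> (\<Sum>b\<in>B. norm b)"
    using reduce_mod_int_span[OF B(1)] by blast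
  \<comment> \<open>\<open>v\<close> has height 1, so \<open>X\<close> is inhabited; capping the
    height at 1 is what leaves only finitely many heights.\<close>
  define X where "X = {x \<in> N \<inter> span (insert v B). 0 < h x \<and> h x \<le> 1}"
  obtain B0 where B0: "independent B0" "N = int_span B0" using N unfolding is_lattice_def by blast
  define R where "R = norm v + (\<Sum>b\<in>B. norm b)"
  have "h ` X \<subseteq> h ` (N \<inter> cball 0 R)"
  proof
    fix y assume "y \<in> h ` X"
    then obtain x where x: "x \<in> X" "y = h x" by blast
    have xs: "x - h x *\<^sub>R v \<in> span B"
      by (rule ker) (use x hv vs in \<open>auto simp: X_def linear_diff[OF h(1)] linear_scale[OF h(1)] intro!: span_diff span_scale\<close>)
    \<comment> \<open>Subtracting an element of \<open>int_span B\<close> preserves the height and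
      moves the point into a ball of fixed radius, so the heights of \<open>X\<close> are those of
      finitely many lattice points.\<close>
    define x' where "x' = x - r (x - h x *\<^sub>R v)"
    have "h x' = h x" using hB[OF int_span_span[OF r(1)[OF xs]]] by (simp add: x'_def linear_diff[OF h(1)])
    moreover have "x' \<in> N" unfolding x'_def
      using x r(1)[OF xs] B by (intro lattice_closed(3)[OF N]) (auto simp: X_def)
    moreover have "norm x' \<le> R"
    proof -
      have "x' = h x *\<^sub>R v + ((x - h x *\<^sub>R v) - r (x - h x *\<^sub>R v))" by (simp add: x'_def)
      then have "norm x' \<le> norm (h x *\<^sub>R v) + norm ((x - h x *\<^sub>R v) - r (x - h x *\<^sub>R v))"
        by (metis norm_triangle_ineq)
      also have "norm (h x *\<^sub>R v) \<le> norm v" using x by (simp add: X_def mult_left_le_one_le)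
      finally show ?thesis using r(2)[OF xs] by (simp add: R_def)
    qed
    ultimately show "y \<in> h ` (N \<inter> cball 0 R)" using x(2) by (intro image_eqI[of _ _ x']) auto
  qed
  moreover have "finite (h ` (N \<inter> cball 0 R))" using finite_int_span_bounded[OF B0(1)] B0 by simp
  ultimately have finX: "finite (h ` X)" using finite_subset by blast
  have vX: "v \<in> X" using v hv by (simp add: X_def span_base)
  define n where "n = (SOME n. n \<in> X \<and> h n = Min (h ` X))"
  have "\<exists>n. n \<in> X \<and> h n = Min (h ` X)" using Min_in[OF finX] vX by fastforce
  then have n: "n \<in> X" "h n = Min (h ` X)" unfolding n_def by (metis (mono_tags, lifting) someI_ex)+
  have nmin: "h n \<le> h x" if "x \<in> X" for x using n(2) finX that by simp
  have hn: "0 < h n" "h n \<le> 1" "n \<in> N" "n \<in> span (insert v B)" using n(1) by (auto simp: X_def)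
  have nB: "n \<notin> span B" using hB hn by force
  have nB': "n \<notin> B" using nB span_base by blast
  have sp: "span (insert n B) = span (insert v B)"
  proof
    show "span (insert n B) \<subseteq> span (insert v B)"
      by (rule span_minimal) (use hn in \<open>auto intro: span_base\<close>)
    have "n - h n *\<^sub>R v \<in> span B"
      by (rule ker) (use hn hv vs in \<open>auto simp: linear_diff[OF h(1)] linear_scale[OF h(1)] intro!: span_diff span_scale\<close>)
    then have "n - h n *\<^sub>R v \<in> span (insert n B)" using span_mono[of B "insert n B"] by blast
    from span_diff[OF span_base[of n "insert n B"] this] have "h n *\<^sub>R v \<in> span (insert n B)" by simp
    from span_scale[OF this, of "1 / h n"] have "v \<in> span (insert n B)" using hn by simp
    then show "span (insert v B) \<subseteq> span (insert n B)"
      by (intro span_minimal) (auto intro: span_base)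
  qed
  have "N \<inter> span (insert v B) = int_span (insert n B)"
  proof
    show "int_span (insert n B) \<subseteq> N \<inter> span (insert v B)"
      using lattice_int_span[OF N, of "insert n B"] BN hn int_span_span[of _ "insert n B"] sp by auto
    show "N \<inter> span (insert v B) \<subseteq> int_span (insert n B)"
    proof
      fix x assume x: "x \<in> N \<inter> span (insert v B)"
      \<comment> \<open>The remainder \<open>y\<close> has height in \<open>[0, h n)\<close>, which
        minimality forces to be 0; thus \<open>y\<close> lies in \<open>span B\<close>.\<close>
      define k where "k = \<lfloor>h x / h n\<rfloor>"
      define y where "y = x - of_int k *\<^sub>R n"
      have yN: "y \<in> N \<inter> span (insert v B)" unfolding y_def using x hn
        by (auto intro!: lattice_closed(3,4)[OF N] span_diff span_scale)
      have hy: "h y = h x - of_int k * h n" by (simp add: y_def linear_diff[OF h(1)] linear_scale[OF h(1)])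
      have "of_int k \<le> h x / h n" "h x / h n < of_int k + 1" unfolding k_def by linarith+
      then have "0 \<le> h y" "h y < h n" using hn by (auto simp: hy field_simps)
      then have "h y = 0" using nmin[of y] yN hn by (fastforce simp: X_def)
      then have "y \<in> int_span B" using ker[of y] yN B by auto
      then show "x \<in> int_span (insert n B)" unfolding int_span_insert[OF fin nB'] y_def
        by (intro CollectI exI[of _ "x - of_int k *\<^sub>R n"] exI[of _ k]) auto
    qed
  qed
  then show ?thesis using that hn nB sp by blast
qed

text \<open>The condition \<open>N \<inter> span B = int_span B\<close> (saturation of the
  sublattice) is carried along as the invariant, since the single step needs it. With
  \<open>B\<close> empty this yields bases of sublattices, in general adapted bases.\<close>

lemma lattice_extend:
  fixes N :: "'a::euclidean_space set"
  assumes N: "is_lattice N" and B: "independent B" "N \<inter> span B = int_span B"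
    and A: "finite A" "A \<subseteq> N"
  obtains B' where "B \<subseteq> B'" "independent B'" "N \<inter> span B' = int_span B'" "span B' = span (B \<union> A)"
proof -
  have "\<exists>B'. B \<subseteq> B' \<and> independent B' \<and> N \<inter> span B' = int_span B' \<and> span B' = span (B \<union> A)"
    using A
  proof (induction A rule: finite_induct)
    case empty
    then show ?case using B by auto
  next
    case (insert a A)
    then obtain B' where B': "B \<subseteq> B'" "independent B'" "N \<inter> span B' = int_span B'" "span B' = span (B \<union> A)"
      by auto
    have sp: "span (insert a B') = span (B \<union> insert a A)"
      using B'(4) by (metis Un_insert_right span_insert)
    show ?case
    proof (cases "a \<in> span B'")
      case True
      then show ?thesis using B' sp by (auto simp: span_redundant)
    next
      case False
      then obtain n where n: "n \<notin> span B'" "N \<inter> span (insert a B') = int_span (insert n B')"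
        "span (insert n B') = span (insert a B')"
        using lattice_extend_step[OF N B'(2,3) _ False] insert.prems by (metis insert_subset)
      then show ?thesis using B' sp by (intro exI[of _ "insert n B'"]) (auto simp: independent_insert)
    qed
  qed
  then show ?thesis using that by blast
qed

lemma sublattice_basis:
  fixes N :: "'a::euclidean_space set"
  assumes N: "is_lattice N" and A: "finite A" "A \<subseteq> N"
  obtains B where "independent B" "N \<inter> span A = int_span B" "span B = span A" "B \<subseteq> N"
proof -
  have "N \<inter> span {} = int_span {}" using lattice_closed(1)[OF N] by (auto simp: int_span_def)
  then obtain B where B: "independent B" "N \<inter> span B = int_span B" "span B = span A"
    using lattice_extend[OF N independent_empty _ A] by auto
  moreover have "B \<subseteq> N" using B int_span_base[of B] independent_imp_finite by blast
  ultimately show ?thesis using that by simp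
qed

text \<open>Pigeonhole: the remainders of the multiples \<open>j x\<close> modulo
  \<open>int_span E\<close> are lattice points in a bounded set, so two of them coincide.\<close>

lemma lattice_multiple_in_int_span:
  fixes N :: "'a::euclidean_space set"
  assumes N: "is_lattice N" and E: "independent E" "E \<subseteq> N" and x: "x \<in> N" "x \<in> span E"
  obtains k :: nat where "k > 0" "of_nat k *\<^sub>R x \<in> int_span E"
proof -
  obtain r where r: "\<And>x. x \<in> span E \<Longrightarrow> r x \<in> int_span E"
    "\<And>x. x \<in> span E \<Longrightarrow> norm (x - r x) \<le> (\<Sum>b\<in>E. norm b)"
    using reduce_mod_int_span[OF E(1)] by blast
  define F where "F j = real j *\<^sub>R x - r (real j *\<^sub>R x)" for j
  obtain B0 where B0: "independent B0" "N = int_span B0" using N unfolding is_lattice_def by blast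
  have jx: "real j *\<^sub>R x \<in> span E" for j using x by (intro span_scale)
  have "range F \<subseteq> N \<inter> cball 0 (\<Sum>b\<in>E. norm b)"
  proof -
    have "F j \<in> N" for j unfolding F_def
      using lattice_closed(3)[OF N] lattice_closed(4)[OF N x(1), of "int j"] r(1)[OF jx] lattice_int_span[OF N E(2)]
      by auto
    moreover have "norm (F j) \<le> (\<Sum>b\<in>E. norm b)" for j unfolding F_def by (rule r(2)[OF jx])
    ultimately show ?thesis by auto
  qed
  then have "finite (range F)" using finite_int_span_bounded[OF B0(1)] B0 finite_subset by blast
  then have "\<not> inj F" using finite_imageD infinite_UNIV_nat by blast
  then obtain i j where ij: "F i = F j" "i < j" unfolding inj_def by (metis nat_neq_iff)
  have "of_nat (j - i) *\<^sub>R x = r (real j *\<^sub>R x) - r (real i *\<^sub>R x)"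
    using ij by (simp add: F_def of_nat_diff scaleR_left_diff_distrib algebra_simps)
  then have "of_nat (j - i) *\<^sub>R x \<in> int_span E" using r(1)[OF jx] int_span_diff by metis
  then show ?thesis using that[of "j - i"] ij by simp
qed

text \<open>\<open>N \<inter> span A\<close> is a direct summand: a basis of it extends to a basis
  of \<open>N\<close>, and the form is continued by zero on the added vectors.\<close>

lemma dual_lattice_extend:
  fixes N :: "'a::euclidean_space set"
  assumes N: "is_lattice N" and A: "finite A" "A \<subseteq> N"
    and l: "linear l" "\<And>x. x \<in> N \<Longrightarrow> x \<in> span A \<Longrightarrow> l x \<in> \<int>"
  obtains L where "L \<in> dual_lattice \<int> N" "\<And>x. x \<in> span A \<Longrightarrow> L x = l x"
proof -
  obtain B where B: "independent B" "N \<inter> span A = int_span B" "span B = span A" "B \<subseteq> N"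
    using sublattice_basis[OF N A] by blast
  obtain B0 where B0: "independent B0" "N = int_span B0" using N unfolding is_lattice_def by blast
  have finB0: "finite B0" using B0 independent_imp_finite by blast
  obtain B' where B': "B \<subseteq> B'" "independent B'" "N \<inter> span B' = int_span B'" "span B' = span (B \<union> B0)"
    using lattice_extend[OF N B(1) _ finB0] B B0 int_span_base[OF finB0] by (metis subsetI)
  have "N \<subseteq> span B'" unfolding B'(4) using B0 int_span_span span_mono[of B0 "B \<union> B0"] by blast
  then have N': "N = int_span B'" using B' by blast
  obtain L :: "'a \<Rightarrow> real" where L: "linear L" "\<And>b. b \<in> B' \<Longrightarrow> L b = (if b \<in> B then l b else 0)"
    using linear_independent_extend[OF B'(2), of "\<lambda>b. if b \<in> B then l b else 0"] by blast
  have eq: "L x = l x" if "x \<in> span A" for x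
    by (rule linear_eq_on_span[OF L(1) l(1), of B]) (use L B' B that in auto)
  have int: "L b \<in> \<int>" if "b \<in> B'" for b
  proof (cases "b \<in> B")
    case True
    then have "b \<in> N \<inter> span A" using B int_span_base independent_imp_finite by blast
    then show ?thesis using l(2) L(2)[OF that] True by auto
  qed (use L that in auto)
  have "L x \<in> \<int>" if x: "x \<in> N" for x
  proof -
    obtain c where "x = (\<Sum>b\<in>B'. of_int (c b) *\<^sub>R b)" using x unfolding N' int_span_def by blast
    then show ?thesis using int by (auto simp: linear_sum[OF L(1)] linear_scale[OF L(1)] intro!: Ints_sum)
  qed
  then show ?thesis by (intro that[of L]) (use L eq in \<open>auto simp: dual_lattice_def\<close>)
qed

text \<open>Integrality on \<open>A\<close> gives integrality only on the group generated by a basis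
  \<open>E\<close> contained in \<open>A\<close>. That group has finite index in
  \<open>N \<inter> span A\<close>, so a multiple of \<open>l\<close> is integral there and extends
  to \<open>N\<close>.\<close>

lemma dual_lattice_multiple:
  fixes N :: "'a::euclidean_space set"
  assumes N: "is_lattice N" and A: "finite A" "A \<subseteq> N"
    and l: "linear l" "\<And>a. a \<in> A \<Longrightarrow> l a \<in> \<int>"
  obtains n :: nat and L where "n > 0" "L \<in> dual_lattice \<int> N" "\<And>x. x \<in> span A \<Longrightarrow> L x = of_nat n * l x"
proof -
  obtain B where B: "independent B" "N \<inter> span A = int_span B" "span B = span A" "B \<subseteq> N"
    using sublattice_basis[OF N A] by blast
  have finB: "finite B" using B independent_imp_finite by blast
  obtain E where E: "E \<subseteq> A" "independent E" "A \<subseteq> span E" by (rule basis_exists[of A]) blast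
  have spE: "span E = span A" using E by (metis span_eq span_superset subset_trans)
  have "\<exists>k>0. of_nat k *\<^sub>R b \<in> int_span E" if "b \<in> B" for b
    using lattice_multiple_in_int_span[OF N E(2), of b] E A that B spE span_superset[of B] by (metis subset_iff)
  then obtain k :: "'a \<Rightarrow> nat" where k: "\<And>b. b \<in> B \<Longrightarrow> k b > 0" "\<And>b. b \<in> B \<Longrightarrow> of_nat (k b) *\<^sub>R b \<in> int_span E"
    by metis
  \<comment> \<open>A common multiple of the exponents that carry the basis vectors \<open>b\<close>
    into \<open>int_span E\<close>.\<close>
  define n where "n = (\<Prod>b\<in>B. k b)"
  have npos: "n > 0" unfolding n_def using k finB by (intro prod_pos) auto
  have lin: "linear (\<lambda>x. of_nat n * l x)" using linear_compose_scale_right[OF l(1), of "of_nat n"] by simp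
  have lE: "l y \<in> \<int>" if y: "y \<in> int_span E" for y
  proof -
    obtain c where "y = (\<Sum>b\<in>E. of_int (c b) *\<^sub>R b)" using y unfolding int_span_def by blast
    then show ?thesis using l E by (auto simp: linear_sum[OF l(1)] linear_scale[OF l(1)] intro!: Ints_sum)
  qed
  have int: "of_nat n * l b \<in> \<int>" if "b \<in> B" for b
  proof -
    have "of_nat n * l b = of_nat (\<Prod>b'\<in>B - {b}. k b') * l (of_nat (k b) *\<^sub>R b)"
      using that finB by (simp add: n_def prod.remove linear_scale[OF l(1)])
    then show ?thesis using lE[OF k(2)[OF that]] by (metis Ints_mult Ints_of_nat)
  qed
  have "of_nat n * l x \<in> \<int>" if x: "x \<in> N" "x \<in> span A" for x
  proof -
    obtain c where c: "x = (\<Sum>b\<in>B. of_int (c b) *\<^sub>R b)" using x B unfolding int_span_def by blast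
    have "of_nat n * l x = (\<Sum>b\<in>B. of_int (c b) * (of_nat n * l b))"
      by (simp add: c linear_sum[OF l(1)] linear_scale[OF l(1)] sum_distrib_left mult.left_commute)
    then show ?thesis using int by (auto intro!: Ints_sum)
  qed
  then obtain L where "L \<in> dual_lattice \<int> N" "\<And>x. x \<in> span A \<Longrightarrow> L x = of_nat n * l x"
    using dual_lattice_extend[OF N A lin] by blast
  then show ?thesis using that npos by blast
qed

section \<open>Normal vectors\<close>

text \<open>Modulo \<open>span \<tau>\<close> both vectors generate the same infinite cyclic group,
  hence agree up to sign; the side of \<open>\<sigma>\<close> excludes the minus sign.\<close>

lemma normal_vec_unique:
  assumes n: "is_normal_vec N \<sigma> \<tau> n" "is_normal_vec N \<sigma> \<tau> n'" and \<sigma>: "\<sigma> \<subseteq> span (sublattice N \<sigma>)"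
  shows "n' - n \<in> span \<tau>"
proof -
  obtain u where u: "\<And>x. x \<in> span \<tau> \<Longrightarrow> u \<bullet> x = 0" "\<And>x. x \<in> \<sigma> \<Longrightarrow> 0 \<le> u \<bullet> x" "0 < u \<bullet> n"
    using n(1) unfolding is_normal_vec_def by blast
  obtain u' where u': "\<And>x. x \<in> span \<tau> \<Longrightarrow> u' \<bullet> x = 0" "\<And>x. x \<in> \<sigma> \<Longrightarrow> 0 \<le> u' \<bullet> x" "0 < u' \<bullet> n'"
    using n(2) unfolding is_normal_vec_def by blast
  have L: "{t + of_int k *\<^sub>R n | t (k::int). t \<in> sublattice N \<tau>} = sublattice N \<sigma>"
    "{t + of_int k *\<^sub>R n' | t (k::int). t \<in> sublattice N \<tau>} = sublattice N \<sigma>" "n \<in> sublattice N \<sigma>" "n' \<in> sublattice N \<sigma>"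
    using n unfolding is_normal_vec_def by blast+
  obtain t k where t: "n' = t + of_int k *\<^sub>R n" "t \<in> span \<tau>" using L unfolding sublattice_def by blast
  obtain t' k' where t': "n = t' + of_int k' *\<^sub>R n'" "t' \<in> span \<tau>" using L unfolding sublattice_def by blast
  have e1: "u \<bullet> n' = of_int k * (u \<bullet> n)" unfolding t(1) using u(1)[OF t(2)] by (simp add: inner_add_right)
  have e2: "u \<bullet> n = of_int k' * (u \<bullet> n')"
    using arg_cong[OF t'(1), of "inner u"] u(1)[OF t'(2)] by (simp add: inner_add_right)
  have "(of_int (k' * k) :: real) * (u \<bullet> n) = 1 * (u \<bullet> n)"
    using e2[unfolded e1] by (simp only: of_int_mult mult.assoc mult_1)
  then have "(of_int (k' * k) :: real) = 1" using u(3) by (metis mult_right_cancel less_irrefl)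
  then have "k' * k = 1" using of_int_eq_1_iff by blast
  then have k1: "k = 1 \<or> k = - 1" by (metis zmult_eq_1_iff mult.commute)
  show ?thesis
  proof (cases "k = 1")
    case True
    then show ?thesis using t by simp
  next
    case False
    then have n'n: "n' = t - n" using t k1 by simp
    \<comment> \<open>The witnesses \<open>u\<close> and \<open>u'\<close> are unrelated, so they
      are compared on a point \<open>x\<close> of \<open>\<sigma>\<close> off the hyperplane of
      \<open>u\<close>. Modulo \<open>span \<tau>\<close> it is a positive multiple of
      \<open>n\<close>, that is of \<open>- n'\<close>, and so \<open>u'\<close> would be negative
      on it.\<close>
    have "\<exists>x\<in>\<sigma>. u \<bullet> x \<noteq> 0"
    proof (rule ccontr)
      assume "\<not> ?thesis"
      then have "\<sigma> \<subseteq> {x. u \<bullet> x = 0}" by auto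
      moreover have "n \<in> span \<sigma>" using L(3) by (simp add: sublattice_def)
      ultimately have "n \<in> {x. u \<bullet> x = 0}" using span_minimal[OF _ subspace_hyperplane, of \<sigma> u] by blast
      then show False using u by simp
    qed
    then obtain x where x: "x \<in> \<sigma>" "u \<bullet> x > 0" using u(2) by force
    have "sublattice N \<sigma> \<subseteq> {y. \<exists>a. y - a *\<^sub>R n \<in> span \<tau>}"
    proof
      fix y assume "y \<in> sublattice N \<sigma>"
      then obtain s k where "y = s + of_int k *\<^sub>R n" "s \<in> span \<tau>" using L(1) unfolding sublattice_def by blast
      then show "y \<in> {y. \<exists>a. y - a *\<^sub>R n \<in> span \<tau>}" by (auto intro!: exI[of _ "of_int k"])
    qed
    moreover have "subspace {y. \<exists>a. y - a *\<^sub>R n \<in> span \<tau>}"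
    proof -
      have "{y. \<exists>a. y - a *\<^sub>R n \<in> span \<tau>} = span (insert n \<tau>)" by (simp add: span_insert)
      then show ?thesis by simp
    qed
    ultimately have "\<exists>a. x - a *\<^sub>R n \<in> span \<tau>"
      using x \<sigma> span_minimal[of "sublattice N \<sigma>" "{y. \<exists>a. y - a *\<^sub>R n \<in> span \<tau>}"] by blast
    then obtain a where a: "x - a *\<^sub>R n \<in> span \<tau>" by blast
    have "u \<bullet> x = a * (u \<bullet> n)" using u(1)[OF a] by (simp add: inner_diff_right)
    then have "a > 0" using x u(3) by (metis zero_less_mult_pos2)
    have "u' \<bullet> x = a * (u' \<bullet> n)" using u'(1)[OF a] by (simp add: inner_diff_right)
    moreover have "u' \<bullet> n' = - (u' \<bullet> n)" unfolding n'n using u'(1)[OF t(2)] by (simp add: inner_diff_right)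
    ultimately have "u' \<bullet> x < 0" using u'(3) \<open>a > 0\<close> by (simp add: mult_less_0_iff)
    then show ?thesis using u'(2) x by force
  qed
qed

lemma normal_vec_eq:
  assumes "is_normal_vec N \<sigma> \<tau> n" "\<sigma> \<subseteq> span (sublattice N \<sigma>)"
  shows "is_normal_vec N \<sigma> \<tau> (normal_vec N \<sigma> \<tau>)" "normal_vec N \<sigma> \<tau> - n \<in> span \<tau>"
proof -
  show *: "is_normal_vec N \<sigma> \<tau> (normal_vec N \<sigma> \<tau>)"
    unfolding normal_vec_def using assms(1) by (rule someI)
  show "normal_vec N \<sigma> \<tau> - n \<in> span \<tau>"
    by (rule normal_vec_unique[OF assms(1) * assms(2)])
qed

text \<open>A basis of the lattice of \<open>\<tau>\<close> extends to one of the lattice of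
  \<open>\<sigma>\<close>; by the dimension count exactly one vector is added, and it serves up to
  sign.\<close>

lemma normal_vec_exists:
  fixes N :: "'a::euclidean_space set"
  assumes N: "is_lattice N" and S: "finite S" "S \<subseteq> N" "span S = span \<tau>"
    and T: "finite T" "T \<subseteq> N" "span T = span \<sigma>" and dim: "dim \<sigma> = dim \<tau> + 1" and sub: "\<tau> \<subseteq> \<sigma>"
    and u: "\<And>x. x \<in> \<tau> \<Longrightarrow> u \<bullet> x = 0" "\<And>x. x \<in> \<sigma> \<Longrightarrow> 0 \<le> u \<bullet> x" "\<exists>x\<in>\<sigma>. 0 < u \<bullet> x"
  shows "\<exists>n. is_normal_vec N \<sigma> \<tau> n"
proof -
  have u0: "u \<bullet> x = 0" if "x \<in> span \<tau>" for x
    using span_minimal[OF _ subspace_hyperplane, of \<tau> u] u(1) that by auto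
  obtain B where B: "independent B" "N \<inter> span S = int_span B" "span B = span S" "B \<subseteq> N"
    using sublattice_basis[OF N S(1,2)] by blast
  obtain B' where B': "B \<subseteq> B'" "independent B'" "N \<inter> span B' = int_span B'" "span B' = span (B \<union> T)"
    using lattice_extend[OF N B(1) _ T(1,2)] B by metis
  have "span (B \<union> T) = span \<sigma>"
  proof
    have "B \<subseteq> span \<sigma>" using B(3) S(3) span_mono[OF sub] span_superset[of B] by blast
    then show "span (B \<union> T) \<subseteq> span \<sigma>" using T(3) span_superset[of T] by (intro span_minimal) auto
    show "span \<sigma> \<subseteq> span (B \<union> T)" using T(3) span_mono[of T "B \<union> T"] by simp
  qed
  then have spB': "span B' = span \<sigma>" using B' by simp
  have fin: "finite B'" "finite B" using B B' independent_imp_finite by auto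
  have "card B' = dim \<sigma>" using B'(2) spB' by (metis dim_span dim_eq_card_independent)
  moreover have "card B = dim \<tau>" using B S by (metis dim_span dim_eq_card_independent)
  ultimately have "card (B' - B) = 1" using dim B' fin by (simp add: card_Diff_subset)
  then obtain n where n: "B' - B = {n}" by (auto simp: card_1_singleton_iff)
  then have B'n: "B' = insert n B" "n \<notin> B" using B' by auto
  have L: "{t + of_int k *\<^sub>R n | t (k::int). t \<in> sublattice N \<tau>} = sublattice N \<sigma>"
    using int_span_insert[OF fin(2) B'n(2)] B'n(1) B'(3) B(2) spB' S(3) by (simp add: sublattice_def)
  have un: "u \<bullet> n \<noteq> 0"
  proof
    assume "u \<bullet> n = 0"
    then have "B' \<subseteq> {x. u \<bullet> x = 0}" using B'n u0 B(3) S(3) span_superset[of B] by auto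
    then have "span \<sigma> \<subseteq> {x. u \<bullet> x = 0}" using span_minimal[OF _ subspace_hyperplane, of B' u] spB' by simp
    then show False using u(3) span_superset[of \<sigma>] by force
  qed
  \<comment> \<open>The sign is chosen so that \<open>m\<close> lies on the positive side of
    \<open>u\<close>, hence on the side of \<open>\<sigma>\<close>.\<close>
  define m where "m = (if u \<bullet> n > 0 then n else - n)"
  have L': "{t + of_int k *\<^sub>R m | t (k::int). t \<in> sublattice N \<tau>} = sublattice N \<sigma>"
  proof (cases "u \<bullet> n > 0")
    case False
    have "{t + of_int k *\<^sub>R - n | t (k::int). t \<in> sublattice N \<tau>} = {t + of_int k *\<^sub>R n | t (k::int). t \<in> sublattice N \<tau>}"
      (is "?A = ?B")
    proof -
      have "t + of_int k *\<^sub>R - n = t + of_int (- k) *\<^sub>R n" for t and k :: int by simp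
      then show ?thesis by (metis (no_types, opaque_lifting) minus_minus)
    qed
    then show ?thesis using False L by (simp add: m_def)
  next
    case True
    then show ?thesis using L by (simp add: m_def)
  qed
  have "0 \<in> sublattice N \<tau>" using lattice_closed(1)[OF N] by (simp add: sublattice_def span_zero)
  then have "m \<in> sublattice N \<sigma>" unfolding L'[symmetric] by (auto intro!: exI[of _ 0] exI[of _ 1])
  then have "is_normal_vec N \<sigma> \<tau> m"
    unfolding is_normal_vec_def using L' u0 u(2) un by (auto intro!: exI[of _ u] simp: m_def)
  then show ?thesis ..
qed

section \<open>Simplicial fans as simplicial complexes\<close>

text \<open>Rewriting \<open>1\<close> to \<open>Suc 0\<close> would disguise \<open>rays \<Sigma>\<close>, which is \<open>cones_of_dim \<Sigma> 1\<close>.\<close>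

declare One_nat_def [simp del]

lemma linear_scaleR_const: "linear g \<Longrightarrow> linear (\<lambda>x. g x *\<^sub>R v)"
  by (simp add: linear_iff scaleR_left_distrib)

lemma cone_hull_finite:
  assumes "finite S"
  shows "convex_cone hull S = {\<Sum>s\<in>S. c s *\<^sub>R s | c. \<forall>s\<in>S. 0 \<le> c s}" (is "_ = ?R")
proof (rule hull_unique)
  show "S \<subseteq> ?R"
  proof
    fix s assume "s \<in> S"
    have "(\<Sum>x\<in>S. (if x = s then 1 else 0) *\<^sub>R x) = (\<Sum>x\<in>S. if x = s then x else 0)"
      by (rule sum.cong) auto
    then have "s = (\<Sum>x\<in>S. (if x = s then 1 else 0) *\<^sub>R x)" using \<open>s \<in> S\<close> assms by (simp add: sum.delta)
    then show "s \<in> ?R" by (intro CollectI exI[of _ "\<lambda>x. if x = s then 1 else 0"]) auto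
  qed
  show "convex_cone ?R"
    unfolding convex_cone_iff
  proof (intro conjI ballI allI impI)
    show "0 \<in> ?R" by (intro CollectI exI[of _ "\<lambda>_. 0"]) auto
    fix x y assume "x \<in> ?R" "y \<in> ?R"
    then obtain c d where "x = (\<Sum>s\<in>S. c s *\<^sub>R s)" "\<forall>s\<in>S. 0 \<le> c s" "y = (\<Sum>s\<in>S. d s *\<^sub>R s)" "\<forall>s\<in>S. 0 \<le> d s"
      by blast
    then show "x + y \<in> ?R"
      by (intro CollectI exI[of _ "\<lambda>s. c s + d s"]) (auto simp: scaleR_left_distrib sum.distrib)
  next
    fix x and k :: real assume "x \<in> ?R" "0 \<le> k"
    then obtain c where "x = (\<Sum>s\<in>S. c s *\<^sub>R s)" "\<forall>s\<in>S. 0 \<le> c s" by blast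
    then show "k *\<^sub>R x \<in> ?R" using \<open>0 \<le> k\<close>
      by (intro CollectI exI[of _ "\<lambda>s. k * c s"]) (auto simp: scaleR_right.sum)
  qed
  fix T assume T: "S \<subseteq> T" "convex_cone T"
  have "(\<Sum>s\<in>S'. c s *\<^sub>R s) \<in> T" if "finite S'" "S' \<subseteq> S" "\<forall>s\<in>S. 0 \<le> c s" for S' c
    using that
    by (induction S' rule: finite_induct)
      (use T in \<open>auto intro!: convex_cone_contains_0 convex_cone_add convex_cone_scaleR\<close>)
  then show "?R \<subseteq> T" using assms by auto
qed

lemma span_cone_hull: "span (convex_cone hull S) = span S"
proof
  have "convex_cone hull S \<subseteq> span S"
    by (rule hull_minimal) (auto simp: span_superset convex_cone_span)
  then show "span (convex_cone hull S) \<subseteq> span S" by (rule span_minimal) simp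
  show "span S \<subseteq> span (convex_cone hull S)" by (rule span_mono) (rule hull_subset)
qed

text \<open>\<open>face_of\<close> is the convex notion of a face, so being a cone has to be
  derived: with \<open>s\<close> on the other side of 1 from \<open>t\<close>, the point
  \<open>z\<close> is interior to the segment from \<open>t z\<close> to \<open>s z\<close>, and the
  face contains both ends.\<close>

lemma face_cone_scale:
  assumes "\<tau> face_of \<sigma>" "convex_cone \<sigma>" "z \<in> \<tau>" "t > 0"
  shows "t *\<^sub>R z \<in> \<tau>"
proof (cases "t = 1 \<or> z = 0")
  case False
  define s :: real where "s = (if t < 1 then 2 else 1 / 2)"
  have z\<sigma>: "z \<in> \<sigma>" using assms face_of_imp_subset by blast
  have *: "t *\<^sub>R z \<in> \<sigma>" "s *\<^sub>R z \<in> \<sigma>"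
    using assms z\<sigma> by (auto simp: s_def intro!: convex_cone_scaleR)
  define u where "u = (1 - t) / (s - t)"
  have st: "s \<noteq> t" using False by (auto simp: s_def split: if_splits)
  have u: "0 < u" "u < 1" using False assms(4) by (auto simp: u_def s_def field_simps split: if_splits)
  have "u * (s - t) = 1 - t" using st by (simp add: u_def)
  then have "(1 - u) * t + u * s = 1" by (simp add: algebra_simps)
  then have "z = (1 - u) *\<^sub>R (t *\<^sub>R z) + u *\<^sub>R (s *\<^sub>R z)"
    by (metis scaleR_add_left scaleR_one scaleR_scaleR)
  moreover have "t *\<^sub>R z \<noteq> s *\<^sub>R z" using False st by simp
  ultimately have "z \<in> open_segment (t *\<^sub>R z) (s *\<^sub>R z)" using u unfolding in_segment by blast
  then show ?thesis using face_ofD[OF assms(1) _ *] assms(3) by blast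
qed (use assms in auto)

text \<open>\<open>x + y\<close> is the midpoint of \<open>2 x\<close> and \<open>2 y\<close>. This
  additive form of extremality is the one used for cones of a fan.\<close>

lemma face_cone_add:
  assumes "\<tau> face_of \<sigma>" "convex_cone \<sigma>" "x \<in> \<sigma>" "y \<in> \<sigma>" "x + y \<in> \<tau>"
  shows "x \<in> \<tau>"
proof -
  have "2 *\<^sub>R x \<in> \<tau>"
  proof (cases "x = y")
    case True
    then show ?thesis using assms(5) by (simp add: scaleR_2)
  next
    case False
    have "x + y = (1 - 1/2) *\<^sub>R (2 *\<^sub>R x) + (1/2) *\<^sub>R (2 *\<^sub>R y)" by simp
    then have "x + y \<in> open_segment (2 *\<^sub>R x) (2 *\<^sub>R y)" unfolding in_segment using False
      by (intro conjI exI[of _ "1/2"]) auto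
    moreover have "2 *\<^sub>R x \<in> \<sigma>" "2 *\<^sub>R y \<in> \<sigma>"
      using assms by (auto intro!: convex_cone_scaleR simp del: scaleR_2)
    ultimately show ?thesis using face_ofD[OF assms(1)] assms(5) by blast
  qed
  from face_cone_scale[OF assms(1,2) this, of "1/2"] show ?thesis by simp
qed

lemma prim_vec_eq:
  assumes "v \<noteq> 0" "N \<inter> \<rho> = {of_nat k *\<^sub>R v | k. True}"
  shows "prim_vec N \<rho> = v"
  unfolding prim_vec_def
proof (rule the_equality)
  show "N \<inter> \<rho> = {of_nat k *\<^sub>R v | k. True}" by fact
  fix w assume w: "N \<inter> \<rho> = {of_nat k *\<^sub>R w | k. True}"
  have "v \<in> {of_nat k *\<^sub>R w | k. True}" unfolding w[symmetric] assms(2) by (auto intro!: exI[of _ 1])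
  then obtain k where k: "v = of_nat k *\<^sub>R w" by blast
  have "w \<in> {of_nat k *\<^sub>R v | k. True}" unfolding assms(2)[symmetric] w by (auto intro!: exI[of _ 1])
  then obtain l where l: "w = of_nat l *\<^sub>R v" by blast
  have "v = of_nat (k * l) *\<^sub>R v" using k l by (metis of_nat_mult scaleR_scaleR)
  then have "real (k * l) = 1" using assms(1) by (metis scaleR_cancel_right scaleR_one)
  then have "k * l = 1" by (metis of_nat_1 of_nat_eq_iff)
  then show "w = v" using l by simp
qed

lemma ray_generator:
  fixes N :: "'a::euclidean_space set"
  assumes N: "is_lattice N" and \<rho>: "rational_cone N \<rho>" "strongly_convex \<rho>" "dim \<rho> = 1"
  obtains v where "v \<noteq> 0" "v \<in> N" "N \<inter> \<rho> = {of_nat k *\<^sub>R v | k. True}" "\<rho> = {t *\<^sub>R v | t. 0 \<le> t}"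
proof -
  obtain S where S: "finite S" "S \<subseteq> N" "\<rho> = convex_cone hull S" using \<rho>(1) unfolding rational_cone_def by blast
  have cone: "convex_cone \<rho>" unfolding S(3) by (rule convex_cone_convex_cone_hull)
  obtain B where B: "independent B" "N \<inter> span S = int_span B" "span B = span S" "B \<subseteq> N"
    using sublattice_basis[OF N S(1,2)] by blast
  have spB: "span B = span \<rho>" using B S span_cone_hull by metis
  then have "card B = 1" using \<rho>(3) B(1) by (metis dim_span dim_eq_card_independent)
  then obtain n where n: "B = {n}" by (rule card_1_singletonE)
  have n0: "n \<noteq> 0" using B(1) n dependent_zero by blast
  have lat: "N \<inter> span \<rho> = {of_int k *\<^sub>R n | k. True}"
    using B n S span_cone_hull[of S] by (auto simp: int_span_def)
  have "\<exists>x\<in>\<rho>. x \<noteq> 0"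
  proof (rule ccontr)
    assume "\<not> ?thesis"
    then have "\<rho> \<subseteq> {0}" by auto
    then show False using \<rho>(3) dim_eq_0[of \<rho>] by simp
  qed
  then obtain x where x: "x \<in> \<rho>" "x \<noteq> 0" by blast
  have spn: "\<exists>t. y = t *\<^sub>R n" if "y \<in> \<rho>" for y
    using that span_superset[of \<rho>] spB n by (auto simp: span_singleton)
  obtain t where t: "x = t *\<^sub>R n" using spn[OF x(1)] by blast
  define v where "v = (if t > 0 then n else - n)"
  have t0: "t \<noteq> 0" using x t by auto
  have "v = (1 / \<bar>t\<bar>) *\<^sub>R x" using t t0 by (auto simp: v_def)
  then have v\<rho>: "v \<in> \<rho>" using cone x by (auto intro: convex_cone_scaleR)
  have v0: "v \<noteq> 0" using n0 by (auto simp: v_def)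
  have "n \<in> N" using B n by blast
  then have vN: "v \<in> N" using lattice_closed(4)[OF N, of n "-1"] by (auto simp: v_def)
  have \<rho>v: "\<rho> = {t *\<^sub>R v | t. 0 \<le> t}"
  proof
    show "{t *\<^sub>R v | t. 0 \<le> t} \<subseteq> \<rho>" using v\<rho> cone by (auto intro: convex_cone_scaleR)
    show "\<rho> \<subseteq> {t *\<^sub>R v | t. 0 \<le> t}"
    proof
      fix y assume y: "y \<in> \<rho>"
      obtain s where "y = s *\<^sub>R n" using spn[OF y] by blast
      then obtain s where s: "y = s *\<^sub>R v" by (metis v_def minus_minus scaleR_minus_left scaleR_minus_right)
      have "s \<ge> 0"
      proof (rule ccontr)
        assume "\<not> s \<ge> 0"
        then have "- v = (1 / - s) *\<^sub>R y" using s by simp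
        then have "- v \<in> \<rho>" using cone y \<open>\<not> s \<ge> 0\<close> convex_cone_scaleR[OF cone _ y, of "1 / - s"] by simp
        then show False using v\<rho> v0 \<rho>(2) unfolding strongly_convex_def by blast
      qed
      then show "y \<in> {t *\<^sub>R v | t. 0 \<le> t}" using s by blast
    qed
  qed
  have "N \<inter> \<rho> = {of_nat k *\<^sub>R v | k. True}"
  proof
    show "{of_nat k *\<^sub>R v | k. True} \<subseteq> N \<inter> \<rho>"
    proof
      fix y assume "y \<in> {of_nat k *\<^sub>R v | k. True}"
      then obtain k :: nat where "y = of_nat k *\<^sub>R v" by blast
      then show "y \<in> N \<inter> \<rho>"
        using lattice_closed(4)[OF N vN, of "int k"] convex_cone_scaleR[OF cone _ v\<rho>, of "of_nat k"] by simp
    qed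
    show "N \<inter> \<rho> \<subseteq> {of_nat k *\<^sub>R v | k. True}"
    proof
      fix y assume y: "y \<in> N \<inter> \<rho>"
      then obtain k :: int where "y = of_int k *\<^sub>R n" using lat span_superset[of \<rho>] by blast
      then obtain k :: int where k: "y = of_int k *\<^sub>R v"
        by (metis v_def minus_minus scaleR_minus_left scaleR_minus_right of_int_minus)
      obtain s where s: "y = s *\<^sub>R v" "0 \<le> s" using y \<rho>v by auto
      have "of_int k = s" using k s v0 by simp
      then have "y = of_nat (nat k) *\<^sub>R v" using k s(2) by auto
      then show "y \<in> {of_nat k *\<^sub>R v | k. True}" by blast
    qed
  qed
  then show ?thesis using that v0 vN \<rho>v by blast
qed

section \<open>Cones encoded by their sets of rays\<close>

locale simplicial_lattice_fan =
  fixes N :: "'a::euclidean_space set" and \<Sigma> :: "'a set set"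
  assumes lattice: "is_lattice N" and fan: "rational_fan N \<Sigma>" and simplicial: "simplicial_fan \<Sigma>"
begin

abbreviation e :: "'a set \<Rightarrow> 'a" where "e \<equiv> prim_vec N"

definition gens :: "'a set \<Rightarrow> 'a set set" where "gens \<sigma> = {\<rho>\<in>rays \<Sigma>. \<rho> \<subseteq> \<sigma>}"

text \<open>On the ray sets of cones of the fan this inverts \<open>gens\<close>; working with sets
  of rays turns incidence of cones into inclusion of finite sets.\<close>

definition cone_of :: "'a set set \<Rightarrow> 'a set" where "cone_of R = convex_cone hull (e ` R)"

lemma finite_fan [simp]: "finite \<Sigma>"
  using fan unfolding rational_fan_def by blast

lemma finite_rays [simp]: "finite (rays \<Sigma>)" "finite (cones_of_dim \<Sigma> k)"
  by (simp_all add: cones_of_dim_def)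

lemma finite_gens [simp]: "finite (gens \<sigma>)"
  by (simp add: gens_def)

lemma rational: "\<sigma> \<in> \<Sigma> \<Longrightarrow> rational_cone N \<sigma>"
  and strong: "\<sigma> \<in> \<Sigma> \<Longrightarrow> strongly_convex \<sigma>"
  and face_closed: "\<sigma> \<in> \<Sigma> \<Longrightarrow> cone_face \<tau> \<sigma> \<Longrightarrow> \<tau> \<in> \<Sigma>"
  and inter_face: "\<sigma> \<in> \<Sigma> \<Longrightarrow> \<eta> \<in> \<Sigma> \<Longrightarrow> cone_face (\<sigma> \<inter> \<eta>) \<sigma>"
  using fan unfolding rational_fan_def by blast+

lemma convex_cone: "\<sigma> \<in> \<Sigma> \<Longrightarrow> convex_cone \<sigma>"
  using rational[of \<sigma>] convex_cone_convex_cone_hull unfolding rational_cone_def by auto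

lemma subset_face: "\<tau> \<in> \<Sigma> \<Longrightarrow> \<sigma> \<in> \<Sigma> \<Longrightarrow> \<tau> \<subseteq> \<sigma> \<Longrightarrow> cone_face \<tau> \<sigma>"
  using inter_face[of \<sigma> \<tau>] by (simp add: inf.absorb2)

lemma subset_face_add:
  "\<tau> \<in> \<Sigma> \<Longrightarrow> \<sigma> \<in> \<Sigma> \<Longrightarrow> \<tau> \<subseteq> \<sigma> \<Longrightarrow> x \<in> \<sigma> \<Longrightarrow> y \<in> \<sigma> \<Longrightarrow> x + y \<in> \<tau> \<Longrightarrow> x \<in> \<tau>"
  using subset_face face_cone_add convex_cone unfolding cone_face_def by blast

lemma ray_props:
  assumes "\<rho> \<in> rays \<Sigma>"
  shows "e \<rho> \<noteq> 0" "e \<rho> \<in> N" "N \<inter> \<rho> = {of_nat k *\<^sub>R e \<rho> | k. True}" "\<rho> = {t *\<^sub>R e \<rho> | t. 0 \<le> t}"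
proof -
  have "\<rho> \<in> \<Sigma>" "dim \<rho> = 1" using assms by (auto simp: cones_of_dim_def)
  then obtain v where v: "v \<noteq> 0" "v \<in> N" "N \<inter> \<rho> = {of_nat k *\<^sub>R v | k. True}" "\<rho> = {t *\<^sub>R v | t. 0 \<le> t}"
    using ray_generator[OF lattice rational[of \<rho>] strong[of \<rho>]] by blast
  moreover have "e \<rho> = v" using v by (intro prim_vec_eq)
  ultimately show "e \<rho> \<noteq> 0" "e \<rho> \<in> N" "N \<inter> \<rho> = {of_nat k *\<^sub>R e \<rho> | k. True}" "\<rho> = {t *\<^sub>R e \<rho> | t. 0 \<le> t}"
    by auto
qed

lemma ray_iff: "\<rho> \<in> rays \<Sigma> \<Longrightarrow> x \<in> \<rho> \<longleftrightarrow> (\<exists>t\<ge>0. x = t *\<^sub>R e \<rho>)"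
proof -
  assume "\<rho> \<in> rays \<Sigma>"
  from arg_cong[OF ray_props(4)[OF this], of "\<lambda>A. x \<in> A"] show ?thesis by auto
qed

lemma e_in_ray: "\<rho> \<in> rays \<Sigma> \<Longrightarrow> e \<rho> \<in> \<rho>"
  by (simp add: ray_iff exI[of _ 1])

lemma e_in_cone_iff:
  assumes "\<rho> \<in> rays \<Sigma>" "\<sigma> \<in> \<Sigma>"
  shows "e \<rho> \<in> \<sigma> \<longleftrightarrow> \<rho> \<subseteq> \<sigma>"
proof
  assume "e \<rho> \<in> \<sigma>"
  then show "\<rho> \<subseteq> \<sigma>" using ray_iff[OF assms(1)] convex_cone[OF assms(2)] by (auto intro: convex_cone_scaleR)
qed (use e_in_ray assms in auto)

lemma e_parallel:
  assumes "\<rho> \<in> rays \<Sigma>" "\<rho>' \<in> rays \<Sigma>" "e \<rho> \<in> \<rho>'"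
  shows "\<rho> = \<rho>'"
proof -
  obtain t where t: "e \<rho> = t *\<^sub>R e \<rho>'" "0 \<le> t" using ray_iff[OF assms(2)] assms(3) by blast
  have t0: "t > 0" using t ray_props(1)[OF assms(1)] by (metis less_eq_real_def scaleR_zero_left)
  have sub: "\<rho> \<subseteq> \<rho>'" using e_in_cone_iff[of \<rho> \<rho>'] assms by (simp add: cones_of_dim_def)
  have "s *\<^sub>R e \<rho>' \<in> \<rho>" if "0 \<le> s" for s
  proof -
    have "s *\<^sub>R e \<rho>' = (s / t) *\<^sub>R e \<rho>" using t t0 by simp
    moreover have "0 \<le> s / t" using that t0 by simp
    ultimately show ?thesis using ray_iff[OF assms(1)] by blast
  qed
  then have "\<rho>' \<subseteq> \<rho>" using ray_iff[OF assms(2)] by auto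
  with sub show ?thesis by blast
qed

lemma inj_e: "inj_on e (rays \<Sigma>)"
  using e_parallel e_in_ray by (metis inj_onI)

text \<open>Simpliciality only supplies some \<open>R\<close> of the right size. Counting dimensions
  makes its primitive vectors independent, and extremality of rays shows that \<open>R\<close>
  already contains every ray of \<open>\<sigma>\<close>.\<close>

lemma gens_props:
  assumes \<sigma>: "\<sigma> \<in> \<Sigma>"
  shows "independent (e ` gens \<sigma>)" "card (gens \<sigma>) = dim \<sigma>" "\<sigma> = cone_of (gens \<sigma>)"
proof -
  obtain R where R: "R \<subseteq> rays \<Sigma>" "card R = dim \<sigma>" "\<sigma> = convex_cone hull (\<Union>R)"
    using simplicial \<sigma> unfolding simplicial_fan_def by blast
  have finR: "finite R" using R(1) finite_rays finite_subset by blast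
  have \<sigma>R: "\<sigma> = cone_of R"
  proof -
    have "e ` R \<subseteq> \<Union>R" using e_in_ray R by blast
    moreover have "\<Union>R \<subseteq> convex_cone hull (e ` R)"
    proof
      fix x assume "x \<in> \<Union>R"
      then obtain \<rho> where "\<rho> \<in> R" "x \<in> \<rho>" by blast
      then obtain t where "x = t *\<^sub>R e \<rho>" "0 \<le> t" using ray_iff[of \<rho> x] R by blast
      then show "x \<in> convex_cone hull (e ` R)" using \<open>\<rho> \<in> R\<close> by (simp add: convex_cone_hull_mul hull_inc)
    qed
    ultimately show ?thesis unfolding R(3) cone_of_def
      by (metis convex_cone_convex_cone_hull hull_minimal hull_mono subset_antisym)
  qed
  have inj: "inj_on e R" using inj_e R(1) inj_on_subset by blast
  have "dim (e ` R) = card (e ` R)"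
    using \<sigma>R R(2) inj span_cone_hull[of "e ` R"] by (metis card_image cone_of_def dim_span)
  then have ind: "independent (e ` R)" using finR card_le_dim_spanning[OF order_refl span_superset, of "e ` R"] by simp
  have "gens \<sigma> = R"
  proof
    show "R \<subseteq> gens \<sigma>" using R hull_subset[of "\<Union>R" convex_cone] by (auto simp: gens_def)
    show "gens \<sigma> \<subseteq> R"
    proof
      fix \<rho> assume \<rho>: "\<rho> \<in> gens \<sigma>"
      then have \<rho>': "\<rho> \<in> rays \<Sigma>" "\<rho> \<subseteq> \<sigma>" "\<rho> \<in> \<Sigma>" by (auto simp: gens_def cones_of_dim_def)
      have "e \<rho> \<in> convex_cone hull (e ` R)" using e_in_ray \<rho>' \<sigma>R by (auto simp: cone_of_def)
      then obtain c where c: "e \<rho> = (\<Sum>s\<in>e ` R. c s *\<^sub>R s)" "\<forall>s\<in>e ` R. 0 \<le> c s"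
        using cone_hull_finite[of "e ` R"] finR by auto
      have "\<exists>s\<in>e ` R. c s \<noteq> 0"
      proof (rule ccontr)
        assume "\<not> ?thesis"
        then have "e \<rho> = 0" unfolding c(1) by (intro sum.neutral) simp
        then show False using ray_props(1)[OF \<rho>'(1)] by simp
      qed
      then obtain r where r: "r \<in> R" "c (e r) > 0" using c(2) by force
      have "e \<rho> = c (e r) *\<^sub>R e r + (\<Sum>s\<in>e ` R - {e r}. c s *\<^sub>R s)"
        unfolding c(1) using r finR by (intro sum.remove) auto
      moreover have "c (e r) *\<^sub>R e r \<in> \<sigma>" using r \<sigma>R by (simp add: cone_of_def convex_cone_hull_mul hull_inc)
      moreover have "(\<Sum>s\<in>e ` R - {e r}. c s *\<^sub>R s) \<in> \<sigma>"
      proof -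
        have "(\<Sum>s\<in>e ` R - {e r}. c s *\<^sub>R s) \<in> convex_cone hull (e ` R - {e r})"
          unfolding cone_hull_finite[OF finite_Diff[OF finite_imageI[OF finR]]] using c(2) by blast
        then show ?thesis using \<sigma>R hull_mono[of "e ` R - {e r}" "e ` R"] by (auto simp: cone_of_def)
      qed
      \<comment> \<open>\<open>\<rho>\<close> is a face of \<open>\<sigma>\<close>, so it contains
        each summand of a decomposition of \<open>e \<rho>\<close>; hence \<open>r\<close> is the
        ray \<open>\<rho>\<close>.\<close>
      ultimately have "c (e r) *\<^sub>R e r \<in> \<rho>"
        using subset_face_add[OF \<rho>'(3) \<sigma> \<rho>'(2)] e_in_ray[OF \<rho>'(1)] by metis
      from convex_cone_scaleR[OF convex_cone[OF \<rho>'(3)] _ this, of "1 / c (e r)"]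
      have "e r \<in> \<rho>" using r by simp
      then show "\<rho> \<in> R" using e_parallel[of r \<rho>] r R \<rho>'(1) by auto
    qed
  qed
  then show "independent (e ` gens \<sigma>)" "card (gens \<sigma>) = dim \<sigma>" "\<sigma> = cone_of (gens \<sigma>)"
    using ind R \<sigma>R by auto
qed

lemma inj_gens: "inj_on e (gens \<sigma>)"
  using inj_e by (rule inj_on_subset) (auto simp: gens_def)

lemma span_gens: "\<sigma> \<in> \<Sigma> \<Longrightarrow> span (e ` gens \<sigma>) = span \<sigma>"
  using gens_props(3) span_cone_hull unfolding cone_of_def by metis

lemma gens_N: "e ` gens \<sigma> \<subseteq> N"
  using ray_props(2) by (auto simp: gens_def)

lemma e_gens_in: "\<rho> \<in> gens \<sigma> \<Longrightarrow> e \<rho> \<in> \<sigma>"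
  using e_in_ray by (auto simp: gens_def)

text \<open>A coordinate with respect to the primitive vectors of \<open>R\<close>, continued
  linearly to the ambient space; the choice made there does not affect its values on the span of
  these vectors.\<close>

definition coord :: "'a set set \<Rightarrow> 'a set \<Rightarrow> 'a \<Rightarrow> real" where
  "coord R \<rho> = (SOME l. linear l \<and> (\<forall>\<rho>'\<in>R. l (e \<rho>') = (if \<rho>' = \<rho> then 1 else 0)))"

lemma coord_props:
  assumes "independent (e ` R)" "R \<subseteq> rays \<Sigma>"
  shows "linear (coord R \<rho>)" "\<rho>' \<in> R \<Longrightarrow> coord R \<rho> (e \<rho>') = (if \<rho>' = \<rho> then 1 else 0)"
proof -
  have inj: "inj_on e R" using inj_e assms(2) inj_on_subset by blast
  obtain l :: "'a \<Rightarrow> real" where l: "linear l"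
    "\<forall>x\<in>e ` R. l x = (if inv_into R e x = \<rho> then 1 else 0)"
    using linear_independent_extend[OF assms(1), of "\<lambda>x. if inv_into R e x = \<rho> then 1 else 0"] by blast
  then have "\<exists>l::'a \<Rightarrow> real. linear l \<and> (\<forall>\<rho>'\<in>R. l (e \<rho>') = (if \<rho>' = \<rho> then 1 else 0))"
    using inj by (intro exI[of _ l]) simp
  from someI_ex[OF this]
  have "linear (coord R \<rho>) \<and> (\<forall>\<rho>'\<in>R. coord R \<rho> (e \<rho>') = (if \<rho>' = \<rho> then 1 else 0))"
    unfolding coord_def .
  then show "linear (coord R \<rho>)" "\<rho>' \<in> R \<Longrightarrow> coord R \<rho> (e \<rho>') = (if \<rho>' = \<rho> then 1 else 0)" by auto
qed

lemmas coord_gens = coord_props[OF gens_props(1)]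

lemma gens_rays: "gens \<sigma> \<subseteq> rays \<Sigma>"
  by (auto simp: gens_def)

lemma cone_of_explicit:
  assumes "R \<subseteq> rays \<Sigma>"
  shows "cone_of R = {\<Sum>\<rho>\<in>R. c \<rho> *\<^sub>R e \<rho> | c. \<forall>\<rho>\<in>R. 0 \<le> c \<rho>}"
proof -
  have fin: "finite R" using assms finite_rays finite_subset by blast
  have inj: "inj_on e R" using inj_e assms(1) inj_on_subset by blast
  have "cone_of R = {\<Sum>s\<in>e ` R. c s *\<^sub>R s | c. \<forall>s\<in>e ` R. 0 \<le> c s}"
    unfolding cone_of_def using fin by (intro cone_hull_finite) auto
  also have "\<dots> = {\<Sum>\<rho>\<in>R. c \<rho> *\<^sub>R e \<rho> | c. \<forall>\<rho>\<in>R. 0 \<le> c \<rho>}"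
  proof (intro equalityI subsetI; elim CollectE exE conjE)
    fix x c assume "x = (\<Sum>s\<in>e ` R. c s *\<^sub>R s)" "\<forall>s\<in>e ` R. 0 \<le> c s"
    then show "x \<in> {\<Sum>\<rho>\<in>R. c \<rho> *\<^sub>R e \<rho> | c. \<forall>\<rho>\<in>R. 0 \<le> c \<rho>}"
      using inj by (intro CollectI exI[of _ "\<lambda>\<rho>. c (e \<rho>)"]) (auto simp: sum.reindex)
  next
    fix x c assume "x = (\<Sum>\<rho>\<in>R. c \<rho> *\<^sub>R e \<rho>)" "\<forall>\<rho>\<in>R. 0 \<le> c \<rho>"
    then show "x \<in> {\<Sum>s\<in>e ` R. c s *\<^sub>R s | c. \<forall>s\<in>e ` R. 0 \<le> c s}"
      using inj by (intro CollectI exI[of _ "\<lambda>s. c (inv_into R e s)"]) (auto simp: sum.reindex)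
  qed
  finally show ?thesis .
qed

text \<open>The sum of the coordinates outside \<open>R\<close> is nonnegative on
  \<open>\<sigma>\<close> and vanishes exactly where only the rays in \<open>R\<close> contribute.
  The adjoint rewrites it as an inner product, as needed for supporting hyperplanes.\<close>

lemma cone_of_face:
  assumes \<sigma>: "\<sigma> \<in> \<Sigma>" and R: "R \<subseteq> gens \<sigma>"
  obtains u where "cone_of R = \<sigma> \<inter> {x. u \<bullet> x = 0}" "\<And>x. x \<in> \<sigma> \<Longrightarrow> 0 \<le> u \<bullet> x"
    "\<And>\<rho>. \<rho> \<in> gens \<sigma> - R \<Longrightarrow> u \<bullet> e \<rho> = 1"
proof -
  note ind = gens_props(1)[OF \<sigma>]
  define l where "l x = (\<Sum>\<rho>\<in>gens \<sigma> - R. coord (gens \<sigma>) \<rho> x)" for x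
  have lin: "linear l" unfolding l_def by (intro linear_compose_sum ballI coord_props ind gens_rays)
  define u where "u = adjoint l 1"
  have u: "u \<bullet> x = l x" for x using adjoint_works[OF lin, of x 1] by (simp add: u_def inner_commute)
  have le: "l (e \<rho>) = (if \<rho> \<in> R then 0 else 1)" if "\<rho> \<in> gens \<sigma>" for \<rho>
  proof -
    have "l (e \<rho>) = (\<Sum>\<rho>'\<in>gens \<sigma> - R. if \<rho>' = \<rho> then 1 else 0)"
      unfolding l_def by (rule sum.cong) (use that coord_props(2)[OF ind gens_rays] in auto)
    then show ?thesis using that by (simp add: sum.delta)
  qed
  have lx: "l (\<Sum>\<rho>\<in>gens \<sigma>. c \<rho> *\<^sub>R e \<rho>) = (\<Sum>\<rho>\<in>gens \<sigma> - R. c \<rho>)" for c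
  proof -
    have "l (\<Sum>\<rho>\<in>gens \<sigma>. c \<rho> *\<^sub>R e \<rho>) = (\<Sum>\<rho>\<in>gens \<sigma>. c \<rho> * (if \<rho> \<in> R then 0 else 1))"
      by (simp add: linear_sum[OF lin] linear_scale[OF lin] le)
    also have "\<dots> = (\<Sum>\<rho>\<in>gens \<sigma> - R. c \<rho>)"
      by (rule sum.mono_neutral_cong_right) (use R in auto)
    finally show ?thesis .
  qed
  have \<sigma>e: "\<sigma> = {\<Sum>\<rho>\<in>gens \<sigma>. c \<rho> *\<^sub>R e \<rho> | c. \<forall>\<rho>\<in>gens \<sigma>. 0 \<le> c \<rho>}"
    using gens_props(3)[OF \<sigma>] cone_of_explicit[OF gens_rays] by metis
  have pos: "0 \<le> u \<bullet> x" if "x \<in> \<sigma>" for x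
  proof -
    have "\<exists>c. x = (\<Sum>\<rho>\<in>gens \<sigma>. c \<rho> *\<^sub>R e \<rho>) \<and> (\<forall>\<rho>\<in>gens \<sigma>. 0 \<le> c \<rho>)"
      using that by (subst (asm) \<sigma>e) blast
    then show ?thesis unfolding u using lx by (auto intro!: sum_nonneg)
  qed
  have "cone_of R = \<sigma> \<inter> {x. u \<bullet> x = 0}"
  proof
    have "e ` R \<subseteq> \<sigma> \<inter> {x. u \<bullet> x = 0}" using R le u e_gens_in by auto
    moreover have "convex_cone (\<sigma> \<inter> {x. u \<bullet> x = 0})"
      using convex_cone[OF \<sigma>] by (auto simp: convex_cone_iff inner_add_right)
    ultimately show "cone_of R \<subseteq> \<sigma> \<inter> {x. u \<bullet> x = 0}" unfolding cone_of_def by (rule hull_minimal)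
    show "\<sigma> \<inter> {x. u \<bullet> x = 0} \<subseteq> cone_of R"
    proof
      fix x assume x: "x \<in> \<sigma> \<inter> {x. u \<bullet> x = 0}"
      have "\<exists>c. x = (\<Sum>\<rho>\<in>gens \<sigma>. c \<rho> *\<^sub>R e \<rho>) \<and> (\<forall>\<rho>\<in>gens \<sigma>. 0 \<le> c \<rho>)"
        using x by (subst (asm) \<sigma>e) blast
      then obtain c where c: "x = (\<Sum>\<rho>\<in>gens \<sigma>. c \<rho> *\<^sub>R e \<rho>)" "\<forall>\<rho>\<in>gens \<sigma>. 0 \<le> c \<rho>" by blast
      have "(\<Sum>\<rho>\<in>gens \<sigma> - R. c \<rho>) = 0" using x c(1) lx u by auto
      then have c0: "c \<rho> = 0" if "\<rho> \<in> gens \<sigma> - R" for \<rho>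
        using sum_nonneg_eq_0_iff[of "gens \<sigma> - R" c] c(2) that by auto
      have "x = (\<Sum>\<rho>\<in>R. c \<rho> *\<^sub>R e \<rho>)" unfolding c(1)
        by (rule sum.mono_neutral_right) (use R c0 in auto)
      then show "x \<in> cone_of R" using cone_of_explicit[of R] R c(2) gens_rays by auto
    qed
  qed
  then show ?thesis by (rule that[of u]) (use pos le u in auto)
qed

lemma cone_of_in_fan:
  assumes \<sigma>: "\<sigma> \<in> \<Sigma>" and R: "R \<subseteq> gens \<sigma>"
  shows "cone_of R \<in> \<Sigma>" "gens (cone_of R) = R" "cone_of R \<subseteq> \<sigma>"
proof -
  obtain u where u: "cone_of R = \<sigma> \<inter> {x. u \<bullet> x = 0}" "\<And>x. x \<in> \<sigma> \<Longrightarrow> 0 \<le> u \<bullet> x"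
    "\<And>\<rho>. \<rho> \<in> gens \<sigma> - R \<Longrightarrow> u \<bullet> e \<rho> = 1" using cone_of_face[OF assms] by blast
  have "cone_of R face_of \<sigma>" unfolding u(1)
    using convex_cone[OF \<sigma>] u(2) by (intro face_of_Int_supporting_hyperplane_ge) (auto simp: convex_cone_def)
  then show in\<Sigma>: "cone_of R \<in> \<Sigma>" using face_closed[OF \<sigma>, of "cone_of R"]
    by (simp add: cone_face_def cone_of_def convex_cone_hull_nonempty)
  show sub: "cone_of R \<subseteq> \<sigma>" using u(1) by blast
  show "gens (cone_of R) = R"
  proof
    show "R \<subseteq> gens (cone_of R)"
    proof
      fix \<rho> assume "\<rho> \<in> R"
      then have "e \<rho> \<in> cone_of R" "\<rho> \<in> rays \<Sigma>" using R gens_rays by (auto simp: cone_of_def hull_inc)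
      then show "\<rho> \<in> gens (cone_of R)" using e_in_cone_iff in\<Sigma> by (simp add: gens_def)
    qed
    show "gens (cone_of R) \<subseteq> R"
    proof
      fix \<rho> assume "\<rho> \<in> gens (cone_of R)"
      then have "e \<rho> \<in> cone_of R" "\<rho> \<in> gens \<sigma>" using sub e_gens_in by (auto simp: gens_def)
      then have "u \<bullet> e \<rho> = 0" "\<rho> \<in> gens \<sigma>" using u(1) by auto
      then show "\<rho> \<in> R" using u(3)[of \<rho>] by fastforce
    qed
  qed
qed

lemma gens_subset_iff: "\<tau> \<in> \<Sigma> \<Longrightarrow> \<sigma> \<in> \<Sigma> \<Longrightarrow> gens \<tau> \<subseteq> gens \<sigma> \<longleftrightarrow> \<tau> \<subseteq> \<sigma>"
  using cone_of_in_fan(3)[of \<sigma> "gens \<tau>"] gens_props(3)[of \<tau>] by (auto simp: gens_def)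

lemma gens_inj: "\<tau> \<in> \<Sigma> \<Longrightarrow> \<sigma> \<in> \<Sigma> \<Longrightarrow> gens \<tau> = gens \<sigma> \<Longrightarrow> \<tau> = \<sigma>"
  using gens_props(3) by metis

lemma subset_dim_eq:
  assumes "\<tau> \<in> \<Sigma>" "\<sigma> \<in> \<Sigma>" "\<tau> \<subseteq> \<sigma>" "dim \<tau> = dim \<sigma>"
  shows "\<tau> = \<sigma>"
  using assms gens_subset_iff[of \<tau> \<sigma>] gens_props(2) gens_inj card_subset_eq[OF finite_gens, of "gens \<tau>" \<sigma>] by metis

lemma zero_cone: "{0} \<in> \<Sigma>" "gens {0} = {}"
proof -
  obtain \<sigma> where "\<sigma> \<in> \<Sigma>" using fan unfolding rational_fan_def by blast
  then have "cone_of {} \<in> \<Sigma>" "gens (cone_of {}) = {}" using cone_of_in_fan[of \<sigma> "{}"] by auto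
  then show "{0} \<in> \<Sigma>" "gens {0} = {}" by (auto simp: cone_of_def)
qed

lemma zero_in: "\<sigma> \<in> \<Sigma> \<Longrightarrow> 0 \<in> \<sigma>"
  using convex_cone convex_cone_contains_0 by blast

text \<open>The abstract simplicial complex of the fan on its rays. The empty set belongs to it, as
  the ray set of the cone \<open>{0}\<close>.\<close>

definition faces :: "'a set set set" where "faces = gens ` \<Sigma>"

lemma cone_of_gens: "\<sigma> \<in> \<Sigma> \<Longrightarrow> cone_of (gens \<sigma>) = \<sigma>"
  using gens_props(3) by simp

lemma faces_props:
  assumes "F \<in> faces"
  shows "cone_of F \<in> \<Sigma>" "gens (cone_of F) = F" "F \<subseteq> rays \<Sigma>" "finite F" "independent (e ` F)" "dim (cone_of F) = card F"
proof -
  obtain \<sigma> where "\<sigma> \<in> \<Sigma>" "F = gens \<sigma>" using assms by (auto simp: faces_def)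
  then show "cone_of F \<in> \<Sigma>" "gens (cone_of F) = F" "F \<subseteq> rays \<Sigma>" "finite F" "independent (e ` F)" "dim (cone_of F) = card F"
    using gens_props[of \<sigma>] gens_rays[of \<sigma>] by simp_all
qed

lemma faces_subset: "F \<in> faces \<Longrightarrow> F' \<subseteq> F \<Longrightarrow> F' \<in> faces"
  using cone_of_in_fan[of "cone_of F" F'] faces_props[of F] by (auto simp: faces_def image_iff)

lemma faces_iff:
  assumes "R \<subseteq> rays \<Sigma>"
  shows "R \<in> faces \<longleftrightarrow> (\<exists>\<sigma>\<in>\<Sigma>. \<forall>\<rho>\<in>R. \<rho> \<subseteq> \<sigma>)"
proof
  assume "\<exists>\<sigma>\<in>\<Sigma>. \<forall>\<rho>\<in>R. \<rho> \<subseteq> \<sigma>"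
  then obtain \<sigma> where "\<sigma> \<in> \<Sigma>" "R \<subseteq> gens \<sigma>" using assms by (auto simp: gens_def)
  then show "R \<in> faces" using faces_subset[of "gens \<sigma>" R] by (auto simp: faces_def)
qed (auto simp: faces_def gens_def)

lemma facet_gens:
  assumes "\<tau> \<in> \<Sigma>" "\<sigma> \<in> \<Sigma>" "\<tau> \<subseteq> \<sigma>" "dim \<sigma> = dim \<tau> + 1"
  obtains \<rho> where "\<rho> \<in> rays \<Sigma>" "\<rho> \<notin> gens \<tau>" "gens \<sigma> = insert \<rho> (gens \<tau>)"
proof -
  have sub: "gens \<tau> \<subseteq> gens \<sigma>" using assms gens_subset_iff by blast
  then have "card (gens \<sigma> - gens \<tau>) = 1" using assms gens_props(2) by (simp add: card_Diff_subset)
  then obtain \<rho> where "gens \<sigma> - gens \<tau> = {\<rho>}" by (rule card_1_singletonE)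
  then show ?thesis using that[of \<rho>] sub gens_rays by blast
qed

lemma cofacets:
  assumes \<tau>: "\<tau> \<in> \<Sigma>"
  shows "bij_betw (\<lambda>\<rho>. cone_of (insert \<rho> (gens \<tau>))) {\<rho>\<in>rays \<Sigma>. \<rho> \<notin> gens \<tau> \<and> insert \<rho> (gens \<tau>) \<in> faces}
    {\<sigma>\<in>cones_of_dim \<Sigma> (dim \<tau> + 1). \<tau> \<subseteq> \<sigma>}"
  unfolding bij_betw_def
proof
  show "inj_on (\<lambda>\<rho>. cone_of (insert \<rho> (gens \<tau>))) {\<rho>\<in>rays \<Sigma>. \<rho> \<notin> gens \<tau> \<and> insert \<rho> (gens \<tau>) \<in> faces}"
  proof (rule inj_onI; elim CollectE conjE)
    fix \<rho> \<rho>' assume "\<rho> \<notin> gens \<tau>" "insert \<rho> (gens \<tau>) \<in> faces" "\<rho>' \<notin> gens \<tau>" "insert \<rho>' (gens \<tau>) \<in> faces"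
      "cone_of (insert \<rho> (gens \<tau>)) = cone_of (insert \<rho>' (gens \<tau>))"
    then have "insert \<rho> (gens \<tau>) = insert \<rho>' (gens \<tau>)" using faces_props(2) by metis
    then show "\<rho> = \<rho>'" using \<open>\<rho> \<notin> gens \<tau>\<close> by blast
  qed
  show "(\<lambda>\<rho>. cone_of (insert \<rho> (gens \<tau>))) ` {\<rho>\<in>rays \<Sigma>. \<rho> \<notin> gens \<tau> \<and> insert \<rho> (gens \<tau>) \<in> faces} =
    {\<sigma>\<in>cones_of_dim \<Sigma> (dim \<tau> + 1). \<tau> \<subseteq> \<sigma>}"
  proof (intro equalityI subsetI; (elim imageE CollectE conjE)?)
    fix \<rho> \<sigma> assume \<rho>: "\<sigma> = cone_of (insert \<rho> (gens \<tau>))" "\<rho> \<notin> gens \<tau>" "insert \<rho> (gens \<tau>) \<in> faces"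
    have "\<tau> \<subseteq> \<sigma>" using faces_props(1,2)[OF \<rho>(3)] gens_subset_iff[OF \<tau>, of \<sigma>] \<rho>(1) by auto
    then show "\<sigma> \<in> {\<sigma>\<in>cones_of_dim \<Sigma> (dim \<tau> + 1). \<tau> \<subseteq> \<sigma>}"
      using faces_props[OF \<rho>(3)] \<rho> gens_props(2)[OF \<tau>] by (simp add: cones_of_dim_def)
  next
    fix \<sigma> assume "\<sigma> \<in> cones_of_dim \<Sigma> (dim \<tau> + 1)" "\<tau> \<subseteq> \<sigma>"
    then have \<sigma>: "\<sigma> \<in> \<Sigma>" "dim \<sigma> = dim \<tau> + 1" "\<tau> \<subseteq> \<sigma>" by (auto simp: cones_of_dim_def)
    obtain \<rho> where "\<rho> \<in> rays \<Sigma>" "\<rho> \<notin> gens \<tau>" "gens \<sigma> = insert \<rho> (gens \<tau>)"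
      using facet_gens[OF \<tau> \<sigma>(1,3,2)] by blast
    then show "\<sigma> \<in> (\<lambda>\<rho>. cone_of (insert \<rho> (gens \<tau>))) ` {\<rho>\<in>rays \<Sigma>. \<rho> \<notin> gens \<tau> \<and> insert \<rho> (gens \<tau>) \<in> faces}"
      using \<sigma> gens_props(3)[OF \<sigma>(1)] by (intro image_eqI[of _ _ \<rho>]) (auto simp: faces_def)
  qed
qed

lemma span_sublattice: "\<sigma> \<in> \<Sigma> \<Longrightarrow> \<sigma> \<subseteq> span (sublattice N \<sigma>)"
proof -
  assume \<sigma>: "\<sigma> \<in> \<Sigma>"
  have "e ` gens \<sigma> \<subseteq> sublattice N \<sigma>" using gens_N e_gens_in span_superset[of \<sigma>] by (auto simp: sublattice_def)
  then have "span (e ` gens \<sigma>) \<subseteq> span (sublattice N \<sigma>)" by (rule span_mono)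
  then show ?thesis using span_gens[OF \<sigma>] span_superset[of \<sigma>] by blast
qed

abbreviation nv :: "'a set \<Rightarrow> 'a set \<Rightarrow> 'a" where "nv \<equiv> normal_vec N"

lemma is_normal:
  assumes "\<tau> \<in> \<Sigma>" "\<sigma> \<in> \<Sigma>" "\<tau> \<subseteq> \<sigma>" "dim \<sigma> = dim \<tau> + 1"
  shows "is_normal_vec N \<sigma> \<tau> (nv \<sigma> \<tau>)"
proof -
  obtain \<rho> where \<rho>: "\<rho> \<in> rays \<Sigma>" "\<rho> \<notin> gens \<tau>" "gens \<sigma> = insert \<rho> (gens \<tau>)" using facet_gens[OF assms] .
  obtain u where u: "cone_of (gens \<tau>) = \<sigma> \<inter> {x. u \<bullet> x = 0}" "\<And>x. x \<in> \<sigma> \<Longrightarrow> 0 \<le> u \<bullet> x"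
    "\<And>\<rho>. \<rho> \<in> gens \<sigma> - gens \<tau> \<Longrightarrow> u \<bullet> e \<rho> = 1" using cone_of_face[OF assms(2), of "gens \<tau>"] \<rho> by blast
  have "\<exists>n. is_normal_vec N \<sigma> \<tau> n"
  proof (rule normal_vec_exists[OF lattice _ gens_N[of \<tau>] _ _ gens_N[of \<sigma>]])
    show "\<exists>x\<in>\<sigma>. 0 < u \<bullet> x" using u(3)[of \<rho>] \<rho> e_gens_in[of \<rho> \<sigma>] by force
    show "u \<bullet> x = 0" if "x \<in> \<tau>" for x using u(1) cone_of_gens[OF assms(1)] that by blast
  qed (use assms u span_gens in auto)
  then show ?thesis using normal_vec_eq(1) span_sublattice[OF assms(2)] by blast
qed

lemma nv_sublattice:
  assumes "\<tau> \<in> \<Sigma>" "\<sigma> \<in> \<Sigma>" "\<tau> \<subseteq> \<sigma>" "dim \<sigma> = dim \<tau> + 1"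
  shows "nv \<sigma> \<tau> \<in> N" "nv \<sigma> \<tau> \<in> span \<sigma>"
  using is_normal[OF assms] by (auto simp: is_normal_vec_def sublattice_def)

lemma nv_ray:
  assumes "\<tau> \<in> \<Sigma>" "\<sigma> \<in> \<Sigma>" "dim \<sigma> = dim \<tau> + 1" "\<rho> \<notin> gens \<tau>" "gens \<sigma> = insert \<rho> (gens \<tau>)"
  obtains k where "k > 0" "nv \<sigma> \<tau> - k *\<^sub>R e \<rho> \<in> span \<tau>"
proof -
  have sub: "\<tau> \<subseteq> \<sigma>" using gens_subset_iff assms by blast
  note n = is_normal[OF assms(1,2) sub assms(3)]
  obtain u where u: "\<And>x. x \<in> span \<tau> \<Longrightarrow> u \<bullet> x = 0" "\<And>x. x \<in> \<sigma> \<Longrightarrow> 0 \<le> u \<bullet> x" "0 < u \<bullet> nv \<sigma> \<tau>"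
    using n unfolding is_normal_vec_def by blast
  have "nv \<sigma> \<tau> \<in> span (insert (e \<rho>) (e ` gens \<tau>))"
    using nv_sublattice(2)[OF assms(1,2) sub assms(3)] span_gens[OF assms(2)] assms(5) by simp
  then obtain k where "nv \<sigma> \<tau> - k *\<^sub>R e \<rho> \<in> span (e ` gens \<tau>)" by (auto simp: span_insert)
  then have k: "nv \<sigma> \<tau> - k *\<^sub>R e \<rho> \<in> span \<tau>" using span_gens[OF assms(1)] by simp
  have uk: "u \<bullet> nv \<sigma> \<tau> = k * (u \<bullet> e \<rho>)" using u(1)[OF k] by (simp add: inner_diff_right)
  have "e \<rho> \<in> \<sigma>" using e_gens_in[of \<rho> \<sigma>] assms(5) by simp
  then have "0 \<le> u \<bullet> e \<rho>" by (rule u(2))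
  then have "k > 0" using u(3) unfolding uk by (simp add: zero_less_mult_iff)
  from that[OF this k] show ?thesis .
qed

end

section \<open>Divisors and star fans\<close>

lemma quot_proj_eqI:
  assumes "y \<in> orthogonal_comp (span \<sigma>)" "x - y \<in> span \<sigma>"
  shows "quot_proj \<sigma> x = y"
  unfolding quot_proj_def
proof (rule the_equality)
  show "y \<in> orthogonal_comp (span \<sigma>) \<and> x - y \<in> span \<sigma>" using assms by blast
  fix z assume z: "z \<in> orthogonal_comp (span \<sigma>) \<and> x - z \<in> span \<sigma>"
  have "z - y \<in> span \<sigma>" using span_diff[OF assms(2) conjunct2[OF z]] by simp
  moreover have "z - y \<in> orthogonal_comp (span \<sigma>)"
    using z assms by (intro subspace_diff[OF subspace_orthogonal_comp]) auto
  ultimately have "orthogonal (z - y) (z - y)" by (auto simp: orthogonal_comp_def)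
  then show "z = y" by (simp add: orthogonal_def)
qed

lemma quot_proj:
  fixes \<sigma> :: "'a::euclidean_space set"
  shows "quot_proj \<sigma> x \<in> orthogonal_comp (span \<sigma>)" "x - quot_proj \<sigma> x \<in> span \<sigma>"
proof -
  obtain y z where yz: "y \<in> span \<sigma>" "\<And>w. w \<in> span \<sigma> \<Longrightarrow> orthogonal z w" "x = y + z"
    using orthogonal_subspace_decomp_exists[of \<sigma> x] by blast
  have z: "z \<in> orthogonal_comp (span \<sigma>)" using yz(2) by (auto simp: orthogonal_comp_def orthogonal_commute)
  moreover have "x - z \<in> span \<sigma>" using yz by simp
  ultimately have "quot_proj \<sigma> x = z" by (rule quot_proj_eqI)
  with z yz show "quot_proj \<sigma> x \<in> orthogonal_comp (span \<sigma>)" "x - quot_proj \<sigma> x \<in> span \<sigma>" by auto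
qed

lemma linear_quot_proj: "linear (quot_proj (\<sigma> :: 'a::euclidean_space set))"
proof (rule linearI)
  have sub: "subspace (orthogonal_comp (span \<sigma>))" by (rule subspace_orthogonal_comp)
  show "quot_proj \<sigma> (x + y) = quot_proj \<sigma> x + quot_proj \<sigma> y" for x y
  proof (rule quot_proj_eqI)
    show "quot_proj \<sigma> x + quot_proj \<sigma> y \<in> orthogonal_comp (span \<sigma>)"
      using sub by (simp add: quot_proj subspace_add)
    have "(x - quot_proj \<sigma> x) + (y - quot_proj \<sigma> y) \<in> span \<sigma>" by (intro span_add quot_proj)
    then show "x + y - (quot_proj \<sigma> x + quot_proj \<sigma> y) \<in> span \<sigma>" by (simp add: algebra_simps)
  qed
  show "quot_proj \<sigma> (c *\<^sub>R x) = c *\<^sub>R quot_proj \<sigma> x" for c x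
  proof (rule quot_proj_eqI)
    show "c *\<^sub>R quot_proj \<sigma> x \<in> orthogonal_comp (span \<sigma>)"
      using sub by (simp add: quot_proj subspace_scale)
    have "c *\<^sub>R (x - quot_proj \<sigma> x) \<in> span \<sigma>" by (intro span_scale quot_proj)
    then show "c *\<^sub>R x - c *\<^sub>R quot_proj \<sigma> x \<in> span \<sigma>" by (simp add: algebra_simps)
  qed
qed

lemma quot_proj_eq_0_iff: "quot_proj \<sigma> x = 0 \<longleftrightarrow> x \<in> span \<sigma>"
proof
  assume "x \<in> span \<sigma>"
  then show "quot_proj \<sigma> x = 0"
    by (intro quot_proj_eqI) (auto simp: subspace_0 subspace_orthogonal_comp)
qed (use quot_proj(2)[of x \<sigma>] in simp)

lemma quot_proj_eq_iff: "quot_proj \<sigma> x = quot_proj \<sigma> y \<longleftrightarrow> x - y \<in> span \<sigma>"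
  using quot_proj_eq_0_iff[of \<sigma> "x - y"] by (simp add: linear_diff[OF linear_quot_proj])

lemma linear_quot_proj_invariant:
  assumes "linear h" "\<And>x. x \<in> \<sigma> \<Longrightarrow> h x = 0"
  shows "h (quot_proj \<sigma> x) = h x"
proof -
  have "h (x - quot_proj \<sigma> x) = 0" using linear_eq_0_on_span[OF assms(1) _ quot_proj(2)] assms(2) by blast
  then show ?thesis by (simp add: linear_diff[OF assms(1)])
qed

text \<open>Vanishing in the quotient by \<open>span \<tau>\<close> is membership in
  \<open>span \<tau>\<close>; the orthogonal model of the quotient disappears from
  balancing.\<close>

lemma balanced_iff:
  "balanced N \<Sigma> p w \<longleftrightarrow>
     (\<forall>\<tau>\<in>\<Sigma>. dim \<tau> + 1 = p \<longrightarrow>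
       (\<Sum>\<sigma> | \<sigma> \<in> cones_of_dim \<Sigma> p \<and> \<tau> \<subseteq> \<sigma>. of_int (w \<sigma>) *\<^sub>R normal_vec N \<sigma> \<tau>) \<in> span \<tau>)"
  unfolding balanced_def
  by (simp add: quot_proj_eq_0_iff linear_sum[OF linear_quot_proj] linear_scale[OF linear_quot_proj]
      flip: quot_proj_eq_0_iff)

lemma linear_span_eq:
  assumes "linear g" "linear h" "\<And>x. x \<in> S \<Longrightarrow> g x = h x" "x \<in> span S"
  shows "g x = h x"
  using linear_eq_on_span[OF assms(1,2) _ assms(4)] assms(3) by blast

lemma lin_part_eq:
  assumes "linear l" "\<And>x. x \<in> \<sigma> \<Longrightarrow> f x = l x"
  shows "linear (lin_part f \<sigma>)" "x \<in> \<sigma> \<Longrightarrow> lin_part f \<sigma> x = f x" "x \<in> span \<sigma> \<Longrightarrow> lin_part f \<sigma> x = l x"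
proof -
  have "linear (lin_part f \<sigma>) \<and> (\<forall>x\<in>\<sigma>. f x = lin_part f \<sigma> x)"
    unfolding lin_part_def by (rule someI[of _ l]) (use assms in blast)
  then show lin: "linear (lin_part f \<sigma>)" and eq: "\<And>x. x \<in> \<sigma> \<Longrightarrow> lin_part f \<sigma> x = f x" by auto
  show "lin_part f \<sigma> x = l x" if "x \<in> span \<sigma>"
    by (rule linear_span_eq[OF lin assms(1) _ that]) (use eq assms(2) in auto)
qed

locale meromorphic_fan = simplicial_lattice_fan N \<Sigma>
  for N :: "'a::euclidean_space set" and \<Sigma> +
  fixes f :: "'a \<Rightarrow> real"
  assumes mero: "meromorphic N \<Sigma> f"
begin

abbreviation fl :: "'a set \<Rightarrow> 'a \<Rightarrow> real" where "fl \<equiv> lin_part f"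

lemma fl_props:
  assumes "\<sigma> \<in> \<Sigma>"
  shows "linear (fl \<sigma>)" "x \<in> \<sigma> \<Longrightarrow> fl \<sigma> x = f x" "x \<in> N \<Longrightarrow> x \<in> span \<sigma> \<Longrightarrow> fl \<sigma> x \<in> \<int>"
proof -
  obtain l where l: "l \<in> dual_lattice \<int> (sublattice N \<sigma>)" "\<forall>x\<in>\<sigma>. f x = l x"
    using mero assms unfolding meromorphic_def by blast
  then have l': "linear l" "\<And>x. x \<in> \<sigma> \<Longrightarrow> f x = l x" by (auto simp: dual_lattice_def)
  show "linear (fl \<sigma>)" "x \<in> \<sigma> \<Longrightarrow> fl \<sigma> x = f x" using lin_part_eq[OF l'] by auto
  show "fl \<sigma> x \<in> \<int>" if "x \<in> N" "x \<in> span \<sigma>"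
    using lin_part_eq(3)[OF l' that(2)] l(1) that by (auto simp: dual_lattice_def sublattice_def)
qed

lemma fl_face:
  assumes "\<tau> \<in> \<Sigma>" "\<sigma> \<in> \<Sigma>" "\<tau> \<subseteq> \<sigma>" "x \<in> span \<tau>"
  shows "fl \<sigma> x = fl \<tau> x"
  by (rule linear_span_eq[OF fl_props(1)[OF assms(2)] fl_props(1)[OF assms(1)] _ assms(4)])
    (use assms fl_props(2) in auto)

lemma f_int: "x \<in> N \<Longrightarrow> \<sigma> \<in> \<Sigma> \<Longrightarrow> x \<in> \<sigma> \<Longrightarrow> f x \<in> \<int>"
  using fl_props(2)[of \<sigma> x] fl_props(3)[of \<sigma> x] span_base[of x \<sigma>] by simp

definition cofs :: "'a set \<Rightarrow> 'a set set" where
  "cofs \<tau> = {\<sigma>. \<sigma> \<in> cones_of_dim \<Sigma> (dim \<tau> + 1) \<and> \<tau> \<subseteq> \<sigma>}"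

lemma cofs_iff: "\<sigma> \<in> cofs \<tau> \<longleftrightarrow> \<sigma> \<in> \<Sigma> \<and> dim \<sigma> = dim \<tau> + 1 \<and> \<tau> \<subseteq> \<sigma>"
  by (auto simp: cofs_def cones_of_dim_def)

lemma finite_cofs [simp]: "finite (cofs \<tau>)"
  by (simp add: cofs_def)

definition wsum :: "('a set \<Rightarrow> int) \<Rightarrow> 'a set \<Rightarrow> 'a" where
  "wsum w \<tau> = (\<Sum>\<sigma>\<in>cofs \<tau>. of_int (w \<sigma>) *\<^sub>R nv \<sigma> \<tau>)"

text \<open>The order for an arbitrary weight \<open>w\<close>, not only \<omega>, and as a real
  number, so that linear algebra applies before integrality is known. For balanced weights it is
  integral and the floor in \<open>ord_at\<close> has no effect.\<close>

definition ordr :: "('a set \<Rightarrow> int) \<Rightarrow> 'a set \<Rightarrow> real" where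
  "ordr w \<tau> = - (\<Sum>\<sigma>\<in>cofs \<tau>. of_int (w \<sigma>) * fl \<sigma> (nv \<sigma> \<tau>)) + fl \<tau> (wsum w \<tau>)"

lemma balanced_wsum:
  "balanced N \<Sigma> p w \<longleftrightarrow> (\<forall>\<tau>\<in>\<Sigma>. dim \<tau> + 1 = p \<longrightarrow> wsum w \<tau> \<in> span \<tau>)"
  unfolding balanced_iff wsum_def cofs_def by auto

lemma wsum_N: "\<tau> \<in> \<Sigma> \<Longrightarrow> wsum w \<tau> \<in> N"
  unfolding wsum_def by (intro lattice_closed(4,5)[OF lattice] nv_sublattice(1)) (auto simp: cofs_iff)

lemma ordr_int:
  assumes "\<tau> \<in> \<Sigma>" "wsum w \<tau> \<in> span \<tau>"
  shows "ordr w \<tau> \<in> \<int>"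
  unfolding ordr_def
  by (intro Ints_add Ints_minus Ints_sum Ints_mult Ints_of_int fl_props(3) nv_sublattice wsum_N)
    (use assms in \<open>auto simp: cofs_iff\<close>)

lemma ord_at_eq: "dim \<tau> + 1 = d \<Longrightarrow> ord_at N \<Sigma> d \<omega> f \<tau> = \<lfloor>ordr \<omega> \<tau>\<rfloor>"
  by (auto simp: ord_at_def ordr_def wsum_def cofs_def)

text \<open>Where f agrees with one linear form \<open>L\<close>, both terms of the order equal
  \<open>L (wsum w \<tau>)\<close>. The weight \<open>w\<close> is arbitrary apart from balancing at
  \<open>\<tau>\<close>.\<close>

lemma ordr_linear:
  assumes \<tau>: "\<tau> \<in> \<Sigma>" "wsum w \<tau> \<in> span \<tau>" and L: "linear L" "\<And>\<sigma> x. \<sigma> \<in> \<Sigma> \<Longrightarrow> \<tau> \<subseteq> \<sigma> \<Longrightarrow> x \<in> \<sigma> \<Longrightarrow> f x = L x"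
  shows "ordr w \<tau> = 0"
proof -
  have eq: "fl \<sigma> x = L x" if "\<sigma> \<in> \<Sigma>" "\<tau> \<subseteq> \<sigma>" "x \<in> span \<sigma>" for \<sigma> x
    by (rule lin_part_eq(3)[OF L(1) L(2)[OF that(1,2)] that(3)])
  have "(\<Sum>\<sigma>\<in>cofs \<tau>. of_int (w \<sigma>) * fl \<sigma> (nv \<sigma> \<tau>)) = (\<Sum>\<sigma>\<in>cofs \<tau>. of_int (w \<sigma>) * L (nv \<sigma> \<tau>))"
  proof (rule sum.cong)
    fix \<sigma> assume "\<sigma> \<in> cofs \<tau>"
    then show "of_int (w \<sigma>) * fl \<sigma> (nv \<sigma> \<tau>) = of_int (w \<sigma>) * L (nv \<sigma> \<tau>)"
      using eq nv_sublattice(2)[OF \<tau>(1)] by (simp add: cofs_iff)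
  qed simp
  also have "\<dots> = L (wsum w \<tau>)" by (simp add: wsum_def linear_sum[OF L(1)] linear_scale[OF L(1)])
  also have "\<dots> = fl \<tau> (wsum w \<tau>)" using eq \<tau> by simp
  finally show ?thesis by (simp add: ordr_def)
qed

end

section \<open>Star fans in the quotient by the span of a cone\<close>

context simplicial_lattice_fan
begin

abbreviation above :: "'a set \<Rightarrow> 'a set set" where "above \<sigma> \<equiv> {\<eta>\<in>\<Sigma>. \<sigma> \<subseteq> \<eta>}"

abbreviation qcone :: "'a set \<Rightarrow> 'a set \<Rightarrow> 'a set" where "qcone \<sigma> \<eta> \<equiv> quot_proj \<sigma> ` \<eta>"

lemma span_difference:
  assumes "\<sigma> \<in> \<Sigma>" "s \<in> span \<sigma>"
  obtains a b where "a \<in> \<sigma>" "b \<in> \<sigma>" "s = a - b"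
proof -
  have "span \<sigma> \<subseteq> {a - b | a b. a \<in> \<sigma> \<and> b \<in> \<sigma>}"
  proof (rule span_minimal)
    show "\<sigma> \<subseteq> {a - b | a b. a \<in> \<sigma> \<and> b \<in> \<sigma>}"
    proof
      fix x assume "x \<in> \<sigma>"
      then show "x \<in> {a - b | a b. a \<in> \<sigma> \<and> b \<in> \<sigma>}"
        using zero_in[OF assms(1)] by (intro CollectI exI[of _ x] exI[of _ 0]) auto
    qed
    show "subspace {a - b | a b. a \<in> \<sigma> \<and> b \<in> \<sigma>}"
      unfolding subspace_def
    proof (intro conjI ballI allI)
      note cc = convex_cone[OF assms(1)]
      show "0 \<in> {a - b | a b. a \<in> \<sigma> \<and> b \<in> \<sigma>}"
        using zero_in[OF assms(1)] by (intro CollectI exI[of _ 0] exI[of _ 0]) auto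
      fix x y assume "x \<in> {a - b | a b. a \<in> \<sigma> \<and> b \<in> \<sigma>}" "y \<in> {a - b | a b. a \<in> \<sigma> \<and> b \<in> \<sigma>}"
      then obtain a b a' b' where "x = a - b" "y = a' - b'" "a \<in> \<sigma>" "b \<in> \<sigma>" "a' \<in> \<sigma>" "b' \<in> \<sigma>" by blast
      then show "x + y \<in> {a - b | a b. a \<in> \<sigma> \<and> b \<in> \<sigma>}"
        by (intro CollectI exI[of _ "a + a'"] exI[of _ "b + b'"]) (auto intro: convex_cone_add[OF cc])
    next
      note cc = convex_cone[OF assms(1)]
      fix c x assume "x \<in> {a - b | a b. a \<in> \<sigma> \<and> b \<in> \<sigma>}"
      then obtain a b where ab: "x = a - b" "a \<in> \<sigma>" "b \<in> \<sigma>" by blast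
      show "c *\<^sub>R x \<in> {a - b | a b. a \<in> \<sigma> \<and> b \<in> \<sigma>}"
      proof (cases "c \<ge> 0")
        case True
        then show ?thesis using ab
          by (intro CollectI exI[of _ "c *\<^sub>R a"] exI[of _ "c *\<^sub>R b"]) (auto intro: convex_cone_scaleR[OF cc] simp: scaleR_diff_right)
      next
        case False
        then have "(- c) *\<^sub>R b \<in> \<sigma>" "(- c) *\<^sub>R a \<in> \<sigma>" using ab by (auto intro!: convex_cone_scaleR[OF cc] simp del: scaleR_minus_left)
        then show ?thesis using ab
          by (intro CollectI exI[of _ "(- c) *\<^sub>R b"] exI[of _ "(- c) *\<^sub>R a"]) (auto simp: scaleR_diff_right)
      qed
    qed
  qed
  then show ?thesis using assms(2) that by blast
qed

text \<open>Equal images give \<open>x + b = y + a\<close> with \<open>a\<close> and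
  \<open>b\<close> in \<open>\<sigma>\<close>. This point lies in both cones, whose intersection is
  a face of \<open>\<eta>\<close>, so extremality puts its summand \<open>x\<close> there.
  Injectivity on cones and well-definedness of functions on the star both follow from this.\<close>

lemma qcone_meet:
  assumes "\<sigma> \<in> \<Sigma>" "\<eta> \<in> above \<sigma>" "\<eta>' \<in> above \<sigma>" "x \<in> \<eta>" "y \<in> \<eta>'" "quot_proj \<sigma> x = quot_proj \<sigma> y"
  obtains a b where "a \<in> \<sigma>" "b \<in> \<sigma>" "x + b = y + a" "x \<in> \<eta>'"
proof -
  have "x - y \<in> span \<sigma>" using assms(6) quot_proj_eq_iff by blast
  then obtain a b where ab: "a \<in> \<sigma>" "b \<in> \<sigma>" "x - y = a - b" using span_difference[OF assms(1)] by blast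
  then have eq: "x + b = y + a" by (simp add: algebra_simps)
  have \<eta>: "\<eta> \<in> \<Sigma>" "\<sigma> \<subseteq> \<eta>" "\<eta>' \<in> \<Sigma>" "\<sigma> \<subseteq> \<eta>'" using assms by auto
  have "x + b \<in> \<eta>" using ab \<eta> assms(4) convex_cone by (auto intro: convex_cone_add)
  moreover have "y + a \<in> \<eta>'" using ab \<eta> assms(5) convex_cone by (auto intro: convex_cone_add)
  ultimately have "x + b \<in> \<eta> \<inter> \<eta>'" using eq by simp
  moreover have "\<eta> \<inter> \<eta>' face_of \<eta>" using inter_face[OF \<eta>(1,3)] by (simp add: cone_face_def)
  ultimately have "x \<in> \<eta> \<inter> \<eta>'"
    using face_cone_add[of "\<eta> \<inter> \<eta>'" \<eta> x b] convex_cone[OF \<eta>(1)] assms(4) ab \<eta> by blast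
  then show ?thesis using that ab eq by blast
qed

lemma qcone_subset_iff:
  assumes "\<sigma> \<in> \<Sigma>" "\<eta> \<in> above \<sigma>" "\<eta>' \<in> above \<sigma>"
  shows "qcone \<sigma> \<eta> \<subseteq> qcone \<sigma> \<eta>' \<longleftrightarrow> \<eta> \<subseteq> \<eta>'"
proof
  assume sub: "qcone \<sigma> \<eta> \<subseteq> qcone \<sigma> \<eta>'"
  show "\<eta> \<subseteq> \<eta>'"
  proof
    fix x assume x: "x \<in> \<eta>"
    then obtain y where "y \<in> \<eta>'" "quot_proj \<sigma> x = quot_proj \<sigma> y" using sub by blast
    then show "x \<in> \<eta>'" using qcone_meet[OF assms x] by metis
  qed
qed blast

lemma qcone_inj: "\<sigma> \<in> \<Sigma> \<Longrightarrow> inj_on (qcone \<sigma>) (above \<sigma>)"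
  by (rule inj_onI) (use qcone_subset_iff[of \<sigma>] in \<open>blast intro: subset_antisym\<close>)

lemma star_fan_eq: "star_fan \<Sigma> \<sigma> = qcone \<sigma> ` above \<sigma>"
  by (simp add: star_fan_def)

lemma star_orientation_qcone:
  assumes "\<sigma> \<in> \<Sigma>" "\<eta> \<in> above \<sigma>"
  shows "star_orientation \<Sigma> \<omega> \<sigma> (qcone \<sigma> \<eta>) = \<omega> \<eta>"
  using assms the_inv_into_f_f[OF qcone_inj[OF assms(1)] assms(2)]
  by (auto simp: star_orientation_def star_fan_eq)

lemma span_qcone: "span (qcone \<sigma> \<eta>) = quot_proj \<sigma> ` span \<eta>"
  by (rule linear_span_image[OF linear_quot_proj])

lemma quot_proj_in_span:
  assumes "\<sigma> \<subseteq> \<eta>" "x \<in> span \<eta>"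
  shows "quot_proj \<sigma> x \<in> span \<eta>"
proof -
  have "x - quot_proj \<sigma> x \<in> span \<eta>" using span_mono[OF assms(1)] quot_proj(2)[of x \<sigma>] by blast
  from span_diff[OF assms(2) this] show ?thesis by simp
qed

lemma quot_proj_in_span_iff:
  assumes "\<sigma> \<subseteq> \<eta>"
  shows "quot_proj \<sigma> x \<in> span (qcone \<sigma> \<eta>) \<longleftrightarrow> x \<in> span \<eta>"
proof
  assume "quot_proj \<sigma> x \<in> span (qcone \<sigma> \<eta>)"
  then obtain y where "y \<in> span \<eta>" "quot_proj \<sigma> x = quot_proj \<sigma> y" unfolding span_qcone by blast
  then have "x - y \<in> span \<eta>" using quot_proj_eq_iff span_mono[OF assms] by blast
  then show "x \<in> span \<eta>" using \<open>y \<in> span \<eta>\<close> span_add by (metis diff_add_cancel)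
qed (auto simp: span_qcone)

lemma span_qcone_subset:
  assumes "\<sigma> \<subseteq> \<eta>" shows "span (qcone \<sigma> \<eta>) \<subseteq> span \<eta>"
  unfolding span_qcone using quot_proj_in_span[OF assms] by blast

lemma dim_qcone:
  assumes "\<sigma> \<subseteq> \<eta>"
  shows "dim (qcone \<sigma> \<eta>) + dim \<sigma> = dim \<eta>"
proof -
  let ?T = "span (qcone \<sigma> \<eta>)"
  have "{x + y |x y. x \<in> span \<sigma> \<and> y \<in> ?T} = span \<eta>"
  proof
    show "{x + y |x y. x \<in> span \<sigma> \<and> y \<in> ?T} \<subseteq> span \<eta>"
      using span_mono[OF assms] span_qcone_subset[OF assms] by (auto intro: span_add)
    show "span \<eta> \<subseteq> {x + y |x y. x \<in> span \<sigma> \<and> y \<in> ?T}"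
    proof
      fix x assume "x \<in> span \<eta>"
      then have "quot_proj \<sigma> x \<in> ?T" by (auto simp: span_qcone)
      then show "x \<in> {x + y |x y. x \<in> span \<sigma> \<and> y \<in> ?T}"
        using quot_proj(2)[of x \<sigma>] by (intro CollectI exI[of _ "x - quot_proj \<sigma> x"] exI[of _ "quot_proj \<sigma> x"]) auto
    qed
  qed
  moreover have "span \<sigma> \<inter> ?T = {0}"
  proof
    show "span \<sigma> \<inter> ?T \<subseteq> {0}"
    proof
      fix x assume x: "x \<in> span \<sigma> \<inter> ?T"
      then have "x \<in> orthogonal_comp (span \<sigma>)" unfolding span_qcone using quot_proj(1) by blast
      then have "orthogonal x x" using x by (auto simp: orthogonal_comp_def)
      then show "x \<in> {0}" by (simp add: orthogonal_def)
    qed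
  qed (auto simp: span_zero)
  ultimately show ?thesis using dim_sums_Int[of "span \<sigma>" ?T] by simp
qed

lemma sublattice_qcone:
  assumes "\<sigma> \<subseteq> \<eta>"
  shows "sublattice (quot_lattice N \<sigma>) (qcone \<sigma> \<eta>) = quot_proj \<sigma> ` sublattice N \<eta>"
  using quot_proj_in_span_iff[OF assms] by (auto simp: sublattice_def quot_lattice_def)

text \<open>A linear form vanishing on \<open>span \<tau>\<close> vanishes on
  \<open>span \<sigma>\<close> and is therefore unchanged by the projection, so the same witness
  \<open>u\<close> works downstairs.\<close>

lemma is_normal_qcone:
  assumes "\<sigma> \<in> \<Sigma>" "\<tau> \<in> above \<sigma>" "\<eta> \<in> above \<sigma>" "\<tau> \<subseteq> \<eta>" "dim \<eta> = dim \<tau> + 1"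
  shows "is_normal_vec (quot_lattice N \<sigma>) (qcone \<sigma> \<eta>) (qcone \<sigma> \<tau>) (quot_proj \<sigma> (nv \<eta> \<tau>))"
proof -
  have n: "is_normal_vec N \<eta> \<tau> (nv \<eta> \<tau>)" using is_normal assms by simp
  have sub: "\<sigma> \<subseteq> \<tau>" "\<sigma> \<subseteq> \<eta>" using assms by auto
  obtain u where u: "\<And>x. x \<in> span \<tau> \<Longrightarrow> u \<bullet> x = 0" "\<And>x. x \<in> \<eta> \<Longrightarrow> 0 \<le> u \<bullet> x" "0 < u \<bullet> nv \<eta> \<tau>"
    using n unfolding is_normal_vec_def by blast
  have uP: "u \<bullet> quot_proj \<sigma> x = u \<bullet> x" for x
    by (rule linear_quot_proj_invariant)
      (use u(1) sub(1) in \<open>auto simp: span_base bounded_linear.linear bounded_linear_inner_right\<close>)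
  have L: "{t + of_int k *\<^sub>R nv \<eta> \<tau> | t (k::int). t \<in> sublattice N \<tau>} = sublattice N \<eta>"
    using n unfolding is_normal_vec_def by blast
  have "{t + of_int k *\<^sub>R quot_proj \<sigma> (nv \<eta> \<tau>) | t (k::int). t \<in> quot_proj \<sigma> ` sublattice N \<tau>}
      = quot_proj \<sigma> ` {t + of_int k *\<^sub>R nv \<eta> \<tau> | t (k::int). t \<in> sublattice N \<tau>}" (is "?A = ?B")
  proof (intro equalityI subsetI)
    fix x assume "x \<in> ?A"
    then obtain t and k :: int where "t \<in> sublattice N \<tau>" "x = quot_proj \<sigma> t + of_int k *\<^sub>R quot_proj \<sigma> (nv \<eta> \<tau>)" by blast
    then show "x \<in> ?B"
      by (intro image_eqI[of _ _ "t + of_int k *\<^sub>R nv \<eta> \<tau>"])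
        (auto simp: linear_add[OF linear_quot_proj] linear_scale[OF linear_quot_proj])
  next
    fix x assume "x \<in> ?B"
    then obtain t and k :: int where "t \<in> sublattice N \<tau>" "x = quot_proj \<sigma> (t + of_int k *\<^sub>R nv \<eta> \<tau>)" by blast
    then show "x \<in> ?A"
      by (intro CollectI exI[of _ "quot_proj \<sigma> t"] exI[of _ k])
        (auto simp: linear_add[OF linear_quot_proj] linear_scale[OF linear_quot_proj])
  qed
  then have eq: "{t + of_int k *\<^sub>R quot_proj \<sigma> (nv \<eta> \<tau>) | t (k::int). t \<in> sublattice (quot_lattice N \<sigma>) (qcone \<sigma> \<tau>)}
      = sublattice (quot_lattice N \<sigma>) (qcone \<sigma> \<eta>)"
    unfolding sublattice_qcone[OF sub(1)] sublattice_qcone[OF sub(2)] L .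
  have "u \<bullet> x = 0" if "x \<in> span (qcone \<sigma> \<tau>)" for x
    using that uP u(1) by (auto simp: span_qcone)
  moreover have "\<forall>x\<in>qcone \<sigma> \<eta>. 0 \<le> u \<bullet> x" using uP u(2) by auto
  moreover have "0 < u \<bullet> quot_proj \<sigma> (nv \<eta> \<tau>)" using uP u(3) by simp
  moreover have "quot_proj \<sigma> (nv \<eta> \<tau>) \<in> sublattice (quot_lattice N \<sigma>) (qcone \<sigma> \<eta>)"
    unfolding sublattice_qcone[OF sub(2)] using n by (auto simp: is_normal_vec_def)
  ultimately show ?thesis unfolding is_normal_vec_def using eq by blast
qed

lemma normal_vec_qcone:
  assumes "\<sigma> \<in> \<Sigma>" "\<tau> \<in> above \<sigma>" "\<eta> \<in> above \<sigma>" "\<tau> \<subseteq> \<eta>" "dim \<eta> = dim \<tau> + 1"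
  shows "normal_vec (quot_lattice N \<sigma>) (qcone \<sigma> \<eta>) (qcone \<sigma> \<tau>) - quot_proj \<sigma> (nv \<eta> \<tau>) \<in> span (qcone \<sigma> \<tau>)"
proof (rule normal_vec_eq(2)[OF is_normal_qcone[OF assms]])
  have sub: "\<sigma> \<subseteq> \<eta>" "\<eta> \<in> \<Sigma>" using assms by auto
  have "qcone \<sigma> \<eta> \<subseteq> quot_proj \<sigma> ` span (sublattice N \<eta>)" using span_sublattice[OF sub(2)] by blast
  also have "\<dots> = span (quot_proj \<sigma> ` sublattice N \<eta>)" by (rule linear_span_image[OF linear_quot_proj, symmetric])
  finally show "qcone \<sigma> \<eta> \<subseteq> span (sublattice (quot_lattice N \<sigma>) (qcone \<sigma> \<eta>))"
    unfolding sublattice_qcone[OF sub(1)] .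
qed

lemma closed_qcone: "\<eta> \<in> \<Sigma> \<Longrightarrow> closed (qcone \<sigma> \<eta>)"
proof -
  assume "\<eta> \<in> \<Sigma>"
  then have "qcone \<sigma> \<eta> = convex_cone hull (quot_proj \<sigma> ` e ` gens \<eta>)"
    using gens_props(3)[of \<eta>] convex_cone_hull_linear_image[OF linear_quot_proj, of \<sigma> "e ` gens \<eta>"]
    by (simp add: cone_of_def)
  then show ?thesis by (simp add: closed_convex_cone_hull)
qed

end

context meromorphic_fan
begin

text \<open>The function induced by \<open>f - L\<close> on the star of \<open>\<sigma>\<close>, for \<open>L\<close> extending \<open>f\<^sub>\<sigma>\<close>.\<close>

definition star_fun :: "('a \<Rightarrow> real) \<Rightarrow> 'a set \<Rightarrow> 'a \<Rightarrow> real" where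
  "star_fun L \<sigma> y = (let x = (SOME x. x \<in> \<Union>(above \<sigma>) \<and> quot_proj \<sigma> x = y) in f x - L x)"

text \<open>Two preimages differ by a difference of points of \<open>\<sigma>\<close>, on which f
  and \<open>L\<close> agree; so the chosen preimage does not matter.\<close>

lemma star_fun_eq:
  assumes \<sigma>: "\<sigma> \<in> \<Sigma>" and L: "linear L" "\<And>x. x \<in> \<sigma> \<Longrightarrow> L x = f x" and x: "\<eta> \<in> above \<sigma>" "x \<in> \<eta>"
  shows "star_fun L \<sigma> (quot_proj \<sigma> x) = f x - L x"
proof -
  define z where "z = (SOME z. z \<in> \<Union>(above \<sigma>) \<and> quot_proj \<sigma> z = quot_proj \<sigma> x)"
  have "z \<in> \<Union>(above \<sigma>) \<and> quot_proj \<sigma> z = quot_proj \<sigma> x"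
    unfolding z_def by (rule someI[of _ x]) (use x in auto)
  then obtain \<eta>' where z: "\<eta>' \<in> above \<sigma>" "z \<in> \<eta>'" "quot_proj \<sigma> z = quot_proj \<sigma> x" by blast
  obtain a b where ab: "a \<in> \<sigma>" "b \<in> \<sigma>" "x + b = z + a" "x \<in> \<eta>'"
    using qcone_meet[OF \<sigma> x(1) z(1) x(2) z(2)] z(3) by metis
  have \<eta>': "\<eta>' \<in> \<Sigma>" "\<sigma> \<subseteq> \<eta>'" using z by auto
  have "f y - L y = fl \<eta>' y - L y" if "y \<in> \<eta>'" for y using fl_props(2)[OF \<eta>'(1) that] by simp
  moreover have "fl \<eta>' x + fl \<eta>' b = fl \<eta>' z + fl \<eta>' a" "L x + L b = L z + L a"
    using ab(3) linear_add[OF fl_props(1)[OF \<eta>'(1)]] linear_add[OF L(1)] by metis+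
  moreover have "fl \<eta>' b = L b" "fl \<eta>' a = L a" using ab \<eta>' L(2) fl_props(2)[OF \<eta>'(1)] by auto
  ultimately have "f x - L x = f z - L z" using ab(4) z(2) by simp
  then show ?thesis unfolding star_fun_def Let_def z_def[symmetric] by simp
qed

lemma star_fun_linear:
  assumes \<sigma>: "\<sigma> \<in> \<Sigma>" and L: "linear L" "\<And>x. x \<in> \<sigma> \<Longrightarrow> L x = f x" and \<eta>: "\<eta> \<in> above \<sigma>"
  shows "linear (\<lambda>y. fl \<eta> y - L y)" "\<And>y. y \<in> qcone \<sigma> \<eta> \<Longrightarrow> star_fun L \<sigma> y = fl \<eta> y - L y"
    "fl \<eta> (quot_proj \<sigma> x) - L (quot_proj \<sigma> x) = fl \<eta> x - L x"
proof -
  have \<eta>': "\<eta> \<in> \<Sigma>" "\<sigma> \<subseteq> \<eta>" using \<eta> by auto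
  show lin: "linear (\<lambda>y. fl \<eta> y - L y)"
    using linear_compose_sub[OF fl_props(1)[OF \<eta>'(1)] L(1)] by simp
  show inv: "fl \<eta> (quot_proj \<sigma> x) - L (quot_proj \<sigma> x) = fl \<eta> x - L x" for x
    by (rule linear_quot_proj_invariant[OF lin]) (use L(2) fl_props(2)[OF \<eta>'(1)] \<eta>' in auto)
  show "star_fun L \<sigma> y = fl \<eta> y - L y" if y: "y \<in> qcone \<sigma> \<eta>" for y
  proof -
    obtain x where x: "x \<in> \<eta>" "y = quot_proj \<sigma> x" using y by blast
    have "star_fun L \<sigma> y = f x - L x" unfolding x(2) by (rule star_fun_eq[OF \<sigma> L \<eta> x(1)])
    then show ?thesis using inv[of x] fl_props(2)[OF \<eta>'(1) x(1)] x(2) by simp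
  qed
qed

lemma star_fun_meromorphic:
  assumes \<sigma>: "\<sigma> \<in> \<Sigma>" and L: "L \<in> dual_lattice \<int> N" "\<And>x. x \<in> \<sigma> \<Longrightarrow> L x = f x"
  shows "meromorphic (quot_lattice N \<sigma>) (star_fan \<Sigma> \<sigma>) (star_fun L \<sigma>)"
  unfolding meromorphic_def
proof
  have lin: "linear L" using L(1) by (simp add: dual_lattice_def)
  have "continuous_on (\<Union>\<eta>\<in>above \<sigma>. qcone \<sigma> \<eta>) (star_fun L \<sigma>)"
  proof (rule continuous_on_closed_Union)
    fix \<eta> assume \<eta>: "\<eta> \<in> above \<sigma>"
    then show "closed (qcone \<sigma> \<eta>)" using closed_qcone by blast
    have "continuous_on (qcone \<sigma> \<eta>) (\<lambda>y. fl \<eta> y - L y)"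
      using star_fun_linear(1)[OF \<sigma> lin L(2) \<eta>] by (rule linear_continuous_on[OF linear_conv_bounded_linear[THEN iffD1]])
    then show "continuous_on (qcone \<sigma> \<eta>) (star_fun L \<sigma>)"
      using star_fun_linear(2)[OF \<sigma> lin L(2) \<eta>] by (simp cong: continuous_on_cong)
  qed simp
  then show "continuous_on (\<Union>(star_fan \<Sigma> \<sigma>)) (star_fun L \<sigma>)" by (simp add: star_fan_eq)
  show "\<forall>\<zeta>\<in>star_fan \<Sigma> \<sigma>. \<exists>l\<in>dual_lattice \<int> (sublattice (quot_lattice N \<sigma>) \<zeta>). \<forall>x\<in>\<zeta>. star_fun L \<sigma> x = l x"
  proof
    fix \<zeta> assume "\<zeta> \<in> star_fan \<Sigma> \<sigma>"
    then obtain \<eta> where \<eta>: "\<eta> \<in> above \<sigma>" "\<zeta> = qcone \<sigma> \<eta>" by (auto simp: star_fan_eq)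
    have "fl \<eta> x - L x \<in> \<int>" if "x \<in> sublattice N \<eta>" for x
      using that fl_props(3)[of \<eta> x] L(1) \<eta> by (auto simp: sublattice_def dual_lattice_def)
    then have "(\<lambda>y. fl \<eta> y - L y) \<in> dual_lattice \<int> (sublattice (quot_lattice N \<sigma>) \<zeta>)"
      using star_fun_linear(1,3)[OF \<sigma> lin L(2) \<eta>(1)] sublattice_qcone[of \<sigma> \<eta>] \<eta>
      by (auto simp: dual_lattice_def)
    then show "\<exists>l\<in>dual_lattice \<int> (sublattice (quot_lattice N \<sigma>) \<zeta>). \<forall>x\<in>\<zeta>. star_fun L \<sigma> x = l x"
      by (rule bexI[rotated]) (use star_fun_linear(2)[OF \<sigma> lin L(2) \<eta>(1)] \<eta>(2) in simp)
  qed
qed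

text \<open>An order changes neither when a linear form is subtracted from f nor when normal vectors
  are altered by elements of \<open>span \<tau>\<close>. The chosen normal vectors of the star fan
  are the projected ones only up to such alterations.\<close>

lemma star_fun_ord:
  assumes \<sigma>: "\<sigma> \<in> \<Sigma>" and L: "linear L" "\<And>x. x \<in> \<sigma> \<Longrightarrow> L x = f x"
    and \<tau>: "\<tau> \<in> above \<sigma>" "wsum \<omega> \<tau> \<in> span \<tau>" "dim \<tau> + 1 = d"
  shows "ord_at (quot_lattice N \<sigma>) (star_fan \<Sigma> \<sigma>) (d - dim \<sigma>) (star_orientation \<Sigma> \<omega> \<sigma>) (star_fun L \<sigma>) (qcone \<sigma> \<tau>)
    = ord_at N \<Sigma> d \<omega> f \<tau>"
proof -
  let ?P = "quot_proj \<sigma>" and ?g = "star_fun L \<sigma>" and ?\<tau> = "qcone \<sigma> \<tau>"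
  define h where "h = (\<lambda>\<eta> x. fl \<eta> x - L x)"
  have \<tau>': "\<tau> \<in> \<Sigma>" "\<sigma> \<subseteq> \<tau>" using \<tau> by auto
  have h: "linear (h \<eta>)" "h \<eta> (?P x) = h \<eta> x" if "\<eta> \<in> above \<sigma>" for \<eta> x
    using star_fun_linear[OF \<sigma> L that] by (auto simp: h_def)
  have lp: "lin_part ?g (qcone \<sigma> \<eta>) x = h \<eta> x" if "\<eta> \<in> above \<sigma>" "x \<in> span (qcone \<sigma> \<eta>)" for \<eta> x
    using lin_part_eq(3)[OF star_fun_linear(1)[OF \<sigma> L that(1)] star_fun_linear(2)[OF \<sigma> L that(1)] that(2)]
    by (simp add: h_def)
  have C: "\<eta> \<in> above \<sigma> \<and> dim \<eta> = dim \<tau> + 1 \<and> \<tau> \<subseteq> \<eta> \<and> \<eta> \<in> \<Sigma>" if "\<eta> \<in> cofs \<tau>" for \<eta>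
    using that \<tau>' by (auto simp: cofs_iff)
  have ind: "{\<zeta>. \<zeta> \<in> cones_of_dim (star_fan \<Sigma> \<sigma>) (d - dim \<sigma>) \<and> ?\<tau> \<subseteq> \<zeta>} = qcone \<sigma> ` cofs \<tau>" (is "?A = ?B")
  proof (intro equalityI subsetI)
    fix \<zeta> assume "\<zeta> \<in> ?A"
    then obtain \<eta> where \<eta>: "\<eta> \<in> above \<sigma>" "\<zeta> = qcone \<sigma> \<eta>" "dim \<zeta> = d - dim \<sigma>" "?\<tau> \<subseteq> \<zeta>"
      by (auto simp: cones_of_dim_def star_fan_eq)
    have "\<tau> \<subseteq> \<eta>" using qcone_subset_iff[OF \<sigma> \<tau>(1) \<eta>(1)] \<eta> by simp
    \<comment> \<open>The truncated subtraction \<open>d - dim \<sigma>\<close> loses nothing: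
      \<open>\<sigma>\<close> lies in \<open>\<tau>\<close>, which has dimension
      \<open>d - 1\<close>.\<close>
    moreover have "dim \<eta> = d" using dim_qcone[of \<sigma> \<eta>] dim_qcone[OF \<tau>'(2)] \<eta> \<tau>(3) by auto
    ultimately have "\<eta> \<in> cofs \<tau>" using \<eta> \<tau>(3) by (simp add: cofs_iff)
    then show "\<zeta> \<in> ?B" using \<eta> by blast
  next
    fix \<zeta> assume "\<zeta> \<in> ?B"
    then obtain \<eta> where \<eta>: "\<eta> \<in> cofs \<tau>" "\<zeta> = qcone \<sigma> \<eta>" by blast
    then show "\<zeta> \<in> ?A" using C[OF \<eta>(1)] dim_qcone[of \<sigma> \<eta>] \<tau>(3)
      by (auto simp: cones_of_dim_def star_fan_eq)
  qed
  have inj: "inj_on (qcone \<sigma>) (cofs \<tau>)"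
    using qcone_inj[OF \<sigma>] by (rule inj_on_subset) (use C in blast)
  define m where "m \<eta> = normal_vec (quot_lattice N \<sigma>) (qcone \<sigma> \<eta>) ?\<tau>" for \<eta>
  \<comment> \<open>The error between the two normal vectors. It will enter the sum and the
    correction term through the same form \<open>h \<tau>\<close> and cancel.\<close>
  define t where "t \<eta> = m \<eta> - ?P (nv \<eta> \<tau>)" for \<eta>
  have t: "t \<eta> \<in> span ?\<tau>" if "\<eta> \<in> cofs \<tau>" for \<eta>
    using normal_vec_qcone[OF \<sigma> \<tau>(1)] C[OF that] by (simp add: t_def m_def)
  have t\<tau>: "t \<eta> \<in> span \<tau>" if "\<eta> \<in> cofs \<tau>" for \<eta>
    using t[OF that] span_qcone_subset[OF \<tau>'(2)] by blast
  have m: "m \<eta> = ?P (nv \<eta> \<tau>) + t \<eta>" for \<eta> by (simp add: t_def)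
  have m_span: "m \<eta> \<in> span (qcone \<sigma> \<eta>)" if "\<eta> \<in> cofs \<tau>" for \<eta>
  proof -
    have "?\<tau> \<subseteq> qcone \<sigma> \<eta>" using C[OF that] by blast
    then have "t \<eta> \<in> span (qcone \<sigma> \<eta>)" using t[OF that] span_mono by blast
    moreover have "?P (nv \<eta> \<tau>) \<in> span (qcone \<sigma> \<eta>)"
      using C[OF that] nv_sublattice(2)[of \<tau> \<eta>] \<tau>' by (auto simp: span_qcone)
    ultimately show ?thesis unfolding m by (rule span_add[rotated])
  qed
  have "(\<Sum>\<zeta>\<in>qcone \<sigma> ` cofs \<tau>. of_int (star_orientation \<Sigma> \<omega> \<sigma> \<zeta>) * lin_part ?g \<zeta> (normal_vec (quot_lattice N \<sigma>) \<zeta> ?\<tau>))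
      = (\<Sum>\<eta>\<in>cofs \<tau>. of_int (\<omega> \<eta>) * (h \<eta> (nv \<eta> \<tau>) + h \<tau> (t \<eta>)))"
    unfolding sum.reindex[OF inj] comp_def
  proof (rule sum.cong)
    fix \<eta> assume \<eta>: "\<eta> \<in> cofs \<tau>"
    have "lin_part ?g (qcone \<sigma> \<eta>) (m \<eta>) = h \<eta> (m \<eta>)" using lp m_span[OF \<eta>] C[OF \<eta>] by blast
    also have "\<dots> = h \<eta> (nv \<eta> \<tau>) + h \<eta> (t \<eta>)" unfolding m using h C[OF \<eta>] by (simp add: linear_add)
    also have "h \<eta> (t \<eta>) = h \<tau> (t \<eta>)" using fl_face[of \<tau> \<eta> "t \<eta>"] \<tau>' C[OF \<eta>] t\<tau>[OF \<eta>] by (simp add: h_def)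
    finally show "of_int (star_orientation \<Sigma> \<omega> \<sigma> (qcone \<sigma> \<eta>)) * lin_part ?g (qcone \<sigma> \<eta>) (normal_vec (quot_lattice N \<sigma>) (qcone \<sigma> \<eta>) ?\<tau>)
      = of_int (\<omega> \<eta>) * (h \<eta> (nv \<eta> \<tau>) + h \<tau> (t \<eta>))"
      using star_orientation_qcone[OF \<sigma>] C[OF \<eta>] by (simp add: m_def)
  qed simp
  moreover have "lin_part ?g ?\<tau> (\<Sum>\<zeta>\<in>qcone \<sigma> ` cofs \<tau>. of_int (star_orientation \<Sigma> \<omega> \<sigma> \<zeta>) *\<^sub>R normal_vec (quot_lattice N \<sigma>) \<zeta> ?\<tau>)
      = h \<tau> (wsum \<omega> \<tau>) + (\<Sum>\<eta>\<in>cofs \<tau>. of_int (\<omega> \<eta>) * h \<tau> (t \<eta>))"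
  proof -
    have "(\<Sum>\<zeta>\<in>qcone \<sigma> ` cofs \<tau>. of_int (star_orientation \<Sigma> \<omega> \<sigma> \<zeta>) *\<^sub>R normal_vec (quot_lattice N \<sigma>) \<zeta> ?\<tau>)
        = (\<Sum>\<eta>\<in>cofs \<tau>. of_int (\<omega> \<eta>) *\<^sub>R m \<eta>)"
      unfolding sum.reindex[OF inj] comp_def
      by (rule sum.cong) (use star_orientation_qcone[OF \<sigma>] C in \<open>auto simp: m_def\<close>)
    also have "\<dots> = ?P (wsum \<omega> \<tau>) + (\<Sum>\<eta>\<in>cofs \<tau>. of_int (\<omega> \<eta>) *\<^sub>R t \<eta>)"
      unfolding m by (simp add: wsum_def linear_sum[OF linear_quot_proj] linear_scale[OF linear_quot_proj]
          scaleR_add_right sum.distrib)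
    finally have eq: "(\<Sum>\<zeta>\<in>qcone \<sigma> ` cofs \<tau>. of_int (star_orientation \<Sigma> \<omega> \<sigma> \<zeta>) *\<^sub>R normal_vec (quot_lattice N \<sigma>) \<zeta> ?\<tau>)
      = ?P (wsum \<omega> \<tau>) + (\<Sum>\<eta>\<in>cofs \<tau>. of_int (\<omega> \<eta>) *\<^sub>R t \<eta>)" .
    \<comment> \<open>\<open>lin_part\<close> is determined only on the span of its cone; balancing
      at \<open>\<tau>\<close> puts the argument there.\<close>
    have "?P (wsum \<omega> \<tau>) + (\<Sum>\<eta>\<in>cofs \<tau>. of_int (\<omega> \<eta>) *\<^sub>R t \<eta>) \<in> span ?\<tau>"
      using \<tau>(2) t by (intro span_add span_sum span_scale) (auto simp: span_qcone)
    then show ?thesis unfolding eq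
      using lp[OF \<tau>(1)] h[OF \<tau>(1)] by (simp add: linear_add linear_sum linear_scale)
  qed
  moreover have "- (\<Sum>\<eta>\<in>cofs \<tau>. of_int (\<omega> \<eta>) * (h \<eta> (nv \<eta> \<tau>) + h \<tau> (t \<eta>)))
      + (h \<tau> (wsum \<omega> \<tau>) + (\<Sum>\<eta>\<in>cofs \<tau>. of_int (\<omega> \<eta>) * h \<tau> (t \<eta>))) = ordr \<omega> \<tau>"
    unfolding ordr_def h_def
    by (simp add: distrib_left right_diff_distrib sum.distrib sum_subtractf)
      (simp add: wsum_def linear_sum[OF L(1)] linear_scale[OF L(1)])
  ultimately show ?thesis unfolding ord_at_eq[OF \<tau>(3)] by (simp add: ord_at_def ind)
qed

text \<open>\<open>L\<close> continues the linear part of f on \<open>\<sigma>\<close> integrally,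
  so \<open>f - L\<close> descends to a meromorphic function on the star fan, with trivial divisor
  since \<open>\<sigma>\<close> is outside \<Delta>. The answer keeps \<open>L\<close> and
  \<open>l\<close> apart because saturation is applied to the form on the quotient.\<close>

lemma div_faithful_star_linear:
  assumes df: "div_faithful N \<Sigma> d \<omega>" and bal: "balanced N \<Sigma> d \<omega>"
    and \<sigma>: "\<sigma> \<in> \<Sigma>" "\<sigma> \<notin> div_subfan N \<Sigma> d \<omega> f"
  obtains L l where "L \<in> dual_lattice \<int> N" "linear l"
    "\<And>\<eta> x. \<eta> \<in> above \<sigma> \<Longrightarrow> x \<in> \<eta> \<Longrightarrow> f x = L x + l (quot_proj \<sigma> x)"
proof -
  obtain L where L: "L \<in> dual_lattice \<int> N" "\<And>x. x \<in> span (e ` gens \<sigma>) \<Longrightarrow> L x = fl \<sigma> x"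
    using dual_lattice_extend[OF lattice _ gens_N fl_props(1)[OF \<sigma>(1)], of \<sigma>] fl_props(3)[OF \<sigma>(1)] span_gens[OF \<sigma>(1)]
    by auto
  have Lf: "L x = f x" if "x \<in> \<sigma>" for x
    using L(2)[of x] fl_props(2)[OF \<sigma>(1) that] that span_gens[OF \<sigma>(1)] by (simp add: span_base)
  have lin: "linear L" using L(1) by (simp add: dual_lattice_def)
  have "trivial_div (quot_lattice N \<sigma>) (star_fan \<Sigma> \<sigma>) (d - dim \<sigma>) (star_orientation \<Sigma> \<omega> \<sigma>) (star_fun L \<sigma>)"
    unfolding trivial_div_def
  proof (intro ballI impI)
    fix \<zeta> assume "\<zeta> \<in> star_fan \<Sigma> \<sigma>" and dim: "dim \<zeta> + 1 = d - dim \<sigma>"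
    then obtain \<tau> where \<tau>: "\<tau> \<in> above \<sigma>" "\<zeta> = qcone \<sigma> \<tau>" by (auto simp: star_fan_eq)
    have d: "dim \<tau> + 1 = d" using dim dim_qcone[of \<sigma> \<tau>] \<tau> by auto
    \<comment> \<open>A nonzero order along \<open>\<tau>\<close> would put its face
      \<open>\<sigma>\<close> into \<Delta>.\<close>
    have "ord_at N \<Sigma> d \<omega> f \<tau> = 0"
      using \<sigma> \<tau> d subset_face[of \<sigma> \<tau>] unfolding div_subfan_def by blast
    moreover have "wsum \<omega> \<tau> \<in> span \<tau>" using bal \<tau> d unfolding balanced_wsum by blast
    ultimately show "ord_at (quot_lattice N \<sigma>) (star_fan \<Sigma> \<sigma>) (d - dim \<sigma>) (star_orientation \<Sigma> \<omega> \<sigma>) (star_fun L \<sigma>) \<zeta> = 0"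
      using star_fun_ord[OF \<sigma>(1) lin Lf \<tau>(1) _ d] \<tau>(2) by simp
  qed
  then obtain l where l: "linear l" "\<forall>x\<in>\<Union>(star_fan \<Sigma> \<sigma>). star_fun L \<sigma> x = l x"
    using df \<sigma>(1) star_fun_meromorphic[OF \<sigma>(1) L(1) Lf] unfolding div_faithful_def by blast
  have "f x = L x + l (quot_proj \<sigma> x)" if "\<eta> \<in> above \<sigma>" "x \<in> \<eta>" for \<eta> x
  proof -
    have "star_fun L \<sigma> (quot_proj \<sigma> x) = l (quot_proj \<sigma> x)" using l(2) that by (auto simp: star_fan_eq)
    then show ?thesis using star_fun_eq[OF \<sigma>(1) lin Lf that] by simp
  qed
  then show ?thesis using that L(1) l(1) by blast
qed

end

section \<open>Divisors of Minkowski weights are balanced\<close>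

text \<open>The two-dimensional core of balancing of divisors: \<open>W r s\<close> is the weight of
  the cone spanned by \<open>r\<close> and \<open>s\<close>, \<open>D\<close> the divisor of the
  function with values \<open>\<phi>\<close>, everything modulo \<open>S\<close>. Exchanging the
  order of summation uses symmetry of \<open>W\<close>; balancing then cancels the \<open>A\<close>
  terms and leaves combinations of the \<open>t r\<close>.\<close>

lemma symmetric_weight_divisor:
  fixes e :: "'r \<Rightarrow> 'a::real_vector" and \<phi> :: "'r \<Rightarrow> real"
  assumes S: "subspace S" and sym: "\<And>r s. r \<in> R \<Longrightarrow> s \<in> R \<Longrightarrow> W r s = W s r"
    and bal: "\<And>r. r \<in> R \<Longrightarrow> (\<Sum>s\<in>R. W r s *\<^sub>R e s) = A r *\<^sub>R e r + t r" and t: "\<And>r. r \<in> R \<Longrightarrow> t r \<in> S"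
    and l: "linear l"
    and D: "\<And>r. r \<in> R \<Longrightarrow> D r = - (\<Sum>s\<in>R. W r s * \<phi> s) + A r * \<phi> r + l (t r)"
  shows "(\<Sum>r\<in>R. D r *\<^sub>R e r) \<in> S"
proof -
  \<comment> \<open>Subtracting \<open>l\<close> from the function does not change \<open>D\<close>
    but absorbs the terms \<open>l (t r)\<close>.\<close>
  define g where "g r = \<phi> r - l (e r)" for r
  have D': "D r = - (\<Sum>s\<in>R. W r s * g s) + A r * g r" if "r \<in> R" for r
  proof -
    have "(\<Sum>s\<in>R. W r s * l (e s)) = A r * l (e r) + l (t r)"
      using arg_cong[OF bal[OF that], of l] by (simp add: linear_sum[OF l] linear_scale[OF l] linear_add[OF l])
    then show ?thesis using D[OF that] by (simp add: g_def right_diff_distrib sum_subtractf)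
  qed
  have "(\<Sum>r\<in>R. (\<Sum>s\<in>R. W r s * g s) *\<^sub>R e r) = (\<Sum>s\<in>R. g s *\<^sub>R (\<Sum>r\<in>R. W s r *\<^sub>R e r))"
  proof -
    have "(\<Sum>r\<in>R. (\<Sum>s\<in>R. W r s * g s) *\<^sub>R e r) = (\<Sum>r\<in>R. \<Sum>s\<in>R. (W s r * g s) *\<^sub>R e r)"
      by (intro sum.cong refl) (auto simp: scaleR_left.sum sym intro!: sum.cong)
    also have "\<dots> = (\<Sum>s\<in>R. \<Sum>r\<in>R. (W s r * g s) *\<^sub>R e r)" by (rule sum.swap)
    finally show ?thesis by (simp add: scaleR_right.sum mult.commute)
  qed
  also have "\<dots> = (\<Sum>s\<in>R. (A s * g s) *\<^sub>R e s) + (\<Sum>s\<in>R. g s *\<^sub>R t s)"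
    by (simp add: bal scaleR_add_right sum.distrib mult.commute)
  finally have eq: "(\<Sum>r\<in>R. (\<Sum>s\<in>R. W r s * g s) *\<^sub>R e r) = (\<Sum>s\<in>R. (A s * g s) *\<^sub>R e s) + (\<Sum>s\<in>R. g s *\<^sub>R t s)" .
  have "(\<Sum>r\<in>R. D r *\<^sub>R e r) = (\<Sum>r\<in>R. (A r * g r) *\<^sub>R e r) - (\<Sum>r\<in>R. (\<Sum>s\<in>R. W r s * g s) *\<^sub>R e r)"
    by (simp add: D' scaleR_left_diff_distrib sum_subtractf)
  also have "\<dots> = - (\<Sum>s\<in>R. g s *\<^sub>R t s)" using eq by simp
  finally show ?thesis using t by (simp add: subspace_neg subspace_sum subspace_scale S)
qed

section \<open>Lattice indices along flags\<close>

context simplicial_lattice_fan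
begin

text \<open>Modulo \<open>span \<tau>\<close> the normal vector is
  \<open>kap \<sigma> \<tau> \<rho>\<close> times \<open>e \<rho>\<close>, when
  \<open>\<rho>\<close> is the ray of \<open>\<sigma>\<close> missing from \<open>\<tau>\<close>. So
  this is the reciprocal of the index of \<open>N_\<tau> + Z e_\<rho>\<close> in
  \<open>N_\<sigma>\<close>.\<close>

definition kap :: "'a set \<Rightarrow> 'a set \<Rightarrow> 'a set \<Rightarrow> real" where
  "kap \<sigma> \<tau> \<rho> = coord (gens \<sigma>) \<rho> (nv \<sigma> \<tau>)"

lemma coord_face_zero:
  assumes "\<sigma> \<in> \<Sigma>" "\<tau> \<in> \<Sigma>" "gens \<tau> \<subseteq> gens \<sigma>" "\<rho> \<notin> gens \<tau>" "x \<in> span \<tau>"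
  shows "coord (gens \<sigma>) \<rho> x = 0"
proof (rule linear_eq_0_on_span[of _ "e ` gens \<tau>"])
  show "linear (coord (gens \<sigma>) \<rho>)" using coord_gens(1)[OF assms(1) gens_rays] .
  show "coord (gens \<sigma>) \<rho> y = 0" if "y \<in> e ` gens \<tau>" for y
    using that assms coord_gens(2)[OF assms(1) gens_rays] by (auto simp: subset_iff)
  show "x \<in> span (e ` gens \<tau>)" using assms span_gens by simp
qed

lemma kap:
  assumes "\<tau> \<in> \<Sigma>" "\<sigma> \<in> \<Sigma>" "\<rho> \<notin> gens \<tau>" "gens \<sigma> = insert \<rho> (gens \<tau>)"
  shows "kap \<sigma> \<tau> \<rho> > 0" "nv \<sigma> \<tau> - kap \<sigma> \<tau> \<rho> *\<^sub>R e \<rho> \<in> span \<tau>"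
proof -
  have "dim \<sigma> = dim \<tau> + 1" using assms by (simp flip: gens_props(2))
  then obtain k where k: "k > 0" "nv \<sigma> \<tau> - k *\<^sub>R e \<rho> \<in> span \<tau>" using nv_ray assms by metis
  have lin: "linear (coord (gens \<sigma>) \<rho>)" using coord_gens(1)[OF assms(2) gens_rays] .
  have "coord (gens \<sigma>) \<rho> (nv \<sigma> \<tau> - k *\<^sub>R e \<rho>) = 0"
    using coord_face_zero[OF assms(2,1) _ assms(3) k(2)] assms(4) by blast
  moreover have "coord (gens \<sigma>) \<rho> (e \<rho>) = 1" using coord_gens(2)[OF assms(2) gens_rays, of \<rho> \<rho>] assms(4) by simp
  ultimately have "kap \<sigma> \<tau> \<rho> = k" by (simp add: kap_def linear_diff[OF lin] linear_scale[OF lin])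
  then show "kap \<sigma> \<tau> \<rho> > 0" "nv \<sigma> \<tau> - kap \<sigma> \<tau> \<rho> *\<^sub>R e \<rho> \<in> span \<tau>" using k by auto
qed

text \<open>Both sides are the index of \<open>N\<^sub>\<delta> + \<int>e\<^sub>1 + \<int>e\<^sub>2\<close> in \<open>N\<^sub>\<sigma>\<close>, inverted: the change of basis between
  the bases of \<open>N\<^sub>\<sigma>/N\<^sub>\<delta>\<close> read off from the two flags has integral determinant.\<close>

lemma kap_dvd:
  assumes \<delta>: "\<delta> \<in> \<Sigma>" "\<tau>1 \<in> \<Sigma>" "\<tau>2 \<in> \<Sigma>" "\<sigma> \<in> \<Sigma>" and r: "r1 \<noteq> r2" "r1 \<notin> gens \<delta>" "r2 \<notin> gens \<delta>"
    and g: "gens \<tau>1 = insert r1 (gens \<delta>)" "gens \<tau>2 = insert r2 (gens \<delta>)" "gens \<sigma> = insert r1 (insert r2 (gens \<delta>))"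
  obtains k :: int where "kap \<sigma> \<tau>2 r1 * kap \<tau>2 \<delta> r2 = of_int k * (kap \<sigma> \<tau>1 r2 * kap \<tau>1 \<delta> r1)"
proof -
  have dims: "dim \<tau>1 = dim \<delta> + 1" "dim \<tau>2 = dim \<delta> + 1" "dim \<sigma> = dim \<tau>1 + 1" "dim \<sigma> = dim \<tau>2 + 1"
    using \<delta> r g by (simp_all flip: gens_props(2))
  have sub: "\<delta> \<subseteq> \<tau>1" "\<delta> \<subseteq> \<tau>2" "\<tau>1 \<subseteq> \<sigma>" "\<tau>2 \<subseteq> \<sigma>" "\<delta> \<subseteq> \<sigma>"
    using \<delta> g by (auto simp flip: gens_subset_iff)
  define c1 where "c1 = coord (gens \<sigma>) r1"
  define c2 where "c2 = coord (gens \<sigma>) r2"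
  have lin: "linear c1" "linear c2" unfolding c1_def c2_def using coord_gens(1)[OF \<delta>(4) gens_rays] by auto
  have ce: "c1 (e r1) = 1" "c1 (e r2) = 0" "c2 (e r1) = 0" "c2 (e r2) = 1"
    unfolding c1_def c2_def using coord_gens(2)[OF \<delta>(4) gens_rays] g r by auto
  have c\<delta>: "c1 x = 0" "c2 x = 0" if "x \<in> span \<delta>" for x
    unfolding c1_def c2_def using coord_face_zero[OF \<delta>(4,1) _ _ that] g r by auto
  have c\<tau>: "c2 x = 0" if "x \<in> span \<tau>1" for x
    unfolding c2_def using coord_face_zero[OF \<delta>(4,2) _ _ that] g r by auto
  have c\<tau>': "c1 x = 0" if "x \<in> span \<tau>2" for x
    unfolding c1_def using coord_face_zero[OF \<delta>(4,3) _ _ that] g r by auto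
  note k = kap[OF \<delta>(1,2) r(2) g(1)] kap[OF \<delta>(1,3) r(3) g(2)]
  have k1: "kap \<sigma> \<tau>1 r2 > 0" "nv \<sigma> \<tau>1 - kap \<sigma> \<tau>1 r2 *\<^sub>R e r2 \<in> span \<tau>1"
    by (rule kap[OF \<delta>(2,4)]; use g r in auto)+
  have k2: "kap \<sigma> \<tau>2 r1 > 0" "nv \<sigma> \<tau>2 - kap \<sigma> \<tau>2 r1 *\<^sub>R e r1 \<in> span \<tau>2"
    by (rule kap[OF \<delta>(3,4)]; use g r in auto)+
  define a where "a = kap \<tau>1 \<delta> r1"
  define b where "b = kap \<sigma> \<tau>1 r2"
  define a' where "a' = kap \<tau>2 \<delta> r2"
  define b' where "b' = kap \<sigma> \<tau>2 r1"
  have n1: "c1 (nv \<tau>1 \<delta>) = a" "c2 (nv \<tau>1 \<delta>) = 0"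
    using c\<delta>[OF k(2)] by (simp_all add: a_def linear_diff[OF lin(1)] linear_scale[OF lin(1)] linear_diff[OF lin(2)] linear_scale[OF lin(2)] ce)
  have n2: "c1 (nv \<tau>2 \<delta>) = 0" "c2 (nv \<tau>2 \<delta>) = a'"
    using c\<delta>[OF k(4)] by (simp_all add: a'_def linear_diff[OF lin(1)] linear_scale[OF lin(1)] linear_diff[OF lin(2)] linear_scale[OF lin(2)] ce)
  have m1: "c2 (nv \<sigma> \<tau>1) = b"
    using c\<tau>[OF k1(2)] by (simp add: b_def linear_diff[OF lin(2)] linear_scale[OF lin(2)] ce)
  have m2: "c1 (nv \<sigma> \<tau>2) = b'"
    using c\<tau>'[OF k2(2)] by (simp add: b'_def linear_diff[OF lin(1)] linear_scale[OF lin(1)] ce)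
  define y where "y = c1 (nv \<sigma> \<tau>1)"
  have dec: "\<exists>p q :: int. c1 x = of_int p * a + of_int q * y \<and> c2 x = of_int q * b" if x: "x \<in> sublattice N \<sigma>" for x
  proof -
    have "{t + of_int k *\<^sub>R nv \<sigma> \<tau>1 | t (k::int). t \<in> sublattice N \<tau>1} = sublattice N \<sigma>"
      "{t + of_int k *\<^sub>R nv \<tau>1 \<delta> | t (k::int). t \<in> sublattice N \<delta>} = sublattice N \<tau>1"
      using is_normal[OF \<delta>(2,4) sub(3) dims(3)] is_normal[OF \<delta>(1,2) sub(1) dims(1)]
      unfolding is_normal_vec_def by blast+
    with x obtain s t and p q :: int where "x = t + of_int q *\<^sub>R nv \<sigma> \<tau>1" "t = s + of_int p *\<^sub>R nv \<tau>1 \<delta>" "s \<in> sublattice N \<delta>"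
      by blast
    then have "c1 x = of_int p * a + of_int q * y" "c2 x = of_int q * b"
      using c\<delta>[of s] n1 m1
      by (simp_all add: sublattice_def y_def linear_add[OF lin(1)] linear_scale[OF lin(1)] linear_add[OF lin(2)] linear_scale[OF lin(2)])
    then show ?thesis by blast
  qed
  have "nv \<tau>2 \<delta> \<in> sublattice N \<sigma>"
    using nv_sublattice[OF \<delta>(1,3) sub(2) dims(2)] span_mono[OF sub(4)] by (auto simp: sublattice_def)
  then obtain p q :: int where pq: "0 = of_int p * a + of_int q * y" "a' = of_int q * b" using dec n2 by metis
  have "nv \<sigma> \<tau>2 \<in> sublattice N \<sigma>"
    using nv_sublattice[OF \<delta>(3,4) sub(4) dims(4)] by (auto simp: sublattice_def)
  then obtain r s :: int where rs: "b' = of_int r * a + of_int s * y" using dec m2 by metis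
  \<comment> \<open>\<open>p, q, r, s\<close> are the entries of the change of basis. The
    off-diagonal coordinate \<open>y\<close> is eliminated by the vanishing of the first coordinate
    of \<open>nv \<tau>2 \<delta>\<close>, which leaves the integral determinant
    \<open>q r - s p\<close>.\<close>
  have "b' * a' = of_int (q * r) * (b * a) + of_int s * b * (of_int q * y)"
    unfolding pq(2) rs by (simp add: algebra_simps)
  also have "of_int q * y = - of_int p * a" using pq(1) by simp
  also have "of_int (q * r) * (b * a) + of_int s * b * (- of_int p * a) = of_int (q * r - s * p) * (b * a)"
    by (simp add: algebra_simps)
  finally show ?thesis using that[of "q * r - s * p"] by (simp only: a_def b_def a'_def b'_def)
qed

text \<open>Each product is an integral multiple of the other by exchanging the two rays; both are
  positive, so the factors are 1.\<close>

lemma kap_commute: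
  assumes \<delta>: "\<delta> \<in> \<Sigma>" "\<tau>1 \<in> \<Sigma>" "\<tau>2 \<in> \<Sigma>" "\<sigma> \<in> \<Sigma>" and r: "r1 \<noteq> r2" "r1 \<notin> gens \<delta>" "r2 \<notin> gens \<delta>"
    and g: "gens \<tau>1 = insert r1 (gens \<delta>)" "gens \<tau>2 = insert r2 (gens \<delta>)" "gens \<sigma> = insert r1 (insert r2 (gens \<delta>))"
  shows "kap \<sigma> \<tau>2 r1 * kap \<tau>2 \<delta> r2 = kap \<sigma> \<tau>1 r2 * kap \<tau>1 \<delta> r1"
proof -
  let ?x = "kap \<sigma> \<tau>2 r1 * kap \<tau>2 \<delta> r2" and ?y = "kap \<sigma> \<tau>1 r2 * kap \<tau>1 \<delta> r1"
  obtain k :: int where k: "?x = of_int k * ?y" by (rule kap_dvd[OF assms])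
  obtain l :: int where l: "?y = of_int l * ?x"
    by (rule kap_dvd[OF \<delta>(1,3,2,4) r(1)[symmetric] r(3,2) g(2,1)]) (use g(3) in blast)+
  have "kap \<tau>1 \<delta> r1 > 0" "kap \<tau>2 \<delta> r2 > 0" using kap(1) \<delta> r g by auto
  moreover have "kap \<sigma> \<tau>1 r2 > 0" "kap \<sigma> \<tau>2 r1 > 0"
    by (rule kap(1)[OF \<delta>(2,4)] kap(1)[OF \<delta>(3,4)]; use g r in auto)+
  ultimately have pos: "?x > 0" "?y > 0" by auto
  have "k > 0" using k pos by (metis of_int_0_less_iff zero_less_mult_pos2)
  have "l > 0" using l pos by (metis of_int_0_less_iff zero_less_mult_pos2)
  have "?x = of_int (k * l) * ?x" using k l by (metis mult.assoc of_int_mult)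
  then have "real_of_int (k * l) = 1" using pos(1) by (metis less_irrefl mult_cancel_right1)
  then have "k * l = 1" by linarith
  then have "k = 1" using \<open>k > 0\<close> \<open>l > 0\<close> by (metis zmult_eq_1_iff less_irrefl neg_less_0_iff_less zero_less_one not_less_iff_gr_or_eq)
  then show ?thesis using k by simp
qed

definition link :: "'a set \<Rightarrow> 'a set set" where
  "link \<tau> = {\<rho>\<in>rays \<Sigma>. \<rho> \<notin> gens \<tau> \<and> insert \<rho> (gens \<tau>) \<in> faces}"

abbreviation join :: "'a set \<Rightarrow> 'a set \<Rightarrow> 'a set" where "join \<tau> \<rho> \<equiv> cone_of (insert \<rho> (gens \<tau>))"

lemma finite_link [simp]: "finite (link \<tau>)"
  by (simp add: link_def)

lemma join:
  assumes "\<tau> \<in> \<Sigma>" "\<rho> \<in> link \<tau>"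
  shows "join \<tau> \<rho> \<in> \<Sigma>" "gens (join \<tau> \<rho>) = insert \<rho> (gens \<tau>)" "\<rho> \<notin> gens \<tau>" "\<rho> \<in> rays \<Sigma>" "\<tau> \<subseteq> join \<tau> \<rho>"
    "dim (join \<tau> \<rho>) = dim \<tau> + 1"
proof -
  have r: "\<rho> \<in> rays \<Sigma>" "\<rho> \<notin> gens \<tau>" "insert \<rho> (gens \<tau>) \<in> faces" using assms by (auto simp: link_def)
  then show "join \<tau> \<rho> \<in> \<Sigma>" "gens (join \<tau> \<rho>) = insert \<rho> (gens \<tau>)" "\<rho> \<notin> gens \<tau>" "\<rho> \<in> rays \<Sigma>"
    using faces_props[OF r(3)] by auto
  then show "\<tau> \<subseteq> join \<tau> \<rho>" "dim (join \<tau> \<rho>) = dim \<tau> + 1"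
    using assms(1) gens_subset_iff[of \<tau> "join \<tau> \<rho>"] gens_props(2) by (auto simp flip: gens_props(2))
qed

end

context meromorphic_fan
begin

lemma cofs_bij: "\<tau> \<in> \<Sigma> \<Longrightarrow> bij_betw (join \<tau>) (link \<tau>) (cofs \<tau>)"
  using cofacets[of \<tau>] by (simp add: link_def cofs_def)

lemma sum_cofs: "\<tau> \<in> \<Sigma> \<Longrightarrow> sum F (cofs \<tau>) = (\<Sum>\<rho>\<in>link \<tau>. F (join \<tau> \<rho>))"
  using sum.reindex_bij_betw[OF cofs_bij, of \<tau> F] by simp

lemma wsum_kap:
  assumes "\<tau> \<in> \<Sigma>"
  shows "wsum w \<tau> - (\<Sum>\<rho>\<in>link \<tau>. (of_int (w (join \<tau> \<rho>)) * kap (join \<tau> \<rho>) \<tau> \<rho>) *\<^sub>R e \<rho>) \<in> span \<tau>"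
proof -
  have "wsum w \<tau> - (\<Sum>\<rho>\<in>link \<tau>. (of_int (w (join \<tau> \<rho>)) * kap (join \<tau> \<rho>) \<tau> \<rho>) *\<^sub>R e \<rho>)
    = (\<Sum>\<rho>\<in>link \<tau>. of_int (w (join \<tau> \<rho>)) *\<^sub>R (nv (join \<tau> \<rho>) \<tau> - kap (join \<tau> \<rho>) \<tau> \<rho> *\<^sub>R e \<rho>))"
    by (simp add: wsum_def sum_cofs assms scaleR_diff_right sum_subtractf)
  also have "\<dots> \<in> span \<tau>"
    by (intro span_sum span_scale kap(2)) (use join[OF assms] assms in auto)
  finally show ?thesis .
qed

text \<open>Normal vectors may be replaced by multiples of primitive vectors, since the differences
  lie in \<open>span \<tau>\<close> and contribute equally to both terms. The order is thereby
  expressed by the values of f on primitive vectors, with \<open>kap\<close> carrying the lattice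
  indices.\<close>

lemma ordr_kap:
  assumes \<tau>: "\<tau> \<in> \<Sigma>"
  shows "ordr w \<tau> = - (\<Sum>\<rho>\<in>link \<tau>. of_int (w (join \<tau> \<rho>)) * kap (join \<tau> \<rho>) \<tau> \<rho> * f (e \<rho>))
    + fl \<tau> (\<Sum>\<rho>\<in>link \<tau>. (of_int (w (join \<tau> \<rho>)) * kap (join \<tau> \<rho>) \<tau> \<rho>) *\<^sub>R e \<rho>)"
proof -
  define s where "s \<rho> = nv (join \<tau> \<rho>) \<tau> - kap (join \<tau> \<rho>) \<tau> \<rho> *\<^sub>R e \<rho>" for \<rho>
  have s: "s \<rho> \<in> span \<tau>" if "\<rho> \<in> link \<tau>" for \<rho>
    unfolding s_def by (rule kap(2)) (use join[OF \<tau> that] \<tau> in auto)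
  have nv: "nv (join \<tau> \<rho>) \<tau> = kap (join \<tau> \<rho>) \<tau> \<rho> *\<^sub>R e \<rho> + s \<rho>" for \<rho> by (simp add: s_def)
  note lin\<tau> = fl_props(1)[OF \<tau>]
  have "fl (join \<tau> \<rho>) (nv (join \<tau> \<rho>) \<tau>) = kap (join \<tau> \<rho>) \<tau> \<rho> * f (e \<rho>) + fl \<tau> (s \<rho>)" if "\<rho> \<in> link \<tau>" for \<rho>
  proof -
    note j = join[OF \<tau> that]
    note lin = fl_props(1)[OF j(1)]
    have "e \<rho> \<in> join \<tau> \<rho>" by (rule e_gens_in) (use j(2) in simp)
    then show ?thesis using fl_face[OF \<tau> j(1,5) s[OF that]] fl_props(2)[OF j(1)]
      by (simp add: nv linear_add[OF lin] linear_scale[OF lin])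
  qed
  then have "(\<Sum>\<rho>\<in>link \<tau>. of_int (w (join \<tau> \<rho>)) * fl (join \<tau> \<rho>) (nv (join \<tau> \<rho>) \<tau>))
    = (\<Sum>\<rho>\<in>link \<tau>. of_int (w (join \<tau> \<rho>)) * kap (join \<tau> \<rho>) \<tau> \<rho> * f (e \<rho>)) + (\<Sum>\<rho>\<in>link \<tau>. of_int (w (join \<tau> \<rho>)) * fl \<tau> (s \<rho>))"
    by (simp add: distrib_left sum.distrib mult.assoc)
  moreover have "fl \<tau> (wsum w \<tau>) = fl \<tau> (\<Sum>\<rho>\<in>link \<tau>. (of_int (w (join \<tau> \<rho>)) * kap (join \<tau> \<rho>) \<tau> \<rho>) *\<^sub>R e \<rho>)
      + (\<Sum>\<rho>\<in>link \<tau>. of_int (w (join \<tau> \<rho>)) * fl \<tau> (s \<rho>))"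
    by (simp add: wsum_def sum_cofs \<tau> nv scaleR_add_right sum.distrib linear_add[OF lin\<tau>] linear_sum[OF lin\<tau>] linear_scale[OF lin\<tau>])
  ultimately show ?thesis by (simp add: ordr_def sum_cofs \<tau>)
qed

text \<open>Modulo \<open>span \<delta>\<close> the cones two dimensions above
  \<open>\<delta>\<close> are spanned by pairs of rays, which reduces the claim to
  \<open>symmetric_weight_divisor\<close>. The lattice indices have to be distributed so that the
  matrix becomes symmetric.\<close>

lemma ordr_balanced:
  assumes \<delta>: "\<delta> \<in> \<Sigma>" and bal: "\<And>\<tau>. \<tau> \<in> cofs \<delta> \<Longrightarrow> wsum w \<tau> \<in> span \<tau>"
  shows "(\<Sum>\<tau>\<in>cofs \<delta>. ordr w \<tau> *\<^sub>R nv \<tau> \<delta>) \<in> span \<delta>"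
proof -
  define R where "R = link \<delta>"
  define T where "T \<rho> = join \<delta> \<rho>" for \<rho>
  define K where "K \<rho> = kap (T \<rho>) \<delta> \<rho>" for \<rho>
  have T: "T \<rho> \<in> \<Sigma>" "gens (T \<rho>) = insert \<rho> (gens \<delta>)" "\<rho> \<notin> gens \<delta>" "\<rho> \<in> rays \<Sigma>" "\<delta> \<subseteq> T \<rho>" "dim (T \<rho>) = dim \<delta> + 1"
    "T \<rho> \<in> cofs \<delta>" if "\<rho> \<in> R" for \<rho>
    using join[OF \<delta>, of \<rho>] that by (auto simp: R_def T_def cofs_iff)
  \<comment> \<open>The weight of the cone over \<open>\<delta>\<close> with both rays, times the
    two indices along the flag that adds \<open>\<rho>\<close> first. By \<open>kap_commute\<close>
    the other flag gives the same product.\<close>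
  define W where "W \<rho> \<rho>' = (if \<rho>' \<in> link (T \<rho>) then of_int (w (join (T \<rho>) \<rho>')) * kap (join (T \<rho>) \<rho>') (T \<rho>) \<rho>' * K \<rho> else 0)"
    for \<rho> \<rho>'
  have linkT: "link (T \<rho>) = {\<rho>' \<in> rays \<Sigma>. \<rho>' \<noteq> \<rho> \<and> \<rho>' \<notin> gens \<delta> \<and> insert \<rho> (insert \<rho>' (gens \<delta>)) \<in> faces}" if "\<rho> \<in> R" for \<rho>
    using T(2)[OF that] by (auto simp: link_def insert_commute)
  have linkR: "\<rho>' \<in> R" if "\<rho> \<in> R" "\<rho>' \<in> link (T \<rho>)" for \<rho> \<rho>'
    using that linkT[OF that(1)] faces_subset[of "insert \<rho> (insert \<rho>' (gens \<delta>))" "insert \<rho>' (gens \<delta>)"] by (auto simp: R_def link_def)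
  have sym: "W \<rho> \<rho>' = W \<rho>' \<rho>" if "\<rho> \<in> R" "\<rho>' \<in> R" for \<rho> \<rho>'
  proof (cases "\<rho>' \<in> link (T \<rho>)")
    case False
    then have "\<rho> \<notin> link (T \<rho>')" using linkT that T by (auto simp: insert_commute)
    with False show ?thesis by (simp add: W_def)
  next
    case True
    then have True': "\<rho> \<in> link (T \<rho>')" using linkT that T by (auto simp: insert_commute)
    let ?\<sigma> = "join (T \<rho>) \<rho>'"
    have \<sigma>: "?\<sigma> = join (T \<rho>') \<rho>" using T(2) that by (simp add: insert_commute)
    have ne: "\<rho>' \<noteq> \<rho>" using True linkT[OF that(1)] by auto
    have "kap ?\<sigma> (T \<rho>') \<rho> * kap (T \<rho>') \<delta> \<rho>' = kap ?\<sigma> (T \<rho>) \<rho>' * kap (T \<rho>) \<delta> \<rho>"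
      by (rule kap_commute[OF \<delta>]) (use T that ne join(1,2)[OF T(1)[OF that(1)] True] in \<open>auto simp: insert_commute\<close>)
    then show ?thesis using True True' \<sigma> by (simp add: W_def K_def mult.assoc)
  qed
  have Wsum: "(\<Sum>\<rho>'\<in>R. W \<rho> \<rho>' *\<^sub>R F \<rho>') = K \<rho> *\<^sub>R (\<Sum>\<rho>'\<in>link (T \<rho>). (of_int (w (join (T \<rho>) \<rho>')) * kap (join (T \<rho>) \<rho>') (T \<rho>) \<rho>') *\<^sub>R F \<rho>')"
    if \<rho>: "\<rho> \<in> R" for \<rho> and F :: "'a set \<Rightarrow> 'v::real_vector"
  proof -
    have "(\<Sum>\<rho>'\<in>R. W \<rho> \<rho>' *\<^sub>R F \<rho>') = (\<Sum>\<rho>'\<in>link (T \<rho>). W \<rho> \<rho>' *\<^sub>R F \<rho>')"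
      by (rule sum.mono_neutral_right) (use linkR \<rho> in \<open>auto simp: R_def W_def\<close>)
    then show ?thesis by (simp add: W_def scaleR_right.sum mult.commute mult.left_commute)
  qed
  \<comment> \<open>Balancing around \<open>T \<rho>\<close> only puts the sum into the span of
    \<open>T \<rho>\<close>; \<open>A\<close> and \<open>t\<close> are components along
    \<open>e \<rho>\<close> and in \<open>span \<delta>\<close>.\<close>
  have "\<exists>A t. (\<Sum>\<rho>'\<in>R. W \<rho> \<rho>' *\<^sub>R e \<rho>') = A *\<^sub>R e \<rho> + t \<and> t \<in> span \<delta>" if \<rho>: "\<rho> \<in> R" for \<rho>
  proof -
    let ?s = "\<Sum>\<rho>'\<in>link (T \<rho>). (of_int (w (join (T \<rho>) \<rho>')) * kap (join (T \<rho>) \<rho>') (T \<rho>) \<rho>') *\<^sub>R e \<rho>'"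
    have "?s \<in> span (T \<rho>)"
      using span_diff[OF bal[OF T(7)[OF \<rho>]] wsum_kap[OF T(1)[OF \<rho>], of w]] by simp
    then have "K \<rho> *\<^sub>R ?s \<in> span (e ` insert \<rho> (gens \<delta>))"
      using span_gens[OF T(1)[OF \<rho>]] T(2)[OF \<rho>] by (auto intro: span_scale)
    then obtain A where "K \<rho> *\<^sub>R ?s - A *\<^sub>R e \<rho> \<in> span \<delta>"
      using span_gens[OF \<delta>] by (auto simp: span_insert)
    then show ?thesis unfolding Wsum[OF \<rho>] by (intro exI[of _ A] exI[of _ "K \<rho> *\<^sub>R ?s - A *\<^sub>R e \<rho>"]) simp
  qed
  then obtain A t where At: "\<And>\<rho>. \<rho> \<in> R \<Longrightarrow> (\<Sum>\<rho>'\<in>R. W \<rho> \<rho>' *\<^sub>R e \<rho>') = A \<rho> *\<^sub>R e \<rho> + t \<rho>" "\<And>\<rho>. \<rho> \<in> R \<Longrightarrow> t \<rho> \<in> span \<delta>"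
    by metis
  have D: "K \<rho> * ordr w (T \<rho>) = - (\<Sum>\<rho>'\<in>R. W \<rho> \<rho>' * f (e \<rho>')) + A \<rho> * f (e \<rho>) + fl \<delta> (t \<rho>)" if \<rho>: "\<rho> \<in> R" for \<rho>
  proof -
    note lin = fl_props(1)[OF T(1)[OF \<rho>]]
    have e\<rho>: "e \<rho> \<in> T \<rho>" by (rule e_gens_in) (use T(2)[OF \<rho>] in simp)
    have "K \<rho> * fl (T \<rho>) (\<Sum>\<rho>'\<in>link (T \<rho>). (of_int (w (join (T \<rho>) \<rho>')) * kap (join (T \<rho>) \<rho>') (T \<rho>) \<rho>') *\<^sub>R e \<rho>')
      = fl (T \<rho>) (A \<rho> *\<^sub>R e \<rho> + t \<rho>)"
      using arg_cong[OF At(1)[OF \<rho>, unfolded Wsum[OF \<rho>]], of "fl (T \<rho>)"] by (simp add: linear_scale[OF lin])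
    also have "\<dots> = A \<rho> * f (e \<rho>) + fl \<delta> (t \<rho>)"
      using fl_face[OF \<delta> T(1)[OF \<rho>] T(5)[OF \<rho>] At(2)[OF \<rho>]] fl_props(2)[OF T(1)[OF \<rho>] e\<rho>]
      by (simp add: linear_add[OF lin] linear_scale[OF lin])
    finally show ?thesis unfolding ordr_kap[OF T(1)[OF \<rho>]]
      using Wsum[OF \<rho>, of "\<lambda>\<rho>'. f (e \<rho>')"] by (simp add: right_diff_distrib)
  qed
  have "(\<Sum>\<rho>\<in>R. (K \<rho> * ordr w (T \<rho>)) *\<^sub>R e \<rho>) \<in> span \<delta>"
    by (rule symmetric_weight_divisor[OF subspace_span sym At fl_props(1)[OF \<delta>] D])
  \<comment> \<open>Returns from \<open>K \<rho>\<close> times the primitive vector to the lattice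
    normal vector, at the cost of an element of \<open>span \<delta>\<close>.\<close>
  moreover have "(\<Sum>\<rho>\<in>R. ordr w (T \<rho>) *\<^sub>R (nv (T \<rho>) \<delta> - K \<rho> *\<^sub>R e \<rho>)) \<in> span \<delta>"
    unfolding K_def by (intro span_sum span_scale kap(2)) (use \<delta> T in auto)
  ultimately have "(\<Sum>\<rho>\<in>R. (K \<rho> * ordr w (T \<rho>)) *\<^sub>R e \<rho>) + (\<Sum>\<rho>\<in>R. ordr w (T \<rho>) *\<^sub>R (nv (T \<rho>) \<delta> - K \<rho> *\<^sub>R e \<rho>)) \<in> span \<delta>"
    by (rule span_add)
  then show ?thesis
    by (simp add: sum_cofs \<delta> R_def T_def scaleR_diff_right sum_subtractf mult.commute)
qed

end

section \<open>Minkowski weights of the modification\<close>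

locale tropical_modif = meromorphic_fan N \<Sigma> f
  for N :: "'a::euclidean_space set" and \<Sigma> f +
  fixes d :: nat and \<omega> :: "'a set \<Rightarrow> int"
  assumes trop: "tropical_fan N \<Sigma> d \<omega>" and df: "div_faithful N \<Sigma> d \<omega>"
begin

abbreviation \<Delta> :: "'a set set" where "\<Delta> \<equiv> div_subfan N \<Sigma> d \<omega> f"
abbreviation gc :: "'a set \<Rightarrow> ('a \<times> real) set" where "gc \<equiv> graph_cone f"
abbreviation uc :: "'a set \<Rightarrow> ('a \<times> real) set" where "uc \<equiv> up_cone f"
abbreviation N' :: "('a \<times> real) set" where "N' \<equiv> N \<times> \<int>"
definition \<Sigma>' :: "('a \<times> real) set set" where "\<Sigma>' = gc ` \<Sigma> \<union> uc ` \<Delta>"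

lemma balanced_\<omega>: "balanced N \<Sigma> d \<omega>"
  using trop by (simp add: tropical_fan_def MW_def)

lemma \<Delta>_sub: "\<delta> \<in> \<Delta> \<Longrightarrow> \<delta> \<in> \<Sigma>"
  unfolding div_subfan_def using face_closed by blast

lemma \<Delta>_face: "\<delta> \<in> \<Delta> \<Longrightarrow> \<tau> \<in> \<Sigma> \<Longrightarrow> \<tau> \<subseteq> \<delta> \<Longrightarrow> \<tau> \<in> \<Delta>"
proof -
  assume \<delta>: "\<delta> \<in> \<Delta>" and \<tau>: "\<tau> \<in> \<Sigma>" "\<tau> \<subseteq> \<delta>"
  then obtain \<kappa> where \<kappa>: "\<kappa> \<in> \<Sigma>" "dim \<kappa> + 1 = d" "ord_at N \<Sigma> d \<omega> f \<kappa> \<noteq> 0" "cone_face \<delta> \<kappa>"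
    unfolding div_subfan_def by blast
  have "\<delta> \<subseteq> \<kappa>" using \<kappa>(4) face_of_imp_subset unfolding cone_face_def by blast
  then have "cone_face \<tau> \<kappa>" using subset_face[OF \<tau>(1) \<kappa>(1)] \<tau>(2) by blast
  then show "\<tau> \<in> \<Delta>" unfolding div_subfan_def using \<kappa> by blast
qed

lemma star_linear:
  assumes "\<sigma> \<in> \<Sigma>" "\<sigma> \<notin> \<Delta>"
  obtains L where "linear L" "\<And>\<eta> x. \<eta> \<in> \<Sigma> \<Longrightarrow> \<sigma> \<subseteq> \<eta> \<Longrightarrow> x \<in> \<eta> \<Longrightarrow> f x = L x"
proof -
  obtain L l where L: "L \<in> dual_lattice \<int> N" "linear l"
    "\<And>\<eta> x. \<eta> \<in> above \<sigma> \<Longrightarrow> x \<in> \<eta> \<Longrightarrow> f x = L x + l (quot_proj \<sigma> x)"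
    using div_faithful_star_linear[OF df balanced_\<omega> assms] by blast
  have "linear (\<lambda>x. L x + l (quot_proj \<sigma> x))"
    using linear_compose_add[of L "\<lambda>x. l (quot_proj \<sigma> x)"] L(1) linear_compose[OF linear_quot_proj L(2)]
    by (simp add: dual_lattice_def comp_def)
  then show ?thesis using that L(3) by blast
qed

text \<open>Being outside \<Delta> is a condition on orders with respect to \<omega>, but it makes f
  linear on the star of \<open>\<tau>\<close>, and this annihilates the order with respect to every
  balanced weight.\<close>

lemma ordr_outside:
  assumes "balanced N \<Sigma> p w" "\<tau> \<in> \<Sigma>" "dim \<tau> + 1 = p" "\<tau> \<notin> \<Delta>"
  shows "ordr w \<tau> = 0"
proof -
  obtain L where "linear L" "\<And>\<eta> x. \<eta> \<in> \<Sigma> \<Longrightarrow> \<tau> \<subseteq> \<eta> \<Longrightarrow> x \<in> \<eta> \<Longrightarrow> f x = L x"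
    using star_linear[OF assms(2,4)] by blast
  then show ?thesis using ordr_linear[OF assms(2)] assms(1,2,3) balanced_wsum by blast
qed

lemma f_zero: "f 0 = 0"
  using fl_props(1,2)[OF zero_cone(1)] linear_0 by fastforce

lemma gc_iff: "z \<in> gc \<sigma> \<longleftrightarrow> fst z \<in> \<sigma> \<and> snd z = f (fst z)"
  unfolding graph_cone_def by (cases z) auto

lemma uc_iff: "z \<in> uc \<sigma> \<longleftrightarrow> fst z \<in> \<sigma> \<and> f (fst z) \<le> snd z"
  unfolding up_cone_def
proof
  assume "z \<in> {y + t *\<^sub>R (0, 1) |y t. y \<in> gc \<sigma> \<and> 0 \<le> t}"
  then show "fst z \<in> \<sigma> \<and> f (fst z) \<le> snd z" by (auto simp: gc_iff)
next
  assume "fst z \<in> \<sigma> \<and> f (fst z) \<le> snd z"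
  then show "z \<in> {y + t *\<^sub>R (0, 1) |y t. y \<in> gc \<sigma> \<and> 0 \<le> t}"
    by (cases z) (auto simp: gc_iff intro!: exI[of _ "fst z"] exI[of _ "f (fst z)"] exI[of _ "snd z - f (fst z)"])
qed

lemma fst_gc [simp]: "fst ` gc \<sigma> = \<sigma>"
  by (simp add: graph_cone_def image_image)

lemma fst_uc [simp]: "fst ` uc \<sigma> = \<sigma>"
proof (intro equalityI subsetI)
  fix x assume "x \<in> \<sigma>"
  then show "x \<in> fst ` uc \<sigma>" by (intro image_eqI[of _ _ "(x, f x)"]) (auto simp: uc_iff)
qed (auto simp: uc_iff)

lemma gc_subset [simp]: "gc \<sigma> \<subseteq> gc \<tau> \<longleftrightarrow> \<sigma> \<subseteq> \<tau>"
  by (auto simp: gc_iff subset_iff)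

lemma uc_subset [simp]: "uc \<sigma> \<subseteq> uc \<tau> \<longleftrightarrow> \<sigma> \<subseteq> \<tau>"
  by (force simp: uc_iff subset_iff)

lemma gc_uc_subset [simp]: "gc \<sigma> \<subseteq> uc \<tau> \<longleftrightarrow> \<sigma> \<subseteq> \<tau>"
  by (force simp: uc_iff gc_iff subset_iff)

lemma uc_gc_not_subset: "\<delta> \<in> \<Sigma> \<Longrightarrow> \<not> uc \<delta> \<subseteq> gc \<sigma>"
proof
  assume "\<delta> \<in> \<Sigma>" "uc \<delta> \<subseteq> gc \<sigma>"
  moreover have "(0, 1) \<in> uc \<delta>" using zero_in[OF \<open>\<delta> \<in> \<Sigma>\<close>] by (simp add: uc_iff f_zero)
  ultimately show False by (auto simp: gc_iff f_zero dest: subsetD)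
qed

lemma gc_inj [simp]: "gc \<sigma> = gc \<tau> \<longleftrightarrow> \<sigma> = \<tau>"
  using fst_gc by metis

lemma uc_inj [simp]: "uc \<sigma> = uc \<tau> \<longleftrightarrow> \<sigma> = \<tau>"
  using fst_uc by metis

lemma gc_neq_uc: "\<delta> \<in> \<Delta> \<Longrightarrow> gc \<sigma> \<noteq> uc \<delta>"
  using uc_gc_not_subset \<Delta>_sub by blast

text \<open>Built from the linear part, so it is linear on the whole space, unlike the graph map of
  f. It transports spans, dimensions and lattices from \<open>\<sigma>\<close> to
  \<open>gc \<sigma>\<close>.\<close>

definition graph :: "'a set \<Rightarrow> 'a \<Rightarrow> 'a \<times> real" where "graph \<sigma> x = (x, fl \<sigma> x)"

lemma linear_graph: "\<sigma> \<in> \<Sigma> \<Longrightarrow> linear (graph \<sigma>)"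
  unfolding graph_def using fl_props(1)[of \<sigma>] by (intro linearI) (auto simp: linear_add linear_scale)

lemma inj_graph: "inj (graph \<sigma>)"
  by (auto simp: inj_def graph_def)

lemma gc_graph: "\<sigma> \<in> \<Sigma> \<Longrightarrow> gc \<sigma> = graph \<sigma> ` \<sigma>"
  using fl_props(2) by (force simp: graph_cone_def graph_def)

lemma span_gc: "\<sigma> \<in> \<Sigma> \<Longrightarrow> span (gc \<sigma>) = graph \<sigma> ` span \<sigma>"
  using linear_span_image[OF linear_graph] by (simp add: gc_graph)

lemma span_gc_iff: "\<sigma> \<in> \<Sigma> \<Longrightarrow> (x, y) \<in> span (gc \<sigma>) \<longleftrightarrow> x \<in> span \<sigma> \<and> y = fl \<sigma> x"
  by (auto simp: span_gc graph_def)

lemma dim_gc: "\<sigma> \<in> \<Sigma> \<Longrightarrow> dim (gc \<sigma>) = dim \<sigma>"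
  unfolding gc_graph using linear_graph inj_graph by (intro dim_image_eq) (auto intro: inj_on_subset)

lemma span_uc: "\<sigma> \<in> \<Sigma> \<Longrightarrow> span (uc \<sigma>) = span (insert (0, 1) (gc \<sigma>))"
proof
  assume \<sigma>: "\<sigma> \<in> \<Sigma>"
  show "span (uc \<sigma>) \<subseteq> span (insert (0, 1) (gc \<sigma>))"
  proof (rule span_minimal)
    show "uc \<sigma> \<subseteq> span (insert (0, 1) (gc \<sigma>))"
    proof
      fix z assume "z \<in> uc \<sigma>"
      then obtain y t where "z = y + t *\<^sub>R (0, 1)" "y \<in> gc \<sigma>" unfolding up_cone_def by blast
      then show "z \<in> span (insert (0, 1) (gc \<sigma>))"
        by (simp only:) (intro span_add span_scale span_base insertI1 insertI2)
    qed
  qed simp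
  have "(0, 1) \<in> uc \<sigma>" using zero_in[OF \<sigma>] by (simp add: uc_iff f_zero)
  then show "span (insert (0, 1) (gc \<sigma>)) \<subseteq> span (uc \<sigma>)"
    by (intro span_mono) (auto simp: gc_iff uc_iff)
qed

lemma span_uc_iff: "\<sigma> \<in> \<Sigma> \<Longrightarrow> (x, y) \<in> span (uc \<sigma>) \<longleftrightarrow> x \<in> span \<sigma>"
proof -
  assume \<sigma>: "\<sigma> \<in> \<Sigma>"
  have "(x, y) \<in> span (uc \<sigma>) \<longleftrightarrow> (\<exists>k. (x, y) - k *\<^sub>R (0, 1) \<in> span (gc \<sigma>))"
    by (simp add: span_uc[OF \<sigma>] span_insert)
  also have "\<dots> \<longleftrightarrow> x \<in> span \<sigma>" using span_gc_iff[OF \<sigma>] by (auto intro!: exI[of _ "y - fl \<sigma> x"])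
  finally show ?thesis .
qed

lemma dim_uc: "\<sigma> \<in> \<Sigma> \<Longrightarrow> dim (uc \<sigma>) = dim \<sigma> + 1"
proof -
  assume \<sigma>: "\<sigma> \<in> \<Sigma>"
  have "(0, 1) \<notin> span (gc \<sigma>)"
    using linear_0[OF fl_props(1)[OF \<sigma>]] by (simp add: span_gc_iff[OF \<sigma>])
  then have "dim (insert (0, 1) (gc \<sigma>)) = dim \<sigma> + 1" by (simp add: dim_insert dim_gc[OF \<sigma>])
  then show ?thesis using span_uc[OF \<sigma>] dim_span by metis
qed

lemma cones_\<Sigma>':
  "cones_of_dim \<Sigma>' p = gc ` cones_of_dim \<Sigma> p \<union> uc ` {\<delta>\<in>\<Delta>. dim \<delta> + 1 = p}"
  using dim_gc dim_uc \<Delta>_sub by (auto simp: cones_of_dim_def \<Sigma>'_def)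

lemma sublattice_gc: "\<sigma> \<in> \<Sigma> \<Longrightarrow> sublattice N' (gc \<sigma>) = graph \<sigma> ` sublattice N \<sigma>"
  using fl_props(3) by (fastforce simp: sublattice_def span_gc graph_def)

lemma sublattice_uc: "\<sigma> \<in> \<Sigma> \<Longrightarrow> sublattice N' (uc \<sigma>) = sublattice N \<sigma> \<times> \<int>"
  using span_uc_iff by (auto simp: sublattice_def)

lemma sublattice_uc_iff: "\<sigma> \<in> \<Sigma> \<Longrightarrow> (x, y) \<in> sublattice N' (uc \<sigma>) \<longleftrightarrow> x \<in> sublattice N \<sigma> \<and> y \<in> \<int>"
  by (simp add: sublattice_uc)

lemma zero_sublattice: "0 \<in> sublattice N \<sigma>"
  using lattice_closed(1)[OF lattice] by (simp add: sublattice_def span_zero)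

lemma span_sublattice_gc: "\<sigma> \<in> \<Sigma> \<Longrightarrow> gc \<sigma> \<subseteq> span (sublattice N' (gc \<sigma>))"
  using image_mono[OF span_sublattice[of \<sigma>], of "graph \<sigma>"] linear_span_image[OF linear_graph, of \<sigma> "sublattice N \<sigma>"]
    sublattice_gc[of \<sigma>] gc_graph[of \<sigma>] by simp

lemma span_sublattice_uc: "\<sigma> \<in> \<Sigma> \<Longrightarrow> uc \<sigma> \<subseteq> span (sublattice N' (uc \<sigma>))"
proof -
  assume \<sigma>: "\<sigma> \<in> \<Sigma>"
  have "sublattice N' (gc \<sigma>) \<subseteq> sublattice N' (uc \<sigma>)"
    using span_mono[of "gc \<sigma>" "uc \<sigma>"] gc_uc_subset[of \<sigma> \<sigma>] by (auto simp: sublattice_def simp del: gc_uc_subset)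
  then have "gc \<sigma> \<subseteq> span (sublattice N' (uc \<sigma>))" using span_sublattice_gc[OF \<sigma>] span_mono by blast
  moreover have "(0, 1) \<in> span (sublattice N' (uc \<sigma>))"
    by (intro span_base) (simp add: sublattice_uc_iff[OF \<sigma>] zero_sublattice)
  ultimately have "y + t *\<^sub>R (0, 1) \<in> span (sublattice N' (uc \<sigma>))" if "y \<in> gc \<sigma>" for y t
    using that by (intro span_add span_scale) auto
  then show ?thesis by (subst (1) up_cone_def) blast
qed

text \<open>\<open>graph \<sigma>\<close> is a linear isomorphism onto its image and restricts to
  \<open>graph \<tau>\<close> on \<open>span \<tau>\<close>; the witnessing form is the one below
  composed with the first projection.\<close>

lemma normal_gc_gc:
  assumes "\<tau> \<in> \<Sigma>" "\<sigma> \<in> \<Sigma>" "\<tau> \<subseteq> \<sigma>" "dim \<sigma> = dim \<tau> + 1"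
  shows "normal_vec N' (gc \<sigma>) (gc \<tau>) - (nv \<sigma> \<tau>, fl \<sigma> (nv \<sigma> \<tau>)) \<in> span (gc \<tau>)"
proof (rule normal_vec_eq(2)[OF _ span_sublattice_gc[OF assms(2)]])
  have n: "is_normal_vec N \<sigma> \<tau> (nv \<sigma> \<tau>)" using is_normal assms by simp
  obtain u where u: "\<And>x. x \<in> span \<tau> \<Longrightarrow> u \<bullet> x = 0" "\<And>x. x \<in> \<sigma> \<Longrightarrow> 0 \<le> u \<bullet> x" "0 < u \<bullet> nv \<sigma> \<tau>"
    using n unfolding is_normal_vec_def by blast
  have L: "{t + of_int k *\<^sub>R nv \<sigma> \<tau> | t (k::int). t \<in> sublattice N \<tau>} = sublattice N \<sigma>"
    using n unfolding is_normal_vec_def by blast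
  have \<tau>g: "sublattice N' (gc \<tau>) = graph \<sigma> ` sublattice N \<tau>"
    unfolding sublattice_gc[OF assms(1)]
    by (rule image_cong) (use fl_face[OF assms(1-3)] in \<open>auto simp: graph_def sublattice_def\<close>)
  have g: "(nv \<sigma> \<tau>, fl \<sigma> (nv \<sigma> \<tau>)) = graph \<sigma> (nv \<sigma> \<tau>)" by (simp add: graph_def)
  have "{t + of_int k *\<^sub>R graph \<sigma> (nv \<sigma> \<tau>) | t (k::int). t \<in> graph \<sigma> ` sublattice N \<tau>}
     = graph \<sigma> ` {t + of_int k *\<^sub>R nv \<sigma> \<tau> | t (k::int). t \<in> sublattice N \<tau>}" (is "?A = ?B")
  proof (intro equalityI subsetI)
    fix x assume "x \<in> ?A"
    then obtain t and k :: int where "t \<in> sublattice N \<tau>" "x = graph \<sigma> t + of_int k *\<^sub>R graph \<sigma> (nv \<sigma> \<tau>)" by blast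
    then show "x \<in> ?B" using linear_graph[OF assms(2)]
      by (intro image_eqI[of _ _ "t + of_int k *\<^sub>R nv \<sigma> \<tau>"]) (auto simp: linear_add linear_scale)
  next
    fix x assume "x \<in> ?B"
    then obtain t and k :: int where "t \<in> sublattice N \<tau>" "x = graph \<sigma> (t + of_int k *\<^sub>R nv \<sigma> \<tau>)" by blast
    then show "x \<in> ?A" using linear_graph[OF assms(2)]
      by (intro CollectI exI[of _ "graph \<sigma> t"] exI[of _ k]) (auto simp: linear_add linear_scale)
  qed
  then have "{t + of_int k *\<^sub>R graph \<sigma> (nv \<sigma> \<tau>) | t (k::int). t \<in> sublattice N' (gc \<tau>)} = sublattice N' (gc \<sigma>)"
    unfolding L \<tau>g sublattice_gc[OF assms(2)] .
  moreover have "graph \<sigma> (nv \<sigma> \<tau>) \<in> sublattice N' (gc \<sigma>)"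
    unfolding sublattice_gc[OF assms(2)] using n by (auto simp: is_normal_vec_def)
  moreover have "(u, 0) \<bullet> x = 0" if "x \<in> span (gc \<tau>)" for x
    using that u(1) by (auto simp: span_gc[OF assms(1)] graph_def)
  moreover have "\<forall>x\<in>gc \<sigma>. 0 \<le> (u, 0) \<bullet> x" using u(2) by (auto simp: gc_iff inner_Pair_0)
  moreover have "0 < (u, 0) \<bullet> graph \<sigma> (nv \<sigma> \<tau>)" using u(3) by (simp add: graph_def)
  ultimately show "is_normal_vec N' (gc \<sigma>) (gc \<tau>) (nv \<sigma> \<tau>, fl \<sigma> (nv \<sigma> \<tau>))"
    unfolding is_normal_vec_def g by blast
qed

text \<open>The form sending \<open>(x, y)\<close> to \<open>y - fl \<tau> x\<close> vanishes on the
  graph and is nonnegative above it. Integrality of \<open>fl \<tau>\<close> on lattice points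
  splits the lattice of \<open>uc \<tau>\<close> as graph plus vertical integers.\<close>

lemma normal_uc_gc:
  assumes "\<tau> \<in> \<Sigma>"
  shows "normal_vec N' (uc \<tau>) (gc \<tau>) - (0, 1) \<in> span (gc \<tau>)"
proof (rule normal_vec_eq(2)[OF _ span_sublattice_uc[OF assms]])
  define a where "a = adjoint (fl \<tau>) 1"
  have a: "a \<bullet> x = fl \<tau> x" for x
    using adjoint_works[OF fl_props(1)[OF assms], of x 1] by (simp add: a_def inner_commute)
  have "{t + of_int k *\<^sub>R (0, 1) | t (k::int). t \<in> sublattice N' (gc \<tau>)} = sublattice N' (uc \<tau>)" (is "?A = ?B")
  proof (intro equalityI subsetI)
    fix x assume "x \<in> ?A"
    then obtain t and k :: int where "t \<in> sublattice N \<tau>" "x = graph \<tau> t + of_int k *\<^sub>R (0, 1)"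
      unfolding sublattice_gc[OF assms] by blast
    moreover have "fl \<tau> t \<in> \<int>" using fl_props(3)[OF assms] calculation(1) by (simp add: sublattice_def)
    ultimately show "x \<in> ?B" by (simp add: sublattice_uc_iff[OF assms] graph_def)
  next
    fix x assume "x \<in> ?B"
    then obtain t y where t: "t \<in> sublattice N \<tau>" "y \<in> \<int>" "x = (t, y)" unfolding sublattice_uc[OF assms] by blast
    then have "y - fl \<tau> t \<in> \<int>" using fl_props(3)[OF assms] by (auto simp: sublattice_def)
    then obtain k where "y - fl \<tau> t = of_int k" by (rule Ints_cases)
    then show "x \<in> ?A" unfolding sublattice_gc[OF assms] using t
      by (intro CollectI exI[of _ "graph \<tau> t"] exI[of _ k]) (auto simp: graph_def algebra_simps)
  qed
  moreover have "(0, 1) \<in> sublattice N' (uc \<tau>)"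
    by (simp add: sublattice_uc_iff[OF assms] zero_sublattice)
  moreover have "\<forall>x\<in>span (gc \<tau>). (- a, 1) \<bullet> x = 0"
    by (auto simp: span_gc[OF assms] graph_def a)
  moreover have "\<forall>x\<in>uc \<tau>. 0 \<le> (- a, 1) \<bullet> x"
    using fl_props(2)[OF assms] by (auto simp: uc_iff inner_prod_def a)
  moreover have "0 < (- a, 1) \<bullet> (0 :: 'a, 1 :: real)" by simp
  ultimately show "is_normal_vec N' (uc \<tau>) (gc \<tau>) (0, 1)"
    unfolding is_normal_vec_def by blast
qed

text \<open>The vertical direction lies in the span of \<open>uc \<tau>\<close>, so the last
  coordinate of the normal vector may be taken to be 0.\<close>

lemma normal_uc_uc:
  assumes "\<tau> \<in> \<Sigma>" "\<sigma> \<in> \<Sigma>" "\<tau> \<subseteq> \<sigma>" "dim \<sigma> = dim \<tau> + 1"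
  shows "normal_vec N' (uc \<sigma>) (uc \<tau>) - (nv \<sigma> \<tau>, 0) \<in> span (uc \<tau>)"
proof (rule normal_vec_eq(2)[OF _ span_sublattice_uc[OF assms(2)]])
  have n: "is_normal_vec N \<sigma> \<tau> (nv \<sigma> \<tau>)" using is_normal assms by simp
  obtain u where u: "\<And>x. x \<in> span \<tau> \<Longrightarrow> u \<bullet> x = 0" "\<And>x. x \<in> \<sigma> \<Longrightarrow> 0 \<le> u \<bullet> x" "0 < u \<bullet> nv \<sigma> \<tau>"
    using n unfolding is_normal_vec_def by blast
  have L: "{t + of_int k *\<^sub>R nv \<sigma> \<tau> | t (k::int). t \<in> sublattice N \<tau>} = sublattice N \<sigma>"
    using n unfolding is_normal_vec_def by blast
  have "{t + of_int k *\<^sub>R (nv \<sigma> \<tau>, 0) | t (k::int). t \<in> sublattice N \<tau> \<times> \<int>} = 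
      {t + of_int k *\<^sub>R nv \<sigma> \<tau> | t (k::int). t \<in> sublattice N \<tau>} \<times> (\<int> :: real set)" (is "?A = ?B")
  proof (intro equalityI subsetI)
    fix x assume "x \<in> ?A"
    then obtain t y and k :: int where "t \<in> sublattice N \<tau>" "y \<in> \<int>" "x = (t, y) + of_int k *\<^sub>R (nv \<sigma> \<tau>, 0)" by blast
    then show "x \<in> ?B" by auto
  next
    fix x assume "x \<in> ?B"
    then obtain t y and k :: int where "t \<in> sublattice N \<tau>" "y \<in> \<int>" "x = (t + of_int k *\<^sub>R nv \<sigma> \<tau>, y)" by blast
    then show "x \<in> ?A" by (intro CollectI exI[of _ "(t, y)"] exI[of _ k]) auto
  qed
  then have "{t + of_int k *\<^sub>R (nv \<sigma> \<tau>, 0) | t (k::int). t \<in> sublattice N' (uc \<tau>)} = sublattice N' (uc \<sigma>)"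
    unfolding sublattice_uc[OF assms(1)] sublattice_uc[OF assms(2)] L .
  moreover have "(nv \<sigma> \<tau>, 0) \<in> sublattice N' (uc \<sigma>)"
    unfolding sublattice_uc[OF assms(2)] using n by (auto simp: is_normal_vec_def)
  moreover have "\<forall>x\<in>span (uc \<tau>). (u, 0) \<bullet> x = 0"
    using span_uc_iff[OF assms(1)] u(1) by auto
  moreover have "\<forall>x\<in>uc \<sigma>. 0 \<le> (u, 0) \<bullet> x" using u(2) by (auto simp: uc_iff)
  moreover have "0 < (u, 0) \<bullet> (nv \<sigma> \<tau>, 0 :: real)" using u(3) by simp
  ultimately show "is_normal_vec N' (uc \<sigma>) (uc \<tau>) (nv \<sigma> \<tau>, 0)"
    unfolding is_normal_vec_def by blast
qed

lemma span_sum_congruent: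
  assumes "\<And>i. i \<in> I \<Longrightarrow> x i - y i \<in> span S"
  shows "(\<Sum>i\<in>I. c i *\<^sub>R x i) \<in> span S \<longleftrightarrow> (\<Sum>i\<in>I. c i *\<^sub>R y i) \<in> span S"
proof -
  have "(\<Sum>i\<in>I. c i *\<^sub>R x i) - (\<Sum>i\<in>I. c i *\<^sub>R y i) = (\<Sum>i\<in>I. c i *\<^sub>R (x i - y i))"
    by (simp add: scaleR_diff_right sum_subtractf)
  also have "\<dots> \<in> span S" by (intro span_sum span_scale assms)
  finally have *: "(\<Sum>i\<in>I. c i *\<^sub>R x i) - (\<Sum>i\<in>I. c i *\<^sub>R y i) \<in> span S" .
  show ?thesis
    using span_diff[OF _ *, of "\<Sum>i\<in>I. c i *\<^sub>R x i"] span_add[OF _ *, of "\<Sum>i\<in>I. c i *\<^sub>R y i"] by auto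
qed

lemma filter_union_images: "{y. y \<in> F ` A \<union> G ` B \<and> P y} = F ` {x\<in>A. P (F x)} \<union> G ` {x\<in>B. P (G x)}"
  by blast

text \<open>The span of \<open>gc \<tau>\<close> is the graph of \<open>fl \<tau>\<close>.
  Membership of the weighted sum is therefore balancing in the first coordinate, plus an equation in
  the last one which says precisely that the weight of \<open>uc \<tau>\<close> is the
  order.\<close>

lemma balanced_at_gc:
  assumes \<tau>: "\<tau> \<in> \<Sigma>" "dim \<tau> + 1 = p"
  shows "(\<Sum>\<zeta> | \<zeta> \<in> cones_of_dim \<Sigma>' p \<and> gc \<tau> \<subseteq> \<zeta>. of_int (w \<zeta>) *\<^sub>R normal_vec N' \<zeta> (gc \<tau>)) \<in> span (gc \<tau>) \<longleftrightarrow>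
    wsum (\<lambda>\<sigma>. w (gc \<sigma>)) \<tau> \<in> span \<tau> \<and> ordr (\<lambda>\<sigma>. w (gc \<sigma>)) \<tau> = (if \<tau> \<in> \<Delta> then of_int (w (uc \<tau>)) else 0)"
proof -
  define U where "U = (if \<tau> \<in> \<Delta> then {\<tau>} else {})"
  have ind: "{\<zeta>. \<zeta> \<in> cones_of_dim \<Sigma>' p \<and> gc \<tau> \<subseteq> \<zeta>} = gc ` cofs \<tau> \<union> uc ` U"
  proof -
    have "\<delta> = \<tau>" if "\<delta> \<in> \<Delta>" "dim \<delta> + 1 = p" "\<tau> \<subseteq> \<delta>" for \<delta>
      using subset_dim_eq[OF \<tau>(1) \<Delta>_sub[OF that(1)] that(3)] that(2) \<tau>(2) by simp
    then have U: "{\<delta>\<in>{\<delta>\<in>\<Delta>. dim \<delta> + 1 = p}. \<tau> \<subseteq> \<delta>} = U" using \<tau>(2) by (auto simp: U_def)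
    have "{\<sigma>\<in>cones_of_dim \<Sigma> p. \<tau> \<subseteq> \<sigma>} = cofs \<tau>" using \<tau>(2) by (simp add: cofs_def)
    with U show ?thesis unfolding cones_\<Sigma>' filter_union_images by (simp only: gc_subset gc_uc_subset)
  qed
  \<comment> \<open>Explicit representatives of the normal vectors modulo the span of
    \<open>gc \<tau>\<close>, the vertical vector serving for the cone
    \<open>uc \<tau>\<close>.\<close>
  define v where "v \<zeta> = (if \<zeta> \<in> gc ` cofs \<tau> then (nv (fst ` \<zeta>) \<tau>, fl (fst ` \<zeta>) (nv (fst ` \<zeta>) \<tau>)) else (0, 1))" for \<zeta>
  have "(\<Sum>\<zeta> | \<zeta> \<in> cones_of_dim \<Sigma>' p \<and> gc \<tau> \<subseteq> \<zeta>. of_int (w \<zeta>) *\<^sub>R normal_vec N' \<zeta> (gc \<tau>)) \<in> span (gc \<tau>) \<longleftrightarrow>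
    (\<Sum>\<zeta>\<in>gc ` cofs \<tau> \<union> uc ` U. of_int (w \<zeta>) *\<^sub>R v \<zeta>) \<in> span (gc \<tau>)"
    unfolding ind
  proof (rule span_sum_congruent)
    fix \<zeta> assume "\<zeta> \<in> gc ` cofs \<tau> \<union> uc ` U"
    then show "normal_vec N' \<zeta> (gc \<tau>) - v \<zeta> \<in> span (gc \<tau>)"
    proof
      assume "\<zeta> \<in> gc ` cofs \<tau>"
      then show ?thesis using normal_gc_gc[OF \<tau>(1)] by (auto simp: v_def cofs_iff)
    next
      assume "\<zeta> \<in> uc ` U"
      then have "\<zeta> = uc \<tau>" "\<tau> \<in> \<Delta>" by (auto simp: U_def split: if_splits)
      then show ?thesis using normal_uc_gc[OF \<tau>(1)] gc_neq_uc[of \<tau>] by (auto simp: v_def)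
    qed
  qed
  also have "(\<Sum>\<zeta>\<in>gc ` cofs \<tau> \<union> uc ` U. of_int (w \<zeta>) *\<^sub>R v \<zeta>) =
     (\<Sum>\<zeta>\<in>gc ` cofs \<tau>. of_int (w \<zeta>) *\<^sub>R v \<zeta>) + (\<Sum>\<zeta>\<in>uc ` U. of_int (w \<zeta>) *\<^sub>R v \<zeta>)"
    by (rule sum.union_disjoint) (auto simp: U_def gc_neq_uc dest: gc_neq_uc[THEN not_sym])
  also have "(\<Sum>\<zeta>\<in>gc ` cofs \<tau>. of_int (w \<zeta>) *\<^sub>R v \<zeta>) = (\<Sum>\<sigma>\<in>cofs \<tau>. of_int (w (gc \<sigma>)) *\<^sub>R (nv \<sigma> \<tau>, fl \<sigma> (nv \<sigma> \<tau>)))"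
    by (subst sum.reindex) (auto simp: inj_on_def v_def intro!: sum.cong)
  also have "\<dots> = (wsum (\<lambda>\<sigma>. w (gc \<sigma>)) \<tau>, \<Sum>\<sigma>\<in>cofs \<tau>. of_int (w (gc \<sigma>)) * fl \<sigma> (nv \<sigma> \<tau>))"
    by (simp add: wsum_def sum_prod)
  also have "(\<Sum>\<zeta>\<in>uc ` U. of_int (w \<zeta>) *\<^sub>R v \<zeta>) = (0, if \<tau> \<in> \<Delta> then of_int (w (uc \<tau>)) else 0)"
  proof (cases "\<tau> \<in> \<Delta>")
    case True
    then have "uc ` U = {uc \<tau>}" "v (uc \<tau>) = (0, 1)" using gc_neq_uc[OF True] by (auto simp: U_def v_def)
    then show ?thesis using True by simp
  next
    case False
    then have "uc ` U = {}" by (simp add: U_def)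
    then show ?thesis using False by (simp add: zero_prod_def)
  qed
  finally show ?thesis by (auto simp: span_gc_iff[OF \<tau>(1)] ordr_def)
qed

text \<open>No graph cone contains an upper cone, so only upper cones contribute, and the last
  coordinate imposes no condition.\<close>

lemma balanced_at_uc:
  assumes \<delta>: "\<delta> \<in> \<Delta>" "dim \<delta> + 2 = p"
  shows "(\<Sum>\<zeta> | \<zeta> \<in> cones_of_dim \<Sigma>' p \<and> uc \<delta> \<subseteq> \<zeta>. of_int (w \<zeta>) *\<^sub>R normal_vec N' \<zeta> (uc \<delta>)) \<in> span (uc \<delta>) \<longleftrightarrow>
    (\<Sum>\<tau>\<in>cofs \<delta> \<inter> \<Delta>. of_int (w (uc \<tau>)) *\<^sub>R nv \<tau> \<delta>) \<in> span \<delta>"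
proof -
  note \<delta>\<Sigma> = \<Delta>_sub[OF \<delta>(1)]
  have ind: "{\<zeta>. \<zeta> \<in> cones_of_dim \<Sigma>' p \<and> uc \<delta> \<subseteq> \<zeta>} = uc ` (cofs \<delta> \<inter> \<Delta>)"
  proof -
    have "{\<tau>\<in>{\<tau>\<in>\<Delta>. dim \<tau> + 1 = p}. \<delta> \<subseteq> \<tau>} = cofs \<delta> \<inter> \<Delta>"
      using \<delta>(2) \<Delta>_sub by (auto simp: cofs_iff)
    then show ?thesis unfolding cones_\<Sigma>' filter_union_images using uc_gc_not_subset[OF \<delta>\<Sigma>]
      by (simp only: uc_subset simp_thms Collect_empty_eq image_empty Un_empty_left) auto
  qed
  have "(\<Sum>\<zeta> | \<zeta> \<in> cones_of_dim \<Sigma>' p \<and> uc \<delta> \<subseteq> \<zeta>. of_int (w \<zeta>) *\<^sub>R normal_vec N' \<zeta> (uc \<delta>)) \<in> span (uc \<delta>) \<longleftrightarrow>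
    (\<Sum>\<zeta>\<in>uc ` (cofs \<delta> \<inter> \<Delta>). of_int (w \<zeta>) *\<^sub>R (nv (fst ` \<zeta>) \<delta>, 0)) \<in> span (uc \<delta>)"
    unfolding ind by (rule span_sum_congruent) (use normal_uc_uc[OF \<delta>\<Sigma>] in \<open>auto simp: cofs_iff\<close>)
  also have "(\<Sum>\<zeta>\<in>uc ` (cofs \<delta> \<inter> \<Delta>). of_int (w \<zeta>) *\<^sub>R (nv (fst ` \<zeta>) \<delta>, 0)) =
      (\<Sum>\<tau>\<in>cofs \<delta> \<inter> \<Delta>. of_int (w (uc \<tau>)) *\<^sub>R nv \<tau> \<delta>, 0 :: real)"
    by (subst sum.reindex) (auto simp: inj_on_def sum_prod)
  finally show ?thesis by (simp add: span_uc_iff[OF \<delta>\<Sigma>])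
qed

lemma balanced_modification:
  "balanced N' \<Sigma>' p w \<longleftrightarrow>
    (\<forall>\<tau>\<in>\<Sigma>. dim \<tau> + 1 = p \<longrightarrow> wsum (\<lambda>\<sigma>. w (gc \<sigma>)) \<tau> \<in> span \<tau> \<and>
        ordr (\<lambda>\<sigma>. w (gc \<sigma>)) \<tau> = (if \<tau> \<in> \<Delta> then of_int (w (uc \<tau>)) else 0)) \<and>
    (\<forall>\<delta>\<in>\<Delta>. dim \<delta> + 2 = p \<longrightarrow> (\<Sum>\<tau>\<in>cofs \<delta> \<inter> \<Delta>. of_int (w (uc \<tau>)) *\<^sub>R nv \<tau> \<delta>) \<in> span \<delta>)"
  (is "?L \<longleftrightarrow> ?A \<and> ?B")
proof -
  let ?S = "\<lambda>\<tau>'. (\<Sum>\<zeta> | \<zeta> \<in> cones_of_dim \<Sigma>' p \<and> \<tau>' \<subseteq> \<zeta>. of_int (w \<zeta>) *\<^sub>R normal_vec N' \<zeta> \<tau>') \<in> span \<tau>'"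
  have "?L \<longleftrightarrow> (\<forall>\<tau>\<in>\<Sigma>. dim (gc \<tau>) + 1 = p \<longrightarrow> ?S (gc \<tau>)) \<and> (\<forall>\<delta>\<in>\<Delta>. dim (uc \<delta>) + 1 = p \<longrightarrow> ?S (uc \<delta>))"
    unfolding balanced_iff by (simp add: \<Sigma>'_def ball_Un)
  also have "(\<forall>\<tau>\<in>\<Sigma>. dim (gc \<tau>) + 1 = p \<longrightarrow> ?S (gc \<tau>)) \<longleftrightarrow> ?A"
    using dim_gc balanced_at_gc by (intro ball_cong refl imp_cong) simp_all
  also have "(\<forall>\<delta>\<in>\<Delta>. dim (uc \<delta>) + 1 = p \<longrightarrow> ?S (uc \<delta>)) \<longleftrightarrow> ?B"
  proof (intro ball_cong refl imp_cong)
    fix \<delta> assume \<delta>: "\<delta> \<in> \<Delta>"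
    show "dim (uc \<delta>) + 1 = p \<longleftrightarrow> dim \<delta> + 2 = p" using dim_uc[OF \<Delta>_sub[OF \<delta>]] by arith
    show "?S (uc \<delta>) \<longleftrightarrow> (\<Sum>\<tau>\<in>cofs \<delta> \<inter> \<Delta>. of_int (w (uc \<tau>)) *\<^sub>R nv \<tau> \<delta>) \<in> span \<delta>" if "dim \<delta> + 2 = p"
      using balanced_at_uc[OF \<delta> that] .
  qed
  finally show ?thesis .
qed

section \<open>Restriction and extension of weights\<close>

definition restrict_weight :: "nat \<Rightarrow> (('a \<times> real) set \<Rightarrow> int) \<Rightarrow> 'a set \<Rightarrow> int" where
  "restrict_weight p w \<sigma> = (if \<sigma> \<in> cones_of_dim \<Sigma> p then w (gc \<sigma>) else 0)"

definition extend_weight :: "nat \<Rightarrow> ('a set \<Rightarrow> int) \<Rightarrow> ('a \<times> real) set \<Rightarrow> int" where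
  "extend_weight p w \<zeta> = (if \<zeta> \<in> gc ` cones_of_dim \<Sigma> p then w (fst ` \<zeta>)
     else if \<zeta> \<in> uc ` {\<delta>\<in>\<Delta>. dim \<delta> + 1 = p} then \<lfloor>ordr w (fst ` \<zeta>)\<rfloor> else 0)"

lemma wsum_cong: "(\<And>\<sigma>. \<sigma> \<in> cofs \<tau> \<Longrightarrow> w \<sigma> = w' \<sigma>) \<Longrightarrow> wsum w \<tau> = wsum w' \<tau>"
  by (simp add: wsum_def)

lemma ordr_cong: "(\<And>\<sigma>. \<sigma> \<in> cofs \<tau> \<Longrightarrow> w \<sigma> = w' \<sigma>) \<Longrightarrow> ordr w \<tau> = ordr w' \<tau>"
  by (simp add: ordr_def wsum_def)

lemma restrict_weight_sums:
  assumes "dim \<tau> + 1 = p"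
  shows "wsum (restrict_weight p w) \<tau> = wsum (\<lambda>\<sigma>. w (gc \<sigma>)) \<tau>"
    "ordr (restrict_weight p w) \<tau> = ordr (\<lambda>\<sigma>. w (gc \<sigma>)) \<tau>"
  using assms by (auto intro!: wsum_cong ordr_cong simp: restrict_weight_def cofs_iff cones_of_dim_def)

lemma MW_carrier: "w \<in> carrier (MW N \<Sigma> p) \<longleftrightarrow> (\<forall>\<sigma>. \<sigma> \<notin> cones_of_dim \<Sigma> p \<longrightarrow> w \<sigma> = 0) \<and> balanced N \<Sigma> p w"
  and MW'_carrier: "w' \<in> carrier (MW N' \<Sigma>' p) \<longleftrightarrow> (\<forall>\<sigma>. \<sigma> \<notin> cones_of_dim \<Sigma>' p \<longrightarrow> w' \<sigma> = 0) \<and> balanced N' \<Sigma>' p w'"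
  by (simp_all add: MW_def)

lemma restrict_weight_carrier:
  "w \<in> carrier (MW N' \<Sigma>' p) \<Longrightarrow> restrict_weight p w \<in> carrier (MW N \<Sigma> p)"
  unfolding MW_carrier MW'_carrier balanced_modification balanced_wsum
  using restrict_weight_sums[of _ p w] by (auto simp: restrict_weight_def)

lemma extend_weight_carrier:
  assumes w: "w \<in> carrier (MW N \<Sigma> p)"
  shows "extend_weight p w \<in> carrier (MW N' \<Sigma>' p)"
  unfolding MW'_carrier balanced_modification
proof (intro conjI allI ballI impI)
  have bal: "balanced N \<Sigma> p w" using w unfolding MW_carrier by blast
  have zero: "extend_weight p w \<zeta> = 0" if "\<zeta> \<notin> cones_of_dim \<Sigma>' p" for \<zeta>
    using that unfolding cones_\<Sigma>' extend_weight_def by auto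
  then show "extend_weight p w \<zeta> = 0" if "\<zeta> \<notin> cones_of_dim \<Sigma>' p" for \<zeta> using that by blast
  have ext_gc: "extend_weight p w (gc \<sigma>) = w \<sigma>" if "\<sigma> \<in> cones_of_dim \<Sigma> p" for \<sigma>
    using that by (simp add: extend_weight_def)
  have ext_uc: "real_of_int (extend_weight p w (uc \<tau>)) = ordr w \<tau>" if "\<tau> \<in> \<Delta>" "dim \<tau> + 1 = p" for \<tau>
  proof -
    have "uc \<tau> \<notin> gc ` cones_of_dim \<Sigma> p" using gc_neq_uc[OF that(1)] by auto
    moreover have "wsum w \<tau> \<in> span \<tau>" using bal that \<Delta>_sub unfolding balanced_wsum by blast
    ultimately show ?thesis using that ordr_int[OF \<Delta>_sub[OF that(1)]]
      by (auto simp: extend_weight_def elim!: Ints_cases)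
  qed
  have sums: "wsum (\<lambda>\<sigma>. extend_weight p w (gc \<sigma>)) \<tau> = wsum w \<tau>" "ordr (\<lambda>\<sigma>. extend_weight p w (gc \<sigma>)) \<tau> = ordr w \<tau>"
    if "dim \<tau> + 1 = p" for \<tau>
    using that ext_gc by (auto intro!: wsum_cong ordr_cong simp: cofs_iff cones_of_dim_def)
  fix \<tau>
  {
    assume \<tau>: "\<tau> \<in> \<Sigma>" "dim \<tau> + 1 = p"
    show "wsum (\<lambda>\<sigma>. extend_weight p w (gc \<sigma>)) \<tau> \<in> span \<tau>"
      using bal \<tau> sums unfolding balanced_wsum by simp
    show "ordr (\<lambda>\<sigma>. extend_weight p w (gc \<sigma>)) \<tau> = (if \<tau> \<in> \<Delta> then of_int (extend_weight p w (uc \<tau>)) else 0)"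
      using ext_uc[of \<tau>] ordr_outside[OF bal \<tau>] \<tau> sums by auto
  }
  {
    assume \<tau>: "\<tau> \<in> \<Delta>" "dim \<tau> + 2 = p"
    have "(\<Sum>\<kappa>\<in>cofs \<tau> \<inter> \<Delta>. of_int (extend_weight p w (uc \<kappa>)) *\<^sub>R nv \<kappa> \<tau>) = (\<Sum>\<kappa>\<in>cofs \<tau> \<inter> \<Delta>. ordr w \<kappa> *\<^sub>R nv \<kappa> \<tau>)"
      using ext_uc \<tau> by (intro sum.cong) (auto simp: cofs_iff)
    \<comment> \<open>Orders vanish outside \<Delta>, so the sum may run over all cofacets, where
      \<open>ordr_balanced\<close> applies.\<close>
    also have "\<dots> = (\<Sum>\<kappa>\<in>cofs \<tau>. ordr w \<kappa> *\<^sub>R nv \<kappa> \<tau>)"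
      using ordr_outside[OF bal] \<tau> by (intro sum.mono_neutral_left) (auto simp: cofs_iff)
    also have "\<dots> \<in> span \<tau>"
      by (rule ordr_balanced[OF \<Delta>_sub[OF \<tau>(1)]]) (use bal \<tau> in \<open>auto simp: balanced_wsum cofs_iff\<close>)
    finally show "(\<Sum>\<kappa>\<in>cofs \<tau> \<inter> \<Delta>. of_int (extend_weight p w (uc \<kappa>)) *\<^sub>R nv \<kappa> \<tau>) \<in> span \<tau>" .
  }
qed

lemma restrict_extend: "w \<in> carrier (MW N \<Sigma> p) \<Longrightarrow> restrict_weight p (extend_weight p w) = w"
  unfolding MW_carrier by (auto simp: restrict_weight_def extend_weight_def)

lemma extend_restrict:
  assumes w: "w \<in> carrier (MW N' \<Sigma>' p)"
  shows "extend_weight p (restrict_weight p w) = w"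
proof
  fix \<zeta>
  have bal: "balanced N' \<Sigma>' p w" and zero: "\<zeta> \<notin> cones_of_dim \<Sigma>' p \<Longrightarrow> w \<zeta> = 0" using w unfolding MW'_carrier by blast+
  show "extend_weight p (restrict_weight p w) \<zeta> = w \<zeta>"
  proof (cases "\<zeta> \<in> cones_of_dim \<Sigma>' p")
    case False
    then show ?thesis using zero unfolding cones_\<Sigma>' by (auto simp: extend_weight_def)
  next
    case True
    then consider (g) \<sigma> where "\<sigma> \<in> cones_of_dim \<Sigma> p" "\<zeta> = gc \<sigma>" | (u) \<delta> where "\<delta> \<in> \<Delta>" "dim \<delta> + 1 = p" "\<zeta> = uc \<delta>"
      unfolding cones_\<Sigma>' by blast
    then show ?thesis
    proof cases
      case g
      then show ?thesis by (simp add: extend_weight_def restrict_weight_def)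
    next
      case u
      have "ordr (\<lambda>\<sigma>. w (gc \<sigma>)) \<delta> = of_int (w (uc \<delta>))"
        using bal u \<Delta>_sub unfolding balanced_modification by auto
      moreover have "uc \<delta> \<notin> gc ` cones_of_dim \<Sigma> p" using gc_neq_uc[OF u(1)] by auto
      ultimately show ?thesis using u by (auto simp: extend_weight_def restrict_weight_sums)
    qed
  qed
qed

lemma restrict_weight_iso: "restrict_weight p \<in> iso (MW N' \<Sigma>' p) (MW N \<Sigma> p)"
  unfolding Group.iso_def
proof (intro CollectI conjI)
  show "restrict_weight p \<in> hom (MW N' \<Sigma>' p) (MW N \<Sigma> p)"
    by (rule homI) (use restrict_weight_carrier in \<open>auto simp: MW_def restrict_weight_def\<close>)
  show "bij_betw (restrict_weight p) (carrier (MW N' \<Sigma>' p)) (carrier (MW N \<Sigma> p))"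
    by (rule bij_betw_byWitness[where f' = "extend_weight p"])
      (use restrict_extend extend_restrict restrict_weight_carrier extend_weight_carrier in auto)
qed

abbreviation \<omega>' :: "('a \<times> real) set \<Rightarrow> int" where "\<omega>' \<equiv> snd (tropical_modification N \<Sigma> d \<omega> f)"

lemma \<omega>'_gc: "\<sigma> \<in> cones_of_dim \<Sigma> d \<Longrightarrow> \<omega>' (gc \<sigma>) = \<omega> \<sigma>"
  by (simp add: tropical_modification_def Let_def)

lemma \<omega>'_uc: "\<delta> \<in> \<Delta> \<Longrightarrow> dim \<delta> + 1 = d \<Longrightarrow> of_int (\<omega>' (uc \<delta>)) = ordr \<omega> \<delta>"
proof -
  assume \<delta>: "\<delta> \<in> \<Delta>" "dim \<delta> + 1 = d"
  have "uc \<delta> \<notin> gc ` cones_of_dim \<Sigma> d" using gc_neq_uc[OF \<delta>(1)] by auto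
  moreover have "ordr \<omega> \<delta> \<in> \<int>"
    using ordr_int balanced_\<omega> \<delta> \<Delta>_sub unfolding balanced_wsum by blast
  ultimately show ?thesis using \<delta>
    by (auto simp: tropical_modification_def Let_def ord_at_eq elim!: Ints_cases)
qed

lemma restrict_\<omega>': "restrict_weight d \<omega>' = \<omega>"
proof
  fix \<sigma>
  have "\<omega> \<sigma> = 0" if "\<sigma> \<notin> cones_of_dim \<Sigma> d" using trop that by (simp add: tropical_fan_def MW_def)
  then show "restrict_weight d \<omega>' \<sigma> = \<omega> \<sigma>" using \<omega>'_gc by (simp add: restrict_weight_def)
qed

end

section \<open>Chow rings of a fan and of its modification\<close>

lemma chow_gens_polys: "chow_gens_I \<Sigma> \<union> chow_gens_J N \<Sigma> \<subseteq> polys (rays \<Sigma>)"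
  by (auto simp: chow_gens_I_def chow_gens_J_def intro!: polys_prod polys_sum polys_mult polys_of_int polys_Xvar)

lemma chow_ideal: "ideal (chow_ideal N \<Sigma>) (poly_ring_on (rays \<Sigma>))"
  unfolding chow_ideal_def by (rule ring.genideal_ideal[OF cring.axioms(1)[OF poly_ring_cring] chow_gens_polys])

lemmas chow_ideal_closed = poly_ideal_closed[OF chow_ideal]

lemma chow_gens_ideal: "chow_gens_I \<Sigma> \<subseteq> chow_ideal N \<Sigma>" "chow_gens_J N \<Sigma> \<subseteq> chow_ideal N \<Sigma>"
  unfolding chow_ideal_def
  using ring.genideal_self[OF cring.axioms(1)[OF poly_ring_cring] chow_gens_polys[of \<Sigma> N]] by auto

lemma chow_ring_cring: "cring (chow_ring N \<Sigma>)"
  unfolding chow_ring_def by (rule ideal.quotient_is_cring[OF chow_ideal poly_ring_cring])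

lemma chow_carrier: "carrier (chow_ring N \<Sigma>) = chow_class N \<Sigma> ` polys (rays \<Sigma>)"
  by (simp add: chow_ring_def carrier_quot chow_class_def[abs_def])

lemma chow_class_hom: "chow_class N \<Sigma> \<in> ring_hom (poly_ring_on (rays \<Sigma>)) (chow_ring N \<Sigma>)"
  unfolding chow_class_def[abs_def] chow_ring_def by (rule ideal.rcos_ring_hom[OF chow_ideal])

lemma chow_class_ops:
  assumes "p \<in> polys (rays \<Sigma>)" "q \<in> polys (rays \<Sigma>)"
  shows "chow_class N \<Sigma> (p + q) = chow_class N \<Sigma> p \<oplus>\<^bsub>chow_ring N \<Sigma>\<^esub> chow_class N \<Sigma> q"
    "chow_class N \<Sigma> (p * q) = chow_class N \<Sigma> p \<otimes>\<^bsub>chow_ring N \<Sigma>\<^esub> chow_class N \<Sigma> q"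
  using ring_hom_add[OF chow_class_hom assms] ring_hom_mult[OF chow_class_hom assms] by auto

lemma chow_class_eq_iff:
  assumes "p \<in> polys (rays \<Sigma>)" "q \<in> polys (rays \<Sigma>)"
  shows "chow_class N \<Sigma> p = chow_class N \<Sigma> q \<longleftrightarrow> p - q \<in> chow_ideal N \<Sigma>"
  unfolding chow_class_def
  using ring.quotient_eq_iff_same_a_r_cos[OF cring.axioms(1)[OF poly_ring_cring] chow_ideal assms] poly_ring_minus[OF assms]
  by simp

lemma chow_class_0: "chow_class N \<Sigma> 0 = \<zero>\<^bsub>chow_ring N \<Sigma>\<^esub>"
  using ring_hom_zero[OF chow_class_hom cring.axioms(1)[OF poly_ring_cring] cring.axioms(1)[OF chow_ring_cring]] by simp

lemma chow_class_zero_iff: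
  "p \<in> polys (rays \<Sigma>) \<Longrightarrow> chow_class N \<Sigma> p = \<zero>\<^bsub>chow_ring N \<Sigma>\<^esub> \<longleftrightarrow> p \<in> chow_ideal N \<Sigma>"
  using chow_class_eq_iff[OF _ polys_0, of p \<Sigma> N] by (simp add: chow_class_0)

lemma polys_of_nat: "of_nat n \<in> polys V"
  using polys_of_int[of "int n" V] by simp

lemma chow_class_of_nat:
  assumes "p \<in> polys (rays \<Sigma>)"
  shows "chow_class N \<Sigma> (of_nat n * p) = [n] \<cdot>\<^bsub>chow_ring N \<Sigma>\<^esub> chow_class N \<Sigma> p"
proof -
  interpret cring "chow_ring N \<Sigma>" by (rule chow_ring_cring)
  show ?thesis
  proof (induction n)
    case 0
    show ?case by (simp add: chow_class_0)
  next
    case (Suc n)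
    have "chow_class N \<Sigma> (of_nat (Suc n) * p) = chow_class N \<Sigma> (of_nat n * p + p)" by (simp add: algebra_simps)
    also have "\<dots> = [Suc n] \<cdot>\<^bsub>chow_ring N \<Sigma>\<^esub> chow_class N \<Sigma> p"
      using assms Suc by (simp add: chow_class_ops polys_mult polys_of_nat chow_carrier)
    finally show ?case .
  qed
qed

lemma ev_congruent:
  assumes K: "ideal K (poly_ring_on W)" and q: "q \<in> polys V"
    and \<theta>: "\<And>v. v \<in> V \<Longrightarrow> \<theta> v \<in> polys W" "\<And>v. v \<in> V \<Longrightarrow> \<theta>' v \<in> polys W" "\<And>v. v \<in> V \<Longrightarrow> \<theta> v - \<theta>' v \<in> K"
  shows "ev \<theta> q - ev \<theta>' q \<in> K"
proof -
  note cl = poly_ideal_closed[OF K]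
  define E where "E a b \<longleftrightarrow> a \<in> polys W \<and> b \<in> polys W \<and> a - b \<in> K" for a b
  have E_refl: "E a a" if "a \<in> polys W" for a using that cl(1) by (simp add: E_def)
  have E_add: "E (a + b) (a' + b')" if "E a a'" "E b b'" for a a' b b'
    using that cl(2)[of "a - a'" "b - b'"] by (simp add: E_def polys_add algebra_simps)
  have E_mult: "E (a * b) (a' * b')" if "E a a'" "E b b'" for a a' b b'
  proof -
    have "a * (b - b') + b' * (a - a') \<in> K" using that cl(2,4) by (simp add: E_def)
    then show ?thesis using that by (simp add: E_def polys_mult algebra_simps)
  qed
  have E_power: "E (a ^ n) (a' ^ n)" if "E a a'" for a a' n
    by (induction n) (use that E_mult E_refl[OF polys_1] in auto)
  have E_prod: "E (\<Prod>v\<in>A. F v) (\<Prod>v\<in>A. F' v)" if "\<And>v. v \<in> A \<Longrightarrow> E (F v) (F' v)" for A :: "'v set" and F F'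
    using that by (induction A rule: infinite_finite_induct) (use E_mult E_refl[OF polys_1] in auto)
  have E_sum: "E (\<Sum>v\<in>A. F v) (\<Sum>v\<in>A. F' v)" if "\<And>v. v \<in> A \<Longrightarrow> E (F v) (F' v)" for A :: "'u set" and F F'
    using that by (induction A rule: infinite_finite_induct) (use E_add E_refl[OF polys_0] in auto)
  have "E (ev \<theta> q) (ev \<theta>' q)"
    unfolding ev_def ev_mono_def
  proof (intro E_sum E_mult E_prod E_power E_refl polys_of_int)
    fix m v assume "m \<in> Poly_Mapping.keys q" "v \<in> Poly_Mapping.keys m"
    then have "v \<in> V" using q by (auto simp: polys_iff)
    then show "E (\<theta> v) (\<theta>' v)" using \<theta> by (simp add: E_def)
  qed
  then show ?thesis by (simp add: E_def)
qed

lemma poly_ideal_sum: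
  assumes K: "ideal K (poly_ring_on V)" and F: "\<And>i. i \<in> I \<Longrightarrow> F i \<in> K"
  shows "sum F I \<in> K"
  using F by (induction I rule: infinite_finite_induct) (auto intro: poly_ideal_closed[OF K])

text \<open>The preimage of the torsion of the Chow ring. As an ideal it can replace the Chow ideal
  as the target of relations, so that rational and integral statements share one argument.\<close>

definition torsion_ideal :: "'a::euclidean_space set \<Rightarrow> 'a set set \<Rightarrow> 'a set int_mpoly set" where
  "torsion_ideal N \<Sigma> = {p \<in> polys (rays \<Sigma>). \<exists>n>0. of_nat n * p \<in> chow_ideal N \<Sigma>}"

lemma torsion_ideal: "ideal (torsion_ideal N \<Sigma>) (poly_ring_on (rays \<Sigma>))"
proof (rule poly_idealI)
  show "0 \<in> torsion_ideal N \<Sigma>" using chow_ideal_closed(1) by (auto simp: torsion_ideal_def polys_0)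
  fix p assume p: "p \<in> torsion_ideal N \<Sigma>"
  then obtain n where n: "n > 0" "of_nat n * p \<in> chow_ideal N \<Sigma>" by (auto simp: torsion_ideal_def)
  show "p + q \<in> torsion_ideal N \<Sigma>" if q: "q \<in> torsion_ideal N \<Sigma>" for q
  proof -
    obtain k where k: "k > 0" "of_nat k * q \<in> chow_ideal N \<Sigma>" using q by (auto simp: torsion_ideal_def)
    have "of_nat k * (of_nat n * p) + of_nat n * (of_nat k * q) \<in> chow_ideal N \<Sigma>"
      by (intro chow_ideal_closed n k polys_of_nat)
    then have "of_nat (n * k) * (p + q) \<in> chow_ideal N \<Sigma>" by (simp add: algebra_simps)
    moreover have "n * k > 0" using n k by simp
    ultimately show ?thesis using p q by (auto simp: torsion_ideal_def intro!: polys_add exI[of _ "n * k"])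
  qed
  show "r * p \<in> torsion_ideal N \<Sigma>" if r: "r \<in> polys (rays \<Sigma>)" for r
  proof -
    have "r * (of_nat n * p) \<in> chow_ideal N \<Sigma>" by (intro chow_ideal_closed n r)
    then show ?thesis using p r n by (auto simp: torsion_ideal_def mult.left_commute intro!: polys_mult exI[of _ n])
  qed
qed (auto simp: torsion_ideal_def)

lemma chow_ideal_subset_torsion: "chow_ideal N \<Sigma> \<subseteq> torsion_ideal N \<Sigma>"
  using chow_ideal_closed(5) by (auto simp: torsion_ideal_def intro!: exI[of _ 1])

lemma torsion_ideal_torsion_free:
  assumes "torsion_free_ring (chow_ring N \<Sigma>)"
  shows "torsion_ideal N \<Sigma> = chow_ideal N \<Sigma>"
proof
  show "torsion_ideal N \<Sigma> \<subseteq> chow_ideal N \<Sigma>"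
  proof
    fix p assume "p \<in> torsion_ideal N \<Sigma>"
    then obtain n where p: "p \<in> polys (rays \<Sigma>)" "n > 0" "of_nat n * p \<in> chow_ideal N \<Sigma>" by (auto simp: torsion_ideal_def)
    have "[n] \<cdot>\<^bsub>chow_ring N \<Sigma>\<^esub> chow_class N \<Sigma> p = \<zero>\<^bsub>chow_ring N \<Sigma>\<^esub>"
      using p by (simp flip: chow_class_of_nat add: chow_class_zero_iff polys_mult polys_of_nat)
    then have "chow_class N \<Sigma> p = \<zero>\<^bsub>chow_ring N \<Sigma>\<^esub>"
      using assms p unfolding torsion_free_ring_def by (auto simp: chow_carrier)
    then show "p \<in> chow_ideal N \<Sigma>" using p chow_class_zero_iff by blast
  qed
qed (rule chow_ideal_subset_torsion)

section \<open>The substitutions between the two polynomial rings and the relations\<close>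

context tropical_modif
begin

lemma finite_dual_rays: "finite (\<Union>\<eta>\<in>above \<sigma>. e ` gens \<eta>)"
  by auto

lemma span_above:
  assumes "\<eta> \<in> above \<sigma>" "x \<in> span \<eta>" shows "x \<in> span (\<Union>\<eta>\<in>above \<sigma>. e ` gens \<eta>)"
  using assms span_gens[of \<eta>] span_mono[of "e ` gens \<eta>" "\<Union>\<eta>\<in>above \<sigma>. e ` gens \<eta>"] by blast

text \<open>The form representing f on the star is integral on the primitive vectors there, because
  f is. So its denominators on the span of the star are bounded and a multiple extends to an element
  of \<open>M\<close>.\<close>

lemma multiple_linear:
  assumes "\<sigma> \<in> \<Sigma>" "\<sigma> \<notin> \<Delta>"
  obtains n :: nat and M where "n > 0" "M \<in> dual_lattice \<int> N" "\<And>\<eta> x. \<eta> \<in> above \<sigma> \<Longrightarrow> x \<in> \<eta> \<Longrightarrow> M x = of_nat n * f x"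
proof -
  obtain L where L: "linear L" "\<And>\<eta> x. \<eta> \<in> \<Sigma> \<Longrightarrow> \<sigma> \<subseteq> \<eta> \<Longrightarrow> x \<in> \<eta> \<Longrightarrow> f x = L x"
    using star_linear[OF assms] by blast
  let ?A = "\<Union>\<eta>\<in>above \<sigma>. e ` gens \<eta>"
  have Lint: "L a \<in> \<int>" if a: "a \<in> ?A" for a
  proof -
    obtain \<eta> \<rho> where "\<eta> \<in> above \<sigma>" "\<rho> \<in> gens \<eta>" "a = e \<rho>" using a by blast
    then show ?thesis using f_int[of a \<eta>] L(2)[of \<eta> a] e_gens_in[of \<rho> \<eta>] gens_N by auto
  qed
  have AN: "?A \<subseteq> N" using gens_N by blast
  obtain n :: nat and M where M: "n > 0" "M \<in> dual_lattice \<int> N" "\<And>x. x \<in> span ?A \<Longrightarrow> M x = of_nat n * L x"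
    using dual_lattice_multiple[OF lattice finite_dual_rays AN L(1) Lint] by blast
  have "M x = of_nat n * f x" if "\<eta> \<in> above \<sigma>" "x \<in> \<eta>" for \<eta> x
    using M(3)[OF span_above[OF that(1) span_base[OF that(2)]]] L(2)[of \<eta> x] that by simp
  with M(1,2) show ?thesis using that by blast
qed

text \<open>Div-faithfulness yields a real linear form \<open>l\<close>, whereas saturation asks for
  one that is rational on the whole quotient lattice. An integral form \<open>M\<close> that equals
  a multiple of \<open>l\<close> on the span of the star provides the substitute
  \<open>l'\<close>.\<close>

lemma saturated_linear:
  assumes sat: "saturated_fan N \<Sigma>" and \<sigma>: "\<sigma> \<in> \<Sigma>" "\<sigma> \<notin> \<Delta>"
  obtains M where "M \<in> dual_lattice \<int> N" "\<And>\<eta> x. \<eta> \<in> above \<sigma> \<Longrightarrow> x \<in> \<eta> \<Longrightarrow> M x = f x"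
proof -
  let ?P = "quot_proj \<sigma>" and ?A = "\<Union>\<eta>\<in>above \<sigma>. e ` gens \<eta>"
  obtain L l where L: "L \<in> dual_lattice \<int> N" "linear l" "\<And>\<eta> x. \<eta> \<in> above \<sigma> \<Longrightarrow> x \<in> \<eta> \<Longrightarrow> f x = L x + l (?P x)"
    using div_faithful_star_linear[OF df balanced_\<omega> \<sigma>] by blast
  have linL: "linear L" using L(1) by (simp add: dual_lattice_def)
  have linlP: "linear (\<lambda>x. l (?P x))" using linear_compose[OF linear_quot_proj L(2)] by (simp add: comp_def)
  have lP: "l (?P x) = fl \<eta> x - L x" if "\<eta> \<in> above \<sigma>" "x \<in> span \<eta>" for \<eta> x
    by (rule linear_span_eq[OF linlP _ _ that(2)])
      (use that L(3) fl_props[of \<eta>] linear_compose_sub[OF _ linL, of "fl \<eta>"] in auto)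
  have lPint: "l (?P x) \<in> \<int>" if "\<eta> \<in> above \<sigma>" "x \<in> span \<eta>" "x \<in> N" for \<eta> x
    using lP[OF that(1,2)] fl_props(3)[of \<eta> x] that L(1) by (auto simp: dual_lattice_def)
  have lint: "l (?P a) \<in> \<int>" if a: "a \<in> ?A" for a
  proof -
    obtain \<eta> \<rho> where "\<eta> \<in> above \<sigma>" "\<rho> \<in> gens \<eta>" "a = e \<rho>" using a by blast
    then show ?thesis using lPint[of \<eta> a] e_gens_in[of \<rho> \<eta>] gens_N by (auto intro: span_base)
  qed
  have AN: "?A \<subseteq> N" using gens_N by blast
  obtain n :: nat and M where M: "n > 0" "M \<in> dual_lattice \<int> N" "\<And>x. x \<in> span ?A \<Longrightarrow> M x = of_nat n * l (?P x)"
    using dual_lattice_multiple[OF lattice finite_dual_rays AN linlP lint] by blast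
  have linM: "linear M" using M(2) by (simp add: dual_lattice_def)
  \<comment> \<open>Vanishing on \<open>\<sigma>\<close> makes \<open>M\<close> invariant under the
    projection, so that \<open>M\<close> evaluated on the quotient lattice is still
    integral.\<close>
  have "M x = 0" if "x \<in> \<sigma>" for x
  proof -
    have "?P x = 0" using that by (simp add: quot_proj_eq_0_iff span_base)
    then show ?thesis using M(3)[OF span_above[of \<sigma> \<sigma> x]] \<sigma> that linear_0[OF L(2)] by (simp add: span_base)
  qed
  then have MP: "M (?P x) = M x" for x by (rule linear_quot_proj_invariant[OF linM])
  define l' where "l' = (\<lambda>y. M y / of_nat n)"
  have l'P: "l' (?P x) = l (?P x)" if "\<eta> \<in> above \<sigma>" "x \<in> span \<eta>" for \<eta> x
    using M(3)[OF span_above[OF that]] MP[of x] M(1) by (simp add: l'_def)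
  have "linear l'" unfolding l'_def using linear_compose_scale_right[OF linM, of "1 / of_nat n"] by simp
  moreover have "l' y \<in> \<rat>" if "y \<in> quot_lattice N \<sigma>" for y
  proof -
    obtain x where x: "x \<in> N" "y = ?P x" using \<open>y \<in> _\<close> by (auto simp: quot_lattice_def)
    then have "M x \<in> \<int>" using M(2) by (simp add: dual_lattice_def)
    then have "M x \<in> \<rat>" by (auto elim: Ints_cases)
    then show ?thesis using x MP by (simp add: l'_def)
  qed
  ultimately have "l' \<in> dual_lattice \<rat> (quot_lattice N \<sigma>)" by (simp add: dual_lattice_def)
  moreover have "l' y \<in> \<int>" if y: "\<zeta> \<in> star_fan \<Sigma> \<sigma>" "y \<in> \<zeta> \<inter> quot_lattice N \<sigma>" for \<zeta> y
  proof -
    obtain \<eta> where \<eta>: "\<eta> \<in> above \<sigma>" "\<zeta> = qcone \<sigma> \<eta>" using y(1) by (auto simp: star_fan_eq)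
    obtain x where x: "x \<in> N" "y = ?P x" using y by (auto simp: quot_lattice_def)
    have "?P x \<in> span (qcone \<sigma> \<eta>)" using x y \<eta> by (auto intro: span_base)
    then have "x \<in> span \<eta>" using quot_proj_in_span_iff[of \<sigma> \<eta>] \<eta> by auto
    then show ?thesis using l'P[OF \<eta>(1)] lPint[OF \<eta>(1)] x by simp
  qed
  ultimately obtain m where m: "m \<in> dual_lattice \<int> (quot_lattice N \<sigma>)" "\<forall>x\<in>\<Union>(star_fan \<Sigma> \<sigma>). l' x = m x"
    using sat \<sigma>(1) unfolding saturated_fan_def by blast
  define M' where "M' = (\<lambda>x. L x + m (?P x))"
  have "linear M'" unfolding M'_def
    using linear_compose_add[OF linL, of "\<lambda>x. m (?P x)"] m(1) linear_compose[OF linear_quot_proj, of m]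
    by (simp add: dual_lattice_def comp_def)
  moreover have "M' x \<in> \<int>" if "x \<in> N" for x
    using that L(1) m(1) by (auto simp: M'_def dual_lattice_def quot_lattice_def)
  moreover have "M' x = f x" if "\<eta> \<in> above \<sigma>" "x \<in> \<eta>" for \<eta> x
  proof -
    have "?P x \<in> \<Union>(star_fan \<Sigma> \<sigma>)" using that by (auto simp: star_fan_eq)
    then have "l' (?P x) = m (?P x)" using m(2) by blast
    then have "m (?P x) = l (?P x)" using l'P[OF that(1) span_base[OF that(2)]] by simp
    then show ?thesis using L(3)[OF that] by (simp add: M'_def)
  qed
  ultimately show ?thesis using that[of M'] by (auto simp: dual_lattice_def)
qed

abbreviation A where "A \<equiv> chow_ring N \<Sigma>"
abbreviation A' where "A' \<equiv> chow_ring N' \<Sigma>'"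
abbreviation up :: "('a \<times> real) set" where "up \<equiv> uc {0}"

lemma up_neq_gc: "up \<noteq> gc \<sigma>" "gc \<sigma> \<noteq> up"
  using uc_gc_not_subset[OF zero_cone(1)] by blast+

lemma rays_\<Sigma>': "rays \<Sigma>' = gc ` rays \<Sigma> \<union> (if {0} \<in> \<Delta> then {up} else {})"
proof -
  have "{\<delta>\<in>\<Delta>. dim \<delta> + 1 = 1} = (if {0} \<in> \<Delta> then {{0}} else {})"
  proof -
    have "\<delta> = {0}" if "\<delta> \<in> \<Delta>" "dim \<delta> = 0" for \<delta>
      using that zero_in[OF \<Delta>_sub[OF that(1)]] dim_eq_0[of \<delta>] by auto
    then show ?thesis by auto
  qed
  then show ?thesis unfolding cones_\<Sigma>' by simp
qed

lemma finite_rays_\<Sigma>' [simp]: "finite (rays \<Sigma>')"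
  unfolding rays_\<Sigma>' by simp

lemma prim_gc:
  assumes "\<rho> \<in> rays \<Sigma>"
  shows "prim_vec N' (gc \<rho>) = (e \<rho>, f (e \<rho>))"
proof (rule prim_vec_eq)
  have \<rho>: "\<rho> \<in> \<Sigma>" using assms by (simp add: cones_of_dim_def)
  have fk: "f (of_nat k *\<^sub>R e \<rho>) = of_nat k * f (e \<rho>)" for k
  proof -
    have "of_nat k *\<^sub>R e \<rho> \<in> \<rho>" using e_in_ray[OF assms] convex_cone[OF \<rho>] by (auto intro: convex_cone_scaleR)
    then show ?thesis using fl_props(2)[OF \<rho>] linear_scale[OF fl_props(1)[OF \<rho>]] e_in_ray[OF assms] by (metis real_scaleR_def)
  qed
  show "(e \<rho>, f (e \<rho>)) \<noteq> 0" using ray_props(1)[OF assms] by (simp add: zero_prod_def)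
  show "N' \<inter> gc \<rho> = {of_nat k *\<^sub>R (e \<rho>, f (e \<rho>)) |k. True}"
  proof (intro equalityI subsetI)
    fix z assume "z \<in> N' \<inter> gc \<rho>"
    then have "fst z \<in> N \<inter> \<rho>" "snd z = f (fst z)" by (auto simp: gc_iff)
    then obtain k where "fst z = of_nat k *\<^sub>R e \<rho>" "snd z = f (fst z)" using ray_props(3)[OF assms] by auto
    then have "z = of_nat k *\<^sub>R (e \<rho>, f (e \<rho>))" using fk by (simp add: prod_eq_iff)
    then show "z \<in> {of_nat k *\<^sub>R (e \<rho>, f (e \<rho>)) |k. True}" by blast
  next
    fix z assume "z \<in> {of_nat k *\<^sub>R (e \<rho>, f (e \<rho>)) |k. True}"
    then obtain k where k: "z = of_nat k *\<^sub>R (e \<rho>, f (e \<rho>))" by blast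
    have "of_nat k *\<^sub>R e \<rho> \<in> N \<inter> \<rho>" unfolding ray_props(3)[OF assms] by blast
    moreover from this have "f (of_nat k *\<^sub>R e \<rho>) \<in> \<int>" using f_int[OF _ \<rho>] by blast
    ultimately show "z \<in> N' \<inter> gc \<rho>" using fk by (auto simp: k gc_iff)
  qed
qed

lemma prim_up: "prim_vec N' up = (0, 1)"
proof (rule prim_vec_eq)
  show "N' \<inter> up = {of_nat k *\<^sub>R (0, 1) |k. True}"
  proof (intro equalityI subsetI)
    fix z assume "z \<in> N' \<inter> up"
    then have z: "fst z = 0" "snd z \<ge> 0" "snd z \<in> \<int>" by (auto simp: uc_iff f_zero)
    then obtain k where "snd z = of_int k" by (auto elim: Ints_cases)
    then have "z = of_nat (nat k) *\<^sub>R (0, 1)" using z by (auto simp: prod_eq_iff)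
    then show "z \<in> {of_nat k *\<^sub>R (0, 1) |k. True}" by blast
  qed (use lattice_closed(1)[OF lattice] in \<open>auto simp: uc_iff f_zero\<close>)
qed (simp add: zero_prod_def)

definition lift_var :: "'a set \<Rightarrow> ('a \<times> real) set int_mpoly" where "lift_var \<rho> = Xvar (gc \<rho>)"

text \<open>A representative of \<open>[f]\<close>; the floor only converts the integral values of f
  on primitive vectors.\<close>

definition fdiv :: "'a set int_mpoly" where "fdiv = (\<Sum>\<rho>\<in>rays \<Sigma>. of_int \<lfloor>f (e \<rho>)\<rfloor> * Xvar \<rho>)"

text \<open>The value at \<open>up\<close> is forced: primitive vectors of graph rays have last
  coordinate \<open>f (e \<rho>)\<close> and that of \<open>up\<close> has 1, so the relation of the
  last coordinate reads \<open>[f]\<close> plus new ray equals zero.\<close>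

definition drop_var :: "('a \<times> real) set \<Rightarrow> 'a set int_mpoly" where
  "drop_var \<zeta> = (if \<zeta> = up then - fdiv else Xvar (fst ` \<zeta>))"

lemma drop_gc: "drop_var (gc \<rho>) = Xvar \<rho>"
  using up_neq_gc by (simp add: drop_var_def)

lemma drop_up: "drop_var up = - fdiv"
  by (simp add: drop_var_def)

lemma fdiv_polys: "fdiv \<in> polys (rays \<Sigma>)"
  unfolding fdiv_def by (intro polys_sum polys_mult polys_of_int polys_Xvar)

lemma lift_polys: "\<rho> \<in> rays \<Sigma> \<Longrightarrow> lift_var \<rho> \<in> polys (rays \<Sigma>')"
  by (auto simp: lift_var_def rays_\<Sigma>' intro!: polys_Xvar)

lemma drop_polys: "\<zeta> \<in> rays \<Sigma>' \<Longrightarrow> drop_var \<zeta> \<in> polys (rays \<Sigma>)"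
  by (auto simp: rays_\<Sigma>' drop_gc drop_up fdiv_polys polys_Xvar intro!: polys_uminus split: if_splits)

lemma ev_lift_polys: "p \<in> polys (rays \<Sigma>) \<Longrightarrow> ev lift_var p \<in> polys (rays \<Sigma>')"
  by (rule ev_polys[where V = "rays \<Sigma>"]) (simp_all add: lift_polys)

lemma ev_drop_polys: "q \<in> polys (rays \<Sigma>') \<Longrightarrow> ev drop_var q \<in> polys (rays \<Sigma>)"
  by (rule ev_polys[where V = "rays \<Sigma>'"]) (simp_all add: drop_polys)

lemma drop_lift: "p \<in> polys (rays \<Sigma>) \<Longrightarrow> ev drop_var (ev lift_var p) = p"
  by (simp add: ev_ev lift_var_def drop_gc ev_Xvar_id)

lemma f_ray_int: "\<rho> \<in> rays \<Sigma> \<Longrightarrow> of_int \<lfloor>f (e \<rho>)\<rfloor> = f (e \<rho>)"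
  using f_int[of "e \<rho>" \<rho>] ray_props(2) e_in_ray by (auto simp: cones_of_dim_def elim!: Ints_cases)

lemma sum_rays_\<Sigma>': "sum F (rays \<Sigma>') = (\<Sum>\<rho>\<in>rays \<Sigma>. F (gc \<rho>)) + (if {0} \<in> \<Delta> then F up else 0)"
proof -
  have "sum F (rays \<Sigma>') = sum F (gc ` rays \<Sigma>) + sum F (if {0} \<in> \<Delta> then {up} else {})"
    unfolding rays_\<Sigma>' by (rule sum.union_disjoint) (use up_neq_gc in auto)
  also have "sum F (gc ` rays \<Sigma>) = (\<Sum>\<rho>\<in>rays \<Sigma>. F (gc \<rho>))"
    by (subst sum.reindex) (auto simp: inj_on_def)
  finally show ?thesis by auto
qed

text \<open>An upper cone contains the same graph cones as the graph cone at its bottom; hence upper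
  cones create no new faces among the old rays.\<close>

lemma common_cone_gc:
  assumes "R \<subseteq> rays \<Sigma>"
  shows "(\<exists>\<zeta>\<in>\<Sigma>'. \<forall>\<xi>\<in>gc ` R. \<xi> \<subseteq> \<zeta>) \<longleftrightarrow> R \<in> faces"
proof
  assume "\<exists>\<zeta>\<in>\<Sigma>'. \<forall>\<xi>\<in>gc ` R. \<xi> \<subseteq> \<zeta>"
  then obtain \<zeta> where "\<zeta> \<in> \<Sigma>'" "\<forall>\<rho>\<in>R. gc \<rho> \<subseteq> \<zeta>" by blast
  then have "\<exists>\<sigma>\<in>\<Sigma>. \<forall>\<rho>\<in>R. gc \<rho> \<subseteq> gc \<sigma> \<or> gc \<rho> \<subseteq> uc \<sigma>" using \<Delta>_sub unfolding \<Sigma>'_def by blast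
  then have "\<exists>\<sigma>\<in>\<Sigma>. \<forall>\<rho>\<in>R. \<rho> \<subseteq> \<sigma>" by (simp only: gc_subset gc_uc_subset simp_thms)
  then show "R \<in> faces" using faces_iff[OF assms] by blast
next
  assume "R \<in> faces"
  then obtain \<sigma> where \<sigma>: "\<sigma> \<in> \<Sigma>" "\<forall>\<rho>\<in>R. \<rho> \<subseteq> \<sigma>" using faces_iff[OF assms] by blast
  show "\<exists>\<zeta>\<in>\<Sigma>'. \<forall>\<xi>\<in>gc ` R. \<xi> \<subseteq> \<zeta>"
  proof (rule bexI[of _ "gc \<sigma>"])
    show "\<forall>\<xi>\<in>gc ` R. \<xi> \<subseteq> gc \<sigma>" using \<sigma>(2) gc_subset by blast
  qed (use \<sigma>(1) in \<open>simp add: \<Sigma>'_def\<close>)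
qed

lemma nonface_ideal: "R \<subseteq> rays \<Sigma> \<Longrightarrow> R \<notin> faces \<Longrightarrow> (\<Prod>\<rho>\<in>R. Xvar \<rho>) \<in> chow_ideal N \<Sigma>"
  using faces_iff[of R] by (intro subsetD[OF chow_gens_ideal(1)]) (auto simp: chow_gens_I_def)

lemma linear_rel_ideal:
  "m \<in> dual_lattice \<int> N \<Longrightarrow> (\<Sum>\<rho>\<in>rays \<Sigma>. of_int \<lfloor>m (e \<rho>)\<rfloor> * Xvar \<rho>) \<in> chow_ideal N \<Sigma>"
  by (intro subsetD[OF chow_gens_ideal(2)]) (auto simp: chow_gens_J_def)

lemma lift_ideal:
  assumes "p \<in> chow_ideal N \<Sigma>"
  shows "ev lift_var p \<in> chow_ideal N' \<Sigma>'"
proof (rule ev_genideal[OF lift_polys chow_ideal chow_gens_polys _ assms[unfolded chow_ideal_def]])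
  fix p assume "p \<in> chow_gens_I \<Sigma> \<union> chow_gens_J N \<Sigma>"
  then show "ev lift_var p \<in> chow_ideal N' \<Sigma>'"
  proof
    assume "p \<in> chow_gens_I \<Sigma>"
    then obtain R where R: "R \<subseteq> rays \<Sigma>" "R \<notin> faces" "p = (\<Prod>\<rho>\<in>R. Xvar \<rho>)"
      using faces_iff unfolding chow_gens_I_def by blast
    have "ev lift_var p = (\<Prod>\<zeta>\<in>gc ` R. Xvar \<zeta>)"
      unfolding R(3) by (subst prod.reindex) (auto simp: inj_on_def ev_prod lift_var_def)
    also have "\<dots> \<in> chow_gens_I \<Sigma>'"
      using R common_cone_gc[OF R(1)] unfolding chow_gens_I_def rays_\<Sigma>' by blast
    finally show ?thesis using chow_gens_ideal(1) by blast
  next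
    assume "p \<in> chow_gens_J N \<Sigma>"
    then obtain m where m: "m \<in> dual_lattice \<int> N" "p = (\<Sum>\<rho>\<in>rays \<Sigma>. of_int \<lfloor>m (e \<rho>)\<rfloor> * Xvar \<rho>)"
      unfolding chow_gens_J_def by blast
    \<comment> \<open>Composed with the first projection, the form vanishes on the primitive vector
      of the new ray, so the lifted relation has no term there.\<close>
    define m' where "m' = (\<lambda>z :: 'a \<times> real. m (fst z))"
    have "linear m'" unfolding m'_def using m(1) linear_compose[OF linear_fst, of m] by (simp add: dual_lattice_def comp_def)
    then have m': "m' \<in> dual_lattice \<int> N'" using m(1) by (auto simp: dual_lattice_def m'_def)
    have m0: "m 0 = 0" using m(1) by (simp add: dual_lattice_def linear_0)
    have "ev lift_var p = (\<Sum>\<zeta>\<in>rays \<Sigma>'. of_int \<lfloor>m' (prim_vec N' \<zeta>)\<rfloor> * Xvar \<zeta>)"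
      unfolding sum_rays_\<Sigma>' by (simp add: m(2) ev_sum ev_mult prim_gc prim_up m'_def m0 lift_var_def)
    then show ?thesis using m' chow_gens_ideal(2)[of N' \<Sigma>'] unfolding chow_gens_J_def by blast
  qed
qed

text \<open>\<open>x\<^sub>\<sigma> \<cdot> [f]\<close> vanishes for \<open>\<sigma>\<close> outside the divisor, since \<open>f\<close> may be replaced by a linear form there.\<close>

lemma star_relation:
  assumes \<sigma>: "\<sigma> \<in> \<Sigma>" and M: "M \<in> dual_lattice \<int> N" "\<And>\<eta> x. \<eta> \<in> above \<sigma> \<Longrightarrow> x \<in> \<eta> \<Longrightarrow> M x = of_nat n * f x"
  shows "of_nat n * ((\<Prod>\<rho>\<in>gens \<sigma>. Xvar \<rho>) * fdiv) \<in> chow_ideal N \<Sigma>"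
proof -
  let ?x = "\<Prod>\<rho>\<in>gens \<sigma>. Xvar \<rho> :: 'a set int_mpoly"
  have xp: "?x \<in> polys (rays \<Sigma>)" using gens_rays by (intro polys_prod polys_Xvar) auto
  \<comment> \<open>Term by term: if \<open>\<rho>\<close> lies in the closed star of
    \<open>\<sigma>\<close>, the coefficient is zero; otherwise the product of
    \<open>x_\<sigma>\<close> with the variable of \<open>\<rho>\<close> is a multiple of a non-face
    relation.\<close>
  have "?x * (of_int (int n * \<lfloor>f (e \<rho>)\<rfloor> - \<lfloor>M (e \<rho>)\<rfloor>) * Xvar \<rho>) \<in> chow_ideal N \<Sigma>" if \<rho>: "\<rho> \<in> rays \<Sigma>" for \<rho>
  proof (cases "insert \<rho> (gens \<sigma>) \<in> faces")
    case True
    let ?\<eta> = "cone_of (insert \<rho> (gens \<sigma>))"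
    have "?\<eta> \<in> above \<sigma>" "e \<rho> \<in> ?\<eta>"
      using faces_props(1,2)[OF True] gens_subset_iff[OF \<sigma>, of ?\<eta>] e_gens_in[of \<rho> ?\<eta>] by auto
    then have "M (e \<rho>) = of_nat n * f (e \<rho>)" using M(2) by blast
    then have "M (e \<rho>) = of_int (int n * \<lfloor>f (e \<rho>)\<rfloor>)" unfolding of_int_mult f_ray_int[OF \<rho>] by simp
    then have "int n * \<lfloor>f (e \<rho>)\<rfloor> - \<lfloor>M (e \<rho>)\<rfloor> = 0" by (simp only: floor_of_int)
    then show ?thesis using chow_ideal_closed(1) by simp
  next
    case False
    then have "\<rho> \<notin> gens \<sigma>" using \<sigma> by (auto simp: insert_absorb faces_def)
    then have "?x * Xvar \<rho> \<in> chow_ideal N \<Sigma>"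
      using nonface_ideal[OF _ False] \<rho> gens_rays[of \<sigma>] by (simp add: mult.commute)
    from chow_ideal_closed(4)[OF this polys_of_int] show ?thesis by (subst mult.left_commute)
  qed
  then have "(\<Sum>\<rho>\<in>rays \<Sigma>. ?x * (of_int (int n * \<lfloor>f (e \<rho>)\<rfloor> - \<lfloor>M (e \<rho>)\<rfloor>) * Xvar \<rho>)) \<in> chow_ideal N \<Sigma>"
    by (intro poly_ideal_sum[OF chow_ideal])
  moreover have "?x * (\<Sum>\<rho>\<in>rays \<Sigma>. of_int \<lfloor>M (e \<rho>)\<rfloor> * Xvar \<rho>) \<in> chow_ideal N \<Sigma>"
    by (intro chow_ideal_closed(4) linear_rel_ideal M xp)
  ultimately have "(\<Sum>\<rho>\<in>rays \<Sigma>. ?x * (of_int (int n * \<lfloor>f (e \<rho>)\<rfloor> - \<lfloor>M (e \<rho>)\<rfloor>) * Xvar \<rho>))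
     + ?x * (\<Sum>\<rho>\<in>rays \<Sigma>. of_int \<lfloor>M (e \<rho>)\<rfloor> * Xvar \<rho>) \<in> chow_ideal N \<Sigma>"
    by (rule chow_ideal_closed(2))
  also have "(\<Sum>\<rho>\<in>rays \<Sigma>. ?x * (of_int (int n * \<lfloor>f (e \<rho>)\<rfloor> - \<lfloor>M (e \<rho>)\<rfloor>) * Xvar \<rho>))
     + ?x * (\<Sum>\<rho>\<in>rays \<Sigma>. of_int \<lfloor>M (e \<rho>)\<rfloor> * Xvar \<rho>) = of_nat n * (?x * fdiv)"
    by (simp add: fdiv_def sum_distrib_left algebra_simps sum_subtractf)
  finally show ?thesis .
qed

lemma star_relation_torsion:
  assumes "\<sigma> \<in> \<Sigma>" "\<sigma> \<notin> \<Delta>"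
  shows "(\<Prod>\<rho>\<in>gens \<sigma>. Xvar \<rho>) * fdiv \<in> torsion_ideal N \<Sigma>"
proof -
  obtain n :: nat and M where "n > 0" "M \<in> dual_lattice \<int> N" "\<And>\<eta> x. \<eta> \<in> above \<sigma> \<Longrightarrow> x \<in> \<eta> \<Longrightarrow> M x = of_nat n * f x"
    using multiple_linear[OF assms] by blast
  moreover have "(\<Prod>\<rho>\<in>gens \<sigma>. Xvar \<rho>) * fdiv \<in> polys (rays \<Sigma>)"
    using gens_rays by (intro polys_mult polys_prod polys_Xvar fdiv_polys) auto
  ultimately show ?thesis using star_relation[OF assms(1)] by (auto simp: torsion_ideal_def)
qed

text \<open>Non-faces without \<open>up\<close> are non-faces of \<Sigma>. A non-face with
  \<open>up\<close> is mapped to \<open>- fdiv\<close> times a monomial whose rays either span no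
  cone or span one outside \<Delta>, and there \<open>rel\<close> applies. The ideal
  \<open>K\<close> is left open to cover both coefficient rings.\<close>

lemma drop_ideal:
  assumes K: "ideal K (poly_ring_on (rays \<Sigma>))" "chow_ideal N \<Sigma> \<subseteq> K"
    and rel: "\<And>\<sigma>. \<sigma> \<in> \<Sigma> \<Longrightarrow> \<sigma> \<notin> \<Delta> \<Longrightarrow> (\<Prod>\<rho>\<in>gens \<sigma>. Xvar \<rho>) * fdiv \<in> K"
    and p: "p \<in> chow_ideal N' \<Sigma>'"
  shows "ev drop_var p \<in> K"
proof (rule ev_genideal[OF drop_polys K(1) chow_gens_polys _ p[unfolded chow_ideal_def]])
  note cl = poly_ideal_closed[OF K(1)]
  fix p assume "p \<in> chow_gens_I \<Sigma>' \<union> chow_gens_J N' \<Sigma>'"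
  then show "ev drop_var p \<in> K"
  proof
    assume "p \<in> chow_gens_I \<Sigma>'"
    then obtain R where R: "R \<subseteq> rays \<Sigma>'" "\<not> (\<exists>\<zeta>\<in>\<Sigma>'. \<forall>\<xi>\<in>R. \<xi> \<subseteq> \<zeta>)" "p = (\<Prod>\<zeta>\<in>R. Xvar \<zeta>)"
      unfolding chow_gens_I_def by blast
    define R0 where "R0 = {\<rho>\<in>rays \<Sigma>. gc \<rho> \<in> R}"
    have R0: "R0 \<subseteq> rays \<Sigma>" "finite R0" by (auto simp: R0_def)
    have RR0: "R - {up} = gc ` R0" using R(1) up_neq_gc unfolding rays_\<Sigma>' R0_def by (auto split: if_splits)
    have prodR0: "(\<Prod>\<zeta>\<in>gc ` R0. drop_var \<zeta>) = (\<Prod>\<rho>\<in>R0. Xvar \<rho>)"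
      by (subst prod.reindex) (auto simp: inj_on_def drop_gc)
    have finR: "finite R" using finite_subset[OF R(1) finite_rays_\<Sigma>'] .
    show ?thesis
    proof (cases "up \<in> R")
      case False
      then have "R = gc ` R0" using RR0 by auto
      then have "R0 \<notin> faces" using R(2) common_cone_gc[OF R0(1)] by (simp only: not_False_eq_True)
      then show ?thesis using nonface_ideal[OF R0(1)] K(2) \<open>R = gc ` R0\<close> prodR0 by (auto simp: R(3) ev_prod)
    next
      case True
      then have "up \<in> rays \<Sigma>'" using R(1) by blast
      then have up: "{0} \<in> \<Delta>" using up_neq_gc unfolding rays_\<Sigma>' by (auto split: if_splits)
      have "ev drop_var p = - fdiv * (\<Prod>\<rho>\<in>R0. Xvar \<rho>)"
        unfolding R(3) ev_prod ev_Xvar by (simp add: prod.remove[OF finR True] RR0 prodR0 drop_up)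
      moreover have "fdiv * (\<Prod>\<rho>\<in>R0. Xvar \<rho>) \<in> K"
      proof (cases "R0 \<in> faces")
        case False
        then show ?thesis using nonface_ideal[OF R0(1)] K(2) by (intro cl(4) fdiv_polys) auto
      next
        case True
        let ?\<sigma> = "cone_of R0"
        note F = faces_props[OF True]
        \<comment> \<open>Otherwise its upper cone would contain \<open>up\<close> and all graph
          rays in \<open>R\<close>, making \<open>R\<close> a face.\<close>
        have "?\<sigma> \<notin> \<Delta>"
        proof
          assume \<sigma>\<Delta>: "?\<sigma> \<in> \<Delta>"
          have "\<xi> \<subseteq> uc ?\<sigma>" if \<xi>: "\<xi> \<in> R" for \<xi>
          proof (cases "\<xi> = up")
            case True
            have "{0} \<subseteq> ?\<sigma>" using zero_in[OF F(1)] by simp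
            then show ?thesis using True uc_subset by blast
          next
            case False
            then have "\<xi> \<in> gc ` R0" using RR0 \<xi> by (metis DiffI singletonD)
            then obtain \<rho> where "\<rho> \<in> R0" "\<xi> = gc \<rho>" by blast
            then show ?thesis using F(2) by (auto simp only: gc_uc_subset gens_def)
          qed
          moreover have "uc ?\<sigma> \<in> \<Sigma>'" using \<sigma>\<Delta> by (simp add: \<Sigma>'_def)
          ultimately have "\<exists>\<zeta>\<in>\<Sigma>'. \<forall>\<xi>\<in>R. \<xi> \<subseteq> \<zeta>" by (intro bexI[of _ "uc ?\<sigma>"] ballI)
          then show False using R(2) by simp
        qed
        then show ?thesis using rel[OF F(1)] F(2) by (simp add: mult.commute)
      qed
      ultimately show ?thesis using cl(3)[OF cl(1)] by fastforce
    qed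
  next
    assume "p \<in> chow_gens_J N' \<Sigma>'"
    then obtain m where m: "m \<in> dual_lattice \<int> N'" "p = (\<Sum>\<zeta>\<in>rays \<Sigma>'. of_int \<lfloor>m (prim_vec N' \<zeta>)\<rfloor> * Xvar \<zeta>)"
      unfolding chow_gens_J_def by blast
    have lin: "linear m" using m(1) by (simp add: dual_lattice_def)
    define m0 where "m0 = (\<lambda>x. m (x, 0))"
    define c where "c = \<lfloor>m (0, 1)\<rfloor>"
    have mint: "m (x, y) \<in> \<int>" if "x \<in> N" "y \<in> \<int>" for x y using that m(1) by (auto simp: dual_lattice_def)
    have c: "m (0, 1) = of_int c"
      using mint[OF lattice_closed(1)[OF lattice], of 1] by (auto simp: c_def elim!: Ints_cases)
    have meq: "m (x, y) = m0 x + of_int c * y" for x y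
    proof -
      have "(x, y) = (x, 0) + y *\<^sub>R (0, 1)" by simp
      then have "m (x, y) = m (x, 0) + y * m (0, 1)" using linear_add[OF lin] linear_scale[OF lin] by (metis real_scaleR_def)
      then show ?thesis by (simp add: c m0_def mult.commute)
    qed
    have "linear m0" unfolding m0_def
      by (rule linearI) (use linear_add[OF lin, of "(_, 0)" "(_, 0)"] linear_scale[OF lin, of _ "(_, 0)"] in auto)
    then have m0: "m0 \<in> dual_lattice \<int> N" using mint by (auto simp: dual_lattice_def m0_def)
    have floor: "\<lfloor>m (prim_vec N' (gc \<rho>))\<rfloor> = \<lfloor>m0 (e \<rho>)\<rfloor> + c * \<lfloor>f (e \<rho>)\<rfloor>" if "\<rho> \<in> rays \<Sigma>" for \<rho>
    proof -
      have "m (prim_vec N' (gc \<rho>)) = m0 (e \<rho>) + of_int (c * \<lfloor>f (e \<rho>)\<rfloor>)"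
        unfolding of_int_mult f_ray_int[OF that] by (simp add: prim_gc[OF that] meq)
      then show ?thesis by (simp only: floor_add_int)
    qed
    have "ev drop_var p = (\<Sum>\<rho>\<in>rays \<Sigma>. of_int \<lfloor>m0 (e \<rho>)\<rfloor> * Xvar \<rho>) + (of_int c * fdiv - (if {0} \<in> \<Delta> then of_int c * fdiv else 0))"
      unfolding m(2) sum_rays_\<Sigma>'
      by (simp add: ev_add ev_sum ev_mult floor drop_gc drop_up prim_up c fdiv_def sum_distrib_left sum.distrib distrib_right mult.assoc)
    \<comment> \<open>The vertical part \<open>c\<close> of the form contributes \<open>c\<close>
      times \<open>fdiv\<close>. If \<open>up\<close> is a ray, its image cancels this; if it is
      not, \<open>{0}\<close> lies outside \<Delta> and \<open>rel\<close> for the empty monomial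
      puts \<open>fdiv\<close> itself into \<open>K\<close>.\<close>
    moreover have "fdiv \<in> K" if "{0} \<notin> \<Delta>" using rel[OF zero_cone(1) that] zero_cone(2) by simp
    then have "of_int c * fdiv - (if {0} \<in> \<Delta> then of_int c * fdiv else 0) \<in> K"
      using cl(1) cl(4)[OF _ polys_of_int] by auto
    ultimately show ?thesis using linear_rel_ideal[OF m0] K(2) cl(2) by auto
  qed
qed

text \<open>The round trip fixes the variables of graph rays and changes only that of
  \<open>up\<close>; congruence on variables passes to all polynomials by
  \<open>ev_congruent\<close>.\<close>

lemma lift_drop:
  assumes "q \<in> polys (rays \<Sigma>')"
  shows "q - ev lift_var (ev drop_var q) \<in> chow_ideal N' \<Sigma>'"
proof -
  have "ev Xvar q - ev (\<lambda>\<zeta>. ev lift_var (drop_var \<zeta>)) q \<in> chow_ideal N' \<Sigma>'"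
  proof (rule ev_congruent[OF chow_ideal assms])
    fix \<zeta> assume \<zeta>: "\<zeta> \<in> rays \<Sigma>'"
    show "Xvar \<zeta> \<in> polys (rays \<Sigma>')" using \<zeta> by (rule polys_Xvar)
    show "ev lift_var (drop_var \<zeta>) \<in> polys (rays \<Sigma>')" by (rule ev_lift_polys[OF drop_polys[OF \<zeta>]])
    show "Xvar \<zeta> - ev lift_var (drop_var \<zeta>) \<in> chow_ideal N' \<Sigma>'"
    proof (cases "\<zeta> = up")
      case False
      then obtain \<rho> where "\<zeta> = gc \<rho>" using \<zeta> unfolding rays_\<Sigma>' by (auto split: if_splits)
      then show ?thesis using chow_ideal_closed(1) by (simp add: drop_gc lift_var_def)
    next
      case True
      then have up: "{0} \<in> \<Delta>" using \<zeta> up_neq_gc unfolding rays_\<Sigma>' by (auto split: if_splits)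
      \<comment> \<open>The relation of the last coordinate is exactly the difference between the
        variable of \<open>up\<close> and its round trip.\<close>
      have "snd \<in> dual_lattice \<int> N'" by (auto simp: dual_lattice_def linear_snd)
      then have "(\<Sum>\<zeta>\<in>rays \<Sigma>'. of_int \<lfloor>snd (prim_vec N' \<zeta>)\<rfloor> * Xvar \<zeta>) \<in> chow_ideal N' \<Sigma>'"
        by (intro subsetD[OF chow_gens_ideal(2)]) (auto simp: chow_gens_J_def)
      also have "(\<Sum>\<zeta>\<in>rays \<Sigma>'. of_int \<lfloor>snd (prim_vec N' \<zeta>)\<rfloor> * Xvar \<zeta>) = Xvar \<zeta> - ev lift_var (drop_var \<zeta>)"
        unfolding sum_rays_\<Sigma>' using up True
        by (simp add: prim_gc prim_up drop_up fdiv_def ev_uminus ev_sum ev_mult lift_var_def)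
      finally show ?thesis .
    qed
  qed
  then show ?thesis by (simp add: ev_Xvar_id ev_ev)
qed

lemma homogeneous_drop: "homogeneous 1 (drop_var \<zeta>)"
proof -
  have "homogeneous 1 fdiv" unfolding fdiv_def
    by (intro homogeneous_sum) (use homogeneous_mult[OF homogeneous_of_int homogeneous_Xvar] in simp)
  then show ?thesis by (simp add: drop_var_def homogeneous_uminus homogeneous_Xvar)
qed

lemma chow_lift:
  obtains g where "g \<in> ring_hom A A'" "\<And>p. p \<in> polys (rays \<Sigma>) \<Longrightarrow> g (chow_class N \<Sigma> p) = chow_class N' \<Sigma>' (ev lift_var p)"
proof -
  let ?h = "\<lambda>p. chow_class N' \<Sigma>' (ev lift_var p)"
  have h: "?h \<in> ring_hom (poly_ring_on (rays \<Sigma>)) A'"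
    using ring_hom_trans[OF ev_ring_hom chow_class_hom, of "rays \<Sigma>" lift_var \<Sigma>' N'] lift_polys by (simp add: comp_def)
  have "?h p = \<zero>\<^bsub>A'\<^esub>" if "p \<in> chow_ideal N \<Sigma>" for p
    using lift_ideal[OF that] chow_class_zero_iff[OF ev_lift_polys[OF chow_ideal_closed(5)[OF that]]] by simp
  then obtain g where "g \<in> ring_hom A A'" "\<And>p. p \<in> polys (rays \<Sigma>) \<Longrightarrow> g (chow_class N \<Sigma> p) = ?h p"
    using quot_hom_lift[OF chow_ideal cring.axioms(1)[OF chow_ring_cring] h]
    unfolding chow_ring_def chow_class_def by metis
  then show ?thesis using that by blast
qed

context
  fixes g assumes g: "g \<in> ring_hom A A'"
    and g_class: "\<And>p. p \<in> polys (rays \<Sigma>) \<Longrightarrow> g (chow_class N \<Sigma> p) = chow_class N' \<Sigma>' (ev lift_var p)"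
begin

lemma lift_section:
  assumes "q \<in> polys (rays \<Sigma>')"
  shows "ev drop_var q \<in> polys (rays \<Sigma>)" "g (chow_class N \<Sigma> (ev drop_var q)) = chow_class N' \<Sigma>' q"
proof -
  show q: "ev drop_var q \<in> polys (rays \<Sigma>)" by (rule ev_drop_polys[OF assms])
  show "g (chow_class N \<Sigma> (ev drop_var q)) = chow_class N' \<Sigma>' q"
    unfolding g_class[OF q] using lift_drop[OF assms] chow_class_eq_iff[OF assms ev_lift_polys[OF q], of N'] by simp
qed

lemma lift_surj: "g ` carrier A = carrier A'"
proof
  show "g ` carrier A \<subseteq> carrier A'" using ring_hom_closed[OF g] by blast
  show "carrier A' \<subseteq> g ` carrier A"
    unfolding chow_carrier using lift_section by (auto intro!: image_eqI[OF _ imageI])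
qed

lemma lift_graded: "g ` chow_graded N \<Sigma> k = chow_graded N' \<Sigma>' k"
proof
  show "g ` chow_graded N \<Sigma> k \<subseteq> chow_graded N' \<Sigma>' k"
  proof
    fix y assume "y \<in> g ` chow_graded N \<Sigma> k"
    then obtain p where p: "p \<in> polys (rays \<Sigma>)" "homogeneous k p" "y = g (chow_class N \<Sigma> p)"
      by (auto simp: chow_graded_def)
    have "homogeneous k (ev lift_var p)"
      by (rule homogeneous_ev[OF p(1,2)]) (simp add: lift_var_def homogeneous_Xvar)
    then show "y \<in> chow_graded N' \<Sigma>' k"
      unfolding p(3) g_class[OF p(1)] chow_graded_def using ev_lift_polys[OF p(1)] by blast
  qed
  show "chow_graded N' \<Sigma>' k \<subseteq> g ` chow_graded N \<Sigma> k"
  proof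
    fix y assume "y \<in> chow_graded N' \<Sigma>' k"
    then obtain q where q: "q \<in> polys (rays \<Sigma>')" "homogeneous k q" "y = chow_class N' \<Sigma>' q"
      by (auto simp: chow_graded_def)
    have "homogeneous k (ev drop_var q)" by (rule homogeneous_ev[OF q(1,2) homogeneous_drop])
    then have "chow_class N \<Sigma> (ev drop_var q) \<in> chow_graded N \<Sigma> k"
      unfolding chow_graded_def using lift_section(1)[OF q(1)] by blast
    then show "y \<in> g ` chow_graded N \<Sigma> k" unfolding q(3) lift_section(2)[OF q(1), symmetric] by (rule imageI)
  qed
qed

text \<open>If the lift of \<open>p\<close> is a relation, dropping it lands in \<open>K\<close>;
  but dropping the lift gives back \<open>p\<close>.\<close>

lemma lift_kernel:
  assumes K: "ideal K (poly_ring_on (rays \<Sigma>))" "chow_ideal N \<Sigma> \<subseteq> K"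
    "\<And>\<sigma>. \<sigma> \<in> \<Sigma> \<Longrightarrow> \<sigma> \<notin> \<Delta> \<Longrightarrow> (\<Prod>\<rho>\<in>gens \<sigma>. Xvar \<rho>) * fdiv \<in> K"
    and p: "p \<in> polys (rays \<Sigma>)" "g (chow_class N \<Sigma> p) = \<zero>\<^bsub>A'\<^esub>"
  shows "p \<in> K"
proof -
  have "ev lift_var p \<in> chow_ideal N' \<Sigma>'"
    using p chow_class_zero_iff[OF ev_lift_polys[OF p(1)]] by (simp add: g_class)
  from drop_ideal[OF K this] show ?thesis by (simp add: drop_lift[OF p(1)])
qed

lemma lift_kernel_torsion:
  assumes "a \<in> carrier A" "g a = \<zero>\<^bsub>A'\<^esub>"
  shows "\<exists>n>0. [(n::nat)] \<cdot>\<^bsub>A\<^esub> a = \<zero>\<^bsub>A\<^esub>"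
proof -
  obtain p where p: "p \<in> polys (rays \<Sigma>)" "a = chow_class N \<Sigma> p" using assms(1) by (auto simp: chow_carrier)
  have "p \<in> torsion_ideal N \<Sigma>"
    by (rule lift_kernel[OF torsion_ideal chow_ideal_subset_torsion star_relation_torsion p(1)]) (use assms p in auto)
  then obtain n where "n > 0" "of_nat n * p \<in> chow_ideal N \<Sigma>" by (auto simp: torsion_ideal_def)
  then show ?thesis
    using p chow_class_zero_iff[of "of_nat n * p" \<Sigma> N] by (auto simp: chow_class_of_nat polys_mult polys_of_nat)
qed

lemma lift_iso:
  assumes "saturated_fan N \<Sigma> \<or> torsion_free_ring A"
  shows "g \<in> ring_iso A A'"
proof -
  have rel: "(\<Prod>\<rho>\<in>gens \<sigma>. Xvar \<rho>) * fdiv \<in> chow_ideal N \<Sigma>" if \<sigma>: "\<sigma> \<in> \<Sigma>" "\<sigma> \<notin> \<Delta>" for \<sigma>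
    using assms
  proof
    assume "saturated_fan N \<Sigma>"
    then obtain M where "M \<in> dual_lattice \<int> N" "\<And>\<eta> x. \<eta> \<in> above \<sigma> \<Longrightarrow> x \<in> \<eta> \<Longrightarrow> M x = f x"
      using saturated_linear \<sigma> by blast
    then show ?thesis using star_relation[OF \<sigma>(1), of M 1] by simp
  next
    assume "torsion_free_ring A"
    then show ?thesis using star_relation_torsion[OF \<sigma>] torsion_ideal_torsion_free by blast
  qed
  have "inj_on g (carrier A)"
  proof (rule inj_onI)
    fix a b assume "a \<in> carrier A" "b \<in> carrier A" and eq: "g a = g b"
    then obtain p q where pq: "p \<in> polys (rays \<Sigma>)" "a = chow_class N \<Sigma> p" "q \<in> polys (rays \<Sigma>)" "b = chow_class N \<Sigma> q"
      by (auto simp: chow_carrier)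
    have "ev lift_var p - ev lift_var q \<in> chow_ideal N' \<Sigma>'"
      using eq pq chow_class_eq_iff[OF ev_lift_polys[OF pq(1)] ev_lift_polys[OF pq(3)], of N'] by (simp add: g_class)
    then have "ev lift_var (p - q) \<in> chow_ideal N' \<Sigma>'" by (simp add: ev_diff)
    from drop_ideal[OF chow_ideal order_refl rel this] have "p - q \<in> chow_ideal N \<Sigma>"
      by (simp add: drop_lift polys_diff pq)
    then show "a = b" using pq chow_class_eq_iff by blast
  qed
  then show ?thesis using g lift_surj by (simp add: ring_iso_def bij_betw_def)
qed

end

end

section \<open>The degree map of a unimodular fan\<close>

locale unimodular_lattice_fan = simplicial_lattice_fan N \<Sigma>
  for N :: "'a::euclidean_space set" and \<Sigma> +
  assumes unimodular: "unimodular_fan N \<Sigma>"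
begin

text \<open>Unimodularity only supplies some basis \<open>B\<close> generating the cone. Each
  \<open>b\<close> is a nonnegative combination of primitive vectors, and these are nonnegative
  integral combinations of \<open>B\<close>; so a primitive vector occurring in \<open>b\<close> is
  an integral multiple of \<open>b\<close>, and primitivity makes them equal.\<close>

lemma sublattice_gens:
  assumes \<sigma>: "\<sigma> \<in> \<Sigma>"
  shows "sublattice N \<sigma> = int_span (e ` gens \<sigma>)"
proof
  have fin: "finite (e ` gens \<sigma>)" by simp
  have "e ` gens \<sigma> \<subseteq> sublattice N \<sigma>"
    using gens_N e_gens_in span_superset[of \<sigma>] by (auto simp: sublattice_def)
  obtain B where B: "independent B" "int_span B = sublattice N \<sigma>" "\<sigma> = convex_cone hull B"
    using unimodular \<sigma> unfolding unimodular_fan_def by blast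
  have finB: "finite B" using B(1) independent_imp_finite by blast
  show "int_span (e ` gens \<sigma>) \<subseteq> sublattice N \<sigma>"
    using int_span_minimal[of "e ` gens \<sigma>" B] B(2) \<open>e ` gens \<sigma> \<subseteq> sublattice N \<sigma>\<close> by simp
  obtain h where h: "\<And>b. linear (h b)" "\<And>b b'. b' \<in> B \<Longrightarrow> h b b' = (if b = b' then 1 else (0::real))"
    "\<And>x. x \<in> span B \<Longrightarrow> x = (\<Sum>b\<in>B. h b x *\<^sub>R b)"
    using dual_basis[OF B(1)] by blast
  have hsum: "h b (\<Sum>b'\<in>B. c b' *\<^sub>R b') = c b" if "b \<in> B" for b c
  proof -
    have "h b (\<Sum>b'\<in>B. c b' *\<^sub>R b') = (\<Sum>b'\<in>B. if b' = b then c b' else 0)"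
      unfolding linear_sum[OF h(1)] linear_scale[OF h(1)] by (rule sum.cong) (auto simp: h(2))
    then show ?thesis using that finB by (simp add: sum.delta)
  qed
  have "b \<in> e ` gens \<sigma>" if b: "b \<in> B" for b
  proof -
    have b0: "b \<noteq> 0" using b B(1) dependent_zero by blast
    have bN: "b \<in> N" using int_span_base[OF finB b] B(2) by (simp add: sublattice_def)
    have "b \<in> cone_of (gens \<sigma>)" using b B(3) gens_props(3)[OF \<sigma>] hull_inc[of b B convex_cone] by simp
    then obtain c where c: "b = (\<Sum>\<rho>\<in>gens \<sigma>. c \<rho> *\<^sub>R e \<rho>)" "\<forall>\<rho>\<in>gens \<sigma>. 0 \<le> c \<rho>"
      using cone_of_explicit[OF gens_rays] by blast
    have pos: "0 \<le> h b' (e \<rho>)" "e \<rho> = (\<Sum>b'\<in>B. h b' (e \<rho>) *\<^sub>R b')" if "\<rho> \<in> gens \<sigma>" "b' \<in> B" for \<rho> b'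
    proof -
      have "e \<rho> \<in> convex_cone hull B" using e_gens_in[OF that(1)] B(3) by simp
      then obtain k where k: "e \<rho> = (\<Sum>b'\<in>B. k b' *\<^sub>R b')" "\<forall>b'\<in>B. 0 \<le> k b'" using cone_hull_finite[OF finB] by auto
      then have "h b'' (e \<rho>) = k b''" if "b'' \<in> B" for b'' using hsum[OF that] by simp
      then show "0 \<le> h b' (e \<rho>)" "e \<rho> = (\<Sum>b'\<in>B. h b' (e \<rho>) *\<^sub>R b')" using k that(2) by auto
    qed
    have "\<exists>\<rho>\<in>gens \<sigma>. c \<rho> \<noteq> 0"
    proof (rule ccontr)
      assume "\<not> ?thesis"
      then have "b = 0" unfolding c(1) by (intro sum.neutral) simp
      then show False using b0 by simp
    qed
    then obtain \<rho> where \<rho>: "\<rho> \<in> gens \<sigma>" "c \<rho> > 0" using c(2) by force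
    \<comment> \<open>The coordinate of \<open>b\<close> at \<open>b'\<close> is zero and a sum of
      nonnegative terms, so each term vanishes.\<close>
    have zero: "h b' (e \<rho>) = 0" if b': "b' \<in> B" "b' \<noteq> b" for b'
    proof -
      have "(\<Sum>\<rho>\<in>gens \<sigma>. c \<rho> * h b' (e \<rho>)) = h b' b"
        unfolding c(1) by (simp add: linear_sum[OF h(1)] linear_scale[OF h(1)])
      then have "(\<Sum>\<rho>\<in>gens \<sigma>. c \<rho> * h b' (e \<rho>)) = 0" using b' b by (simp add: h(2))
      moreover have "0 \<le> c \<rho> * h b' (e \<rho>)" if "\<rho> \<in> gens \<sigma>" for \<rho> using that c(2) pos(1)[OF that b'(1)] by simp
      ultimately have "c \<rho> * h b' (e \<rho>) = 0" using \<rho>(1) by (metis (no_types, lifting) finite_gens sum_nonneg_eq_0_iff)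
      then show ?thesis using \<rho>(2) by simp
    qed
    have "e \<rho> = (\<Sum>b'\<in>B. if b' = b then h b (e \<rho>) *\<^sub>R b else 0)"
      by (subst pos(2)[OF \<rho>(1) b]) (rule sum.cong, use zero in auto)
    then have eb: "e \<rho> = h b (e \<rho>) *\<^sub>R b" using b finB by (simp add: sum.delta)
    have "e \<rho> \<in> int_span B" using B(2) gens_N \<rho>(1) e_gens_in[OF \<rho>(1)] by (auto simp: sublattice_def span_base)
    then obtain k where "e \<rho> = (\<Sum>b'\<in>B. of_int (k b') *\<^sub>R b')" unfolding int_span_def by blast
    then have hk: "h b (e \<rho>) = of_int (k b)" using hsum[OF b] by simp
    have \<rho>r: "\<rho> \<in> rays \<Sigma>" using \<rho>(1) gens_rays by blast
    have kpos: "k b > 0"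
    proof -
      have "h b (e \<rho>) \<noteq> 0" using eb ray_props(1)[OF \<rho>r] by auto
      then show ?thesis using pos(1)[OF \<rho>(1) b] hk by simp
    qed
    have "b = (1 / of_int (k b)) *\<^sub>R e \<rho>" using eb hk kpos by simp
    then have "b \<in> N \<inter> \<rho>" using bN kpos ray_iff[OF \<rho>r, of b] by (auto intro!: exI[of _ "1 / of_int (k b)"])
    then obtain j where j: "b = of_nat j *\<^sub>R e \<rho>" using ray_props(3)[OF \<rho>r] by blast
    have "e \<rho> = (of_int (k b) * of_nat j) *\<^sub>R e \<rho>" using eb hk j by (metis scaleR_scaleR)
    then have "real_of_int (k b * int j) = 1" using ray_props(1)[OF \<rho>r] by (metis scaleR_cancel_right scaleR_one of_int_mult of_int_of_nat_eq)
    then have "k b * int j = 1" by linarith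
    then have "j = 1" using kpos by (metis int_ops(2) nat_int zmult_eq_1_iff of_nat_eq_iff of_nat_0_le_iff not_one_le_zero pos_zmult_eq_1_iff)
    then have "b = e \<rho>" using j by simp
    then show ?thesis using \<rho>(1) by blast
  qed
  then have "B \<subseteq> int_span (e ` gens \<sigma>)" using int_span_base[OF fin] by blast
  then show "sublattice N \<sigma> \<subseteq> int_span (e ` gens \<sigma>)" using int_span_minimal B(2) by blast
qed

lemma coord_int:
  assumes \<sigma>: "\<sigma> \<in> \<Sigma>" and x: "x \<in> N" "x \<in> span \<sigma>" and \<rho>: "\<rho> \<in> gens \<sigma>"
  shows "coord (gens \<sigma>) \<rho> x \<in> \<int>"
proof -
  have "x \<in> int_span (e ` gens \<sigma>)" using x sublattice_gens[OF \<sigma>] by (auto simp: sublattice_def)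
  then obtain c where "x = (\<Sum>v\<in>e ` gens \<sigma>. of_int (c v) *\<^sub>R v)" unfolding int_span_def by blast
  then have "x = (\<Sum>\<rho>\<in>gens \<sigma>. of_int (c (e \<rho>)) *\<^sub>R e \<rho>)" using inj_gens by (simp add: sum.reindex)
  then show ?thesis
    using coord_gens[OF \<sigma> gens_rays] by (auto simp: linear_sum linear_scale intro!: Ints_sum)
qed

text \<open>The dual basis vectors are taken in \<open>M\<close> itself and not just as integral
  forms on the span of \<open>T\<close>. They exist because the primitive vectors of a face are part
  of a basis of \<open>N\<close>; being in \<open>M\<close>, they give linear relations of the Chow
  ring.\<close>

definition dl :: "'a set set \<Rightarrow> 'a set \<Rightarrow> 'a \<Rightarrow> real" where
  "dl T \<rho> = (SOME m. m \<in> dual_lattice \<int> N \<and> (\<forall>\<rho>'\<in>T. m (e \<rho>') = (if \<rho>' = \<rho> then 1 else 0)))"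

lemma dl:
  assumes "T \<in> faces" "\<rho> \<in> T"
  shows "dl T \<rho> \<in> dual_lattice \<int> N" "linear (dl T \<rho>)" "\<rho>' \<in> T \<Longrightarrow> dl T \<rho> (e \<rho>') = (if \<rho>' = \<rho> then 1 else 0)"
proof -
  obtain \<sigma> where \<sigma>: "\<sigma> \<in> \<Sigma>" "T = gens \<sigma>" using assms by (auto simp: faces_def)
  note lin = coord_gens(1)[OF \<sigma>(1) gens_rays, of \<rho>]
  obtain m where m: "m \<in> dual_lattice \<int> N" "\<And>x. x \<in> span (e ` gens \<sigma>) \<Longrightarrow> m x = coord (gens \<sigma>) \<rho> x"
    using dual_lattice_extend[OF lattice _ gens_N lin, of \<sigma>] coord_int[OF \<sigma>(1) _ _ assms(2)[unfolded \<sigma>(2)]] span_gens[OF \<sigma>(1)]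
    by auto
  have "m \<in> dual_lattice \<int> N \<and> (\<forall>\<rho>'\<in>T. m (e \<rho>') = (if \<rho>' = \<rho> then 1 else 0))"
    using m coord_gens(2)[OF \<sigma>(1) gens_rays] \<sigma>(2) by (auto simp: span_base)
  then have "\<exists>m. m \<in> dual_lattice \<int> N \<and> (\<forall>\<rho>'\<in>T. m (e \<rho>') = (if \<rho>' = \<rho> then 1 else 0))"
    by (rule exI[where x = m])
  from someI_ex[OF this]
  have *: "dl T \<rho> \<in> dual_lattice \<int> N \<and> (\<forall>\<rho>'\<in>T. dl T \<rho> (e \<rho>') = (if \<rho>' = \<rho> then 1 else 0))" unfolding dl_def .
  then show "dl T \<rho> \<in> dual_lattice \<int> N" "linear (dl T \<rho>)" "\<rho>' \<in> T \<Longrightarrow> dl T \<rho> (e \<rho>') = (if \<rho>' = \<rho> then 1 else 0)"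
    by (auto simp: dual_lattice_def)
qed

lemma dl_expand:
  assumes T: "T \<in> faces" and x: "x \<in> span (e ` T)"
  shows "x = (\<Sum>\<rho>\<in>T. dl T \<rho> x *\<^sub>R e \<rho>)"
proof (rule linear_span_eq[OF linear_ident _ _ x])
  have fin: "finite T" using faces_props(4)[OF T] .
  show "linear (\<lambda>x. \<Sum>\<rho>\<in>T. dl T \<rho> x *\<^sub>R e \<rho>)"
    using dl(2)[OF T] by (intro linear_compose_sum ballI linear_scaleR_const) auto
  fix y assume "y \<in> e ` T"
  then obtain r where r: "r \<in> T" "y = e r" by blast
  have "(\<Sum>\<rho>\<in>T. dl T \<rho> y *\<^sub>R e \<rho>) = (\<Sum>\<rho>\<in>T. if \<rho> = r then e \<rho> else 0)"
    by (rule sum.cong) (use r dl(3)[OF T] in auto)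
  then show "y = (\<Sum>\<rho>\<in>T. dl T \<rho> y *\<^sub>R e \<rho>)" using r fin by (simp add: sum.delta)
qed

text \<open>The coordinate of the normal vector is integral by unimodularity, and it divides 1
  because \<open>e \<rho>\<close> is an integral multiple of the normal vector modulo the lattice of
  \<open>\<tau>\<close>.\<close>

lemma kap_1:
  assumes "\<tau> \<in> \<Sigma>" "\<sigma> \<in> \<Sigma>" "\<rho> \<notin> gens \<tau>" "gens \<sigma> = insert \<rho> (gens \<tau>)"
  shows "kap \<sigma> \<tau> \<rho> = 1"
proof -
  have sub: "\<tau> \<subseteq> \<sigma>" using assms gens_subset_iff by blast
  have dim: "dim \<sigma> = dim \<tau> + 1" using assms by (simp flip: gens_props(2))
  have \<rho>: "\<rho> \<in> gens \<sigma>" using assms by simp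
  note lin = coord_gens(1)[OF assms(2) gens_rays, of \<rho>]
  have "kap \<sigma> \<tau> \<rho> \<in> \<int>"
    unfolding kap_def using nv_sublattice[OF assms(1,2) sub dim] by (intro coord_int[OF assms(2) _ _ \<rho>])
  then obtain k where k: "kap \<sigma> \<tau> \<rho> = of_int k" by (rule Ints_cases)
  have "e \<rho> \<in> sublattice N \<sigma>" using gens_N e_gens_in[OF \<rho>] \<rho> by (auto simp: sublattice_def span_base)
  then obtain t and l :: int where t: "e \<rho> = t + of_int l *\<^sub>R nv \<sigma> \<tau>" "t \<in> sublattice N \<tau>"
    using is_normal[OF assms(1,2) sub dim] unfolding is_normal_vec_def by blast
  have "coord (gens \<sigma>) \<rho> t = 0"
    by (rule coord_face_zero[OF assms(2,1) _ assms(3)]) (use assms(4) t(2) in \<open>auto simp: sublattice_def\<close>)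
  then have "coord (gens \<sigma>) \<rho> (e \<rho>) = of_int l * kap \<sigma> \<tau> \<rho>"
    using arg_cong[OF t(1), of "coord (gens \<sigma>) \<rho>"] by (simp add: linear_add[OF lin] linear_scale[OF lin] kap_def)
  then have "real_of_int (l * k) = 1" using coord_gens(2)[OF assms(2) gens_rays \<rho>, of \<rho>] k by simp
  then have "l * k = 1" by linarith
  moreover have "k > 0" using kap(1)[OF assms] k by simp
  ultimately have "k = 1" using pos_zmult_eq_1_iff[of k l] by (simp add: mult.commute)
  then show ?thesis using k by simp
qed

text \<open>Multiplication by the class of the ray \<open>\<rho>\<close> on weights on the faces. Weights are balanced when
  \<open>\<Sum>\<^sub>\<rho> act \<rho> w T e\<^sub>\<rho> = 0\<close>, which is how the value on \<open>T \<ni> \<rho>\<close> is forced.\<close>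

definition act :: "'a set \<Rightarrow> ('a set set \<Rightarrow> real) \<Rightarrow> 'a set set \<Rightarrow> real" where
  "act \<rho> w T = (if \<rho> \<notin> T then w (insert \<rho> T)
     else if T \<in> faces then - (\<Sum>r\<in>rays \<Sigma> - T. w (insert r T) * dl T \<rho> (e r)) else 0)"

definition wvec :: "('a set set \<Rightarrow> real) \<Rightarrow> 'a set set \<Rightarrow> 'a" where
  "wvec w T = (\<Sum>r\<in>rays \<Sigma> - T. w (insert r T) *\<^sub>R e r)"

text \<open>Minkowski weights of dimension \<open>k\<close>, as functions on ray sets with real
  values. Primitive vectors stand in for normal vectors, which is legitimate since all factors
  \<open>kap\<close> are 1 here.\<close>

definition weight :: "nat \<Rightarrow> ('a set set \<Rightarrow> real) \<Rightarrow> bool" where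
  "weight k w \<longleftrightarrow> (\<forall>T. w T \<noteq> 0 \<longrightarrow> T \<in> faces \<and> card T = k) \<and>
     (\<forall>T\<in>faces. card T + 1 = k \<longrightarrow> wvec w T \<in> span (e ` T))"

lemma act_in: "T \<in> faces \<Longrightarrow> \<rho> \<in> T \<Longrightarrow> act \<rho> w T = - dl T \<rho> (wvec w T)"
  using dl(2)[of T \<rho>] by (simp add: act_def wvec_def linear_sum linear_scale)

lemma act_notin: "\<rho> \<notin> T \<Longrightarrow> act \<rho> w T = w (insert \<rho> T)"
  by (simp add: act_def)

lemma act_support:
  assumes "act \<rho> w T \<noteq> 0"
  obtains r where "w (insert r T) \<noteq> 0" "r \<notin> T" "\<rho> \<in> insert r T"
proof (cases "\<rho> \<in> T")
  case True
  then have "\<exists>r\<in>rays \<Sigma> - T. w (insert r T) * dl T \<rho> (e r) \<noteq> 0"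
    using assms by (metis (no_types, lifting) act_def add.inverse_neutral sum.neutral)
  then show ?thesis using that True by auto
next
  case False
  then show ?thesis using assms that by (auto simp: act_def)
qed

lemma weight_support: "weight k w \<Longrightarrow> w T \<noteq> 0 \<Longrightarrow> T \<in> faces \<and> card T = k"
  by (simp add: weight_def)

lemma act_weight_support:
  assumes w: "weight (k + 1) w" and "act \<rho> w T \<noteq> 0"
  shows "T \<in> faces \<and> card T = k"
proof -
  obtain r where r: "w (insert r T) \<noteq> 0" "r \<notin> T" using act_support[OF assms(2)] by metis
  have F: "insert r T \<in> faces" "card (insert r T) = k + 1" using weight_support[OF w r(1)] by auto
  have "finite T" using faces_props(4)[OF F(1)] by simp
  then show ?thesis using F r(2) faces_subset[OF F(1), of T] by auto
qed

text \<open>\<open>A r\<close> and \<open>t r\<close> are the components of \<open>wvec w (insert r T)\<close> along \<open>e r\<close> and \<open>span T\<close>; both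
  are zero when \<open>insert r T\<close> is not a face.\<close>

definition splits :: "('a set set \<Rightarrow> real) \<Rightarrow> 'a set set \<Rightarrow> ('a set \<Rightarrow> real) \<Rightarrow> ('a set \<Rightarrow> 'a) \<Rightarrow> bool" where
  "splits w T A t \<longleftrightarrow> (\<forall>r\<in>rays \<Sigma> - T.
      (\<Sum>s\<in>rays \<Sigma> - T. (if s = r then 0 else w (insert r (insert s T))) *\<^sub>R e s) = A r *\<^sub>R e r + t r \<and>
      t r \<in> span (e ` T) \<and> (\<forall>\<rho>\<in>T. act \<rho> w (insert r T) = - dl T \<rho> (t r)) \<and> act r w (insert r T) = - A r)"

lemma splitsD:
  assumes "splits w T A t" "r \<in> rays \<Sigma> - T"
  shows "(\<Sum>s\<in>rays \<Sigma> - T. (if s = r then 0 else w (insert r (insert s T))) *\<^sub>R e s) = A r *\<^sub>R e r + t r"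
    "t r \<in> span (e ` T)" "\<rho> \<in> T \<Longrightarrow> act \<rho> w (insert r T) = - dl T \<rho> (t r)" "act r w (insert r T) = - A r"
  using assms unfolding splits_def by auto

lemma weight_split:
  assumes w: "weight (k + 1) w" and T: "T \<in> faces" "card T + 1 = k"
  obtains A t where "splits w T A t"
proof -
  have finT: "finite T" using faces_props(4)[OF T(1)] .
  \<comment> \<open>The entry for \<open>s = r\<close> is set to zero because there
    \<open>insert s (insert r T)\<close> adds no ray; with this convention the matrix is symmetric
    on all rays outside \<open>T\<close>.\<close>
  have vec: "(\<Sum>s\<in>rays \<Sigma> - T. (if s = r then 0 else w (insert r (insert s T))) *\<^sub>R e s) = wvec w (insert r T)"
    if "r \<in> rays \<Sigma> - T" for r
    unfolding wvec_def by (rule sum.mono_neutral_cong_right) (use that in \<open>auto simp: insert_commute\<close>)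
  have "\<exists>A t. wvec w (insert r T) = A *\<^sub>R e r + t \<and> t \<in> span (e ` T) \<and>
      (\<forall>\<rho>\<in>T. act \<rho> w (insert r T) = - dl T \<rho> t) \<and> act r w (insert r T) = - A"
    if r: "r \<in> rays \<Sigma> - T" for r
  proof (cases "insert r T \<in> faces")
    case False
    have z: "w (insert s (insert r T)) = 0" for s
      using weight_support[OF w, of "insert s (insert r T)"] False faces_subset[of "insert s (insert r T)" "insert r T"] by blast
    then have "wvec w (insert r T) = 0" by (simp add: wvec_def)
    moreover have "act \<rho> w (insert r T) = 0" if "\<rho> \<in> insert r T" for \<rho> using that False by (simp add: act_def)
    moreover have "dl T \<rho> 0 = 0" if "\<rho> \<in> T" for \<rho> using dl(2)[OF T(1) that] by (rule linear_0)
    ultimately show ?thesis by (intro exI[of _ 0]) (simp add: span_zero)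
  next
    case True
    have "card (insert r T) + 1 = k + 1" using r T finT by simp
    moreover have "\<forall>T\<in>faces. card T + 1 = k + 1 \<longrightarrow> wvec w T \<in> span (e ` T)" using w unfolding weight_def by (rule conjunct2)
    ultimately have V: "wvec w (insert r T) \<in> span (e ` insert r T)" using True by blast
    define A where "A = dl (insert r T) r (wvec w (insert r T))"
    define t where "t = (\<Sum>\<rho>\<in>T. dl (insert r T) \<rho> (wvec w (insert r T)) *\<^sub>R e \<rho>)"
    have "wvec w (insert r T) = A *\<^sub>R e r + t"
      using dl_expand[OF True V] r finT by (simp add: A_def t_def)
    moreover have "t \<in> span (e ` T)" unfolding t_def by (auto intro!: span_sum span_scale intro: span_base)
    moreover have "act \<rho> w (insert r T) = - dl T \<rho> t" if \<rho>: "\<rho> \<in> T" for \<rho>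
    proof -
      note lin = dl(2)[OF T(1) \<rho>]
      have "dl T \<rho> t = (\<Sum>\<rho>'\<in>T. if \<rho>' = \<rho> then dl (insert r T) \<rho>' (wvec w (insert r T)) else 0)"
        unfolding t_def linear_sum[OF lin] linear_scale[OF lin] by (rule sum.cong) (use dl(3)[OF T(1) \<rho>] in auto)
      then show ?thesis using act_in[OF True, of \<rho>] \<rho> finT by (simp add: sum.delta)
    qed
    moreover have "act r w (insert r T) = - A" using act_in[OF True, of r] by (simp add: A_def)
    ultimately show ?thesis by blast
  qed
  then obtain A t where "\<And>r. r \<in> rays \<Sigma> - T \<Longrightarrow> wvec w (insert r T) = A r *\<^sub>R e r + t r \<and> t r \<in> span (e ` T) \<and>
      (\<forall>\<rho>\<in>T. act \<rho> w (insert r T) = - dl T \<rho> (t r)) \<and> act r w (insert r T) = - A r"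
    by metis
  then have "splits w T A t" unfolding splits_def using vec by simp
  then show ?thesis by (rule that)
qed

text \<open>For \<open>\<rho>\<close> in \<open>T\<close> the new weight is the divisor of the zero
  function corrected by the linear form \<open>- dl T \<rho>\<close>, to which
  \<open>symmetric_weight_divisor\<close> applies. For \<open>\<rho>\<close> outside
  \<open>T\<close> its value on \<open>insert \<rho> T\<close> is made to cancel the component along
  \<open>e \<rho>\<close>.\<close>

lemma act_weight:
  assumes w: "weight (k + 1) w" and \<rho>: "\<rho> \<in> rays \<Sigma>"
  shows "weight k (act \<rho> w)"
  unfolding weight_def
proof (intro conjI allI ballI impI)
  show "T \<in> faces" "card T = k" if "act \<rho> w T \<noteq> 0" for T using act_weight_support[OF w that] by auto
  fix T assume T: "T \<in> faces" "card T + 1 = k"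
  obtain A t where "splits w T A t" using weight_split[OF w T] .
  note At = splitsD[OF this]
  show "wvec (act \<rho> w) T \<in> span (e ` T)"
  proof (cases "\<rho> \<in> T")
    case True
    have "linear (\<lambda>x. - dl T \<rho> x)" using linear_compose_neg[OF dl(2)[OF T(1) True]] .
    from symmetric_weight_divisor[OF subspace_span _ At(1,2) this, of "act \<rho> w \<circ> (\<lambda>r. insert r T)" "\<lambda>_. 0"]
    show ?thesis unfolding wvec_def using At(3) True by (simp add: insert_commute)
  next
    case False
    then have \<rho>': "\<rho> \<in> rays \<Sigma> - T" using \<rho> by simp
    have "wvec (act \<rho> w) T = (\<Sum>s\<in>rays \<Sigma> - T. (if s = \<rho> then act \<rho> w (insert \<rho> T) *\<^sub>R e \<rho> else 0)
       + (if s = \<rho> then 0 else w (insert \<rho> (insert s T))) *\<^sub>R e s)"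
      unfolding wvec_def by (rule sum.cong) (use False in \<open>auto simp: act_notin\<close>)
    also have "\<dots> = act \<rho> w (insert \<rho> T) *\<^sub>R e \<rho> + (A \<rho> *\<^sub>R e \<rho> + t \<rho>)"
      unfolding sum.distrib At(1)[OF \<rho>'] using \<rho>' by (simp add: sum.delta)
    also have "\<dots> = t \<rho>" using At(4)[OF \<rho>'] by simp
    finally show ?thesis using At(2)[OF \<rho>'] by simp
  qed
qed

lemma act_commute_aux:
  assumes w: "weight (k + 1) w" and \<rho>: "\<rho> \<in> rays \<Sigma>" "\<rho>' \<in> rays \<Sigma>" "\<rho> \<in> T" "\<rho>' \<notin> T" and T: "T \<in> faces" "card T + 1 = k"
  shows "act \<rho>' (act \<rho> w) T = act \<rho> (act \<rho>' w) T"
proof -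
  obtain A t where "splits w T A t" using weight_split[OF w T] .
  note At = splitsD[OF this]
  have r: "\<rho>' \<in> rays \<Sigma> - T" using \<rho> by simp
  have "wvec (act \<rho>' w) T = (\<Sum>s\<in>rays \<Sigma> - T. (if s = \<rho>' then act \<rho>' w (insert \<rho>' T) *\<^sub>R e \<rho>' else 0)
     + (if s = \<rho>' then 0 else w (insert \<rho>' (insert s T))) *\<^sub>R e s)"
    unfolding wvec_def by (rule sum.cong) (use \<rho> in \<open>auto simp: act_notin\<close>)
  also have "\<dots> = act \<rho>' w (insert \<rho>' T) *\<^sub>R e \<rho>' + (A \<rho>' *\<^sub>R e \<rho>' + t \<rho>')"
    unfolding sum.distrib At(1)[OF r] using r by (simp add: sum.delta)
  also have "\<dots> = t \<rho>'" using At(4)[OF r] by simp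
  finally have "act \<rho> (act \<rho>' w) T = - dl T \<rho> (t \<rho>')" using act_in[OF T(1) \<rho>(3)] by simp
  then show ?thesis using At(3)[OF r \<rho>(3)] \<rho>(4) by (simp add: act_notin)
qed

text \<open>If not both rays lie in \<open>T\<close>, the components of a splitting identify the two
  sides. If both do, the composite is a double sum whose matrix of weights is symmetric, minus a
  diagonal part symmetric in the two rays.\<close>

lemma act_commute:
  assumes w: "weight (k + 2) w" and \<rho>: "\<rho> \<in> rays \<Sigma>" "\<rho>' \<in> rays \<Sigma>"
  shows "act \<rho>' (act \<rho> w) = act \<rho> (act \<rho>' w)"
proof
  fix T
  have w1: "weight (k + 1 + 1) w" using w by (simp add: numeral_2_eq_2 One_nat_def)
  show "act \<rho>' (act \<rho> w) T = act \<rho> (act \<rho>' w) T"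
  proof (cases "T \<in> faces \<and> card T = k \<and> \<rho> \<noteq> \<rho>'")
    case False
    show ?thesis
    proof (cases "\<rho> = \<rho>'")
      case ne: False
      have "act \<rho>' (act \<rho> w) T = 0"
        using act_weight_support[OF act_weight[OF w1 \<rho>(1)], of \<rho>' T] False ne by argo
      moreover have "act \<rho> (act \<rho>' w) T = 0"
        using act_weight_support[OF act_weight[OF w1 \<rho>(2)], of \<rho> T] False ne by argo
      ultimately show ?thesis by simp
    qed simp
  next
    case True
    then have T: "T \<in> faces" "card T + 1 = k + 1" "\<rho> \<noteq> \<rho>'" by auto
    consider "\<rho> \<notin> T" "\<rho>' \<notin> T" | "\<rho> \<in> T" "\<rho>' \<notin> T" | "\<rho> \<notin> T" "\<rho>' \<in> T" | "\<rho> \<in> T" "\<rho>' \<in> T" by blast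
    then show ?thesis
    proof cases
      case 1
      then show ?thesis using T(3) by (simp add: act_notin insert_commute)
    next
      case 2
      then show ?thesis using act_commute_aux[OF w1 \<rho> 2 T(1,2)] by simp
    next
      case 3
      then show ?thesis using act_commute_aux[OF w1 \<rho>(2,1) 3(2,1) T(1,2)] by simp
    next
      case 4
      obtain A t where "splits w T A t" using weight_split[OF w1 T(1,2)] .
      note At = splitsD[OF this]
      define W where "W r s = (if s = r then 0 else w (insert r (insert s T)))" for r s
      have W_sym: "W r s = W s r" for r s by (auto simp: W_def insert_commute)
      have val: "act b (act a w) T =
          (\<Sum>r\<in>rays \<Sigma> - T. \<Sum>s\<in>rays \<Sigma> - T. W r s * dl T a (e s) * dl T b (e r))
          - (\<Sum>r\<in>rays \<Sigma> - T. A r * dl T a (e r) * dl T b (e r))" if ab: "a \<in> T" "b \<in> T" for a b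
      proof -
        note lina = dl(2)[OF T(1) ab(1)] and linb = dl(2)[OF T(1) ab(2)]
        have ta: "dl T a (t r) = (\<Sum>s\<in>rays \<Sigma> - T. W r s * dl T a (e s)) - A r * dl T a (e r)" if "r \<in> rays \<Sigma> - T" for r
          using arg_cong[OF At(1)[OF that], of "dl T a"]
          by (simp add: linear_sum[OF lina] linear_scale[OF lina] linear_add[OF lina] W_def)
        have "act b (act a w) T = (\<Sum>r\<in>rays \<Sigma> - T. dl T a (t r) * dl T b (e r))"
          using ab At(3) T(1) by (simp add: act_def[of b] sum_negf)
        also have "\<dots> = (\<Sum>r\<in>rays \<Sigma> - T. (\<Sum>s\<in>rays \<Sigma> - T. W r s * dl T a (e s) * dl T b (e r)) - A r * dl T a (e r) * dl T b (e r))"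
          by (rule sum.cong) (auto simp: ta left_diff_distrib sum_distrib_right)
        finally show ?thesis by (simp add: sum_subtractf)
      qed
      have "(\<Sum>r\<in>rays \<Sigma> - T. \<Sum>s\<in>rays \<Sigma> - T. W r s * dl T \<rho> (e s) * dl T \<rho>' (e r)) =
          (\<Sum>r\<in>rays \<Sigma> - T. \<Sum>s\<in>rays \<Sigma> - T. W r s * dl T \<rho>' (e s) * dl T \<rho> (e r))"
        by (subst sum.swap) (auto intro!: sum.cong simp: W_sym)
      then show ?thesis using val[OF 4] val[OF 4(2,1)] by (simp add: mult.commute mult.left_commute)
    qed
  qed
qed

text \<open>Rays outside \<open>T\<close> contribute \<open>m (wvec w T)\<close>; those in
  \<open>T\<close> contribute its negative, as \<open>dl T\<close> gives the coordinates of
  \<open>wvec w T\<close>. These are the linear relations of the Chow ring, as identities of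
  operators.\<close>

lemma act_linear_relation:
  assumes w: "weight (k + 1) w" and T: "T \<in> faces" "card T = k" and m: "linear m"
  shows "(\<Sum>\<rho>\<in>rays \<Sigma>. act \<rho> w T * m (e \<rho>)) = 0"
proof -
  have sub: "T \<subseteq> rays \<Sigma>" "finite T" using faces_props[OF T(1)] by auto
  have V: "wvec w T \<in> span (e ` T)" using w T by (simp add: weight_def)
  have "(\<Sum>\<rho>\<in>rays \<Sigma>. act \<rho> w T * m (e \<rho>)) = (\<Sum>\<rho>\<in>rays \<Sigma> - T. act \<rho> w T * m (e \<rho>)) + (\<Sum>\<rho>\<in>T. act \<rho> w T * m (e \<rho>))"
    using sub by (simp add: sum.subset_diff[OF sub(1)])
  also have "(\<Sum>\<rho>\<in>rays \<Sigma> - T. act \<rho> w T * m (e \<rho>)) = m (wvec w T)"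
    by (simp add: wvec_def linear_sum[OF m] linear_scale[OF m] act_notin)
  also have "(\<Sum>\<rho>\<in>T. act \<rho> w T * m (e \<rho>)) = - m (\<Sum>\<rho>\<in>T. dl T \<rho> (wvec w T) *\<^sub>R e \<rho>)"
    by (simp add: linear_sum[OF m] linear_scale[OF m] act_in[OF T(1)] sum_negf)
  also have "(\<Sum>\<rho>\<in>T. dl T \<rho> (wvec w T) *\<^sub>R e \<rho>) = wvec w T" using dl_expand[OF T(1) V] by simp
  finally show ?thesis by simp
qed

lemma act_int:
  assumes "\<And>T. w T \<in> \<int>"
  shows "act \<rho> w T \<in> \<int>"
proof -
  have "dl T \<rho> (e r) \<in> \<int>" if "T \<in> faces" "\<rho> \<in> T" "r \<in> rays \<Sigma>" for r
    using dl(1)[OF that(1,2)] ray_props(2)[OF that(3)] by (simp add: dual_lattice_def)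
  then show ?thesis using assms by (auto simp: act_def intro!: Ints_minus Ints_sum Ints_mult)
qed

lemma fold_act_weight: "weight (length l + k) w \<Longrightarrow> set l \<subseteq> rays \<Sigma> \<Longrightarrow> weight k (fold act l w)"
proof (induction l arbitrary: w)
  case (Cons x l)
  then have "weight (length l + k) (act x w)" by (intro act_weight) (auto simp: One_nat_def)
  then show ?case using Cons by simp
qed simp

text \<open>Operators commute only on balanced weights, of dimension at least 2. Tying the dimension
  to the length of the list guarantees this: whenever a swap is needed, two rays are still to be
  applied.\<close>

lemma fold_act_remove1:
  "weight (length l) w \<Longrightarrow> set l \<subseteq> rays \<Sigma> \<Longrightarrow> \<rho> \<in> set l \<Longrightarrow> fold act l w = fold act (remove1 \<rho> l) (act \<rho> w)"
proof (induction l arbitrary: w)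
  case (Cons x l)
  show ?case
  proof (cases "x = \<rho>")
    case False
    then have \<rho>: "\<rho> \<in> set l" "\<rho> \<in> rays \<Sigma>" "x \<in> rays \<Sigma>" using Cons.prems by auto
    have wx: "weight (length l) (act x w)" using Cons.prems by (intro act_weight) (auto simp: One_nat_def)
    have "length l > 0" using \<rho>(1) by auto
    then have "act \<rho> (act x w) = act x (act \<rho> w)"
      using Cons.prems \<rho> by (intro act_commute[of "length l - 1"]) (auto simp: numeral_2_eq_2 One_nat_def)
    then show ?thesis using Cons.IH[OF wx _ \<rho>(1)] Cons.prems False by simp
  qed simp
qed simp

lemma fold_act_mset:
  assumes "weight (length l) w" "set l \<subseteq> rays \<Sigma>" "mset l = mset l'"
  shows "fold act l w = fold act l' w"
  using assms
proof (induction l arbitrary: l' w)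
  case (Cons x l)
  have len: "length l' = length (x # l)" using Cons.prems(3) by (metis size_mset)
  have set: "set l' = set (x # l)" using Cons.prems(3) by (metis set_mset_mset)
  have "weight (length l) (act x w)" using Cons.prems by (intro act_weight) (auto simp: One_nat_def)
  moreover have "mset l = mset (remove1 x l')" using Cons.prems(3) by (simp flip: Cons.prems(3))
  ultimately have "fold act l (act x w) = fold act (remove1 x l') (act x w)" using Cons by simp
  also have "\<dots> = fold act l' w"
    using fold_act_remove1[of l' w x] Cons.prems len set by auto
  finally show ?case by simp
qed simp

text \<open>\<open>S\<close> collects the rays applied so far. An operator can be nonzero at
  \<open>T\<close> only if some larger face containing its ray carries weight, so all applied rays
  lie in a common face; this yields the non-face relations.\<close>

lemma fold_act_support:
  assumes "\<And>T. w T \<noteq> 0 \<Longrightarrow> T \<union> S \<in> faces" "fold act l w T \<noteq> 0"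
  shows "T \<union> (set l \<union> S) \<in> faces"
  using assms
proof (induction l arbitrary: w S)
  case (Cons x l)
  have "T \<union> insert x S \<in> faces" if nz: "act x w T \<noteq> 0" for T
  proof -
    obtain r where "w (insert r T) \<noteq> 0" "x \<in> insert r T" using act_support[OF nz] by metis
    then show ?thesis using Cons.prems(1)[of "insert r T"] faces_subset[of "insert r T \<union> S" "T \<union> insert x S"] by blast
  qed
  from Cons.IH[OF this] Cons.prems(2) show ?case by simp
qed simp

lemma fold_act_distinct:
  "distinct l \<Longrightarrow> set l \<inter> T = {} \<Longrightarrow> fold act l w T = w (set l \<union> T)"
proof (induction l arbitrary: w)
  case (Cons x l)
  then have "fold act l (act x w) T = act x w (set l \<union> T)" by simp
  then show ?case using Cons.prems by (simp add: act_notin)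
qed simp

lemma fold_act_int: "(\<And>T. w T \<in> \<int>) \<Longrightarrow> fold act l w T \<in> \<int>"
  by (induction l arbitrary: w) (auto simp: act_int)

end

text \<open>A monomial written out as a list of variables, so that it can act by
  \<open>fold\<close>. The order is a choice, immaterial by \<open>fold_act_mset\<close>.\<close>

definition mlist :: "('v \<Rightarrow>\<^sub>0 nat) \<Rightarrow> 'v list" where
  "mlist m = (SOME l. mset l = Abs_multiset (Poly_Mapping.lookup m))"

lemma count_mlist: "count (mset (mlist m)) = Poly_Mapping.lookup m"
proof -
  have "\<exists>l. mset l = Abs_multiset (Poly_Mapping.lookup m)" by (rule ex_mset)
  then have "mset (mlist m) = Abs_multiset (Poly_Mapping.lookup m)" unfolding mlist_def by (rule someI_ex)
  moreover have "finite {v. 0 < Poly_Mapping.lookup m v}" using finite_lookup[of m] by simp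
  ultimately show ?thesis by (simp add: Abs_multiset_inverse)
qed

lemma set_mlist: "set (mlist m) = Poly_Mapping.keys m"
proof -
  have "v \<in> set (mlist m) \<longleftrightarrow> count (mset (mlist m)) v \<noteq> 0" for v by simp
  then show ?thesis unfolding count_mlist by (auto simp: in_keys_iff)
qed

lemma length_mlist: "length (mlist m) = mdeg m"
proof -
  have "length (mlist m) = size (mset (mlist m))" by simp
  also have "\<dots> = mdeg m" unfolding size_multiset_overloaded_eq mdeg_def count_mlist set_mset_mset set_mlist ..
  finally show ?thesis .
qed

lemma mlist_add: "mset (mlist (m + n)) = mset (mlist m) + mset (mlist n)"
  by (rule multiset_eqI) (simp add: count_mlist lookup_add)

lemma mlist_single: "mset (mlist (Poly_Mapping.single v 1)) = {#v#}"
  by (rule multiset_eqI) (auto simp: count_mlist lookup_single when_def)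

definition sqfree_mono :: "'v set \<Rightarrow> ('v \<Rightarrow>\<^sub>0 nat)" where
  "sqfree_mono R = (\<Sum>v\<in>R. Poly_Mapping.single v 1)"

lemma lookup_sqfree_mono: "finite R \<Longrightarrow> Poly_Mapping.lookup (sqfree_mono R) v = (if v \<in> R then 1 else 0)"
  by (simp add: sqfree_mono_def lookup_sum lookup_single when_def sum.delta)

lemma keys_sqfree_mono: "finite R \<Longrightarrow> Poly_Mapping.keys (sqfree_mono R) = R"
  by (auto simp: in_keys_iff lookup_sqfree_mono split: if_splits)

lemma mdeg_sqfree_mono: "finite R \<Longrightarrow> mdeg (sqfree_mono R) = card R"
  by (simp add: mdeg_def keys_sqfree_mono lookup_sqfree_mono)

lemma prod_Xvar: "(\<Prod>v\<in>R. Xvar v) = (frag_of (sqfree_mono R) :: 'v int_mpoly)"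
  unfolding sqfree_mono_def
  by (induction R rule: infinite_finite_induct) (auto simp: Xvar_def frag_of_mult)

lemma mlist_sqfree_mono: "distinct l \<Longrightarrow> mset (mlist (sqfree_mono (set l))) = mset l"
  by (rule multiset_eqI) (simp add: count_mlist lookup_sqfree_mono distinct_count_atmost_1)

lemma mult_Xvar: "frag_of m * Xvar v = (frag_of (m + Poly_Mapping.single v 1) :: 'v int_mpoly)"
  unfolding Xvar_def by (rule frag_of_mult)

lemma polys_frag: "Poly_Mapping.keys m \<subseteq> V \<Longrightarrow> frag_of m \<in> polys V"
  by (simp add: polys_iff)

lemma homogeneous_frag: "homogeneous (mdeg m) (frag_of m)"
  by (simp add: homogeneous_iff)

lemma chow_class_prod:
  assumes "finite R" "R \<subseteq> rays \<Sigma>"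
  shows "chow_class N \<Sigma> (\<Prod>\<rho>\<in>R. Xvar \<rho>) = finprod (chow_ring N \<Sigma>) (\<lambda>\<zeta>. chow_class N \<Sigma> (Xvar \<zeta>)) R"
proof -
  interpret cring "chow_ring N \<Sigma>" by (rule chow_ring_cring)
  show ?thesis using assms
  proof (induction R rule: finite_induct)
    case empty
    show ?case using ring_hom_one[OF chow_class_hom, of N \<Sigma>] by simp
  next
    case (insert \<rho> R)
    have c: "chow_class N \<Sigma> (Xvar \<zeta>) \<in> carrier (chow_ring N \<Sigma>)" if "\<zeta> \<in> rays \<Sigma>" for \<zeta>
      using that by (auto simp: chow_carrier polys_Xvar)
    have "chow_class N \<Sigma> (\<Prod>\<rho>\<in>insert \<rho> R. Xvar \<rho>) = chow_class N \<Sigma> (Xvar \<rho>) \<otimes>\<^bsub>chow_ring N \<Sigma>\<^esub> chow_class N \<Sigma> (\<Prod>\<rho>\<in>R. Xvar \<rho>)"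
    proof -
      have "prod Xvar R \<in> polys (rays \<Sigma>)" using insert.prems by (intro polys_prod polys_Xvar) auto
      then show ?thesis using insert chow_class_ops(2)[OF polys_Xvar, of \<rho> \<Sigma> "prod Xvar R" N] by simp
    qed
    then show ?case using insert c by (simp add: finprod_insert Pi_def subset_iff)
  qed
qed

lemma chow_x_class:
  assumes "finite (rays \<Sigma>)"
  shows "chow_x N \<Sigma> \<sigma> = chow_class N \<Sigma> (\<Prod>\<rho>\<in>{\<rho>\<in>rays \<Sigma>. \<rho> \<subseteq> \<sigma>}. Xvar \<rho>)"
  unfolding chow_x_def by (rule chow_class_prod[symmetric]) (use assms in auto)

section \<open>The degree form attached to a weight\<close>

context unimodular_lattice_fan
begin

context
  fixes w d assumes w: "weight d w"
begin

text \<open>After \<open>d\<close> operators a weight of dimension 0 is left, a number sitting on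
  the empty face, that is, on the cone \<open>{0}\<close>.\<close>

definition mono_form :: "('a set \<Rightarrow>\<^sub>0 nat) \<Rightarrow> real" where
  "mono_form m = (if mdeg m = d then fold act (mlist m) w {} else 0)"

definition deg_form :: "'a set int_mpoly \<Rightarrow> real" where
  "deg_form p = (\<Sum>m\<in>Poly_Mapping.keys p. of_int (Poly_Mapping.lookup p m) * mono_form m)"

lemma deg_form_add: "deg_form (p + q) = deg_form p + deg_form q"
  unfolding deg_form_def by (rule setsum_keys_plus_distrib) (auto simp: algebra_simps)

lemma deg_form_0: "deg_form 0 = 0"
  by (simp add: deg_form_def)

lemma deg_form_diff: "deg_form (p - q) = deg_form p - deg_form q"
  using deg_form_add[of "p - q" q] by simp

lemma deg_form_frag: "deg_form (frag_of m) = mono_form m"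
  by (simp add: deg_form_def)

lemma deg_form_sum: "deg_form (sum F I) = (\<Sum>i\<in>I. deg_form (F i))"
  by (induction I rule: infinite_finite_induct) (auto simp: deg_form_0 deg_form_add)

lemma deg_form_of_int: "deg_form (of_int c * p) = of_int c * deg_form p"
proof -
  have nat: "deg_form (of_nat n * p) = of_nat n * deg_form p" for n p
    by (induction n) (auto simp: deg_form_0 deg_form_add algebra_simps)
  show ?thesis
    using nat[of _ p] deg_form_diff[of 0 "of_nat _ * p"] by (cases c rule: int_cases2) (auto simp: deg_form_0)
qed

lemma mono_form_eq:
  assumes "Poly_Mapping.keys m \<subseteq> rays \<Sigma>" "mset l = mset (mlist m)" "mdeg m = d"
  shows "mono_form m = fold act l w {}"
  using fold_act_mset[of "mlist m" w l] assms w by (simp add: mono_form_def length_mlist set_mlist)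

text \<open>A monomial of degree \<open>d - 1\<close> leaves a weight of dimension 1, and its
  balancing at the origin is the relation; in other degrees all terms are zero by
  definition.\<close>

lemma deg_form_linear_rel:
  assumes m: "Poly_Mapping.keys m \<subseteq> rays \<Sigma>" and l: "l \<in> dual_lattice \<int> N"
  shows "deg_form (frag_of m * (\<Sum>\<rho>\<in>rays \<Sigma>. of_int \<lfloor>l (e \<rho>)\<rfloor> * Xvar \<rho>)) = 0"
proof -
  have lint: "of_int \<lfloor>l (e \<rho>)\<rfloor> = l (e \<rho>)" if "\<rho> \<in> rays \<Sigma>" for \<rho>
    using l ray_props(2)[OF that] by (auto simp: dual_lattice_def elim!: Ints_cases)
  have "frag_of m * (\<Sum>\<rho>\<in>rays \<Sigma>. of_int \<lfloor>l (e \<rho>)\<rfloor> * Xvar \<rho>) = (\<Sum>\<rho>\<in>rays \<Sigma>. of_int \<lfloor>l (e \<rho>)\<rfloor> * frag_of (m + Poly_Mapping.single \<rho> 1))"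
    by (simp add: sum_distrib_left mult.left_commute[of "frag_of m"] mult_Xvar)
  then have "deg_form (frag_of m * (\<Sum>\<rho>\<in>rays \<Sigma>. of_int \<lfloor>l (e \<rho>)\<rfloor> * Xvar \<rho>))
      = (\<Sum>\<rho>\<in>rays \<Sigma>. l (e \<rho>) * mono_form (m + Poly_Mapping.single \<rho> 1))"
    by (simp add: deg_form_sum deg_form_of_int deg_form_frag lint)
  also have "\<dots> = 0"
  proof (cases "mdeg m + 1 = d")
    case False
    then show ?thesis by (simp add: mono_form_def mdeg_add)
  next
    case True
    let ?v = "fold act (mlist m) w"
    have "mono_form (m + Poly_Mapping.single \<rho> 1) = act \<rho> ?v {}" if "\<rho> \<in> rays \<Sigma>" for \<rho>
    proof -
      have "Poly_Mapping.keys (m + Poly_Mapping.single \<rho> 1) \<subseteq> rays \<Sigma>"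
        using keys_add[of m "Poly_Mapping.single \<rho> 1"] m that by auto
      then have "mono_form (m + Poly_Mapping.single \<rho> 1) = fold act (mlist m @ [\<rho>]) w {}"
        using True by (intro mono_form_eq) (auto simp: mlist_add mlist_single mdeg_add)
      then show ?thesis by simp
    qed
    moreover have "weight (0 + 1) ?v"
      by (rule fold_act_weight) (use True w m in \<open>auto simp: length_mlist set_mlist\<close>)
    from act_linear_relation[OF this, of "{}" l] have "(\<Sum>\<rho>\<in>rays \<Sigma>. act \<rho> ?v {} * l (e \<rho>)) = 0"
      using l zero_cone by (auto simp: dual_lattice_def faces_def intro: image_eqI[of _ _ "{0}"])
    ultimately show ?thesis by (simp add: mult.commute)
  qed
  finally show ?thesis .
qed

lemma deg_form_nonface:
  assumes m: "Poly_Mapping.keys m \<subseteq> rays \<Sigma>" and R: "R \<subseteq> rays \<Sigma>" "R \<notin> faces"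
  shows "deg_form (frag_of m * (\<Prod>\<rho>\<in>R. Xvar \<rho>)) = 0"
proof -
  have finR: "finite R" using R(1) finite_rays finite_subset by blast
  have k: "Poly_Mapping.keys (m + sqfree_mono R) = Poly_Mapping.keys m \<union> R"
    using finR by (auto simp: in_keys_iff lookup_add lookup_sqfree_mono split: if_splits)
  have "fold act (mlist (m + sqfree_mono R)) w {} = 0"
  proof (rule ccontr)
    assume nz: "fold act (mlist (m + sqfree_mono R)) w {} \<noteq> 0"
    have "{} \<union> (set (mlist (m + sqfree_mono R)) \<union> {}) \<in> faces"
      by (rule fold_act_support[OF _ nz]) (use weight_support[OF w] in simp)
    then have "Poly_Mapping.keys m \<union> R \<in> faces" by (simp add: set_mlist k)
    then show False using R(2) faces_subset by blast
  qed
  then show ?thesis by (simp add: prod_Xvar frag_of_mult deg_form_frag mono_form_def)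
qed

lemma deg_form_ideal:
  assumes "p \<in> chow_ideal N \<Sigma>"
  shows "deg_form p = 0"
proof -
  define K where "K = {p \<in> polys (rays \<Sigma>). \<forall>q\<in>polys (rays \<Sigma>). deg_form (q * p) = 0}"
  have "ideal K (poly_ring_on (rays \<Sigma>))"
  proof (rule poly_idealI)
    show "r * p \<in> K" if p: "p \<in> K" and r: "r \<in> polys (rays \<Sigma>)" for p r
    proof -
      have "deg_form (q * (r * p)) = 0" if "q \<in> polys (rays \<Sigma>)" for q
        using p polys_mult[OF that r] by (simp add: K_def flip: mult.assoc)
      then show ?thesis using p r by (auto simp: K_def polys_mult)
    qed
  qed (auto simp: K_def polys_0 polys_add deg_form_0 deg_form_add distrib_left)
  moreover have "chow_gens_I \<Sigma> \<union> chow_gens_J N \<Sigma> \<subseteq> K"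
  proof
    fix p assume p: "p \<in> chow_gens_I \<Sigma> \<union> chow_gens_J N \<Sigma>"
    have mono: "deg_form (frag_of m * p) = 0" if m: "Poly_Mapping.keys m \<subseteq> rays \<Sigma>" for m
      using p
    proof
      assume "p \<in> chow_gens_I \<Sigma>"
      then obtain R where "R \<subseteq> rays \<Sigma>" "R \<notin> faces" "p = (\<Prod>\<rho>\<in>R. Xvar \<rho>)"
        using faces_iff unfolding chow_gens_I_def by blast
      then show ?thesis using deg_form_nonface[OF m] by simp
    next
      assume "p \<in> chow_gens_J N \<Sigma>"
      then show ?thesis using deg_form_linear_rel[OF m] unfolding chow_gens_J_def by auto
    qed
    have "deg_form (q * p) = 0" if "q \<in> polys (rays \<Sigma>)" for q
    proof -
      have "Poly_Mapping.keys q \<subseteq> {m. Poly_Mapping.keys m \<subseteq> rays \<Sigma>}" using that by (auto simp: polys_iff)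
      then show ?thesis
        by (induction q rule: frag_induction) (auto simp: deg_form_0 deg_form_diff left_diff_distrib mono)
    qed
    moreover have "p \<in> polys (rays \<Sigma>)" using p chow_gens_polys by blast
    ultimately show "p \<in> K" by (simp add: K_def)
  qed
  ultimately have "chow_ideal N \<Sigma> \<subseteq> K"
    unfolding chow_ideal_def by (rule ring.genideal_minimal[OF cring.axioms(1)[OF poly_ring_cring]])
  then have "deg_form (1 * p) = 0" using assms polys_1 unfolding K_def by blast
  then show ?thesis by simp
qed

lemma deg_form_face:
  assumes "S \<in> faces" "card S = d"
  shows "deg_form (\<Prod>\<rho>\<in>S. Xvar \<rho>) = w S"
proof -
  note S = faces_props(3,4)[OF assms(1)]
  obtain l where l: "set l = S" "distinct l" using finite_distinct_list[OF S(2)] by blast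
  have "mono_form (sqfree_mono S) = fold act l w {}"
    by (rule mono_form_eq) (use S l assms(2) mlist_sqfree_mono[OF l(2)] in \<open>auto simp: keys_sqfree_mono mdeg_sqfree_mono\<close>)
  then show ?thesis using fold_act_distinct[OF l(2), of "{}" w] l(1) by (simp add: prod_Xvar deg_form_frag)
qed

text \<open>Applying \<open>r\<close> first covers the case that \<open>r\<close> belongs to
  \<open>S\<close>: the remaining rays are distinct and only evaluate the resulting weight at
  \<open>S\<close>.\<close>

lemma deg_form_face_mult:
  assumes "S \<in> faces" "card S + 1 = d" "r \<in> rays \<Sigma>"
  shows "deg_form ((\<Prod>\<rho>\<in>S. Xvar \<rho>) * Xvar r) = act r w S"
proof -
  note S = faces_props(3,4)[OF assms(1)]
  obtain l where l: "set l = S" "distinct l" using finite_distinct_list[OF S(2)] by blast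
  have k: "Poly_Mapping.keys (sqfree_mono S + Poly_Mapping.single r 1) \<subseteq> rays \<Sigma>"
    using keys_add[of "sqfree_mono S" "Poly_Mapping.single r 1"] S assms(3) by (auto simp: keys_sqfree_mono)
  have "mono_form (sqfree_mono S + Poly_Mapping.single r 1) = fold act (r # l) w {}"
    by (rule mono_form_eq[OF k])
      (use S l assms(2) mlist_sqfree_mono[OF l(2)] in \<open>auto simp: mdeg_add mdeg_sqfree_mono mlist_add mlist_single\<close>)
  then show ?thesis using fold_act_distinct[OF l(2), of "{}" "act r w"] l(1)
    by (simp add: prod_Xvar mult_Xvar deg_form_frag)
qed

lemma deg_form_int: "(\<And>T. w T \<in> \<int>) \<Longrightarrow> deg_form p \<in> \<int>"
  unfolding deg_form_def mono_form_def using fold_act_int[of w]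
  by (intro Ints_sum Ints_mult) auto

end

text \<open>Since the generators of a cone are part of a basis of \<open>N\<close>, a linear relation removes a repeated
  factor of a monomial at the cost of monomials with more variables.\<close>

lemma top_degree_zero:
  fixes F :: "'a set int_mpoly \<Rightarrow> int"
  assumes add: "\<And>p q. p \<in> polys (rays \<Sigma>) \<Longrightarrow> homogeneous d p \<Longrightarrow> q \<in> polys (rays \<Sigma>) \<Longrightarrow> homogeneous d q \<Longrightarrow> F (p + q) = F p + F q"
    and ideal: "\<And>p. p \<in> chow_ideal N \<Sigma> \<Longrightarrow> homogeneous d p \<Longrightarrow> F p = 0"
    and face: "\<And>S. S \<in> faces \<Longrightarrow> card S = d \<Longrightarrow> F (\<Prod>\<rho>\<in>S. Xvar \<rho>) = 0"
    and p: "p \<in> polys (rays \<Sigma>)" "homogeneous d p"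
  shows "F p = 0"
proof -
  define Z where "Z = {p \<in> polys (rays \<Sigma>). homogeneous d p \<and> F p = 0}"
  have Z0: "0 \<in> Z" using ideal[OF chow_ideal_closed(1) homogeneous_0] by (simp add: Z_def polys_0 homogeneous_0)
  have Zadd: "p + q \<in> Z" if "p \<in> Z" "q \<in> Z" for p q
    using that by (auto simp: Z_def polys_add homogeneous_add add)
  have Zneg: "- p \<in> Z" if "p \<in> Z" for p
    using that add[of p "- p"] Z0 by (auto simp: Z_def polys_uminus homogeneous_uminus)
  have Zdiff: "p - q \<in> Z" if "p \<in> Z" "q \<in> Z" for p q
    using Zadd[OF that(1) Zneg[OF that(2)]] by simp
  have Zint: "of_int c * p \<in> Z" if "p \<in> Z" for c p
  proof -
    have "of_nat n * p \<in> Z" for n by (induction n) (use that Z0 Zadd in \<open>auto simp: distrib_right\<close>)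
    then show ?thesis using Zneg[of "of_nat _ * p"] by (cases c rule: int_cases2) auto
  qed
  have Zsum: "sum G I \<in> Z" if "\<And>i. i \<in> I \<Longrightarrow> G i \<in> Z" for G and I :: "'a set set"
    using that by (induction I rule: infinite_finite_induct) (auto simp: Z0 Zadd)
  have Zideal: "p \<in> Z" if "p \<in> chow_ideal N \<Sigma>" "homogeneous d p" for p
    using that ideal chow_ideal_closed(5) by (simp add: Z_def)
  \<comment> \<open>The induction decreases the number of rays not occurring in the
    monomial.\<close>
  have mono: "frag_of m \<in> Z" if "Poly_Mapping.keys m \<subseteq> rays \<Sigma>" "mdeg m = d" for m
    using that
  proof (induction "card (rays \<Sigma>) - card (Poly_Mapping.keys m)" arbitrary: m rule: less_induct)
    case less
    let ?S = "Poly_Mapping.keys m"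
    have fin: "finite ?S" by simp
    have hom: "homogeneous d (frag_of m)" using homogeneous_frag[of m] less.prems by simp
    consider "?S \<notin> faces" | "?S \<in> faces" "\<forall>\<rho>\<in>?S. Poly_Mapping.lookup m \<rho> = 1"
      | \<rho> where "?S \<in> faces" "\<rho> \<in> ?S" "Poly_Mapping.lookup m \<rho> \<noteq> 1" by blast
    then show ?case
    proof cases
      case 1
      define m' where "m' = m - sqfree_mono ?S"
      have "m = m' + sqfree_mono ?S"
        by (rule poly_mapping_eqI) (auto simp: m'_def lookup_add lookup_minus lookup_sqfree_mono in_keys_iff)
      then have eq: "frag_of m = frag_of m' * (\<Prod>\<rho>\<in>?S. Xvar \<rho>)" by (simp only: prod_Xvar frag_of_mult)
      have "Poly_Mapping.keys m' \<subseteq> rays \<Sigma>"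
        using less.prems(1) by (auto simp: m'_def in_keys_iff lookup_minus)
      moreover have "(\<Prod>\<rho>\<in>?S. Xvar \<rho>) \<in> chow_ideal N \<Sigma>"
        by (rule subsetD[OF chow_gens_ideal(1)]) (use 1 less.prems(1) faces_iff in \<open>auto simp: chow_gens_I_def\<close>)
      ultimately have "frag_of m \<in> chow_ideal N \<Sigma>"
        unfolding eq by (intro chow_ideal_closed(4) polys_frag)
      then show ?thesis using Zideal hom by blast
    next
      case 2
      then have "m = sqfree_mono ?S" using fin
        by (intro poly_mapping_eqI) (auto simp: lookup_sqfree_mono in_keys_iff)
      then have eq: "frag_of m = (\<Prod>\<rho>\<in>?S. Xvar \<rho>)" by (simp add: prod_Xvar)
      have "card ?S = d" using 2(2) less.prems(2) by (simp add: mdeg_def)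
      then have "F (frag_of m) = 0" unfolding eq using face 2(1) by blast
      then show ?thesis using hom polys_frag[OF less.prems(1)] by (simp add: Z_def)
    next
      case 3
      \<comment> \<open>Only one copy of the repeated ray is removed, so \<open>m'\<close> has the
        same variables as \<open>m\<close>. In its product with the relation of
        \<open>dl ?S \<rho>\<close>, the term at \<open>\<rho>\<close> is \<open>m\<close>, the
        other rays of \<open>?S\<close> have coefficient 0, and every remaining term has one more
        variable.\<close>
      define m' where "m' = m - Poly_Mapping.single \<rho> 1"
      have m: "m = m' + Poly_Mapping.single \<rho> 1" using 3(2)
        by (intro poly_mapping_eqI) (auto simp: m'_def lookup_add lookup_minus lookup_single when_def in_keys_iff)
      have keys: "Poly_Mapping.keys m' = ?S" using 3(2,3)
        by (auto simp: m'_def lookup_minus lookup_single when_def in_keys_iff)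
      have deg: "mdeg m' + 1 = d" using less.prems(2) m by (simp add: mdeg_add)
      define c where "c r = \<lfloor>dl ?S \<rho> (e r)\<rfloor>" for r
      define G where "G r = (of_int (c r) * frag_of (m' + Poly_Mapping.single r 1) :: 'a set int_mpoly)" for r
      have "(\<Sum>r\<in>rays \<Sigma>. of_int \<lfloor>dl ?S \<rho> (e r)\<rfloor> * Xvar r) \<in> chow_ideal N \<Sigma>"
        by (rule subsetD[OF chow_gens_ideal(2)]) (use dl(1)[OF 3(1,2)] in \<open>auto simp: chow_gens_J_def\<close>)
      then have "frag_of m' * (\<Sum>r\<in>rays \<Sigma>. of_int \<lfloor>dl ?S \<rho> (e r)\<rfloor> * Xvar r) \<in> chow_ideal N \<Sigma>"
        using keys less.prems(1) by (intro chow_ideal_closed(4) polys_frag) auto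
      moreover have "frag_of m' * (\<Sum>r\<in>rays \<Sigma>. of_int \<lfloor>dl ?S \<rho> (e r)\<rfloor> * Xvar r) = sum G (rays \<Sigma>)"
        by (simp add: sum_distrib_left mult.left_commute[of "frag_of m'"] mult_Xvar G_def c_def)
      moreover have "homogeneous d (sum G (rays \<Sigma>))"
      proof (rule homogeneous_sum)
        fix r
        have "homogeneous (0 + mdeg (m' + Poly_Mapping.single r 1)) (G r)"
          unfolding G_def by (intro homogeneous_mult homogeneous_of_int homogeneous_frag)
        then show "homogeneous d (G r)" using deg by (simp add: mdeg_add)
      qed
      ultimately have rel: "sum G (rays \<Sigma>) \<in> Z" using Zideal by simp
      have Gzero: "G r = 0" if "r \<in> ?S" "r \<noteq> \<rho>" for r
        using dl(3)[OF 3(1,2) that(1)] that(2) by (simp add: G_def c_def)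
      have G\<rho>: "G \<rho> = frag_of m" using dl(3)[OF 3(1,2,2)] m by (simp add: G_def c_def)
      have \<rho>: "\<rho> \<in> rays \<Sigma>" using 3(2) less.prems(1) by blast
      have "sum G (rays \<Sigma> - {\<rho>}) \<in> Z"
      proof (rule Zsum)
        fix r assume r: "r \<in> rays \<Sigma> - {\<rho>}"
        show "G r \<in> Z"
        proof (cases "r \<in> ?S")
          case True
          then show ?thesis using Gzero r Z0 by simp
        next
          case False
          let ?n = "m' + Poly_Mapping.single r 1"
          have kn: "Poly_Mapping.keys ?n = insert r ?S"
            unfolding keys[symmetric] by (auto simp: in_keys_iff lookup_add lookup_single when_def split: if_splits)
          have sub: "insert r ?S \<subseteq> rays \<Sigma>" using less.prems(1) r by blast
          have "card (insert r ?S) \<le> card (rays \<Sigma>)" using card_mono[OF finite_rays(1) sub] .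
          then have "card (rays \<Sigma>) - card (Poly_Mapping.keys ?n) < card (rays \<Sigma>) - card ?S"
            using False by (simp add: kn)
          then have "frag_of ?n \<in> Z" by (rule less.hyps) (use sub deg in \<open>auto simp: kn mdeg_add\<close>)
          then show ?thesis unfolding G_def by (rule Zint)
        qed
      qed
      with rel have "sum G (rays \<Sigma>) - sum G (rays \<Sigma> - {\<rho>}) \<in> Z" by (rule Zdiff)
      then show ?thesis using G\<rho> sum.remove[OF finite_rays(1) \<rho>, of G] by simp
    qed
  qed
  have "Poly_Mapping.keys p \<subseteq> {m. Poly_Mapping.keys m \<subseteq> rays \<Sigma> \<and> mdeg m = d}"
    using p by (auto simp: polys_iff homogeneous_iff)
  then have "p \<in> Z" by (induction p rule: frag_induction) (auto simp: Z0 Zdiff mono)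
  then show ?thesis by (simp add: Z_def)
qed

end

text \<open>Evaluates the definite description once for both fans: \<open>D\<close> provides the
  candidate, and \<open>unique\<close> excludes any other. Uniqueness is a hypothesis because on the
  modification it is transported from \<Sigma>.\<close>

lemma chow_deg_class:
  fixes N :: "'a::euclidean_space set" and D :: "'a set int_mpoly \<Rightarrow> int"
  assumes fin: "finite (rays \<Sigma>)"
    and D_add: "\<And>p q. p \<in> polys (rays \<Sigma>) \<Longrightarrow> q \<in> polys (rays \<Sigma>) \<Longrightarrow> D (p + q) = D p + D q"
    and D_ideal: "\<And>p. p \<in> chow_ideal N \<Sigma> \<Longrightarrow> D p = 0"
    and D_cone: "\<And>\<sigma>. \<sigma> \<in> cones_of_dim \<Sigma> d \<Longrightarrow> D (\<Prod>\<rho>\<in>{\<rho>\<in>rays \<Sigma>. \<rho> \<subseteq> \<sigma>}. Xvar \<rho>) = \<omega> \<sigma>"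
    and card_cone: "\<And>\<sigma>. \<sigma> \<in> cones_of_dim \<Sigma> d \<Longrightarrow> card {\<rho>\<in>rays \<Sigma>. \<rho> \<subseteq> \<sigma>} = d"
    and unique: "\<And>(F :: 'a set int_mpoly \<Rightarrow> int) p.
      (\<And>p q. p \<in> polys (rays \<Sigma>) \<Longrightarrow> homogeneous d p \<Longrightarrow> q \<in> polys (rays \<Sigma>) \<Longrightarrow> homogeneous d q \<Longrightarrow> F (p + q) = F p + F q) \<Longrightarrow>
      (\<And>p. p \<in> chow_ideal N \<Sigma> \<Longrightarrow> homogeneous d p \<Longrightarrow> F p = 0) \<Longrightarrow>
      (\<And>\<sigma>. \<sigma> \<in> cones_of_dim \<Sigma> d \<Longrightarrow> F (\<Prod>\<rho>\<in>{\<rho>\<in>rays \<Sigma>. \<rho> \<subseteq> \<sigma>}. Xvar \<rho>) = 0) \<Longrightarrow>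
      p \<in> polys (rays \<Sigma>) \<Longrightarrow> homogeneous d p \<Longrightarrow> F p = 0"
  shows "p \<in> polys (rays \<Sigma>) \<Longrightarrow> homogeneous d p \<Longrightarrow> chow_deg N \<Sigma> d \<omega> (chow_class N \<Sigma> p) = D p"
proof -
  let ?G = "chow_graded N \<Sigma> d" and ?A = "chow_ring N \<Sigma>" and ?x = "\<lambda>\<sigma>. \<Prod>\<rho>\<in>{\<rho>\<in>rays \<Sigma>. \<rho> \<subseteq> \<sigma>}. Xvar \<rho> :: 'a set int_mpoly"
  have G: "a \<in> ?G \<longleftrightarrow> (\<exists>p. p \<in> polys (rays \<Sigma>) \<and> homogeneous d p \<and> a = chow_class N \<Sigma> p)" for a
    unfolding chow_graded_def by auto
  have x: "?x \<sigma> \<in> polys (rays \<Sigma>)" for \<sigma> by (intro polys_prod polys_Xvar) auto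
  have xG: "chow_x N \<Sigma> \<sigma> \<in> ?G" if "\<sigma> \<in> cones_of_dim \<Sigma> d" for \<sigma>
  proof -
    have "homogeneous (\<Sum>\<rho>\<in>{\<rho>\<in>rays \<Sigma>. \<rho> \<subseteq> \<sigma>}. 1) (?x \<sigma>)"
      using fin by (intro homogeneous_prod homogeneous_Xvar) auto
    then have "homogeneous d (?x \<sigma>)" using card_cone[OF that] by (simp flip: card_eq_sum)
    then show ?thesis unfolding chow_x_class[OF fin] G using x by blast
  qed
  have eq: "D p = D q" if "p \<in> polys (rays \<Sigma>)" "q \<in> polys (rays \<Sigma>)" "p - q \<in> chow_ideal N \<Sigma>" for p q
    using D_add[of "p - q" q] D_ideal[of "p - q"] that by (simp add: polys_diff)
  obtain H where H: "\<And>p. p \<in> polys (rays \<Sigma>) \<Longrightarrow> H (chow_class N \<Sigma> p) = D p"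
  proof (rule quot_lift[OF chow_ideal, where f = D])
    fix p q assume pq: "p \<in> polys (rays \<Sigma>)" "q \<in> polys (rays \<Sigma>)" "p \<ominus>\<^bsub>poly_ring_on (rays \<Sigma>)\<^esub> q \<in> chow_ideal N \<Sigma>"
    then show "D p = D q" using eq poly_ring_minus[OF pq(1,2)] by simp
  qed (auto simp: chow_class_def)
  have deg: "chow_deg N \<Sigma> d \<omega> = restrict H ?G"
    unfolding chow_deg_def
  proof (rule the_equality)
    have "additive_map_on ?A ?G (restrict H ?G)"
      unfolding additive_map_on_def
    proof (intro ballI)
      fix a b assume "a \<in> ?G" "b \<in> ?G"
      then obtain p q where pq: "p \<in> polys (rays \<Sigma>)" "homogeneous d p" "a = chow_class N \<Sigma> p"
        "q \<in> polys (rays \<Sigma>)" "homogeneous d q" "b = chow_class N \<Sigma> q" unfolding G by blast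
      have ab: "a \<oplus>\<^bsub>?A\<^esub> b = chow_class N \<Sigma> (p + q)" using chow_class_ops(1)[OF pq(1,4)] pq(3,6) by simp
      have "a \<oplus>\<^bsub>?A\<^esub> b \<in> ?G" unfolding ab G using pq by (auto intro: polys_add homogeneous_add)
      moreover have "H (a \<oplus>\<^bsub>?A\<^esub> b) = H a + H b" unfolding ab using pq by (simp add: H polys_add D_add)
      ultimately show "restrict H ?G (a \<oplus>\<^bsub>?A\<^esub> b) = restrict H ?G a + restrict H ?G b"
        using \<open>a \<in> ?G\<close> \<open>b \<in> ?G\<close> by simp
    qed
    moreover have "restrict H ?G (chow_x N \<Sigma> \<sigma>) = \<omega> \<sigma>" if "\<sigma> \<in> cones_of_dim \<Sigma> d" for \<sigma>
      using xG[OF that] H[OF x] D_cone[OF that] by (simp add: chow_x_class[OF fin])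
    ultimately show "restrict H ?G \<in> extensional ?G \<and> additive_map_on ?A ?G (restrict H ?G) \<and>
        (\<forall>\<sigma>\<in>cones_of_dim \<Sigma> d. restrict H ?G (chow_x N \<Sigma> \<sigma>) = \<omega> \<sigma>)" by simp
  next
    fix h assume h: "h \<in> extensional ?G \<and> additive_map_on ?A ?G h \<and> (\<forall>\<sigma>\<in>cones_of_dim \<Sigma> d. h (chow_x N \<Sigma> \<sigma>) = \<omega> \<sigma>)"
    \<comment> \<open>The difference of two candidates vanishes on the classes of top-dimensional
      cones, so \<open>unique\<close> annihilates it.\<close>
    define F where "F p = h (chow_class N \<Sigma> p) - D p" for p
    have hadd: "h (chow_class N \<Sigma> (p + q)) = h (chow_class N \<Sigma> p) + h (chow_class N \<Sigma> q)"
      if "p \<in> polys (rays \<Sigma>)" "homogeneous d p" "q \<in> polys (rays \<Sigma>)" "homogeneous d q" for p q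
    proof -
      have "chow_class N \<Sigma> p \<in> ?G" "chow_class N \<Sigma> q \<in> ?G" using that unfolding G by auto
      then show ?thesis using h that by (simp add: additive_map_on_def chow_class_ops)
    qed
    have h0: "h (chow_class N \<Sigma> 0) = 0" using hadd[of 0 0] by (simp add: polys_0 homogeneous_0)
    have F: "F p = 0" if p: "p \<in> polys (rays \<Sigma>)" "homogeneous d p" for p
    proof (rule unique[OF _ _ _ p])
      fix p assume "p \<in> chow_ideal N \<Sigma>"
      then have "chow_class N \<Sigma> p = chow_class N \<Sigma> 0"
        using chow_class_zero_iff[OF chow_ideal_closed(5)[OF \<open>p \<in> chow_ideal N \<Sigma>\<close>]] by (simp add: chow_class_0)
      then show "F p = 0" using h0 D_ideal \<open>p \<in> chow_ideal N \<Sigma>\<close> by (simp add: F_def)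
    next
      fix \<sigma> assume "\<sigma> \<in> cones_of_dim \<Sigma> d"
      then show "F (?x \<sigma>) = 0" using h D_cone[of \<sigma>] by (simp add: F_def chow_x_class[OF fin])
    qed (simp add: F_def hadd D_add)
    show "h = restrict H ?G"
    proof (rule extensionalityI)
      fix a assume "a \<in> ?G"
      then obtain p where "p \<in> polys (rays \<Sigma>)" "homogeneous d p" "a = chow_class N \<Sigma> p" unfolding G by blast
      then show "h a = restrict H ?G a" using F[of p] \<open>a \<in> ?G\<close> by (simp add: F_def H)
    qed (use h in auto)
  qed
  show "chow_deg N \<Sigma> d \<omega> (chow_class N \<Sigma> p) = D p" if p: "p \<in> polys (rays \<Sigma>)" "homogeneous d p"
  proof -
    have "chow_class N \<Sigma> p \<in> ?G" using p unfolding G by auto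
    then show ?thesis using H[OF p(1)] by (simp add: deg)
  qed
qed

section \<open>The rational degree map\<close>

lemma rat_chow_graded_carrier:
  assumes "a \<in> chow_graded N \<Sigma> k"
  shows "a \<in> carrier (chow_ring N \<Sigma>)" "pure_tensor (chow_ring N \<Sigma>) a s \<in> carrier (rat_chow_ring N \<Sigma>)"
proof -
  interpret cring "chow_ring N \<Sigma>" by (rule chow_ring_cring)
  show "a \<in> carrier (chow_ring N \<Sigma>)" using assms by (auto simp: chow_graded_def chow_carrier)
  then show "pure_tensor (chow_ring N \<Sigma>) a s \<in> carrier (rat_chow_ring N \<Sigma>)"
    unfolding rat_chow_ring_def by (rule pure_carrier)
qed

lemma rat_chow_ring: "ring (rat_chow_ring N \<Sigma>)"
  unfolding rat_chow_ring_def by (rule cring.rat_tensor_ring[OF chow_ring_cring])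

lemma rat_chow_graded_subgroup:
  "subgroup (rat_chow_graded N \<Sigma> k) (add_monoid (rat_chow_ring N \<Sigma>))"
  unfolding rat_chow_graded_def
  by (rule group.generate_is_subgroup[OF abelian_group.a_group[OF ring.is_abelian_group[OF rat_chow_ring]]])
    (auto intro: rat_chow_graded_carrier)

lemma additive_map_eq_generate:
  assumes R: "ring R" and S: "S \<subseteq> carrier R"
    and h: "additive_map_on R (generate (add_monoid R) S) h" and h': "additive_map_on R (generate (add_monoid R) S) h'"
    and eq: "\<And>x. x \<in> S \<Longrightarrow> h x = (h' x :: 'k::ab_group_add)" and x: "x \<in> generate (add_monoid R) S"
  shows "h x = h' x"
proof -
  interpret ring R by (rule R)
  let ?G = "generate (add_monoid R) S"
  have sub: "subgroup ?G (add_monoid R)" using S by (intro add.generate_is_subgroup) simp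
  define F where "F x = h x - h' x" for x
  have add: "F (x \<oplus>\<^bsub>R\<^esub> y) = F x + F y" if "x \<in> ?G" "y \<in> ?G" for x y
    using h h' that by (simp add: F_def additive_map_on_def)
  have carr: "x \<in> carrier R" if "x \<in> ?G" for x using subgroup.mem_carrier[OF sub that] by simp
  have zero: "\<zero>\<^bsub>R\<^esub> \<in> ?G" using subgroup.one_closed[OF sub] by simp
  have F0: "F \<zero>\<^bsub>R\<^esub> = 0" using add[OF zero zero] by simp
  have "F x = 0"
    using x
  proof (induction x rule: generate.induct)
    case one
    show ?case using F0 by simp
  next
    case (incl a)
    then show ?case by (simp add: F_def eq)
  next
    case (inv a)
    have a: "a \<in> ?G" "inv\<^bsub>add_monoid R\<^esub> a \<in> ?G" using inv by (auto intro: generate.intros)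
    have "F (a \<oplus>\<^bsub>R\<^esub> (inv\<^bsub>add_monoid R\<^esub> a)) = 0" using F0 carr[OF a(1)] by (simp add: r_neg flip: a_inv_def)
    then show ?case using add[OF a] inv by (simp add: F_def eq)
  next
    case (eng a b)
    then show ?case using add by simp
  qed
  then show ?thesis by (simp add: F_def)
qed

lemma rat_chow_deg_eq:
  assumes add: "\<And>x y. x \<in> carrier (rat_chow_ring N \<Sigma>) \<Longrightarrow> y \<in> carrier (rat_chow_ring N \<Sigma>) \<Longrightarrow>
      E (x \<oplus>\<^bsub>rat_chow_ring N \<Sigma>\<^esub> y) = E x + E y"
    and pure: "\<And>a s. a \<in> chow_graded N \<Sigma> d \<Longrightarrow> E (pure_tensor (chow_ring N \<Sigma>) a s) = of_int (chow_deg N \<Sigma> d \<omega> a) * s"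
    and x: "x \<in> rat_chow_graded N \<Sigma> d"
  shows "rat_chow_deg N \<Sigma> d \<omega> x = E x"
proof -
  let ?G = "rat_chow_graded N \<Sigma> d" and ?Q = "rat_chow_ring N \<Sigma>" and ?S = "{pure_tensor (chow_ring N \<Sigma>) a s | a s. a \<in> chow_graded N \<Sigma> d}"
  interpret G: subgroup ?G "add_monoid ?Q" by (rule rat_chow_graded_subgroup)
  have pG: "pure_tensor (chow_ring N \<Sigma>) a s \<in> ?G" if "a \<in> chow_graded N \<Sigma> d" for a s
    unfolding rat_chow_graded_def using that by (intro generate.incl) blast
  have "rat_chow_deg N \<Sigma> d \<omega> = restrict E ?G"
    unfolding rat_chow_deg_def
  proof (rule the_equality)
    show E: "restrict E ?G \<in> extensional ?G \<and> additive_map_on ?Q ?G (restrict E ?G) \<and>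
        (\<forall>a\<in>chow_graded N \<Sigma> d. \<forall>s. restrict E ?G (pure_tensor (chow_ring N \<Sigma>) a s) = of_int (chow_deg N \<Sigma> d \<omega> a) * s)"
      using G.m_closed G.mem_carrier pG pure add by (auto simp: additive_map_on_def)
    fix h assume h: "h \<in> extensional ?G \<and> additive_map_on ?Q ?G h \<and>
        (\<forall>a\<in>chow_graded N \<Sigma> d. \<forall>s. h (pure_tensor (chow_ring N \<Sigma>) a s) = of_int (chow_deg N \<Sigma> d \<omega> a) * s)"
    have eq: "h y = restrict E ?G y" if "y \<in> ?S" for y
    proof -
      obtain a s where a: "a \<in> chow_graded N \<Sigma> d" "y = pure_tensor (chow_ring N \<Sigma>) a s" using \<open>y \<in> ?S\<close> by blast
      show ?thesis
        unfolding a(2) conjunct2[OF conjunct2[OF h], rule_format, OF a(1)] conjunct2[OF conjunct2[OF E], rule_format, OF a(1)] ..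
    qed
    show "h = restrict E ?G"
    proof (rule extensionalityI)
      fix x assume "x \<in> ?G"
      then show "h x = restrict E ?G x"
        unfolding rat_chow_graded_def
      proof (rule additive_map_eq_generate[OF rat_chow_ring, rotated -1])
        show "additive_map_on ?Q (generate (add_monoid ?Q) ?S) h" "additive_map_on ?Q (generate (add_monoid ?Q) ?S) (restrict E (generate (add_monoid ?Q) ?S))"
          using h E unfolding rat_chow_graded_def by blast+
        show "?S \<subseteq> carrier ?Q" using rat_chow_graded_carrier by blast
        show "h y = restrict E (generate (add_monoid ?Q) ?S) y" if "y \<in> ?S" for y
          using that eq unfolding rat_chow_graded_def by blast
      qed
    qed (use h in auto)
  qed
  then show ?thesis using x by simp
qed

section \<open>Compatibility with the degree maps\<close>

locale unimodular_modif = tropical_modif N \<Sigma> f d \<omega> + unimodular_lattice_fan N \<Sigma>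
  for N :: "'a::euclidean_space set" and \<Sigma> f d \<omega>
begin

definition face_weight :: "'a set set \<Rightarrow> real" where
  "face_weight T = (if T \<in> faces \<and> card T = d then of_int (\<omega> (cone_of T)) else 0)"

text \<open>Since \<open>kap\<close> is 1 and non-faces carry no weight, sums over all rays outside
  \<open>\<tau>\<close> agree with the sums over the link that express balancing and orders.\<close>

lemma sum_face_weight:
  fixes F :: "'a set \<Rightarrow> 'v::real_vector"
  assumes \<tau>: "\<tau> \<in> \<Sigma>" "dim \<tau> + 1 = d"
  shows "(\<Sum>r\<in>rays \<Sigma> - gens \<tau>. face_weight (insert r (gens \<tau>)) *\<^sub>R F r)
    = (\<Sum>r\<in>link \<tau>. (of_int (\<omega> (join \<tau> r)) * kap (join \<tau> r) \<tau> r) *\<^sub>R F r)"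
proof (rule sum.mono_neutral_cong_right)
  show "link \<tau> \<subseteq> rays \<Sigma> - gens \<tau>" by (auto simp: link_def)
  show "\<forall>r\<in>rays \<Sigma> - gens \<tau> - link \<tau>. face_weight (insert r (gens \<tau>)) *\<^sub>R F r = 0"
    by (auto simp: link_def face_weight_def)
  fix r assume r: "r \<in> link \<tau>"
  note j = join[OF \<tau>(1) r]
  have "insert r (gens \<tau>) \<in> faces" "card (insert r (gens \<tau>)) = d"
    using r j(3) \<tau> gens_props(2)[OF \<tau>(1)] by (auto simp: link_def)
  then show "face_weight (insert r (gens \<tau>)) *\<^sub>R F r = (of_int (\<omega> (join \<tau> r)) * kap (join \<tau> r) \<tau> r) *\<^sub>R F r"
    by (simp add: face_weight_def kap_1[OF \<tau>(1) j(1) j(3) j(2)])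
qed (use finite_rays in auto)

lemma face_weight: "weight d face_weight"
  unfolding weight_def
proof (intro conjI allI ballI impI)
  fix T assume T: "T \<in> faces" "card T + 1 = d"
  let ?\<tau> = "cone_of T"
  note F = faces_props[OF T(1)]
  have d: "dim ?\<tau> + 1 = d" using F(6) T(2) by simp
  have "wsum \<omega> ?\<tau> \<in> span ?\<tau>" using balanced_\<omega> F(1) d unfolding balanced_wsum by blast
  from span_diff[OF this wsum_kap[OF F(1), of \<omega>]]
  have "wvec face_weight (gens ?\<tau>) \<in> span ?\<tau>" unfolding wvec_def sum_face_weight[OF F(1) d] by simp
  then show "wvec face_weight T \<in> span (e ` T)" using span_gens[OF F(1)] F(2) by simp
qed (auto simp: face_weight_def split: if_splits)

text \<open>By the linear relation of \<open>fl \<delta>\<close>, f may be replaced by its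
  difference with \<open>fl \<delta>\<close>. This vanishes on the rays of \<open>\<delta>\<close>,
  and what remains is the sum over the link that defines the order.\<close>

lemma face_weight_divisor:
  assumes \<delta>: "\<delta> \<in> \<Sigma>" "dim \<delta> + 1 = d"
  shows "ordr \<omega> \<delta> = - (\<Sum>r\<in>rays \<Sigma>. act r face_weight (gens \<delta>) * f (e r))"
proof -
  let ?T = "gens \<delta>"
  have T: "?T \<in> faces" "card ?T + 1 = d" using \<delta> gens_props(2) by (auto simp: faces_def)
  note lin = fl_props(1)[OF \<delta>(1)]
  have fe: "fl \<delta> (e r) = f (e r)" if "r \<in> ?T" for r using fl_props(2)[OF \<delta>(1) e_gens_in[OF that]] .
  have "weight (card ?T + 1) face_weight" using face_weight T(2) by simp
  from act_linear_relation[OF this T(1) refl lin]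
  have "(\<Sum>r\<in>rays \<Sigma>. act r face_weight ?T * fl \<delta> (e r)) = 0" .
  then have "(\<Sum>r\<in>rays \<Sigma>. act r face_weight ?T * f (e r)) = (\<Sum>r\<in>rays \<Sigma>. act r face_weight ?T * (f (e r) - fl \<delta> (e r)))"
    by (simp add: right_diff_distrib sum_subtractf)
  also have "\<dots> = (\<Sum>r\<in>rays \<Sigma> - ?T. act r face_weight ?T * (f (e r) - fl \<delta> (e r)))"
    using gens_rays[of \<delta>] finite_rays fe by (intro sum.mono_neutral_right) auto
  also have "\<dots> = (\<Sum>r\<in>rays \<Sigma> - ?T. face_weight (insert r ?T) *\<^sub>R (f (e r) - fl \<delta> (e r)))"
    by (rule sum.cong) (auto simp: act_notin)
  also have "\<dots> = - ordr \<omega> \<delta>"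
    unfolding sum_face_weight[OF \<delta>] ordr_kap[OF \<delta>(1)]
    by (simp add: linear_sum[OF lin] linear_scale[OF lin] right_diff_distrib sum_subtractf)
  finally show ?thesis by simp
qed

abbreviation dform :: "'a set int_mpoly \<Rightarrow> int" where
  "dform p \<equiv> \<lfloor>deg_form face_weight d p\<rfloor>"

lemma dform_real: "of_int (dform p) = deg_form face_weight d p"
proof -
  have "face_weight T \<in> \<int>" for T by (simp add: face_weight_def)
  then have "deg_form face_weight d p \<in> \<int>" by (rule deg_form_int[OF face_weight])
  then show ?thesis by (auto elim: Ints_cases)
qed

lemma dform_add: "dform (p + q) = dform p + dform q"
proof -
  have "real_of_int (dform (p + q)) = of_int (dform p + dform q)"
    unfolding of_int_add dform_real by (rule deg_form_add[OF face_weight])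
  then show ?thesis by (simp only: of_int_eq_iff)
qed

lemma dform_ideal: "p \<in> chow_ideal N \<Sigma> \<Longrightarrow> dform p = 0"
  using deg_form_ideal[OF face_weight] by simp

text \<open>Degrees take values in a torsion-free group. This is what lets the degree descend to the
  modification, where \<open>drop_var\<close> sends relations only into the torsion ideal.\<close>

lemma dform_torsion:
  assumes "p \<in> torsion_ideal N \<Sigma>" shows "dform p = 0"
proof -
  obtain n where n: "n > 0" "of_nat n * p \<in> chow_ideal N \<Sigma>" using assms by (auto simp: torsion_ideal_def)
  have "deg_form face_weight d (of_int (int n) * p) = 0" using deg_form_ideal[OF face_weight n(2)] by simp
  then have "deg_form face_weight d p = 0" using n(1) unfolding deg_form_of_int[OF face_weight] by simp
  then show ?thesis by simp
qed

lemma rays_below: "\<sigma> \<in> \<Sigma> \<Longrightarrow> {\<rho>\<in>rays \<Sigma>. \<rho> \<subseteq> \<sigma>} = gens \<sigma>"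
  by (simp add: gens_def)

lemma dform_cone:
  assumes "\<sigma> \<in> cones_of_dim \<Sigma> d"
  shows "dform (\<Prod>\<rho>\<in>gens \<sigma>. Xvar \<rho>) = \<omega> \<sigma>"
proof -
  have \<sigma>: "\<sigma> \<in> \<Sigma>" "card (gens \<sigma>) = d" using assms gens_props(2) by (auto simp: cones_of_dim_def)
  then have F: "gens \<sigma> \<in> faces" by (simp add: faces_def)
  have "deg_form face_weight d (\<Prod>\<rho>\<in>gens \<sigma>. Xvar \<rho>) = of_int (\<omega> \<sigma>)"
    using deg_form_face[OF face_weight F \<sigma>(2)] F \<sigma> by (simp add: face_weight_def cone_of_gens)
  then show ?thesis by simp
qed

lemma dform_divisor:
  assumes \<delta>: "\<delta> \<in> \<Delta>" "dim \<delta> + 1 = d"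
  shows "dform (- fdiv * (\<Prod>\<rho>\<in>gens \<delta>. Xvar \<rho>)) = \<omega>' (uc \<delta>)"
proof -
  note \<delta>\<Sigma> = \<Delta>_sub[OF \<delta>(1)]
  let ?x = "\<Prod>\<rho>\<in>gens \<delta>. Xvar \<rho> :: 'a set int_mpoly"
  have T: "gens \<delta> \<in> faces" "card (gens \<delta>) + 1 = d" using \<delta> \<delta>\<Sigma> gens_props(2) by (auto simp: faces_def)
  have "- fdiv * ?x = 0 - (\<Sum>\<rho>\<in>rays \<Sigma>. of_int \<lfloor>f (e \<rho>)\<rfloor> * (?x * Xvar \<rho>))"
    by (simp add: fdiv_def sum_distrib_left ac_simps)
  then have "deg_form face_weight d (- fdiv * ?x) = - (\<Sum>\<rho>\<in>rays \<Sigma>. of_int \<lfloor>f (e \<rho>)\<rfloor> * act \<rho> face_weight (gens \<delta>))"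
    by (simp only: deg_form_diff[OF face_weight] deg_form_sum[OF face_weight] deg_form_of_int[OF face_weight] deg_form_0[OF face_weight])
      (simp add: deg_form_face_mult[OF face_weight T])
  also have "\<dots> = ordr \<omega> \<delta>"
    unfolding face_weight_divisor[OF \<delta>\<Sigma> \<delta>(2)] by (simp add: f_ray_int mult.commute)
  also have "\<dots> = of_int (\<omega>' (uc \<delta>))" using \<omega>'_uc[OF \<delta>] by simp
  finally show ?thesis by simp
qed

lemma chow_deg_source:
  "p \<in> polys (rays \<Sigma>) \<Longrightarrow> homogeneous d p \<Longrightarrow> chow_deg N \<Sigma> d \<omega> (chow_class N \<Sigma> p) = dform p"
proof (rule chow_deg_class)
  fix F :: "'a set int_mpoly \<Rightarrow> int" and p
  assume F: "\<And>p q. p \<in> polys (rays \<Sigma>) \<Longrightarrow> homogeneous d p \<Longrightarrow> q \<in> polys (rays \<Sigma>) \<Longrightarrow> homogeneous d q \<Longrightarrow> F (p + q) = F p + F q"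
    "\<And>p. p \<in> chow_ideal N \<Sigma> \<Longrightarrow> homogeneous d p \<Longrightarrow> F p = 0"
    "\<And>\<sigma>. \<sigma> \<in> cones_of_dim \<Sigma> d \<Longrightarrow> F (\<Prod>\<rho>\<in>{\<rho>\<in>rays \<Sigma>. \<rho> \<subseteq> \<sigma>}. Xvar \<rho>) = 0"
    and p: "p \<in> polys (rays \<Sigma>)" "homogeneous d p"
  show "F p = 0"
  proof (rule top_degree_zero[OF F(1,2) _ p])
    fix S assume S: "S \<in> faces" "card S = d"
    note P = faces_props[OF S(1)]
    have "cone_of S \<in> cones_of_dim \<Sigma> d" using P S(2) by (simp add: cones_of_dim_def)
    from F(3)[OF this] show "F (\<Prod>\<rho>\<in>S. Xvar \<rho>) = 0" unfolding rays_below[OF P(1)] P(2) .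
  qed
next
  fix \<sigma> assume \<sigma>: "\<sigma> \<in> cones_of_dim \<Sigma> d"
  then have \<Sigma>: "\<sigma> \<in> \<Sigma>" "dim \<sigma> = d" by (auto simp: cones_of_dim_def)
  show "dform (\<Prod>\<rho>\<in>{\<rho>\<in>rays \<Sigma>. \<rho> \<subseteq> \<sigma>}. Xvar \<rho>) = \<omega> \<sigma>" "card {\<rho>\<in>rays \<Sigma>. \<rho> \<subseteq> \<sigma>} = d"
    unfolding rays_below[OF \<Sigma>(1)] using dform_cone[OF \<sigma>] gens_props(2)[OF \<Sigma>(1)] \<Sigma>(2) by simp_all
qed (use finite_rays dform_add dform_ideal in auto)

lemma rays_below_gc: "\<sigma> \<in> \<Sigma> \<Longrightarrow> {\<zeta>\<in>rays \<Sigma>'. \<zeta> \<subseteq> gc \<sigma>} = gc ` gens \<sigma>"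
  using uc_gc_not_subset[OF zero_cone(1), of \<sigma>] gc_subset[of _ \<sigma>] unfolding rays_\<Sigma>' gens_def
  by (cases "{0} \<in> \<Delta>"; simp only: if_True if_False; blast)

lemma rays_below_uc:
  assumes "\<delta> \<in> \<Delta>" shows "{\<zeta>\<in>rays \<Sigma>'. \<zeta> \<subseteq> uc \<delta>} = insert up (gc ` gens \<delta>)"
proof -
  have "{0} \<subseteq> \<delta>" using zero_in[OF \<Delta>_sub[OF assms]] by simp
  then have "{0} \<in> \<Delta>" "up \<subseteq> uc \<delta>" using \<Delta>_face[OF assms zero_cone(1)] by auto
  then show ?thesis using gc_uc_subset[of _ \<delta>] unfolding rays_\<Sigma>' gens_def by (simp only: if_True; blast)
qed

lemma prod_gc: "(\<Prod>\<zeta>\<in>gc ` R. F \<zeta>) = (\<Prod>\<rho>\<in>R. F (gc \<rho>))"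
  by (subst prod.reindex) (auto simp: inj_on_def)

lemma up_notin_gc: "up \<notin> gc ` R"
  using up_neq_gc by auto

text \<open>The degree of \<Sigma> after \<open>drop_var\<close> has the right value on
  \<open>uc \<delta>\<close> by \<open>dform_divisor\<close>. For uniqueness, \<open>q\<close>
  differs from the lift of its drop by a homogeneous relation, and an additive function composed
  with the lift is subject to uniqueness on \<Sigma>.\<close>

lemma chow_deg_target:
  "q \<in> polys (rays \<Sigma>') \<Longrightarrow> homogeneous d q \<Longrightarrow> chow_deg N' \<Sigma>' d \<omega>' (chow_class N' \<Sigma>' q) = dform (ev drop_var q)"
proof (rule chow_deg_class)
  fix q assume "q \<in> chow_ideal N' \<Sigma>'"
  then show "dform (ev drop_var q) = 0"
    using drop_ideal[OF torsion_ideal chow_ideal_subset_torsion star_relation_torsion] dform_torsion by blast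
next
  fix \<zeta> assume "\<zeta> \<in> cones_of_dim \<Sigma>' d"
  then consider (g) \<sigma> where "\<sigma> \<in> cones_of_dim \<Sigma> d" "\<zeta> = gc \<sigma>" | (u) \<delta> where "\<delta> \<in> \<Delta>" "dim \<delta> + 1 = d" "\<zeta> = uc \<delta>"
    unfolding cones_\<Sigma>' by blast
  then have "dform (ev drop_var (\<Prod>\<rho>\<in>{\<rho>\<in>rays \<Sigma>'. \<rho> \<subseteq> \<zeta>}. Xvar \<rho>)) = \<omega>' \<zeta> \<and> card {\<rho>\<in>rays \<Sigma>'. \<rho> \<subseteq> \<zeta>} = d"
  proof cases
    case g
    then have \<sigma>: "\<sigma> \<in> \<Sigma>" "card (gens \<sigma>) = d" using gens_props(2)[of \<sigma>] by (auto simp: cones_of_dim_def)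
    have "card (gc ` gens \<sigma>) = d" using \<sigma>(2) by (subst card_image) (auto simp: inj_on_def)
    then show ?thesis unfolding g(2) rays_below_gc[OF \<sigma>(1)] ev_prod ev_Xvar prod_gc drop_gc
      using dform_cone[OF g(1)] \<omega>'_gc[OF g(1)] by simp
  next
    case u
    have "card (gc ` gens \<delta>) + 1 = d" using u(2) gens_props(2)[OF \<Delta>_sub[OF u(1)]] by (subst card_image) (auto simp: inj_on_def)
    then show ?thesis unfolding u(3) rays_below_uc[OF u(1)] ev_prod ev_Xvar
      using dform_divisor[OF u(1,2)] up_notin_gc[of "gens \<delta>"] by (simp add: prod_gc drop_gc drop_up)
  qed
  then show "dform (ev drop_var (\<Prod>\<rho>\<in>{\<rho>\<in>rays \<Sigma>'. \<rho> \<subseteq> \<zeta>}. Xvar \<rho>)) = \<omega>' \<zeta>" "card {\<rho>\<in>rays \<Sigma>'. \<rho> \<subseteq> \<zeta>} = d" by auto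
next
  fix F :: "('a \<times> real) set int_mpoly \<Rightarrow> int" and q
  assume F: "\<And>p q. p \<in> polys (rays \<Sigma>') \<Longrightarrow> homogeneous d p \<Longrightarrow> q \<in> polys (rays \<Sigma>') \<Longrightarrow> homogeneous d q \<Longrightarrow> F (p + q) = F p + F q"
    "\<And>p. p \<in> chow_ideal N' \<Sigma>' \<Longrightarrow> homogeneous d p \<Longrightarrow> F p = 0"
    "\<And>\<sigma>. \<sigma> \<in> cones_of_dim \<Sigma>' d \<Longrightarrow> F (\<Prod>\<rho>\<in>{\<rho>\<in>rays \<Sigma>'. \<rho> \<subseteq> \<sigma>}. Xvar \<rho>) = 0"
    and q: "q \<in> polys (rays \<Sigma>')" "homogeneous d q"
  have lh: "homogeneous d (ev lift_var p)" if "p \<in> polys (rays \<Sigma>)" "homogeneous d p" for p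
    by (rule homogeneous_ev[OF that]) (simp add: lift_var_def homogeneous_Xvar)
  have dq: "ev drop_var q \<in> polys (rays \<Sigma>)" "homogeneous d (ev drop_var q)"
    using ev_drop_polys[OF q(1)] homogeneous_ev[OF q homogeneous_drop] by auto
  have "F (ev lift_var (ev drop_var q)) = 0"
  proof (rule top_degree_zero[OF _ _ _ dq, of "\<lambda>p. F (ev lift_var p)"])
    show "F (ev lift_var (p + p')) = F (ev lift_var p) + F (ev lift_var p')"
      if "p \<in> polys (rays \<Sigma>)" "homogeneous d p" "p' \<in> polys (rays \<Sigma>)" "homogeneous d p'" for p p'
      unfolding ev_add using that by (intro F(1) ev_lift_polys lh)
    show "F (ev lift_var p) = 0" if "p \<in> chow_ideal N \<Sigma>" "homogeneous d p" for p
      using that chow_ideal_closed(5) by (intro F(2) lift_ideal lh) auto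
    show "F (ev lift_var (\<Prod>\<rho>\<in>S. Xvar \<rho>)) = 0" if S: "S \<in> faces" "card S = d" for S
    proof -
      note P = faces_props[OF S(1)]
      have "gc (cone_of S) \<in> cones_of_dim \<Sigma>' d" using P S(2) unfolding cones_\<Sigma>' by (auto simp: cones_of_dim_def)
      from F(3)[OF this] show ?thesis
        unfolding rays_below_gc[OF P(1)] P(2) prod_gc by (simp add: ev_prod lift_var_def)
    qed
  qed
  moreover have "F (q - ev lift_var (ev drop_var q)) = 0"
    by (rule F(2)[OF lift_drop[OF q(1)]])
      (use homogeneous_add[OF q(2) homogeneous_uminus[OF lh[OF dq]]] in simp)
  moreover have "F (q - ev lift_var (ev drop_var q) + ev lift_var (ev drop_var q)) = F (q - ev lift_var (ev drop_var q)) + F (ev lift_var (ev drop_var q))"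
    by (rule F(1)[OF polys_diff[OF q(1) ev_lift_polys[OF dq(1)]] _ ev_lift_polys[OF dq(1)] lh[OF dq]])
      (use homogeneous_add[OF q(2) homogeneous_uminus[OF lh[OF dq]]] in simp)
  ultimately show "F q = 0" by simp
qed (use finite_rays_\<Sigma>' dform_add in \<open>auto simp: ev_add\<close>)

lemma chow_deg_lift:
  assumes g: "\<And>p. p \<in> polys (rays \<Sigma>) \<Longrightarrow> g (chow_class N \<Sigma> p) = chow_class N' \<Sigma>' (ev lift_var p)"
    and a: "a \<in> chow_graded N \<Sigma> d"
  shows "chow_deg N' \<Sigma>' d \<omega>' (g a) = chow_deg N \<Sigma> d \<omega> a"
proof -
  obtain p where p: "p \<in> polys (rays \<Sigma>)" "homogeneous d p" "a = chow_class N \<Sigma> p" using a by (auto simp: chow_graded_def)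
  have "homogeneous d (ev lift_var p)"
    by (rule homogeneous_ev[OF p(1,2)]) (simp add: lift_var_def homogeneous_Xvar)
  then show ?thesis
    using chow_deg_target[OF ev_lift_polys[OF p(1)]] chow_deg_source[OF p(1,2)] by (simp add: p(3) g[OF p(1)] drop_lift[OF p(1)])
qed

text \<open>\<open>rat_tensor_functional\<close> starts from an additive function on the whole ring,
  while \<open>chow_deg\<close> is meaningful only on the top graded piece; \<open>dform\<close>
  extends it.\<close>

lemma dform_class:
  obtains D where "\<And>a b. a \<in> carrier A' \<Longrightarrow> b \<in> carrier A' \<Longrightarrow> D (a \<oplus>\<^bsub>A'\<^esub> b) = D a + (D b :: int)"
    "\<And>a. a \<in> chow_graded N' \<Sigma>' d \<Longrightarrow> D a = chow_deg N' \<Sigma>' d \<omega>' a"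
proof -
  have zero: "dform (ev drop_var q) = 0" if "q \<in> chow_ideal N' \<Sigma>'" for q
    using drop_ideal[OF torsion_ideal chow_ideal_subset_torsion star_relation_torsion that] dform_torsion by blast
  obtain D where D: "\<And>q. q \<in> polys (rays \<Sigma>') \<Longrightarrow> D (chow_class N' \<Sigma>' q) = dform (ev drop_var q)"
  proof (rule quot_lift[OF chow_ideal, where f = "\<lambda>q. dform (ev drop_var q)"])
    fix p q assume pq: "p \<in> polys (rays \<Sigma>')" "q \<in> polys (rays \<Sigma>')" "p \<ominus>\<^bsub>poly_ring_on (rays \<Sigma>')\<^esub> q \<in> chow_ideal N' \<Sigma>'"
    then have "p - q \<in> chow_ideal N' \<Sigma>'" using poly_ring_minus[OF pq(1,2)] by simp
    from zero[OF this] show "dform (ev drop_var p) = dform (ev drop_var q)"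
      using dform_add[of "ev drop_var (p - q)" "ev drop_var q"] by (simp add: ev_diff)
  qed (auto simp: chow_class_def)
  show ?thesis
  proof (rule that[of D])
    fix a b assume "a \<in> carrier A'" "b \<in> carrier A'"
    then obtain p q where pq: "p \<in> polys (rays \<Sigma>')" "q \<in> polys (rays \<Sigma>')" "a = chow_class N' \<Sigma>' p" "b = chow_class N' \<Sigma>' q"
      by (auto simp: chow_carrier)
    then show "D (a \<oplus>\<^bsub>A'\<^esub> b) = D a + D b"
      by (simp add: D polys_add ev_add dform_add flip: chow_class_ops(1))
  next
    fix a assume "a \<in> chow_graded N' \<Sigma>' d"
    then show "D a = chow_deg N' \<Sigma>' d \<omega>' a" using D chow_deg_target by (auto simp: chow_graded_def)
  qed
qed

end

text \<open>The maps constructed go from the Chow ring of \<Sigma> to that of the modification; the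
  isomorphisms asked for are their inverses.\<close>

lemma graded_ring_iso_inv:
  assumes R: "ring R" and H: "H \<in> ring_iso R S" and gr: "\<And>k. grR k \<subseteq> carrier R" "\<And>k. H ` grR k = grS k"
  shows "inv_into (carrier R) H \<in> graded_ring_iso S grS R grR"
    "b \<in> grS k \<Longrightarrow> inv_into (carrier R) H b \<in> grR k" "b \<in> grS k \<Longrightarrow> H (inv_into (carrier R) H b) = b"
proof -
  have inj: "inj_on H (carrier R)" using H by (auto simp: ring_iso_def bij_betw_def)
  have *: "inv_into (carrier R) H (H a) = a" if "a \<in> grR k" for a k
    using that gr(1) inj by (auto intro: inv_into_f_f)
  have "inv_into (carrier R) H ` grS k = grR k" for k
    unfolding gr(2)[symmetric] image_image using * by simp
  then show "inv_into (carrier R) H \<in> graded_ring_iso S grS R grR"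
    using ring_iso_set_sym[OF R H] by (simp add: graded_ring_iso_def)
  show "inv_into (carrier R) H b \<in> grR k" "H (inv_into (carrier R) H b) = b" if "b \<in> grS k"
    using that * unfolding gr(2)[symmetric] by auto
qed

context tropical_modif
begin

lemma rat_graded_image:
  assumes g: "g ` chow_graded N \<Sigma> k = chow_graded N' \<Sigma>' k"
    and H: "H \<in> ring_iso (rat_chow_ring N \<Sigma>) (rat_chow_ring N' \<Sigma>')"
    and pure: "\<And>a s. a \<in> carrier A \<Longrightarrow> H (pure_tensor A a s) = pure_tensor A' (g a) s"
  shows "H ` rat_chow_graded N \<Sigma> k = rat_chow_graded N' \<Sigma>' k"
proof -
  let ?S = "{pure_tensor A a s | a s. a \<in> chow_graded N \<Sigma> k}"
  have "group_hom (add_monoid (rat_chow_ring N \<Sigma>)) (add_monoid (rat_chow_ring N' \<Sigma>')) H"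
  proof (rule group_hom.intro[OF _ _ group_hom_axioms.intro])
    show "Group.group (add_monoid (rat_chow_ring N \<Sigma>))" "Group.group (add_monoid (rat_chow_ring N' \<Sigma>'))"
      using abelian_group.a_group[OF ring.is_abelian_group[OF rat_chow_ring]] by blast+
    show "H \<in> hom (add_monoid (rat_chow_ring N \<Sigma>)) (add_monoid (rat_chow_ring N' \<Sigma>'))"
      using H by (auto simp: ring_iso_def ring_hom_def hom_def)
  qed
  moreover have "?S \<subseteq> carrier (add_monoid (rat_chow_ring N \<Sigma>))" using rat_chow_graded_carrier by auto
  ultimately have "H ` rat_chow_graded N \<Sigma> k = generate (add_monoid (rat_chow_ring N' \<Sigma>')) (H ` ?S)"
    unfolding rat_chow_graded_def by (rule group_hom.generate_img[symmetric])
  also have "H ` ?S = {pure_tensor A' b s | b s. b \<in> chow_graded N' \<Sigma>' k}"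
  proof -
    have "H (pure_tensor A a s) = pure_tensor A' (g a) s" if "a \<in> chow_graded N \<Sigma> k" for a s
      using pure rat_chow_graded_carrier(1)[OF that] by blast
    then show ?thesis unfolding g[symmetric] by (auto simp: image_iff) metis
  qed
  finally show ?thesis by (simp add: rat_chow_graded_def)
qed

end

text \<open>A single functional \<open>E\<close> on the target serves both sides: on the target it
  is the rational degree, and pulled back along \<open>H\<close> it has the defining values of the
  rational degree of \<Sigma>.\<close>

lemma (in unimodular_modif) rat_chow_deg_lift:
  assumes g: "\<And>p. p \<in> polys (rays \<Sigma>) \<Longrightarrow> g (chow_class N \<Sigma> p) = chow_class N' \<Sigma>' (ev lift_var p)"
    and gr: "\<And>k. g ` chow_graded N \<Sigma> k = chow_graded N' \<Sigma>' k"
    and H: "H \<in> ring_iso (rat_chow_ring N \<Sigma>) (rat_chow_ring N' \<Sigma>')"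
    and pure: "\<And>a s. a \<in> carrier A \<Longrightarrow> H (pure_tensor A a s) = pure_tensor A' (g a) s"
    and x: "x \<in> rat_chow_graded N \<Sigma> d"
  shows "rat_chow_deg N' \<Sigma>' d \<omega>' (H x) = rat_chow_deg N \<Sigma> d \<omega> x"
proof -
  interpret A': cring A' by (rule chow_ring_cring)
  obtain D where D: "\<And>a b. a \<in> carrier A' \<Longrightarrow> b \<in> carrier A' \<Longrightarrow> D (a \<oplus>\<^bsub>A'\<^esub> b) = D a + (D b :: int)"
    "\<And>a. a \<in> chow_graded N' \<Sigma>' d \<Longrightarrow> D a = chow_deg N' \<Sigma>' d \<omega>' a" using dform_class by blast
  obtain E where E: "\<And>x y. x \<in> carrier (rat_tensor A') \<Longrightarrow> y \<in> carrier (rat_tensor A') \<Longrightarrow> E (x \<oplus>\<^bsub>rat_tensor A'\<^esub> y) = E x + E y"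
    "\<And>a s. a \<in> carrier A' \<Longrightarrow> E (pure_tensor A' a s) = of_int (D a) * s"
    using A'.rat_tensor_functional[of D] D(1) by blast
  have "rat_chow_deg N' \<Sigma>' d \<omega>' (H x) = E (H x)"
  proof (rule rat_chow_deg_eq)
    show "H x \<in> rat_chow_graded N' \<Sigma>' d" using rat_graded_image[OF gr H pure] x by blast
    show "E (pure_tensor A' a s) = of_int (chow_deg N' \<Sigma>' d \<omega>' a) * s" if "a \<in> chow_graded N' \<Sigma>' d" for a s
      using E(2) D(2) rat_chow_graded_carrier(1) that by metis
  qed (use E(1) in \<open>simp add: rat_chow_ring_def\<close>)
  moreover have "rat_chow_deg N \<Sigma> d \<omega> x = E (H x)"
  proof (rule rat_chow_deg_eq[OF _ _ x])
    fix a s assume a: "a \<in> chow_graded N \<Sigma> d"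
    then have b: "g a \<in> chow_graded N' \<Sigma>' d" unfolding gr[symmetric] by (rule imageI)
    show "E (H (pure_tensor A a s)) = of_int (chow_deg N \<Sigma> d \<omega> a) * s"
      using pure[OF rat_chow_graded_carrier(1)[OF a]] E(2)[OF rat_chow_graded_carrier(1)[OF b]] D(2)[OF b] chow_deg_lift[OF g a]
      by simp
  next
    fix y z assume yz: "y \<in> carrier (rat_chow_ring N \<Sigma>)" "z \<in> carrier (rat_chow_ring N \<Sigma>)"
    have h: "H \<in> ring_hom (rat_chow_ring N \<Sigma>) (rat_chow_ring N' \<Sigma>')" using H by (simp add: ring_iso_def)
    show "E (H (y \<oplus>\<^bsub>rat_chow_ring N \<Sigma>\<^esub> z)) = E (H y) + E (H z)"
      unfolding ring_hom_add[OF h yz]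
      using E(1)[of "H y" "H z"] ring_hom_closed[OF h] yz by (simp add: rat_chow_ring_def)
  qed
  ultimately show ?thesis by simp
qed

theorem theorem1p11:
  fixes N :: "'a::euclidean_space set"
    and \<Sigma> :: "'a set set"
    and d :: nat
    and \<omega> :: "'a set \<Rightarrow> int"
    and f :: "'a \<Rightarrow> real"
    and N' :: "('a \<times> real) set"
    and \<Sigma>' :: "('a \<times> real) set set"
    and \<omega>' :: "('a \<times> real) set \<Rightarrow> int"
  assumes "is_lattice N"
    and "tropical_fan N \<Sigma> d \<omega>"
    and "simplicial_fan \<Sigma>"
    and "meromorphic N \<Sigma> f"
    and "N' = N \<times> \<int>"
    and "(\<Sigma>', \<omega>') = tropical_modification N \<Sigma> d \<omega> f"
    and "div_faithful N \<Sigma> d \<omega>"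
  shows "(\<exists>\<phi> \<in> graded_ring_iso (rat_chow_ring N' \<Sigma>') (rat_chow_graded N' \<Sigma>')
                              (rat_chow_ring N \<Sigma>) (rat_chow_graded N \<Sigma>).
            unimodular_fan N \<Sigma> \<longrightarrow>
              (\<forall>a\<in>rat_chow_graded N' \<Sigma>' d. rat_chow_deg N \<Sigma> d \<omega> (\<phi> a) = rat_chow_deg N' \<Sigma>' d \<omega>' a))
       \<and> (\<exists>\<psi>. (\<forall>p. \<psi> p \<in> iso (MW N' \<Sigma>' p) (MW N \<Sigma> p)) \<and> \<psi> d \<omega>' = \<omega>)
       \<and> (saturated_fan N \<Sigma> \<or> torsion_free_ring (chow_ring N \<Sigma>) \<longrightarrow>
          (\<exists>\<phi> \<in> graded_ring_iso (chow_ring N' \<Sigma>') (chow_graded N' \<Sigma>')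
                                (chow_ring N \<Sigma>) (chow_graded N \<Sigma>).
             unimodular_fan N \<Sigma> \<longrightarrow>
               (\<forall>a\<in>chow_graded N' \<Sigma>' d. chow_deg N \<Sigma> d \<omega> (\<phi> a) = chow_deg N' \<Sigma>' d \<omega>' a)))"
proof -
  interpret T: tropical_modif N \<Sigma> f d \<omega>
    by unfold_locales (use assms in \<open>auto simp: tropical_fan_def\<close>)
  have \<Sigma>': "\<Sigma>' = T.\<Sigma>'" and \<omega>': "\<omega>' = snd (tropical_modification N \<Sigma> d \<omega> f)"
    using arg_cong[OF assms(6), of fst] arg_cong[OF assms(6), of snd] by (simp_all add: T.\<Sigma>'_def tropical_modification_def Let_def)
  have U: "unimodular_modif N \<Sigma> f d \<omega>" if "unimodular_fan N \<Sigma>"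
    by (intro unimodular_modif.intro unimodular_lattice_fan.intro unimodular_lattice_fan_axioms.intro
        T.tropical_modif_axioms T.simplicial_lattice_fan_axioms that)
  obtain g where g: "g \<in> ring_hom (chow_ring N \<Sigma>) (chow_ring N' \<Sigma>')"
    "\<And>p. p \<in> polys (rays \<Sigma>) \<Longrightarrow> g (chow_class N \<Sigma> p) = chow_class N' \<Sigma>' (ev T.lift_var p)"
    using T.chow_lift unfolding \<Sigma>' assms(5) by blast
  note g' = g[unfolded \<Sigma>' assms(5)]
  have surj: "g ` carrier (chow_ring N \<Sigma>) = carrier (chow_ring N' \<Sigma>')"
    using T.lift_surj[OF g'] unfolding \<Sigma>' assms(5) .
  have gr: "g ` chow_graded N \<Sigma> k = chow_graded N' \<Sigma>' k" for k
    using T.lift_graded[OF g'] unfolding \<Sigma>' assms(5) .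
  obtain H where H: "H \<in> ring_iso (rat_chow_ring N \<Sigma>) (rat_chow_ring N' \<Sigma>')"
    "\<And>a s. a \<in> carrier (chow_ring N \<Sigma>) \<Longrightarrow> H (pure_tensor (chow_ring N \<Sigma>) a s) = pure_tensor (chow_ring N' \<Sigma>') (g a) s"
    using rat_tensor_iso[OF chow_ring_cring chow_ring_cring g(1) surj] T.lift_kernel_torsion[OF g']
    unfolding rat_chow_ring_def \<Sigma>' assms(5) by blast
  have Hgr: "H ` rat_chow_graded N \<Sigma> k = rat_chow_graded N' \<Sigma>' k" for k
    using T.rat_graded_image[of g k H] gr H unfolding \<Sigma>' assms(5) by blast
  have Hc: "rat_chow_graded N \<Sigma> k \<subseteq> carrier (rat_chow_ring N \<Sigma>)" for k
    using subgroup.subset[OF rat_chow_graded_subgroup] by simp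
  note Hinv = graded_ring_iso_inv[where grR = "rat_chow_graded N \<Sigma>" and grS = "rat_chow_graded N' \<Sigma>'", OF rat_chow_ring H(1) Hc Hgr]
  have rat: "\<exists>\<phi> \<in> graded_ring_iso (rat_chow_ring N' \<Sigma>') (rat_chow_graded N' \<Sigma>') (rat_chow_ring N \<Sigma>) (rat_chow_graded N \<Sigma>).
      unimodular_fan N \<Sigma> \<longrightarrow> (\<forall>a\<in>rat_chow_graded N' \<Sigma>' d. rat_chow_deg N \<Sigma> d \<omega> (\<phi> a) = rat_chow_deg N' \<Sigma>' d \<omega>' a)"
  proof (rule bexI[OF _ Hinv(1)], intro impI ballI)
    fix a assume uni: "unimodular_fan N \<Sigma>" and a: "a \<in> rat_chow_graded N' \<Sigma>' d"
    show "rat_chow_deg N \<Sigma> d \<omega> (inv_into (carrier (rat_chow_ring N \<Sigma>)) H a) = rat_chow_deg N' \<Sigma>' d \<omega>' a"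
      using unimodular_modif.rat_chow_deg_lift[OF U[OF uni] g'(2) gr[unfolded \<Sigma>' assms(5)] H[unfolded \<Sigma>' assms(5)] Hinv(2)[OF a]]
        Hinv(3)[OF a] unfolding \<Sigma>' assms(5) \<omega>' by simp
  qed
  have mw: "\<exists>\<psi>. (\<forall>p. \<psi> p \<in> iso (MW N' \<Sigma>' p) (MW N \<Sigma> p)) \<and> \<psi> d \<omega>' = \<omega>"
    using T.restrict_weight_iso T.restrict_\<omega>' unfolding \<Sigma>' assms(5) \<omega>' by blast
  have int: "\<exists>\<phi> \<in> graded_ring_iso (chow_ring N' \<Sigma>') (chow_graded N' \<Sigma>') (chow_ring N \<Sigma>) (chow_graded N \<Sigma>).
      unimodular_fan N \<Sigma> \<longrightarrow> (\<forall>a\<in>chow_graded N' \<Sigma>' d. chow_deg N \<Sigma> d \<omega> (\<phi> a) = chow_deg N' \<Sigma>' d \<omega>' a)"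
    if sat: "saturated_fan N \<Sigma> \<or> torsion_free_ring (chow_ring N \<Sigma>)"
  proof -
    have iso: "g \<in> ring_iso (chow_ring N \<Sigma>) (chow_ring N' \<Sigma>')"
      using T.lift_iso[OF g' sat] unfolding \<Sigma>' assms(5) .
    have "chow_graded N \<Sigma> k \<subseteq> carrier (chow_ring N \<Sigma>)" for k using rat_chow_graded_carrier(1) by blast
    note inv = graded_ring_iso_inv[where grR = "chow_graded N \<Sigma>" and grS = "chow_graded N' \<Sigma>'", OF cring.axioms(1)[OF chow_ring_cring] iso this gr]
    show ?thesis
    proof (rule bexI[OF _ inv(1)], intro impI ballI)
      fix a assume uni: "unimodular_fan N \<Sigma>" and a: "a \<in> chow_graded N' \<Sigma>' d"
      show "chow_deg N \<Sigma> d \<omega> (inv_into (carrier (chow_ring N \<Sigma>)) g a) = chow_deg N' \<Sigma>' d \<omega>' a"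
        using unimodular_modif.chow_deg_lift[OF U[OF uni] g'(2) inv(2)[OF a]] inv(3)[OF a] unfolding \<Sigma>' assms(5) \<omega>' by simp
    qed
  qed
  from rat mw int show ?thesis by blast
qed

end
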